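(* Let $s\in(0,\tfrac12)$, let $r=-\bar q$ with $q\in B_\delta\cap\mathscr{S}(\mathbb{R})$ for $\delta>0$ sufficiently small, and let $i\varkappa^2,\,i\kappa^2\in\mathbb{R}\setminus(-1,1)$ with $\kappa^2\ne\varkappa^2$. Put $\Theta=\frac{\varkappa\kappa^3}{\kappa^2-\varkappa^2}$ and $\Xi=\frac{\varkappa^2\kappa^2}{\kappa^2-\varkappa^2}$. Under the $A(\kappa)$ flow, we have $$\frac{d}{dt}g_{12}(\varkappa)=-\Xi\, g_{12}(\varkappa)[\gamma(\kappa)+1]+\Theta\, g_{12}(\kappa)[\gamma(\varkappa)+1],$$ $$\frac{d}{dt}g_{21}(\varkappa)=\Xi\, g_{21}(\varkappa)[\gamma(\kappa)+1]-\Theta\, g_{21}(\kappa)[\gamma(\varkappa)+1],$$ $$\frac{d}{dt}\gamma(\varkappa)=-2\Theta\,[g_{12}(\kappa)g_{21}(\varkappa)-g_{21}(\kappa)g_{12}(\varkappa)],$$ and the following microscopic conservation laws: $$\partial_t\bigl\{2i\varkappa\,\gamma(\varkappa)-(q\,g_{21}(\varkappa)+r\,g_{12}(\varkappa))\bigr\}+\partial_x j_\gamma(\varkappa,\kappa)=0,$$ $$\partial_t\rho(\varkappa)+\partial_x j_{A(\kappa)}(\varkappa,\kappa)=0,\qquad \rho(\varkappa)=-\varkappa\frac{q\,g_{21}(\varkappa)+r\,g_{12}(\varkappa)}{2+\gamma(\varkappa)},$$ where the fluxes are $$j_\gamma(\varkappa,\kappa)=-\tfrac{\kappa^3(\kappa^2+\varkappa^2)}{(\kappa^2-\varkappa^2)^2}[g_{12}(\kappa)g_{21}(\varkappa)+g_{21}(\kappa)g_{12}(\varkappa)]-\tfrac{\kappa^4\varkappa}{(\kappa^2-\varkappa^2)^2}(\gamma(\kappa)+1)(\gamma(\varkappa)+1),$$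 $$j_{A(\kappa)}(\varkappa,\kappa)=-\Theta\,\frac{g_{12}(\kappa)g_{21}(\varkappa)+g_{12}(\varkappa)g_{21}(\kappa)}{2+\gamma(\varkappa)}-\Theta\,\frac{\varkappa}{2\kappa}\,\gamma(\kappa).$$
   Context: Throughout $r=-\bar q$, $\mathscr{S}(\mathbb{R})$ is the Schwartz space, and $B_\delta=\{q\in H^s:\|q\|_{H^s}\le\delta\}$ with $\|q\|_{H^s}^2=\int(4+\xi^2)^s|\hat q(\xi)|^2d\xi$ ($\hat q$ the unitary Fourier transform). For complex $\kappa$ with $i\kappa^2\in\mathbb{R}$, $|\kappa|\ge1$, let $$L(\kappa)=\begin{bmatrix}\partial+i\kappa^2&-\kappa q\\-\kappa r&\partial-i\kappa^2\end{bmatrix},\qquad L_0(\kappa)=\begin{bmatrix}\partial+i\kappa^2&0\\0&\partial-i\kappa^2\end{bmatrix},\qquad \partial=\partial_x.$$ For $\delta$ sufficiently small and $q\in B_\delta$, $L(\kappa)$ is invertible on $L^2$ ($\mathbb{C}^2$-valued); $G(x,y;\kappa)$ and $G_0(x,y;\kappa)$ denote the $2\times2$ matrix integral kernels of $L(\kappa)^{-1}$ and $L_0(\kappa)^{-1}$, and $G-G_0$ is continuous in $(x,y)$. Define $$\gamma(x;\kappa)=\mathrm{sgn}(i\kappa^2)[G_{11}(x,x;\kappa)-G_{22}(x,x;\kappa)]-1,$$ $$g_{12}(x;\kappa)=\mathrm{sgn}(i\kappa^2)G_{12}(x,x;\kappa),\qquad g_{21}(x;\kappa)=\mathrm{sgn}(i\kappa^2)G_{21}(x,x;\kappa),$$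 where on the diagonal $G_0$ contributes $\mathrm{sgn}(i\kappa^2)$ to $G_{11}-G_{22}$, i.e. $\gamma=\mathrm{sgn}(i\kappa^2)[(G-G_0)_{11}-(G-G_0)_{22}](x,x;\kappa)$. Let $\Lambda=(\partial+i\kappa^2)^{-1/2}\kappa q(\partial-i\kappa^2)^{-1/2}$ and $\Gamma=(\partial-i\kappa^2)^{-1/2}\kappa r(\partial+i\kappa^2)^{-1/2}$ (Fourier multipliers with $z^{-1/2}=|z|^{-1/2}e^{-\frac i2\arg z}$, $\arg z\in(-\pi,\pi]$), and $$A(\kappa)=A(\kappa;q,r)=-\mathrm{sgn}(i\kappa^2)\sum_{m=1}^\infty\tfrac1m\mathrm{tr}\{(\Lambda\Gamma)^m\}.$$ A Hamiltonian $H$ generates the flow $\partial_tq=\partial_x\frac{\delta H}{\delta r}$, $\partial_tr=\partial_x\frac{\delta H}{\delta q}$, where the functional derivatives satisfy $\frac{d}{d\theta}\big|_{\theta=0}H(q+\theta f)=\int f\,\frac{\delta H}{\delta q}-\bar f\,\frac{\delta H}{\delta r}\,dx$ for Schwartz $f$. The $A(\kappa)$ flow is the one with $H=A(\kappa)$; it reads $\partial_tq=-\kappa\,\partial_xg_{12}(\kappa)$, $\partial_tr=-\kappa\,\partial_xg_{21}(\kappa)$. *)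

theory Defs
  imports "HOL-Analysis.Analysis"
begin

definition dx :: "(real \<Rightarrow> complex) \<Rightarrow> real \<Rightarrow> complex" where
  "dx f = (\<lambda>x. vector_derivative f (at x))"

definition schwartz :: "(real \<Rightarrow> complex) \<Rightarrow> bool" where
  "schwartz f \<longleftrightarrow>
     (\<forall>n x. (dx ^^ n) f differentiable (at x)) \<and>
     (\<forall>k n. \<exists>C. \<forall>x. \<bar>x\<bar> ^ k * norm ((dx ^^ n) f x) \<le> C)"

text \<open>The derivative at time t of a curve of Schwartz functions: the difference quotients
  converge in every Schwartz seminorm.\<close>

definition schwartz_has_derivative ::
    "(real \<Rightarrow> real \<Rightarrow> complex) \<Rightarrow> (real \<Rightarrow> complex) \<Rightarrow> real \<Rightarrow> bool" where
  "schwartz_has_derivative u v t \<longleftrightarrow> schwartz v \<and>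
     (\<forall>k n. \<forall>\<epsilon>>0. \<forall>\<^sub>F h in at (0::real). \<forall>x.
        \<bar>x\<bar> ^ k * norm ((dx ^^ n) (\<lambda>y. (u (t + h) y - u t y) / complex_of_real h - v y) x) \<le> \<epsilon>)"

definition fourier :: "(real \<Rightarrow> complex) \<Rightarrow> real \<Rightarrow> complex" where
  "fourier f \<xi> = complex_of_real (1 / sqrt (2 * pi)) *
     (\<integral>x. exp (- \<i> * complex_of_real (x * \<xi>)) * f x \<partial>lborel)"

definition Hs_norm :: "real \<Rightarrow> (real \<Rightarrow> complex) \<Rightarrow> real" where
  "Hs_norm s q = sqrt (\<integral>\<xi>. (4 + \<xi>\<^sup>2) powr s * (norm (fourier q \<xi>))\<^sup>2 \<partial>lborel)"

definition schwartz_ball :: "real \<Rightarrow> real \<Rightarrow> (real \<Rightarrow> complex) set" where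
  "schwartz_ball s \<delta> = {q. schwartz q \<and> Hs_norm s q \<le> \<delta>}"

text \<open>Elements of L2 are represented by Borel functions; equality is almost everywhere.\<close>

definition L2 :: "(real \<Rightarrow> 'a::euclidean_space) set" where
  "L2 = {f. f \<in> borel_measurable lborel \<and> integrable lborel (\<lambda>x. (norm (f x))\<^sup>2)}"

definition L2_norm :: "(real \<Rightarrow> 'a::euclidean_space) \<Rightarrow> real" where
  "L2_norm f = sqrt (\<integral>x. (norm (f x))\<^sup>2 \<partial>lborel)"

definition L2_inner :: "(real \<Rightarrow> complex) \<Rightarrow> (real \<Rightarrow> complex) \<Rightarrow> complex" where
  "L2_inner f g = (\<integral>x. cnj (f x) * g x \<partial>lborel)"

definition weak_deriv :: "(real \<Rightarrow> complex) \<Rightarrow> (real \<Rightarrow> complex) \<Rightarrow> bool" where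
  "weak_deriv u v \<longleftrightarrow>
     (\<forall>\<phi>. schwartz \<phi> \<longrightarrow> (\<integral>x. u x * dx \<phi> x \<partial>lborel) = - (\<integral>x. v x * \<phi> x \<partial>lborel))"

text \<open>The graph of the unbounded operator L, with domain H1. The potentials q and r are
  independent here, and L_0 is the case q = r = 0.\<close>

definition lax :: "complex \<Rightarrow> (real \<Rightarrow> complex) \<Rightarrow> (real \<Rightarrow> complex) \<Rightarrow>
    (real \<Rightarrow> complex^2) \<Rightarrow> (real \<Rightarrow> complex^2) \<Rightarrow> bool" where
  "lax \<kappa> q r u F \<longleftrightarrow> u \<in> L2 \<and> F \<in> L2 \<and>
     (\<exists>v\<in>L2. (\<forall>i. weak_deriv (\<lambda>x. u x $ i) (\<lambda>x. v x $ i)) \<and>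
        (AE x in lborel. F x = v x +
           (vector [vector [\<i> * \<kappa>\<^sup>2, - \<kappa> * q x],
                    vector [- \<kappa> * r x, - \<i> * \<kappa>\<^sup>2]] :: complex^2^2) *v u x))"

definition lax_invertible ::
    "complex \<Rightarrow> (real \<Rightarrow> complex) \<Rightarrow> (real \<Rightarrow> complex) \<Rightarrow> bool" where
  "lax_invertible \<kappa> q r \<longleftrightarrow>
     (\<exists>C. \<forall>F\<in>L2. \<exists>u. lax \<kappa> q r u F \<and> L2_norm u \<le> C * L2_norm F \<and>
        (\<forall>u'. lax \<kappa> q r u' F \<longrightarrow> (AE x in lborel. u' x = u x)))"

definition green_kernel :: "complex \<Rightarrow> (real \<Rightarrow> complex) \<Rightarrow> (real \<Rightarrow> complex) \<Rightarrow>
    (real \<Rightarrow> real \<Rightarrow> complex^2^2) \<Rightarrow> bool" where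
  "green_kernel \<kappa> q r G \<longleftrightarrow> lax_invertible \<kappa> q r \<and>
     (\<lambda>(x, y). G x y) \<in> borel_measurable (lborel \<Otimes>\<^sub>M lborel) \<and>
     (\<forall>u F. lax \<kappa> q r u F \<longrightarrow>
        (AE x in lborel. integrable lborel (\<lambda>y. G x y *v F y) \<and>
           u x = (\<integral>y. G x y *v F y \<partial>lborel)))"

text \<open>G - G_0. The two kernels are only determined almost everywhere, but their difference has
  exactly one continuous version, and it is this version that is restricted to the diagonal.\<close>

definition green_diff :: "complex \<Rightarrow> (real \<Rightarrow> complex) \<Rightarrow> (real \<Rightarrow> complex) \<Rightarrow>
    real \<Rightarrow> real \<Rightarrow> complex^2^2" where
  "green_diff \<kappa> q r = (THE D. continuous_on UNIV (\<lambda>(x, y). D x y) \<and>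
     (\<exists>G G\<^sub>0. green_kernel \<kappa> q r G \<and> green_kernel \<kappa> (\<lambda>_. 0) (\<lambda>_. 0) G\<^sub>0 \<and>
        (\<forall>x y. D x y = G x y - G\<^sub>0 x y)))"

text \<open>G_0 is a diagonal matrix, so it does not contribute to the off-diagonal entries, and it
  contributes the constant 1 that is subtracted in the definition of gamma.\<close>

definition gam :: "complex \<Rightarrow> (real \<Rightarrow> complex) \<Rightarrow> (real \<Rightarrow> complex) \<Rightarrow> real \<Rightarrow> complex" where
  "gam \<kappa> q r x = sgn (\<i> * \<kappa>\<^sup>2) * (green_diff \<kappa> q r x x $ 1 $ 1 - green_diff \<kappa> q r x x $ 2 $ 2)"

definition g12 :: "complex \<Rightarrow> (real \<Rightarrow> complex) \<Rightarrow> (real \<Rightarrow> complex) \<Rightarrow> real \<Rightarrow> complex" where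
  "g12 \<kappa> q r x = sgn (\<i> * \<kappa>\<^sup>2) * green_diff \<kappa> q r x x $ 1 $ 2"

definition g21 :: "complex \<Rightarrow> (real \<Rightarrow> complex) \<Rightarrow> (real \<Rightarrow> complex) \<Rightarrow> real \<Rightarrow> complex" where
  "g21 \<kappa> q r x = sgn (\<i> * \<kappa>\<^sup>2) * green_diff \<kappa> q r x x $ 2 $ 1"

text \<open>The unitary Fourier transform on L2, as the transpose of the one on Schwartz functions.\<close>

definition L2_fourier :: "(real \<Rightarrow> complex) \<Rightarrow> (real \<Rightarrow> complex) \<Rightarrow> bool" where
  "L2_fourier f F \<longleftrightarrow> f \<in> L2 \<and> F \<in> L2 \<and>
     (\<forall>\<phi>. schwartz \<phi> \<longrightarrow> (\<integral>\<xi>. F \<xi> * \<phi> \<xi> \<partial>lborel) = (\<integral>x. f x * fourier \<phi> x \<partial>lborel))"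

text \<open>The result is determined almost everywhere, and depends only on the class of f.\<close>

definition fourier_multiplier ::
    "(real \<Rightarrow> complex) \<Rightarrow> (real \<Rightarrow> complex) \<Rightarrow> real \<Rightarrow> complex" where
  "fourier_multiplier m f =
     (SOME g. \<exists>F. L2_fourier f F \<and> L2_fourier g (\<lambda>\<xi>. m \<xi> * F \<xi>))"

text \<open>The multipliers for $(\partial \pm i\kappa^2)^{-1/2}$. The complex power is the principal branch,
  with argument in $(-\pi, \pi]$.\<close>

definition inv_sqrt_plus :: "complex \<Rightarrow> (real \<Rightarrow> complex) \<Rightarrow> real \<Rightarrow> complex" where
  "inv_sqrt_plus \<kappa> =
     fourier_multiplier (\<lambda>\<xi>. (\<i> * complex_of_real \<xi> + \<i> * \<kappa>\<^sup>2) powr (- 1 / 2))"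

definition inv_sqrt_minus :: "complex \<Rightarrow> (real \<Rightarrow> complex) \<Rightarrow> real \<Rightarrow> complex" where
  "inv_sqrt_minus \<kappa> =
     fourier_multiplier (\<lambda>\<xi>. (\<i> * complex_of_real \<xi> - \<i> * \<kappa>\<^sup>2) powr (- 1 / 2))"

definition Lambda_op ::
    "complex \<Rightarrow> (real \<Rightarrow> complex) \<Rightarrow> (real \<Rightarrow> complex) \<Rightarrow> real \<Rightarrow> complex" where
  "Lambda_op \<kappa> q f = inv_sqrt_plus \<kappa> (\<lambda>x. \<kappa> * q x * inv_sqrt_minus \<kappa> f x)"

definition Gamma_op ::
    "complex \<Rightarrow> (real \<Rightarrow> complex) \<Rightarrow> (real \<Rightarrow> complex) \<Rightarrow> real \<Rightarrow> complex" where
  "Gamma_op \<kappa> r f = inv_sqrt_minus \<kappa> (\<lambda>x. \<kappa> * r x * inv_sqrt_plus \<kappa> f x)"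

definition L2_basis :: "(nat \<Rightarrow> real \<Rightarrow> complex) \<Rightarrow> bool" where
  "L2_basis e \<longleftrightarrow> (\<forall>n. e n \<in> L2) \<and>
     (\<forall>m n. L2_inner (e m) (e n) = (if m = n then 1 else 0)) \<and>
     (\<forall>f\<in>L2. (\<forall>n. L2_inner (e n) f = 0) \<longrightarrow> (AE x in lborel. f x = 0))"

text \<open>A bounded operator is of trace class iff this sum converges for every orthonormal basis,
  and then the sum does not depend on the basis.\<close>

definition op_trace :: "((real \<Rightarrow> complex) \<Rightarrow> (real \<Rightarrow> complex)) \<Rightarrow> complex" where
  "op_trace T = (THE \<tau>. \<forall>e. L2_basis e \<longrightarrow> (\<lambda>n. L2_inner (e n) (T (e n))) sums \<tau>)"

definition A_fun :: "complex \<Rightarrow> (real \<Rightarrow> complex) \<Rightarrow> (real \<Rightarrow> complex) \<Rightarrow> complex" where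
  "A_fun \<kappa> q r = - sgn (\<i> * \<kappa>\<^sup>2) *
     (\<Sum>m. 1 / of_nat (Suc m) * op_trace ((Lambda_op \<kappa> q \<circ> Gamma_op \<kappa> r) ^^ Suc m))"

text \<open>hq and hr are the functional derivatives of H with respect to q and r. A variation f of q
  changes r = - cnj q by - cnj f. Since f may be replaced by i f, the identity determines both
  continuous functions hq and hr.\<close>

definition functional_derivatives ::
    "((real \<Rightarrow> complex) \<Rightarrow> (real \<Rightarrow> complex) \<Rightarrow> complex) \<Rightarrow> (real \<Rightarrow> complex) \<Rightarrow> (real \<Rightarrow> complex) \<Rightarrow>
     (real \<Rightarrow> complex) \<Rightarrow> (real \<Rightarrow> complex) \<Rightarrow> bool" where
  "functional_derivatives H q r hq hr \<longleftrightarrow>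
     continuous_on UNIV hq \<and> continuous_on UNIV hr \<and>
     (\<forall>f. schwartz f \<longrightarrow>
        integrable lborel (\<lambda>x. f x * hq x) \<and> integrable lborel (\<lambda>x. cnj (f x) * hr x) \<and>
        ((\<lambda>\<theta>::real. H (\<lambda>x. q x + complex_of_real \<theta> * f x) (\<lambda>x. r x - complex_of_real \<theta> * cnj (f x)))
           has_vector_derivative (\<integral>x. f x * hq x - cnj (f x) * hr x \<partial>lborel)) (at 0))"

text \<open>A solution on the time set I of
  $\partial_t q = \partial_x \frac{\delta H}{\delta r}$,
  $\partial_t r = \partial_x \frac{\delta H}{\delta q}$
  with values in pairs of Schwartz functions. The relation r = - cnj q is not part of the
  definition, because a complex-valued H need not preserve it. The quadratic part of A_fun at
  r = - cnj q is $i\sigma \int |\hat q(\xi)|^2 / (2\sigma + i\xi) \, d\xi$ with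
  $\sigma = i\kappa^2$, which is not real, and its flow leaves the set r = - cnj q at small q other than 0.\<close>

definition hamiltonian_flow ::
    "((real \<Rightarrow> complex) \<Rightarrow> (real \<Rightarrow> complex) \<Rightarrow> complex) \<Rightarrow> real set \<Rightarrow>
     (real \<Rightarrow> real \<Rightarrow> complex) \<Rightarrow> (real \<Rightarrow> real \<Rightarrow> complex) \<Rightarrow> bool" where
  "hamiltonian_flow H I q r \<longleftrightarrow>
     (\<forall>t\<in>I. schwartz (q t) \<and> schwartz (r t) \<and>
        (\<exists>hq hr. functional_derivatives H (q t) (r t) hq hr \<and>
           (\<forall>x. hq differentiable (at x)) \<and> (\<forall>x. hr differentiable (at x)) \<and>
           schwartz_has_derivative q (dx hr) t \<and> schwartz_has_derivative r (dx hq) t))"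

text \<open>Below, $\mu$ is the spectral parameter of the density ($\varkappa$) and $\kappa$ that of the flow.\<close>

definition Theta :: "complex \<Rightarrow> complex \<Rightarrow> complex" where
  "Theta \<mu> \<kappa> = \<mu> * \<kappa> ^ 3 / (\<kappa>\<^sup>2 - \<mu>\<^sup>2)"

definition Xi :: "complex \<Rightarrow> complex \<Rightarrow> complex" where
  "Xi \<mu> \<kappa> = \<mu>\<^sup>2 * \<kappa>\<^sup>2 / (\<kappa>\<^sup>2 - \<mu>\<^sup>2)"

definition gamma_density ::
    "complex \<Rightarrow> (real \<Rightarrow> complex) \<Rightarrow> (real \<Rightarrow> complex) \<Rightarrow> real \<Rightarrow> complex" where
  "gamma_density \<mu> q r x =
     2 * \<i> * \<mu> * gam \<mu> q r x - (q x * g21 \<mu> q r x + r x * g12 \<mu> q r x)"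

definition rho_density ::
    "complex \<Rightarrow> (real \<Rightarrow> complex) \<Rightarrow> (real \<Rightarrow> complex) \<Rightarrow> real \<Rightarrow> complex" where
  "rho_density \<mu> q r x =
     - \<mu> * ((q x * g21 \<mu> q r x + r x * g12 \<mu> q r x) / (2 + gam \<mu> q r x))"

definition j_gamma ::
    "complex \<Rightarrow> complex \<Rightarrow> (real \<Rightarrow> complex) \<Rightarrow> (real \<Rightarrow> complex) \<Rightarrow> real \<Rightarrow> complex" where
  "j_gamma \<mu> \<kappa> q r x =
     - (\<kappa> ^ 3 * (\<kappa>\<^sup>2 + \<mu>\<^sup>2) / (\<kappa>\<^sup>2 - \<mu>\<^sup>2)\<^sup>2) *
         (g12 \<kappa> q r x * g21 \<mu> q r x + g21 \<kappa> q r x * g12 \<mu> q r x)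
     - (\<kappa> ^ 4 * \<mu> / (\<kappa>\<^sup>2 - \<mu>\<^sup>2)\<^sup>2) * (gam \<kappa> q r x + 1) * (gam \<mu> q r x + 1)"

definition j_A ::
    "complex \<Rightarrow> complex \<Rightarrow> (real \<Rightarrow> complex) \<Rightarrow> (real \<Rightarrow> complex) \<Rightarrow> real \<Rightarrow> complex" where
  "j_A \<mu> \<kappa> q r x =
     - Theta \<mu> \<kappa> * ((g12 \<kappa> q r x * g21 \<mu> q r x + g12 \<mu> q r x * g21 \<kappa> q r x) / (2 + gam \<mu> q r x))
     - Theta \<mu> \<kappa> * (\<mu> / (2 * \<kappa>)) * gam \<kappa> q r x"

end

theory Submission
  imports Defs "HOL-Probability.Probability" "HOL-Computational_Algebra.Polynomial"
begin

text \<open>The off-diagonal Green functions solve first-order equations in $x$, and once they are explicit the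
conservation laws are algebra. The proof therefore has three parts.

The Lax operator is diagonalised. Solutions of the two Riccati equations
$m' = \kappa r - \kappa q m^2 + 2\sigma m$ and $n' = \kappa q - \kappa r n^2 - 2\sigma n$, with
$\sigma = i\kappa^2$, turn the columns $(1, m)$ and $(n, 1)$ into solutions of the Lax equation after
multiplication by scalar exponentials. In this basis the inverse of the Lax operator consists of the
resolvents of $\partial$ at $\pm\sigma$, and on the diagonal $g_{12} = -n/(1-mn)$,
$g_{21} = m/(1-mn)$ and $\gamma = 2mn/(1-mn)$. A small $L^2$ norm of the potentials makes
the Riccati equations contractions (lemmas riccati and diagonal_green).

The time derivatives of $m$ and $n$ are the bounded solutions of the linearised Riccati equations. For
the flow these solutions are explicit in the diagonal Green functions, and the quotient rule gives
the stated formulas (theorem flow_derivatives).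

The flow itself is given by a sum of operator traces, whose gradient must be found. A Fourier
representation of one resolvent writes $(\Lambda\Gamma)^m$ as an integral of operators of rank one, so
that its trace can be computed in any orthonormal basis; a Gaussian regularisation then turns it
into an integral over the diagonal of a kernel (theorem trace_formula). Scaling $r$ by $\lambda$,
these integrals are the coefficients of the Neumann series of $\int \kappa r g_{12}$. The energy
$\int \kappa q m$ has the same derivative in $\lambda$ by a Wronskian identity for
the Riccati solutions of two different potentials, hence the trace series is minus the energy. The same identity
yields the gradient $-\kappa g_{21}$, $-\kappa g_{12}$ of the Hamiltonian (theorem A_fun_gradient).

In formulas kap, sig, xi, eta, ... denote the Greek letters, BM Borel functions, L1
Lebesgue integrable functions, sqint square-integrable functions, hvd the vector derivative.\<close>

abbreviation (input) BM :: "('a::topological_space => 'b::topological_space) set" where "BM == borel_measurable borel"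
abbreviation (input) L1 :: "(real => 'a::{banach, second_countable_topology}) => bool" where "L1 == integrable lborel"
abbreviation (input) cont :: "('a::topological_space => 'b::topological_space) => bool" where "cont == continuous_on UNIV"
abbreviation (input) tends :: "(nat => 'a::topological_space) => 'a => bool" (infix "-->>" 60) where "X -->> l == X \<longlonglongrightarrow> l"
notation has_vector_derivative (infix "hvd" 50)
lemmas int_cong = Bochner_Integration.integral_cong and L1_bound = Bochner_Integration.integrable_bound

section \<open>Resolvents of the derivative on the line\<close>

text \<open>The fundamental solution of $\partial + c$ that is bounded on the whole line; it lives on the right half-line for $c > 0$ and on the left one for $c < 0$.\<close>

definition ker :: "real => real => complex" where
 "ker c u = (if 0 < c then (if 0 <= u then of_real (exp (- (c * u))) else 0)
       else (if u < 0 then - of_real (exp (- (c * u))) else 0))"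

text \<open>The resolvent $(\partial + c)^{-1}$.\<close>

definition Rop :: "real => (real => complex) => real => complex" where
 "Rop c h x = (LBINT y. ker c (x - y) * h y)"

lemma ker_measurable [measurable]: "ker c \<in> BM"
 unfolding ker_def by measurable

lemma norm_ker_le: "norm (ker c u) <= exp (- (\<bar>c\<bar> * \<bar>u\<bar>))"
proof (cases "c <= 0 \<and> u < 0")
 case True
 then have "\<bar>c\<bar> * \<bar>u\<bar> = c * u" by (simp add: abs_of_nonpos)
 then show ?thesis using True by (auto simp: ker_def)
qed (auto simp: ker_def)

lemma norm_ker_le_1: "norm (ker c u) <= 1"
 by (rule order_trans[OF norm_ker_le]) (simp)

lemma ker_swap: "u ~= 0 ==> c ~= 0 ==> ker c u = - ker (- c) (- u)"
 by (auto simp: ker_def)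

lemma exp_halfline_integrable:
 assumes "a > 0"
 shows "L1 (%u::real. indicator {0..} u * exp (- (a * u)))"
  and "(LBINT u. indicator {0..} u * exp (- (a * u))) = 1 / a"
proof -
 have 1: "((%u. exp (- a * u)) has_integral 1 / a) {0..}"
  using has_integral_exp_minus_to_infinity[OF assms, of 0] by simp
 have "((%u. if u \<in> {0..} then exp (- a * u) else 0) has_integral 1 / a) UNIV"
  using 1 by (subst has_integral_restrict_UNIV)
 then have 2: "((%u. indicator {0..} u * exp (- (a * u))) has_integral 1 / a) UNIV"
  by (rule has_integral_eq[rotated]) (auto simp: indicator_def)
 have 3: "(\<integral>\<^sup>+u. ennreal (indicator {0..} u * exp (- (a * u))) \<partial>lborel) = ennreal (1 / a)"
  by (rule nn_integral_has_integral_lborel[OF _ _ 2]) auto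
 show "L1 (%u::real. indicator {0..} u * exp (- (a * u)))"
  by (rule integrableI_nonneg) (use 3 in auto)
 show "(LBINT u. indicator {0..} u * exp (- (a * u))) = 1 / a"
  by (rule integral_eq_nn_integral[THEN trans]) (use 3 assms in auto)
qed

lemma exp_halfline_reflect:
 assumes "a > 0"
 shows "L1 (%u::real. indicator {..0} u * exp (a * u))"
  and "(LBINT u. indicator {..0} u * exp (a * u)) = 1 / a"
proof -
 have eq: "(%u::real. indicator {0..} (-u) * exp (- (a * (-u)))) = (%u. indicator {..0} u * exp (a * u))"
  by (auto simp: indicator_def)
 show "L1 (%u::real. indicator {..0} u * exp (a * u))"
  using lborel_integrable_real_affine[OF exp_halfline_integrable(1)[OF assms], of "-1" 0] eq by simp
 show "(LBINT u. indicator {..0} u * exp (a * u)) = 1 / a"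
  using lborel_integral_real_affine[of "-1" "%u::real. indicator {0..} u * exp (- (a * u))" 0]
   exp_halfline_integrable(2)[OF assms] eq by simp
qed

lemma AE_lborel_neq: "AE y in lborel. y ~= (a::real)"
 by (rule AE_lborel_singleton)

lemma norm_ker_eq:
 assumes "c ~= 0" and that: "n > 0"
 shows "AE u in lborel. norm (ker c u) ^ n =
  (if 0 < c then indicator {0..} u * exp (- ((of_nat n * c) * u)) else indicator {..0} u * exp ((- of_nat n * c) * u))"
 using AE_lborel_neq[of 0]
proof eventually_elim
 case (elim u)
 show ?case using elim that assms
  by (auto simp: ker_def indicator_def exp_of_nat_mult[symmetric] mult_ac)
qed

lemma ker_power_integrable:
 assumes "c ~= 0" "n > 0"
 shows "L1 (%u. norm (ker c u) ^ n)"
  and "(LBINT u. norm (ker c u) ^ n) = 1 / (of_nat n * \<bar>c\<bar>)"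
proof -
 have ae: "AE u in lborel. norm (ker c u) ^ n =
  (if 0 < c then indicator {0..} u * exp (- ((of_nat n * c) * u)) else indicator {..0} u * exp ((- of_nat n * c) * u))"
  using norm_ker_eq assms by blast
 have i: "L1 (%u. (if 0 < c then indicator {0..} u * exp (- ((of_nat n * c) * u)) else indicator {..0} u * exp ((- of_nat n * c) * u)))
  \<and> (LBINT u. (if 0 < c then indicator {0..} u * exp (- ((of_nat n * c) * u)) else indicator {..0} u * exp ((- of_nat n * c) * u))) = 1 / (of_nat n * \<bar>c\<bar>)"
 proof (cases "0 < c")
  case True
  then show ?thesis using exp_halfline_integrable[of "real n * c"] assms by simp
 next
  case False
  then have "- real n * c > 0" using assms by (simp add: mult_pos_neg)
  then show ?thesis using exp_halfline_reflect[of "- real n * c"] assms False by (simp add: abs_if)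
 qed
 show "L1 (%u. norm (ker c u) ^ n)"
  using i by (subst integrable_cong_AE[OF _ _ ae]) auto
 show "(LBINT u. norm (ker c u) ^ n) = 1 / (of_nat n * \<bar>c\<bar>)"
  using i by (subst integral_cong_AE[OF _ _ ae]) auto
qed

lemma ker_integrable: "c ~= 0 ==> L1 (ker c)"
 using ker_power_integrable(1)[of c 1] by (simp add: integrable_norm_iff)

lemma lborel_integrable_shift:
 fixes f :: "real => 'a::{banach, second_countable_topology}"
 assumes "L1 f"
 shows "L1 (%y. f (x - y))" "L1 (%y. f (y - x))" "L1 (%y. f (- y))"
  "L1 (%y. f (x + y))" "L1 (%y. f (y + x))"
 using lborel_integrable_real_affine[OF assms, of "-1" x] lborel_integrable_real_affine[OF assms, of 1 "-x"]
  lborel_integrable_real_affine[OF assms, of "-1" 0] lborel_integrable_real_affine[OF assms, of "1" x]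
 by (simp_all add: add.commute)

lemma lborel_integral_shift:
 fixes f :: "real => 'a::{banach, second_countable_topology}"
 shows "(LBINT y. f (x - y)) = (LBINT y. f y)" "(LBINT y. f (y - x)) = (LBINT y. f y)"
  "(LBINT y. f (- y)) = (LBINT y. f y)" "(LBINT y. f (x + y)) = (LBINT y. f y)"
  "(LBINT y. f (y + x)) = (LBINT y. f y)"
 using lborel_integral_real_affine[of "-1" f x] lborel_integral_real_affine[of 1 f "-x"]
  lborel_integral_real_affine[of "-1" f 0] lborel_integral_real_affine[of 1 f x]
 by (simp_all add: add.commute)

definition sqint :: "(real => complex) => bool" where
 "sqint f \<longleftrightarrow> f \<in> BM \<and> L1 (%x. (norm (f x))\<^sup>2)"

lemma L2_complex_iff: "f \<in> L2 \<longleftrightarrow> sqint f" for f :: "real => complex"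
 by (simp add: L2_def sqint_def)

lemma sq_integrable_measurable [measurable_dest]: "sqint f ==> f \<in> BM"
 by (simp add: sqint_def)

lemma prod_le_half_squares: "(a::real) * b <= (a^2 + b^2) / 2"
 using sum_squares_bound[of a b] by simp

lemma sq_integrable_mult:
 assumes "sqint f" "sqint g"
 shows "L1 (%x. f x * g x)"
proof (rule L1_bound)
 show "L1 (%x. ((norm (f x))^2 + (norm (g x))^2) / 2)"
  using assms by (auto simp: sqint_def)
 show "(%x. f x * g x) \<in> borel_measurable lborel" using assms by (auto simp: sqint_def)
 show "AE x in lborel. norm (f x * g x) <= norm (((norm (f x))^2 + (norm (g x))^2) / 2)"
  using prod_le_half_squares by (auto simp: norm_mult)
qed

lemma Cauchy_Schwarz_integral:
 assumes "sqint f" "sqint g"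
 shows "(LBINT x. norm (f x) * norm (g x)) <= L2_norm f * L2_norm g"
proof -
 let ?a = "\<integral>x. (norm (f x))\<^sup>2 \<partial>lborel" and ?b = "\<integral>x. (norm (g x))\<^sup>2 \<partial>lborel" and ?c = "\<integral>x. norm (f x) * norm (g x) \<partial>lborel"
 have i: "L1 (%x. norm (f x) * norm (g x))"
  using integrable_norm[OF sq_integrable_mult[OF assms]] by (simp add: norm_mult)
 have ia: "L1 (%x. (norm (f x))\<^sup>2)" "L1 (%x. (norm (g x))\<^sup>2)"
  using assms by (auto simp: sqint_def)
 have q: "t^2 * ?a - 2 * t * ?c + ?b \<ge> 0" for t
 proof -
  have "0 <= (LBINT x. (t * norm (f x) - norm (g x))\<^sup>2)" by simp
  also have "... = (LBINT x. t\<^sup>2 * (norm (f x))^2 - 2 * t * (norm (f x) * norm (g x)) + (norm (g x))^2)"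
   by (rule int_cong) (auto simp: power2_eq_square algebra_simps)
  also have "... = t^2 * ?a - 2 * t * ?c + ?b"
   using i ia by simp
  finally show ?thesis .
 qed
 have nn: "?a \<ge> 0" "?b \<ge> 0" "?c \<ge> 0" by simp_all
 have "?c\<^sup>2 <= ?a * ?b"
 proof (cases "?a = 0")
  case True
  have "?c = 0"
  proof (rule ccontr)
   assume "?c ~= 0"
   then have "?c > 0" using nn(3) by linarith
   then show False using q[of "(?b + 1) / (2 * ?c)"] True by (simp add: field_simps)
  qed
  then show ?thesis using True by simp
 next
  case False
  then have "?a > 0" using nn(1) by linarith
  then show ?thesis using q[of "?c / ?a"] by (simp add: field_simps power2_eq_square)
 qed
 then have "?c <= sqrt (?a * ?b)" using nn real_le_rsqrt by blast
 then show ?thesis by (simp add: L2_norm_def real_sqrt_mult)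
qed

lemma norm_integral_mult_le:
 assumes "sqint f" "sqint g"
 shows "norm (LBINT x. f x * g x) <= L2_norm f * L2_norm g"
proof -
 have "norm (LBINT x. f x * g x) <= (LBINT x. norm (f x * g x))" by (rule integral_norm_bound)
 also have "... <= L2_norm f * L2_norm g" using Cauchy_Schwarz_integral[OF assms] by (simp add: norm_mult)
 finally show ?thesis .
qed

lemma sq_integrable_ker: "c ~= 0 ==> sqint (%y. ker c (x - y))"
 using lborel_integrable_shift(1)[OF ker_power_integrable(1)[of c 2], of x] unfolding sqint_def by simp

lemma L2_norm_ker: "c ~= 0 ==> L2_norm (%y. ker c (x - y)) = 1 / sqrt (2 * \<bar>c\<bar>)"
 unfolding L2_norm_def using lborel_integral_shift(1)[of "%u. (norm (ker c u))\<^sup>2" x] ker_power_integrable(2)[of c 2]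
 by (simp add: real_sqrt_divide)

lemma L2_norm_nonneg [simp]: "0 <= L2_norm f" by (simp add: L2_norm_def)

lemma Rop_integrable_bounded:
 assumes "c ~= 0" "h \<in> BM" "!!y. norm (h y) <= M"
 shows "L1 (%y. ker c (x - y) * h y)"
proof (rule L1_bound)
 show "L1 (%y. M * norm (ker c (x - y)))"
  using lborel_integrable_shift(1)[OF integrable_norm[OF ker_integrable[OF assms(1)]], of x] by simp
 show "(%y. ker c (x - y) * h y) \<in> borel_measurable lborel" using assms(2) by simp
 have "norm (ker c (x - y) * h y) <= norm (M * norm (ker c (x - y)))" for y
 proof -
  have "M \<ge> 0" using order_trans[OF norm_ge_zero assms(3)] .
  then show ?thesis using mult_right_mono[OF assms(3)[of y], of "norm (ker c (x - y))"] by (simp add: norm_mult mult.commute)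
 qed
 then show "AE y in lborel. norm (ker c (x - y) * h y) <= norm (M * norm (ker c (x - y)))" by simp
qed

lemma Rop_integrable_L1:
 assumes "L1 h"
 shows "L1 (%y. ker c (x - y) * h y)"
proof (rule L1_bound[OF assms])
 show "(%y. ker c (x - y) * h y) \<in> borel_measurable lborel" using assms by measurable
 show "AE y in lborel. norm (ker c (x - y) * h y) <= norm (h y)"
  using mult_right_mono[OF norm_ker_le_1 norm_ge_zero] by (auto simp: norm_mult)
qed

lemma Rop_integrable_L2:
 assumes "c ~= 0" "sqint h"
 shows "L1 (%y. ker c (x - y) * h y)"
 by (rule sq_integrable_mult[OF sq_integrable_ker assms(2)]) fact

lemma Rop_bound_sup:
 assumes "c ~= 0" "h \<in> BM" "!!y. norm (h y) <= M"
 shows "norm (Rop c h x) <= M / \<bar>c\<bar>"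
proof -
 have M: "M \<ge> 0" using order_trans[OF norm_ge_zero assms(3)] .
 have "norm (Rop c h x) <= (LBINT y. norm (ker c (x - y) * h y))"
  unfolding Rop_def by (rule integral_norm_bound)
 also have "... <= (LBINT y. M * norm (ker c (x - y)))"
 proof (rule integral_mono)
  show "L1 (%y. norm (ker c (x - y) * h y))" using Rop_integrable_bounded[OF assms] by simp
  show "L1 (%y. M * norm (ker c (x - y)))"
   using lborel_integrable_shift(1)[OF integrable_norm[OF ker_integrable[OF assms(1)]], of x] by simp
  show "norm (ker c (x - y) * h y) <= M * norm (ker c (x - y))" for y
   using mult_right_mono[OF assms(3)[of y], of "norm (ker c (x - y))"] by (simp add: norm_mult mult.commute)
 qed
 also have "... = M / \<bar>c\<bar>"
  using lborel_integral_shift(1)[of "%u. norm (ker c u)" x] ker_power_integrable(2)[of c 1] assms(1) by simp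
 finally show ?thesis .
qed

lemma Rop_bound_L1:
 assumes "L1 h"
 shows "norm (Rop c h x) <= (LBINT y. norm (h y))"
proof -
 have "norm (Rop c h x) <= (LBINT y. norm (ker c (x - y) * h y))"
  unfolding Rop_def by (rule integral_norm_bound)
 also have "... <= (LBINT y. norm (h y))"
  using integrable_norm[OF Rop_integrable_L1[OF assms, of c x]] integrable_norm[OF assms] mult_right_mono[OF norm_ker_le_1 norm_ge_zero]
  by (intro integral_mono) (auto simp: norm_mult)
 finally show ?thesis .
qed

lemma Rop_bound_L2:
 assumes "c ~= 0" "sqint a" "f \<in> BM" "!!y. norm (f y) <= M"
 shows "norm (Rop c (%y. a y * f y) x) <= M * (L2_norm a / sqrt (2 * \<bar>c\<bar>))"
proof -
 have M: "M \<ge> 0" using order_trans[OF norm_ge_zero assms(4)] .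
 have af: "sqint (%y. a y * f y)" unfolding sqint_def
 proof
  show "L1 (%x. (norm (a x * f x))\<^sup>2)"
  proof (rule L1_bound)
   show "L1 (%x. M\<^sup>2 * (norm (a x))^2)" using assms(2) by (simp add: sqint_def)
   show "(%x. (norm (a x * f x))\<^sup>2) \<in> borel_measurable lborel" using assms by measurable
   show "AE x in lborel. norm ((norm (a x * f x))^2) <= norm (M^2 * (norm (a x))^2)"
    using mult_left_mono[OF power_mono[OF assms(4) norm_ge_zero, of _ 2] zero_le_power2]
    by (auto simp: norm_mult power_mult_distrib mult.commute[of "M^2"])
  qed
 qed (use assms in measurable)
 have i: "L1 (%y. norm (ker c (x - y)) * norm (a y))"
  using integrable_norm[OF Rop_integrable_L2[OF assms(1,2), of x]] by (simp add: norm_mult)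
 have "norm (Rop c (%y. a y * f y) x) <= (LBINT y. norm (ker c (x - y) * (a y * f y)))"
  unfolding Rop_def by (rule integral_norm_bound)
 also have "... <= (LBINT y. M * (norm (ker c (x - y)) * norm (a y)))"
 proof (rule integral_mono)
  show "norm (ker c (x - y) * (a y * f y)) <= M * (norm (ker c (x - y)) * norm (a y))" for y
   using mult_right_mono[OF assms(4)[of y], of "norm (ker c (x - y)) * norm (a y)"] by (simp add: norm_mult mult_ac)
 qed (use i integrable_norm[OF Rop_integrable_L2[OF assms(1) af]] in auto)
 also have "... = M * (LBINT y. norm (ker c (x - y)) * norm (a y))" by simp
 also have "... <= M * (L2_norm (%y. ker c (x - y)) * L2_norm a)"
  using Cauchy_Schwarz_integral[OF sq_integrable_ker[OF assms(1)] assms(2)] M by (intro mult_left_mono)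
 finally show ?thesis by (simp add: L2_norm_ker[OF assms(1)])
qed

lemma Rop_measurable [measurable]:
 assumes [measurable]: "h \<in> BM"
 shows "Rop c h \<in> BM"
 unfolding Rop_def by measurable

lemma Rop_reflect:
 assumes "c ~= 0" and [measurable]: "h \<in> BM"
 shows "Rop c h x = - Rop (- c) (%y. h (- y)) (- x)"
proof -
 have "Rop c h x = (LBINT y. - (ker (- c) (- x + y) * h y))"
  unfolding Rop_def
 proof (rule integral_cong_AE)
  show "AE y in lborel. ker c (x - y) * h y = - (ker (- c) (- x + y) * h y)"
   using AE_lborel_neq[of x] by eventually_elim (use ker_swap[OF _ assms(1)] in auto)
 qed measurable
 also have "... = - (LBINT y. ker (- c) (- x + y) * h y)" by simp
 also have "... = - Rop (- c) (%y. h (- y)) (- x)"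
  unfolding Rop_def using lborel_integral_shift(3)[of "%y. ker (- c) (- x + y) * h y"] by simp
 finally show ?thesis .
qed

lemma halfline_integral:
 fixes g :: "real => complex"
 assumes [measurable]: "g \<in> BM" and int: "!!z. L1 (%y. indicator {..z} y *\<^sub>R g y)"
 shows "isCont (%z. \<integral>y. indicator {..z} y *\<^sub>R g y \<partial>lborel) x"
  and "isCont g x ==> ((%z. \<integral>y. indicator {..z} y *\<^sub>R g y \<partial>lborel) hvd g x) (at x)"
proof -
 define F where "F z = (LBINT y. indicator {..z} y *\<^sub>R g y)" for z
 define a where "a = x - 1"
 have setint: "set_integrable lborel {a..z} g" for z
 proof -
  have "set_integrable lborel {..z} g" using int by (simp add: set_integrable_def)
  then show ?thesis by (rule set_integrable_subset) auto
 qed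
 have split: "F z = F a + integral {a..z} g" if "z \<ge> a" for z
 proof -
  have "F z = (LBINT y. indicator {..a} y *\<^sub>R g y + indicator {a..z} y *\<^sub>R g y)"
   unfolding F_def
  proof (rule integral_cong_AE)
   show "AE y in lborel. indicator {..z} y *\<^sub>R g y = indicator {..a} y *\<^sub>R g y + indicator {a..z} y *\<^sub>R g y"
    using AE_lborel_neq[of a] by eventually_elim (use that in \<open>auto simp: indicator_def\<close>)
  qed measurable
  also have "... = F a + (LBINT y. indicator {a..z} y *\<^sub>R g y)"
   unfolding F_def using int setint[of z] by (intro Bochner_Integration.integral_add) (auto simp: set_integrable_def)
  also have "(LBINT y. indicator {a..z} y *\<^sub>R g y) = integral {a..z} g"
   using set_borel_integral_eq_integral(2)[OF setint[of z]] by (simp add: set_lebesgue_integral_def)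
  finally show ?thesis .
 qed
 have gi: "g integrable_on {a..x+1}" using set_borel_integral_eq_integral(1)[OF setint] .
 have "continuous_on {a..x+1} (%u. integral {a..u} g)"
  by (rule indefinite_integral_continuous_1[OF gi])
 then have "continuous_on {a<..<x+1} (%u. F a + integral {a..u} g)"
  by (intro continuous_intros) (auto elim: continuous_on_subset)
 then have "continuous_on {a<..<x+1} F"
  by (rule continuous_on_eq) (metis split greaterThanLessThan_iff less_imp_le)
 then show "isCont (%z. \<integral>y. indicator {..z} y *\<^sub>R g y \<partial>lborel) x"
  unfolding F_def[symmetric] by (rule continuous_on_interior) (auto simp: a_def)
 assume contg: "isCont g x"
 have "((%u. integral {a..u} g) hvd g x) (at x within {a..x+1})"
 proof -
  have "continuous (at x within {a..x + 1} - {}) g" using contg by (simp add: continuous_at_imp_continuous_at_within)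
  then show ?thesis
   using integral_has_vector_derivative_continuous_at[of g a "x+1" x "{}"] gi by (auto simp: a_def)
 qed
 then have d1: "((%u. integral {a..u} g) hvd g x) (at x)"
  by (subst (asm) at_within_interior) (auto simp: a_def)
 have d2: "((%u. F a + integral {a..u} g) hvd (0 + g x)) (at x)"
  by (rule has_vector_derivative_add[OF has_vector_derivative_const d1])
 have "(F hvd (0 + g x)) (at x)"
 proof (rule has_vector_derivative_transform_within_open[OF d2, of "{a<..}"])
  show "F a + integral {a..u} g = F u" if "u \<in> {a<..}" for u
   by (rule split[symmetric]) (use that in simp)
 qed (simp_all add: a_def)
 then show "((%z. \<integral>y. indicator {..z} y *\<^sub>R g y \<partial>lborel) hvd g x) (at x)"
  unfolding F_def by simp
qed

lemma has_vector_derivative_exp_mult: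
 "((%y. of_real (exp (c * y)) :: complex) hvd of_real (c * exp (c * x))) (at x)"
 by (auto intro!: derivative_eq_intros simp: has_vector_derivative_def scaleR_conv_of_real)

lemma Rop_has_derivative_pos:
 assumes c: "c > 0" and h [measurable]: "h \<in> BM" and M: "!!y. norm (h y) <= M"
 shows "isCont (Rop c h) x"
  and "isCont h x ==> (Rop c h hvd (h x - c * Rop c h x)) (at x)"
proof -
 define g where "g y = of_real (exp (c * y)) * h y" for y
 have [measurable]: "g \<in> BM" unfolding g_def by measurable
 define F where "F z = (LBINT y. indicator {..z} y *\<^sub>R g y)" for z
 have R: "Rop c h z = of_real (exp ((- c) * z)) * F z" for z
 proof -
  have "ker c (z - y) * h y = of_real (exp (- (c * z))) * (indicator {..z} y *\<^sub>R g y)" for y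
   using c by (auto simp: ker_def g_def indicator_def exp_diff exp_minus field_simps right_diff_distrib)
  then have "Rop c h z = (LBINT y. of_real (exp (- (c * z))) * (indicator {..z} y *\<^sub>R g y))" unfolding Rop_def by presburger
  then show ?thesis unfolding F_def by (simp only: integral_mult_right_zero minus_mult_left[symmetric])
 qed
 have int: "L1 (%y. indicator {..z} y *\<^sub>R g y)" for z
 proof -
  have "L1 (%y. of_real (exp (c * z)) * (ker c (z - y) * h y))"
   using Rop_integrable_bounded[OF _ h M] c by simp
  moreover have "of_real (exp (c * z)) * (ker c (z - y) * h y) = indicator {..z} y *\<^sub>R g y" for y
   using c by (auto simp: ker_def g_def indicator_def exp_diff exp_minus field_simps right_diff_distrib simp flip: of_real_mult)
  ultimately show ?thesis by simp
 qed
 have Req: "Rop c h = (%z. of_real (exp ((- c) * z)) * F z)" by (rule ext, rule R)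
 have "isCont F x" unfolding F_def by (rule halfline_integral(1)[OF _ int]) measurable
 then show "isCont (Rop c h) x" unfolding Req by (intro continuous_intros)
 assume "isCont h x"
 then have contg: "isCont g x" unfolding g_def by (intro continuous_intros)
 have dF: "(F hvd g x) (at x)"
  unfolding F_def by (rule halfline_integral(2)[OF _ int contg]) measurable
 have "((%u. of_real (exp ((- c) * u)) * F u) hvd
   (of_real (exp ((- c) * x)) * g x + of_real ((- c) * exp ((- c) * x)) * F x)) (at x)"
  by (rule has_vector_derivative_mult[OF has_vector_derivative_exp_mult[of "-c" x] dF])
 moreover have "of_real (exp ((- c) * x)) * g x + of_real ((- c) * exp ((- c) * x)) * F x = h x - c * Rop c h x"
  unfolding R by (simp add: g_def exp_minus field_simps)
 ultimately show "(Rop c h hvd (h x - c * Rop c h x)) (at x)"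
  unfolding Req by (simp add: mult.assoc)
qed

lemma Rop_isCont:
 assumes c: "c ~= 0" and h [measurable]: "h \<in> BM" and M: "!!y. norm (h y) <= M"
 shows "isCont (Rop c h) x"
proof (cases "c > 0")
 case True
 show ?thesis by (rule Rop_has_derivative_pos(1)[OF True h M])
next
 case False
 let ?h = "%y. h (- y)"
 have "isCont (Rop (- c) ?h) (- x)" using c False M by (intro Rop_has_derivative_pos) auto
 then have "isCont (%z. Rop (- c) ?h (- z)) x"
  by (intro isCont_o2[where f=uminus and g="Rop (- c) ?h"]) (simp_all add: isCont_minus)
 then have "isCont (%z. - Rop (- c) ?h (- z)) x" by (rule continuous_minus)
 moreover have "(%z. - Rop (- c) ?h (- z)) = Rop c h"
  unfolding o_def by (rule ext, rule Rop_reflect[OF c h, symmetric])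
 ultimately show ?thesis by simp
qed

lemma Rop_has_derivative:
 assumes c: "c ~= 0" and h [measurable]: "h \<in> BM" and M: "!!y. norm (h y) <= M" and "isCont h x"
 shows "(Rop c h hvd (h x - c * Rop c h x)) (at x)"
proof (cases "c > 0")
 case True
 show ?thesis by (rule Rop_has_derivative_pos(2)[OF True h M assms(4)])
next
 case False
 let ?h = "%y. h (- y)"
 have "isCont ?h (- x)"
  by (rule isCont_o2[where f=uminus and g=h]) (use assms(4) in \<open>simp_all add: isCont_minus\<close>)
 then have 1: "(Rop (- c) ?h hvd (?h (- x) - of_real (- c) * Rop (- c) ?h (- x))) (at (- x))"
  using c False M by (intro Rop_has_derivative_pos) auto
 define D where "D = ?h (- x) - of_real (- c) * Rop (- c) ?h (- x)"
 have "(Rop (- c) ?h has_derivative (%t. t *\<^sub>R D)) (at (- x))"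
  using 1 unfolding has_vector_derivative_def D_def .
 then have "((%z. - Rop (- c) ?h (- z)) has_derivative (%t. - ((- t) *\<^sub>R D))) (at x)"
  by (intro has_derivative_minus has_derivative_compose[where f=uminus and f'=uminus and g="Rop (- c) ?h"])
   (auto intro: has_derivative_minus[OF has_derivative_ident])
 moreover have eq: "(%z. - Rop (- c) ?h (- z)) = Rop c h"
  by (rule ext, rule Rop_reflect[OF c h, symmetric])
 moreover have "D = h x - c * Rop c h x" unfolding D_def Rop_reflect[OF c h, of x] by simp
 ultimately show ?thesis by (simp add: has_vector_derivative_def)
qed

text \<open>Two bounded solutions of $u' + c u = h$ differ by a multiple of $e^{-cx}$, which is unbounded at one end. The exceptional point allows for a jump of $h$, which is needed for the columns of a Green function.\<close>

lemma Rop_char: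
 assumes c: "c ~= 0" and h [measurable]: "h \<in> BM" and M: "!!y. norm (h y) <= M"
  and u: "cont u" "!!y. norm (u y) <= K"
  and d: "!!y. y ~= x ==> isCont h y \<and> (u hvd (h y - c * u y)) (at y)"
 shows "u = Rop c h"
proof -
 have contR: "cont (Rop c h)"
 proof (rule continuous_at_imp_continuous_on, rule ballI)
  fix y
  show "isCont (Rop c h) y" by (rule Rop_isCont[OF c h M])
 qed
 define z where "z y = (u y - Rop c h y) * of_real (exp (c * y))" for y
 have dz: "(z has_derivative (%_. 0)) (at y within UNIV)" if "y \<in> UNIV - {x}" for y
 proof -
  have d1: "isCont h y" "(u hvd (h y - c * u y)) (at y)" using d that by auto
  have d2: "(Rop c h hvd (h y - c * Rop c h y)) (at y)"
   by (rule Rop_has_derivative[OF c h M d1(1)])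
  have "(z hvd 0) (at y)"
   unfolding z_def[abs_def]
  proof (rule has_vector_derivative_eq_rhs[OF has_vector_derivative_mult[OF has_vector_derivative_diff[OF d1(2) d2] has_vector_derivative_exp_mult[of c y]]])
   show "(u y - Rop c h y) * complex_of_real (c * exp (c * y)) + (h y - c * u y - (h y - c * Rop c h y)) * complex_of_real (exp (c * y)) = 0"
    by (simp add: algebra_simps)
  qed
  then show ?thesis by (simp add: has_vector_derivative_def)
 qed
 have zcont: "cont z" unfolding z_def by (intro continuous_intros contR u)
 have zc: "z y = z 0" for y
 proof (rule has_derivative_zero_unique_strong_connected[of UNIV "{x}" z 0 "z 0" y])
  show "(z has_derivative (%h. 0)) (at w within UNIV)" if "w \<in> UNIV - {x}" for w using dz that by blast
 qed (simp_all add: zcont)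
 have zb: "norm (z y) <= (K + M / \<bar>c\<bar>) * exp (c * y)" for y
 proof -
  have "norm (u y - Rop c h y) <= K + M / \<bar>c\<bar>"
   by (rule order_trans[OF norm_triangle_ineq4 add_mono[OF u(2) Rop_bound_sup[OF c h M]]])
  then show ?thesis unfolding z_def by (simp add: norm_mult mult_right_mono)
 qed
 have e0: "(%n. exp (- real n)) -->> 0"
  by real_asymp
 have "norm (z 0) <= (K + M / \<bar>c\<bar>) * exp (- real n)" for n
  using zb[of "real n / - c"] zc[of "real n / - c"] c by simp
 then have "norm (z 0) <= (K + M / \<bar>c\<bar>) * 0"
  by (intro LIMSEQ_le_const[OF tendsto_mult_left[OF e0]]) auto
 then have "z y = 0" for y using zc[of y] by simp
 then show ?thesis unfolding z_def by (auto simp: fun_eq_iff)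
qed

lemma conv_integrable:
 fixes k f :: "real => 'a::{real_normed_field, banach, second_countable_topology}"
 assumes k: "L1 k" and f: "L1 f"
 shows "integrable (lborel \<Otimes>\<^sub>M lborel) (%(x, y). k (x - y) * f y)"
  and "integrable (lborel \<Otimes>\<^sub>M lborel) (%(x, y). k (y - x) * f x)"
proof -
 have [measurable]: "k \<in> BM" "f \<in> BM" using k f by auto
 show 1: "integrable (lborel \<Otimes>\<^sub>M lborel) (%(x, y). k (y - x) * f x)"
 proof (rule lborel_pair.Fubini_integrable)
  show "(%(x, y). k (y - x) * f x) \<in> borel_measurable (lborel \<Otimes>\<^sub>M lborel)" by measurable
  have "(LBINT y. norm (case (x, y) of (x, y) => k (y - x) * f x)) = (LBINT y. norm (k y)) * norm (f x)" for x
   using lborel_integral_shift(2)[of "%y. norm (k y)" x] by (simp add: norm_mult)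
  then show "L1 (%x. \<integral>y. norm (case (x, y) of (x, y) => k (y - x) * f x) \<partial>lborel)"
   using f by simp
  show "AE x in lborel. L1 (%y. case (x, y) of (x, y) => k (y - x) * f x)"
   using lborel_integrable_shift(2)[OF k] by simp
 qed
 show "integrable (lborel \<Otimes>\<^sub>M lborel) (%(x, y). k (x - y) * f y)"
  using lborel_pair.integrable_product_swap[OF 1] by simp
qed

lemma ker_prod_integrable:
 assumes c: "c ~= 0" and fg: "L1 f \<and> g \<in> BM \<and> (\<forall>x. norm (g x) <= M) \<or> sqint f \<and> sqint g"
 shows "integrable (lborel \<Otimes>\<^sub>M lborel) (%(x, y). ker c (x - y) * f y * g x)"
 using fg
proof
 assume a: "L1 f \<and> g \<in> BM \<and> (\<forall>x. norm (g x) <= M)"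
 then have f: "L1 f" and g[measurable]: "g \<in> BM" and M: "!!x. norm (g x) <= M" by auto
 have [measurable]: "f \<in> BM" using f by auto
 show ?thesis
 proof (rule L1_bound)
  show "integrable (lborel \<Otimes>\<^sub>M lborel) (%p. M * norm (case p of (x, y) => ker c (x - y) * f y))"
   using conv_integrable(1)[OF ker_integrable[OF c] f] by (intro integrable_mult_right integrable_norm)
  show "AE p in lborel \<Otimes>\<^sub>M lborel. norm (case p of (x, y) => ker c (x - y) * f y * g x) <= norm (M * norm (case p of (x, y) => ker c (x - y) * f y))"
  proof (rule AE_I2)
   fix p :: "real \<times> real"
   obtain x y where p: "p = (x, y)" by (cases p)
   have "norm (ker c (x - y) * f y * g x) <= norm (ker c (x - y) * f y) * M"
    using mult_left_mono[OF M[of x], of "norm (ker c (x - y) * f y)"] by (simp add: norm_mult)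
   also have "... <= norm (M * norm (ker c (x - y) * f y))" by (simp add: abs_mult mult.commute mult_right_mono)
   finally show "norm (case p of (x, y) => ker c (x - y) * f y * g x) <= norm (M * norm (case p of (x, y) => ker c (x - y) * f y))"
    by (simp add: p)
  qed
 qed measurable
next
 assume a: "sqint f \<and> sqint g"
 then have [measurable]: "f \<in> BM" "g \<in> BM" by (auto simp: sqint_def)
 have k: "L1 (%u. norm (ker c u))" using ker_integrable[OF c] by simp
 show ?thesis
 proof (rule L1_bound)
  show "integrable (lborel \<Otimes>\<^sub>M lborel) (%p. ((case p of (x, y) => norm (ker c (x - y)) * (norm (f y))^2) +
    (case p of (x, y) => norm (ker c (- (y - x))) * (norm (g x))^2)) / 2)"
   using conv_integrable(1)[OF k, of "%x. (norm (f x))\<^sup>2"] conv_integrable(2)[OF lborel_integrable_shift(3)[OF k], of "%x. (norm (g x))\<^sup>2"] a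
   by (intro integrable_divide integrable_add) (auto simp: sqint_def)
  show "AE p in lborel \<Otimes>\<^sub>M lborel. norm (case p of (x, y) => ker c (x - y) * f y * g x) <= norm (((case p of (x, y) => norm (ker c (x - y)) * (norm (f y))^2) +
    (case p of (x, y) => norm (ker c (- (y - x))) * (norm (g x))^2)) / 2)"
  proof (rule AE_I2)
   fix p :: "real \<times> real"
   obtain x y where p: "p = (x, y)" by (cases p)
   have "norm (ker c (x - y) * f y * g x) = norm (ker c (x - y)) * (norm (f y) * norm (g x))" by (simp add: norm_mult)
   also have "... <= norm (ker c (x - y)) * (((norm (f y))^2 + (norm (g x))^2) / 2)"
    by (intro mult_left_mono prod_le_half_squares) simp
   finally show "norm (case p of (x, y) => ker c (x - y) * f y * g x) <= norm (((case p of (x, y) => norm (ker c (x - y)) * (norm (f y))^2) +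
    (case p of (x, y) => norm (ker c (- (y - x))) * (norm (g x))^2)) / 2)"
    by (simp add: p algebra_simps)
  qed
 qed measurable
qed

text \<open>Fubini: transposition reflects the kernel, and reflection changes the sign of $c$.\<close>

lemma Rop_dual:
 assumes c: "c ~= 0" and fg: "L1 f \<and> g \<in> BM \<and> (\<forall>x. norm (g x) <= M) \<or> sqint f \<and> sqint g"
 shows "(LBINT x. Rop c f x * g x) = - (LBINT x. f x * Rop (- c) g x)"
  and "L1 (%x. Rop c f x * g x)"
  and "L1 (%x. f x * Rop (- c) g x)"
proof -
 have [measurable]: "f \<in> BM" "g \<in> BM" using fg by (auto simp: sqint_def)
 have i: "integrable (lborel \<Otimes>\<^sub>M lborel) (%(x, y). ker c (x - y) * f y * g x)"
  by (rule ker_prod_integrable[OF c fg])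
 have a: "(LBINT y. ker c (x - y) * f y * g x) = Rop c f x * g x" for x
  unfolding Rop_def by (rule integral_mult_left_zero)
 have b: "(LBINT x. ker c (x - y) * f y * g x) = - (f y * Rop (- c) g y)" for y
 proof -
  have "(LBINT x. ker c (x - y) * f y * g x) = (LBINT x. - f y * (ker (- c) (y - x) * g x))"
  proof (rule integral_cong_AE)
   show "AE x in lborel. ker c (x - y) * f y * g x = - f y * (ker (- c) (y - x) * g x)"
    using AE_lborel_neq[of y] by eventually_elim (use ker_swap[OF _ c] in auto)
  qed measurable
  also have "... = - (f y * Rop (- c) g y)" unfolding Rop_def by (simp only: integral_mult_right_zero) simp
  finally show ?thesis .
 qed
 show "(LBINT x. Rop c f x * g x) = - (LBINT x. f x * Rop (- c) g x)"
  using lborel_pair.Fubini_integral[OF i] unfolding a b by simp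
 show "L1 (%x. Rop c f x * g x)"
  using lborel_pair.integrable_fst[OF i] unfolding a .
 show "L1 (%x. f x * Rop (- c) g x)"
  using lborel_pair.integrable_snd[OF i] unfolding b by simp
qed

lemma Rop_L1:
 assumes c: "c ~= 0" and f: "L1 f"
 shows "L1 (Rop c f)"
 using Rop_dual(2)[OF c, of f "%_. 1" 1] f by simp

lemma Rop_L2:
 assumes c: "c ~= 0" and f: "sqint f"
 shows "sqint (Rop c f)" and "L2_norm (Rop c f) <= L2_norm f / \<bar>c\<bar>"
proof -
 have [measurable]: "f \<in> BM" using f by (auto simp: sqint_def)
 have k: "L1 (%u. norm (ker c u))" using ker_integrable[OF c] by simp
 have kv: "(LBINT u. norm (ker c u)) = 1 / \<bar>c\<bar>" using ker_power_integrable(2)[OF c, of 1] by simp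
 have f2: "L1 (%x. (norm (f x))\<^sup>2)" using f by (simp add: sqint_def)
 let ?g = "%x y. norm (ker c (x - y)) * (norm (f y))^2"
 have i: "integrable (lborel \<Otimes>\<^sub>M lborel) (%(x, y). ?g x y)"
  by (rule conv_integrable(1)[OF k f2])
 have G: "(LBINT x. \<integral>y. ?g x y \<partial>lborel) = 1 / \<bar>c\<bar> * (LBINT x. (norm (f x))\<^sup>2)"
  using lborel_pair.Fubini_integral[OF i] lborel_integral_shift(2)[of "%u. norm (ker c u)"] kv by simp
 have b: "AE x in lborel. (norm (Rop c f x))\<^sup>2 <= 1 / \<bar>c\<bar> * (LBINT y. ?g x y)"
  using lborel_pair.AE_integrable_fst[OF i]
 proof eventually_elim
  case (elim x)
  let ?a = "%y. complex_of_real (sqrt (norm (ker c (x - y))))" and ?b = "%y. complex_of_real (sqrt (norm (ker c (x - y))) * norm (f y))"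
  have sa: "sqint ?a" unfolding sqint_def using lborel_integrable_shift(1)[OF k, of x] by simp
  have sb: "sqint ?b" unfolding sqint_def using elim by (simp add: norm_mult power_mult_distrib del: of_real_mult)
  have "norm (Rop c f x) <= (LBINT y. norm (ker c (x - y) * f y))" unfolding Rop_def by (rule integral_norm_bound)
  also have "... = (LBINT y. norm (?a y) * norm (?b y))"
   by (rule int_cong) (auto simp: norm_mult abs_mult simp flip: mult.assoc)
  also have "... <= L2_norm ?a * L2_norm ?b" by (rule Cauchy_Schwarz_integral[OF sa sb])
  also have "L2_norm ?a = sqrt (1 / \<bar>c\<bar>)"
   unfolding L2_norm_def using lborel_integral_shift(1)[of "%u. norm (ker c u)" x] kv by simp
  also have "L2_norm ?b = sqrt (LBINT y. ?g x y)"
   unfolding L2_norm_def by (simp add: norm_mult power_mult_distrib del: of_real_mult)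
  finally have "norm (Rop c f x) <= sqrt (1 / \<bar>c\<bar> * (LBINT y. ?g x y))" by (simp only: real_sqrt_mult)
  then have "(norm (Rop c f x))^2 <= (sqrt (1 / \<bar>c\<bar> * (LBINT y. ?g x y)))^2" by (intro power_mono) auto
  then show ?case by simp
 qed
 have i2: "L1 (%x. 1 / \<bar>c\<bar> * (LBINT y. ?g x y))"
  using lborel_pair.integrable_fst[OF i] by (rule integrable_mult_right)
 have i3: "L1 (%x. (norm (Rop c f x))\<^sup>2)"
  by (rule L1_bound[OF i2]) (use b in auto)
 then show "sqint (Rop c f)" by (simp add: sqint_def)
 have "(LBINT x. (norm (Rop c f x))\<^sup>2) <= (LBINT x. 1 / \<bar>c\<bar> * (LBINT y. ?g x y))"
  by (rule integral_mono_AE[OF i3 i2 b])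
 also have "... = (1 / \<bar>c\<bar>)^2 * (LBINT x. (norm (f x))\<^sup>2)"
  by (simp only: integral_mult_right_zero G) (simp add: power2_eq_square)
 finally have "L2_norm (Rop c f) <= sqrt ((1 / \<bar>c\<bar>)^2 * (LBINT x. (norm (f x))\<^sup>2))" unfolding L2_norm_def by simp
 also have "... = L2_norm f / \<bar>c\<bar>" by (simp add: L2_norm_def real_sqrt_mult)
 finally show "L2_norm (Rop c f) <= L2_norm f / \<bar>c\<bar>" .
qed

lemma Rop_cong_AE:
 assumes "AE x in lborel. f x = g x" and [measurable]: "f \<in> BM" "g \<in> BM"
 shows "Rop c f = Rop c g"
proof
 fix x show "Rop c f x = Rop c g x" unfolding Rop_def
  by (rule integral_cong_AE) (use assms(1) in auto)
qed

lemma Rop_unique: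
 assumes c: "c ~= 0" and d: "!!y. (u hvd u' y) (at y)" and cont: "cont u'"
  and b: "!!y. norm (u y) <= K" "!!y. norm (u' y) <= K'"
 shows "u = Rop c (%y. u' y + c * u y)"
proof -
 have uc: "cont u"
  using d by (intro continuous_at_imp_continuous_on ballI) (auto intro: has_vector_derivative_continuous)
 have cont': "cont (%y. u' y + c * u y)" by (intro continuous_intros cont uc)
 show ?thesis
 proof (rule Rop_char[OF c _ _ uc b(1)])
  show "(%y. u' y + c * u y) \<in> BM" by (rule borel_measurable_continuous_onI[OF cont'])
  show "norm (u' y + c * u y) <= K' + \<bar>c\<bar> * K" for y
   by (rule order_trans[OF norm_triangle_ineq]) (use b in \<open>auto simp: norm_mult intro!: add_mono mult_left_mono\<close>)
  show "isCont (%y. u' y + c * u y) y \<and> (u hvd u' y + c * u y - c * u y) (at y)" for y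
   using d cont' by (auto simp: continuous_on_eq_continuous_at)
 qed
qed

section \<open>Schwartz functions\<close>

lemma has_vector_derivative_dx: "f differentiable (at x) ==> (f hvd dx f x) (at x)"
 by (simp add: dx_def vector_derivative_works)

lemma schwartz_dx: "schwartz f ==> schwartz (dx f)"
 unfolding schwartz_def by (metis comp_apply funpow_Suc_right)

lemma schwartz_has_derivative_dx: "schwartz f ==> (f hvd dx f x) (at x)"
 using has_vector_derivative_dx unfolding schwartz_def by (metis funpow_0)

lemma schwartz_continuous: "schwartz f ==> cont f"
 by (intro continuous_at_imp_continuous_on ballI) (auto intro: has_vector_derivative_continuous schwartz_has_derivative_dx)

lemma schwartz_measurable [measurable_dest]: "schwartz f ==> f \<in> BM"
 by (intro borel_measurable_continuous_onI schwartz_continuous)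

lemma schwartz_power_bound: "schwartz f ==> \<exists>C. \<forall>x. \<bar>x\<bar> ^ k * norm (f x) <= C"
 unfolding schwartz_def by (metis funpow_0)

lemma schwartz_bounded: "schwartz f ==> \<exists>C. \<forall>x. norm (f x) <= C"
 using schwartz_power_bound[of f 0] by simp

lemma inverse_square_integrable: "L1 (%x::real. 1 / (1 + x^2))"
proof -
 have e: "einterval (- \<infinity>) \<infinity> = (UNIV :: real set)" by (auto simp: einterval_def)
 show ?thesis using integrable_inverse_1_plus_square unfolding e by (simp add: set_integrable_def inverse_eq_divide)
qed

lemma decay_integrable:
 fixes f :: "real => 'a::{banach, second_countable_topology}"
 assumes "f \<in> BM" "!!x. norm (f x) <= C / (1 + x^2)"
 shows "L1 f"
proof (rule L1_bound)
 show "L1 (%x::real. C * (1 / (1 + x^2)))" by (rule integrable_mult_right[OF inverse_square_integrable])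
 show "AE x in lborel. norm (f x) <= norm (C * (1 / (1 + x^2)))"
  using order_trans[OF assms(2) abs_ge_self] by simp
qed (use assms(1) in simp)

lemma schwartz_decay:
 assumes "schwartz f"
 shows "\<exists>C. \<forall>x. \<bar>x\<bar> ^ k * norm (f x) <= C / (1 + x^2)"
proof -
 obtain A where A: "!!x. \<bar>x\<bar> ^ k * norm (f x) <= A" using schwartz_power_bound[OF assms] by blast
 obtain B where B: "!!x. \<bar>x\<bar> ^ (k + 2) * norm (f x) <= B" using schwartz_power_bound[OF assms] by blast
 have "\<bar>x\<bar> ^ k * norm (f x) <= (A + B) / (1 + x^2)" for x
 proof -
  have "(1 + x^2) > 0" by (simp add: add_pos_nonneg)
  moreover have "\<bar>x\<bar> ^ k * norm (f x) * (1 + x^2) = \<bar>x\<bar> ^ k * norm (f x) + \<bar>x\<bar> ^ (k + 2) * norm (f x)"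
   by (simp add: power_add power2_eq_square algebra_simps)
  ultimately show ?thesis using A[of x] B[of x] by (simp add: pos_le_divide_eq)
 qed
 then show ?thesis by blast
qed

lemma schwartz_power_integrable:
 assumes "schwartz f"
 shows "L1 (%x. \<bar>x\<bar> ^ k * norm (f x))"
proof -
 have [measurable]: "f \<in> BM" using assms by measurable
 obtain C where "!!x. \<bar>x\<bar> ^ k * norm (f x) <= C / (1 + x^2)" using schwartz_decay[OF assms] by blast
 then show ?thesis by (intro decay_integrable[of _ C]) auto
qed

lemma schwartz_integrable: "schwartz f ==> L1 f"
 using schwartz_power_integrable[of f 0] by (simp add: integrable_norm_iff schwartz_measurable)

lemma bounded_integrable_sq_integrable:
 assumes "L1 f" "!!x. norm (f x) <= C"
 shows "sqint f"
 unfolding sqint_def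
proof
 show [measurable]: "f \<in> BM" using assms(1) by auto
 show "L1 (%x. (norm (f x))\<^sup>2)"
 proof (rule L1_bound)
  show "L1 (%x. C * norm (f x))" using assms(1) by simp
  show "AE x in lborel. norm ((norm (f x))^2) <= norm (C * norm (f x))"
   using order_trans[OF assms(2) abs_ge_self] by (auto simp: power2_eq_square abs_mult intro!: mult_right_mono)
 qed measurable
qed

lemma schwartz_sq_integrable: "schwartz f ==> sqint f"
 using schwartz_bounded schwartz_integrable bounded_integrable_sq_integrable by blast

lemma Rop_dx:
 assumes c: "c ~= 0" and f: "schwartz f"
 shows "(Rop c f hvd Rop c (dx f) x) (at x)" and "f x - c * Rop c f x = Rop c (dx f) x"
proof -
 obtain C where C: "!!x. norm (f x) <= C" using schwartz_bounded[OF f] by blast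
 obtain C' where C': "!!x. norm (dx f x) <= C'" using schwartz_bounded[OF schwartz_dx[OF f]] by blast
 have cont: "isCont f x" for x using schwartz_continuous[OF f] by (simp add: continuous_on_eq_continuous_at)
 have "f = Rop c (%y. dx f y + c * f y)"
  by (rule Rop_unique[OF c schwartz_has_derivative_dx[OF f] schwartz_continuous[OF schwartz_dx[OF f]] C C'])
 then have "f x = Rop c (%y. dx f y + c * f y) x" by metis
 also have "... = Rop c (dx f) x + c * Rop c f x"
 proof -
  have "Rop c (%y. dx f y + c * f y) x = (LBINT y. ker c (x - y) * dx f y + c * (ker c (x - y) * f y))"
   unfolding Rop_def by (simp add: algebra_simps)
  also have "... = (LBINT y. ker c (x - y) * dx f y) + (LBINT y. c * (ker c (x - y) * f y))"
   by (intro Bochner_Integration.integral_add integrable_mult_right Rop_integrable_L1 schwartz_integrable f schwartz_dx)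
  also have "... = Rop c (dx f) x + c * Rop c f x" unfolding Rop_def by (simp only: integral_mult_right_zero)
  finally show ?thesis .
 qed
 finally show e: "f x - c * Rop c f x = Rop c (dx f) x" by simp
 show "(Rop c f hvd Rop c (dx f) x) (at x)"
  using Rop_has_derivative[OF c schwartz_measurable[OF f] C cont, of x] unfolding e .
qed

lemma power_le_fact_exp: "\<bar>x\<bar> ^ k <= fact k * exp \<bar>x::real\<bar>"
proof -
 have "\<bar>x\<bar> ^ k / fact k <= exp \<bar>x\<bar>"
 proof -
  have "(\<Sum>i\<in>{k}. \<bar>x\<bar> ^ i /\<^sub>R fact i) <= (\<Sum>i. \<bar>x\<bar> ^ i /\<^sub>R fact i)"
   using summable_exp_generic[of "\<bar>x\<bar>"] by (intro sum_le_suminf) auto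
  then show ?thesis by (simp add: exp_def divide_inverse mult.commute)
 qed
 then show ?thesis by (simp add: field_simps)
qed

lemma norm_ker_power_bound:
 assumes c: "c ~= 0"
 shows "\<bar>u\<bar> ^ k * norm (ker c u) <= fact k / \<bar>c\<bar> ^ k"
proof -
 have "(\<bar>c\<bar> * \<bar>u\<bar>) ^ k * norm (ker c u) <= fact k * exp (\<bar>c\<bar> * \<bar>u\<bar>) * exp (- (\<bar>c\<bar> * \<bar>u\<bar>))"
  using power_le_fact_exp[of "\<bar>c\<bar> * \<bar>u\<bar>" k] norm_ker_le[of c u] by (intro mult_mono) auto
 also have "... = fact k" by (simp add: exp_minus)
 finally show ?thesis using c by (simp add: field_simps power_mult_distrib)
qed

lemma Rop_power_bound:
 assumes c: "c ~= 0" and f: "schwartz f"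
 shows "\<exists>C. \<forall>x. \<bar>x\<bar> ^ k * norm (Rop c f x) <= C"
proof -
 let ?I = "%k. \<integral>y. \<bar>y\<bar> ^ k * norm (f y) \<partial>lborel"
 have [measurable]: "f \<in> BM" using f by measurable
 have "\<bar>x\<bar> ^ k * norm (Rop c f x) <= 2 ^ k * (fact k / \<bar>c\<bar> ^ k * ?I 0 + ?I k)" for x
 proof -
  have "\<bar>x\<bar> ^ k * norm (Rop c f x) <= \<bar>x\<bar> ^ k * (LBINT y. norm (ker c (x - y) * f y))"
   unfolding Rop_def by (intro mult_left_mono integral_norm_bound) simp
  also have "... = (LBINT y. \<bar>x\<bar> ^ k * norm (ker c (x - y) * f y))" by simp
  also have "... <= (LBINT y. 2 ^ k * (fact k / \<bar>c\<bar> ^ k * (\<bar>y\<bar> ^ 0 * norm (f y)) + \<bar>y\<bar> ^ k * norm (f y)))"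
  proof (rule integral_mono)
   show "L1 (%y. \<bar>x\<bar> ^ k * norm (ker c (x - y) * f y))"
    using Rop_integrable_L1[OF schwartz_integrable[OF f]] by (intro integrable_mult_right integrable_norm)
   show "L1 (%y. 2 ^ k * (fact k / \<bar>c\<bar> ^ k * (\<bar>y\<bar> ^ 0 * norm (f y)) + \<bar>y\<bar> ^ k * norm (f y)))"
    by (intro integrable_mult_right Bochner_Integration.integrable_add; rule schwartz_power_integrable[OF f])
   fix y
   have "\<bar>x\<bar> <= 2 * max \<bar>x - y\<bar> \<bar>y\<bar>" using abs_triangle_ineq[of "x - y" y] by (auto simp: max_def)
   then have "\<bar>x\<bar> ^ k <= (2 * max \<bar>x - y\<bar> \<bar>y\<bar>) ^ k" by (intro power_mono) auto
   also have "... <= 2 ^ k * (\<bar>x - y\<bar> ^ k + \<bar>y\<bar> ^ k)" by (auto simp: power_mult_distrib max_def)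
   finally have "\<bar>x\<bar> ^ k * norm (ker c (x - y) * f y) <= 2 ^ k * (\<bar>x - y\<bar> ^ k + \<bar>y\<bar> ^ k) * norm (ker c (x - y) * f y)"
    by (intro mult_right_mono) auto
   also have "... = 2 ^ k * ((\<bar>x - y\<bar> ^ k * norm (ker c (x - y))) * norm (f y) + norm (ker c (x - y)) * (\<bar>y\<bar> ^ k * norm (f y)))"
    by (simp add: norm_mult algebra_simps)
   also have "... <= 2 ^ k * (fact k / \<bar>c\<bar> ^ k * norm (f y) + 1 * (\<bar>y\<bar> ^ k * norm (f y)))"
    by (intro mult_left_mono add_mono mult_right_mono norm_ker_power_bound[OF c] norm_ker_le_1) auto
   finally show "\<bar>x\<bar> ^ k * norm (ker c (x - y) * f y) <= 2 ^ k * (fact k / \<bar>c\<bar> ^ k * (\<bar>y\<bar> ^ 0 * norm (f y)) + \<bar>y\<bar> ^ k * norm (f y))" by simp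
  qed
  also have "... = 2 ^ k * (fact k / \<bar>c\<bar> ^ k * ?I 0 + ?I k)"
   by (subst integral_mult_right_zero, subst Bochner_Integration.integral_add)
    (auto intro!: integrable_mult_right schwartz_power_integrable[OF f] simp del: power_0)
  finally show ?thesis .
 qed
 then show ?thesis by blast
qed

lemma Rop_schwartz:
 assumes c: "c ~= 0" and f: "schwartz f"
 shows "schwartz (Rop c f)"
proof -
 have s: "schwartz ((dx ^^ n) f)" for n using f schwartz_dx by (induction n) auto
 have e: "(dx ^^ n) (Rop c f) = Rop c ((dx ^^ n) f)" for n
 proof (induction n)
  case (Suc n)
  have "dx (Rop c ((dx ^^ n) f)) = Rop c (dx ((dx ^^ n) f))"
   unfolding dx_def[of "Rop c ((dx ^^ n) f)"] by (rule ext, rule vector_derivative_at, rule Rop_dx(1)[OF c s])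
  then show ?case using Suc by simp
 qed simp
 show ?thesis unfolding schwartz_def e
  using differentiableI_vector[OF Rop_dx(1)[OF c s]] Rop_power_bound[OF c s] by blast
qed

lemma gauss_power_bound:
 fixes x :: real
 assumes s: "s > 0"
 shows "\<bar>x\<bar> ^ k * exp (- s * x^2 / 2 + b * x) <= fact k * exp ((\<bar>b\<bar> + 1)^2 / (2 * s))"
proof -
 have "\<bar>x\<bar> ^ k * exp (- s * x^2 / 2 + b * x) <= fact k * exp \<bar>x\<bar> * exp (- s * x^2 / 2 + b * x)"
  by (intro mult_right_mono power_le_fact_exp) simp
 also have "... = fact k * exp (\<bar>x\<bar> - s * x^2 / 2 + b * x)" by (simp add: exp_add[symmetric] algebra_simps)
 also have "... <= fact k * exp ((\<bar>b\<bar> + 1)^2 / (2 * s))"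
 proof -
  have "b * x <= \<bar>b\<bar> * \<bar>x\<bar>" by (metis abs_ge_self abs_mult)
  then have "\<bar>x\<bar> - s * x^2 / 2 + b * x <= (\<bar>b\<bar> + 1) * \<bar>x\<bar> - s * \<bar>x\<bar>\<^sup>2 / 2" by (simp add: algebra_simps)
  also have "... <= (\<bar>b\<bar> + 1)^2 / (2 * s)"
  proof -
   have "0 <= ((\<bar>b\<bar> + 1) - s * \<bar>x\<bar>)^2" by simp
   then have "(2 * s) * ((\<bar>b\<bar> + 1) * \<bar>x\<bar> - s * \<bar>x\<bar>\<^sup>2 / 2) <= (\<bar>b\<bar> + 1)^2"
    unfolding power2_diff by (simp add: algebra_simps power2_eq_square)
   then show ?thesis using s by (simp add: pos_le_divide_eq mult.commute)
  qed
  finally show ?thesis by simp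
 qed
 finally show ?thesis .
qed

definition poly_gauss :: "complex poly => real => complex => real => complex" where
 "poly_gauss p s c x = poly p (of_real x) * exp (- of_real s * (of_real x)^2 / 2 + c * of_real x)"

lemma poly_gauss_has_derivative:
 "(poly_gauss p s c hvd poly_gauss (pderiv p + p * [:c, - of_real s:]) s c x) (at x)"
proof -
 have "((%z. poly p z * exp (- of_real s * z^2 / 2 + c * z)) has_field_derivative
   poly_gauss (pderiv p + p * [:c, - of_real s:]) s c x) (at (of_real x))"
  unfolding poly_gauss_def
  by (auto intro!: derivative_eq_intros poly_DERIV simp: algebra_simps)
 then show ?thesis unfolding poly_gauss_def[abs_def] by (rule has_vector_derivative_real_field)
qed

lemma norm_poly_gauss: "norm (poly_gauss p s c x) = norm (poly p (of_real x)) * exp (- s * x^2 / 2 + Re c * x)"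
proof -
 have "Re (- of_real s * (of_real x)^2 / 2 + c * of_real x) = - s * x^2 / 2 + Re c * x"
  by (simp flip: of_real_power of_real_mult)
 then show ?thesis unfolding poly_gauss_def by (simp add: norm_mult del: Re_divide_numeral)
qed

lemma poly_gauss_bound:
 assumes s: "s > 0"
 shows "\<exists>C. \<forall>x. \<bar>x\<bar> ^ k * norm (poly_gauss p s c x) <= C"
proof (induction p arbitrary: k)
 case 0
 then show ?case by (auto simp: poly_gauss_def)
next
 case (pCons a p)
 obtain C where C: "!!x. \<bar>x\<bar> ^ (Suc k) * norm (poly_gauss p s c x) <= C" using pCons.IH by blast
 have "\<bar>x\<bar> ^ k * norm (poly_gauss (pCons a p) s c x) <= norm a * (fact k * exp ((\<bar>Re c\<bar> + 1)^2 / (2 * s))) + C" for x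
 proof -
  let ?E = "exp (- s * x^2 / 2 + Re c * x)"
  have "\<bar>x\<bar> ^ k * norm (poly_gauss (pCons a p) s c x) = \<bar>x\<bar> ^ k * norm (a + of_real x * poly p (of_real x)) * ?E"
   by (simp add: norm_poly_gauss)
  also have "... <= \<bar>x\<bar> ^ k * (norm a + \<bar>x\<bar> * norm (poly p (of_real x))) * ?E"
   by (intro mult_right_mono mult_left_mono order_trans[OF norm_triangle_ineq]) (auto simp: norm_mult)
  also have "... = norm a * (\<bar>x\<bar> ^ k * ?E) + \<bar>x\<bar> ^ (Suc k) * norm (poly_gauss p s c x)"
   by (simp add: norm_poly_gauss algebra_simps)
  also have "... <= norm a * (fact k * exp ((\<bar>Re c\<bar> + 1)^2 / (2 * s))) + C"
   by (intro add_mono mult_left_mono gauss_power_bound[OF s] C) simp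
  finally show ?thesis .
 qed
 then show ?case by blast
qed

lemma schwartz_poly_gauss:
 assumes s: "s > 0"
 shows "schwartz (poly_gauss p s c)"
proof -
 have d: "dx (poly_gauss p s c) = poly_gauss (pderiv p + p * [:c, - of_real s:]) s c" for p
  unfolding dx_def[of "poly_gauss p s c"] by (rule ext, rule vector_derivative_at, rule poly_gauss_has_derivative)
 have "\<exists>q. (dx ^^ n) (poly_gauss p s c) = poly_gauss q s c" for n
 proof (induction n)
  case (Suc n)
  then obtain q where "(dx ^^ n) (poly_gauss p s c) = poly_gauss q s c" by blast
  then show ?case using d[of q] by (intro exI[of _ "pderiv q + q * [:c, - of_real s:]"]) simp
 qed auto
 then show ?thesis unfolding schwartz_def
  using differentiableI_vector[OF poly_gauss_has_derivative] poly_gauss_bound[OF s] by metis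
qed

abbreviation gauss :: "real => complex => real => complex" where
 "gauss \<equiv> poly_gauss 1"

lemma gauss_eq: "gauss s c x = exp (- of_real s * (of_real x)^2 / 2 + c * of_real x)"
 by (simp add: poly_gauss_def)

definition bump :: "nat => real => real" where
 "bump n u = real (Suc n) * std_normal_density (real (Suc n) * u)"

lemma bump_nonneg [simp]: "0 <= bump n u" by (simp add: bump_def)

lemma bump_measurable [measurable]: "bump n \<in> BM" unfolding bump_def by measurable

lemma bump_minus: "bump n (- u) = bump n u" by (simp add: bump_def std_normal_density_def)

lemma bump_integrable: "L1 (bump n)" and bump_integral: "(LBINT u. bump n u) = 1"
proof -
 show "L1 (bump n)" unfolding bump_def
  using lborel_integrable_real_affine[of std_normal_density "real (Suc n)" 0] by simp
 show "(LBINT u. bump n u) = 1" unfolding bump_def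
  using lborel_integral_real_affine[of "real (Suc n)" std_normal_density 0] by simp
qed

lemma bump_gauss:
 "complex_of_real (bump n (x - a)) = of_real (real (Suc n) / sqrt (2 * pi) * exp (- (real (Suc n))\<^sup>2 * a^2 / 2)) * gauss ((real (Suc n))^2) (of_real ((real (Suc n))^2 * a)) x"
proof -
 let ?s = "(real (Suc n))^2"
 have g: "gauss ?s (of_real (?s * a)) x = of_real (exp (- ?s * x^2 / 2 + ?s * a * x))"
  unfolding gauss_eq exp_of_real[symmetric] by simp
 have "bump n (x - a) = real (Suc n) / sqrt (2 * pi) * exp (- ?s * (x - a)^2 / 2)"
  unfolding bump_def std_normal_density_def power_mult_distrib by simp
 also have "exp (- ?s * (x - a)^2 / 2) = exp (- ?s * a^2 / 2) * exp (- ?s * x^2 / 2 + ?s * a * x)"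
  unfolding exp_add[symmetric] by (rule arg_cong[of _ _ exp]) (simp add: power2_diff algebra_simps add_divide_distrib diff_divide_distrib)
 finally show ?thesis unfolding g of_real_mult[symmetric] by (simp only: mult.assoc)
qed

lemma bump_approx:
 fixes f :: "real => complex"
 assumes [measurable]: "f \<in> BM" and M: "!!y. norm (f y) <= M" and c: "isCont f x"
 shows "(%n. \<integral>y. bump n (y - x) * f y \<partial>lborel) -->> f x"
proof -
 have e: "(LBINT y. bump n (y - x) * f y) = (LBINT z. std_normal_density z * f (x + z / real (Suc n)))" for n
 proof -
  have "(LBINT z. std_normal_density z * f (x + z / real (Suc n))) =
    real (Suc n) *\<^sub>R (LBINT z. std_normal_density (- real (Suc n) * x + real (Suc n) * z) * f (x + (- real (Suc n) * x + real (Suc n) * z) / real (Suc n)))"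
   by (subst lborel_integral_real_affine[of "real (Suc n)" _ "- real (Suc n) * x"]) auto
  also have "... = (LBINT y. bump n (y - x) * f y)"
   unfolding integral_scaleR_right[symmetric]
  proof (rule int_cong[OF refl])
   fix z
   have "x + (- real (Suc n) * x + real (Suc n) * z) / real (Suc n) = z" by (simp add: field_simps del: of_nat_Suc)
   moreover have "- real (Suc n) * x + real (Suc n) * z = real (Suc n) * (z - x)" by (simp add: algebra_simps)
   ultimately show "real (Suc n) *\<^sub>R (complex_of_real (std_normal_density (- real (Suc n) * x + real (Suc n) * z)) * f (x + (- real (Suc n) * x + real (Suc n) * z) / real (Suc n))) =
     complex_of_real (bump n (z - x)) * f z"
    by (simp add: bump_def scaleR_conv_of_real mult.assoc)
  qed
  finally show ?thesis by simp
 qed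
 have "(%n. \<integral>z. std_normal_density z * f (x + z / real (Suc n)) \<partial>lborel) -->> (LBINT z. std_normal_density z * f x)"
 proof (rule integral_dominated_convergence)
  show "L1 (%z. std_normal_density z * M)" by (intro integrable_mult_left) simp
  show "AE z in lborel. (%n. complex_of_real (std_normal_density z) * f (x + z / real (Suc n))) -->> std_normal_density z * f x"
  proof (rule AE_I2)
   fix z
   have "(%n. x + z / real (Suc n)) -->> x + 0"
    by (intro tendsto_add tendsto_const) real_asymp
   then have "(%n. f (x + z / real (Suc n))) -->> f x"
    using isCont_tendsto_compose[OF c] by simp
   then show "(%n. complex_of_real (std_normal_density z) * f (x + z / real (Suc n))) -->> std_normal_density z * f x"
    by (rule tendsto_mult_left)
  qed
  show "AE z in lborel. norm (complex_of_real (std_normal_density z) * f (x + z / real (Suc n))) <= std_normal_density z * M" for n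
   using M by (auto simp: norm_mult intro!: mult_left_mono)
 qed measurable
 also have "(LBINT z. std_normal_density z * f x) = f x" by simp
 finally show ?thesis unfolding e .
qed

lemma integral_halflines_zero:
 fixes h :: "real => complex"
 assumes h: "L1 h" and z: "!!a. (LBINT x. indicator {..a} x *\<^sub>R h x) = 0"
 shows "AE x in lborel. h x = 0"
proof -
 have [measurable]: "h \<in> BM" using h by auto
 have ih: "L1 (%x. indicator A x *\<^sub>R h x)" if "A \<in> sets borel" for A
  using h that by (intro integrable_mult_indicator) auto
 have tot: "(LBINT x. h x) = 0"
 proof -
  have "(%n. \<integral>x. indicator {..real n} x *\<^sub>R h x \<partial>lborel) -->> (LBINT x. h x)"
  proof (rule integral_dominated_convergence)
   show "L1 (%x. norm (h x))" using h by simp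
   show "AE x in lborel. (%n. indicator {..real n} x *\<^sub>R h x) -->> h x"
   proof (rule AE_I2)
    fix x :: real
    have "\<forall>\<^sub>F n in sequentially. indicator {..real n} x *\<^sub>R h x = h x"
     using eventually_ge_at_top[of "nat \<lceil>x\<rceil>"] by eventually_elim (simp add: indicator_def nat_le_iff ceiling_le_iff)
    then show "(%n. indicator {..real n} x *\<^sub>R h x) -->> h x" by (rule tendsto_eventually)
   qed
  qed (auto simp: indicator_def)
  then show ?thesis unfolding z by (simp add: LIMSEQ_const_iff)
 qed
 have "(LBINT x. indicator A x *\<^sub>R h x) = 0" if "A \<in> sets borel" for A
 proof -
  have A: "A \<in> sigma_sets UNIV (range atMost)" using that by (simp add: borel_eq_atMost[where 'a=real] sets_measure_of)
  have "Int_stable (range (atMost :: real => real set))" by (auto simp: Int_stable_def)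
  moreover have "range (atMost :: real => real set) \<subseteq> Pow UNIV" by simp
  ultimately show ?thesis using A
  proof (induction rule: sigma_sets_induct_disjoint)
   case (basic A)
   then show ?case using z by auto
  next
   case empty
   then show ?case by simp
  next
   case (compl A)
   have A: "A \<in> sets borel" using compl(1) by (simp add: borel_eq_atMost[where 'a=real] sets_measure_of)
   have "(LBINT x. indicator (UNIV - A) x *\<^sub>R h x) = (LBINT x. h x - indicator A x *\<^sub>R h x)"
    by (rule int_cong) (auto simp: indicator_def)
   also have "... = 0" using ih[OF A] h tot compl by simp
   finally show ?case .
  next
   case (union A)
   have A: "A i \<in> sets borel" for i using union(2) by (auto simp: borel_eq_atMost[where 'a=real] sets_measure_of)
   have "set_lebesgue_integral lborel (\<Union>i. A i) h = (\<Sum>i. set_lebesgue_integral lborel (A i) h)"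
    by (rule lebesgue_integral_countable_add) (use A union(1) ih in \<open>auto simp: set_integrable_def disjoint_family_on_def\<close>)
   then show ?case using union(3) by (simp add: set_lebesgue_integral_def)
  qed
 qed
 then show ?thesis
  using sigma_finite_measure.density_zero[OF sigma_finite_lborel h] by (auto simp: set_lebesgue_integral_def)
qed

lemma bump_separates:
 fixes h :: "real => complex"
 assumes h: "L1 h" and z: "!!a n. (LBINT x. h x * bump n (x - a)) = 0"
 shows "AE x in lborel. h x = 0"
proof (rule integral_halflines_zero[OF h])
 fix a
 have [measurable]: "h \<in> BM" using h by auto
 have 0: "(LBINT x. h x * (LBINT y. complex_of_real (bump n (y - x)) * indicator {..a} y)) = 0" for n
 proof -
  have b: "L1 (%u. complex_of_real (bump n u))" using bump_integrable by simp
  have i: "integrable (lborel \<Otimes>\<^sub>M lborel) (%(x, y). (complex_of_real (bump n (y - x)) * h x) * indicator {..a} y)"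
  proof (rule L1_bound[OF conv_integrable(2)[OF b h]])
  qed (auto simp: indicator_def split_beta)
  have "(LBINT x. h x * (LBINT y. complex_of_real (bump n (y - x)) * indicator {..a} y)) =
   (LBINT x. \<integral>y. (complex_of_real (bump n (y - x)) * h x) * indicator {..a} y \<partial>lborel)"
   by (simp flip: integral_mult_right_zero add: mult_ac)
  also have "... = (LBINT y. \<integral>x. (complex_of_real (bump n (y - x)) * h x) * indicator {..a} y \<partial>lborel)"
   by (rule lborel_pair.Fubini_integral[OF i, symmetric])
  also have "... = (LBINT y. (LBINT x. h x * bump n (x - y)) * indicator {..a} y)"
  proof -
   have "bump n (y - x) = bump n (x - y)" for x y using bump_minus[of n "x - y"] by simp
   then show ?thesis by (simp add: mult.commute)
  qed
  finally show ?thesis using z by simp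
 qed
 have "(%n. \<integral>x. h x * (LBINT y. complex_of_real (bump n (y - x)) * indicator {..a} y) \<partial>lborel) -->> (LBINT x. h x * indicator {..a} x)"
 proof (rule integral_dominated_convergence)
  show "L1 (%x. norm (h x))" using h by simp
  show "AE x in lborel. (%n. h x * (LBINT y. complex_of_real (bump n (y - x)) * indicator {..a} y)) -->> h x * indicator {..a} x"
   using AE_lborel_neq[of a]
  proof eventually_elim
   case (elim x)
   have "isCont (%y. indicator {..a} y :: complex) x"
   proof (cases "x < a")
    case True
    have "\<forall>\<^sub>F y in nhds x. (indicator {..a} y :: complex) = 1"
     using eventually_nhds_in_open[of "{..<a}" x] True by (auto elim!: eventually_mono simp: indicator_def)
    then show ?thesis by (simp add: isCont_cong)
   next
    case False
    then have "a < x" using elim by simp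
    then have "\<forall>\<^sub>F y in nhds x. (indicator {..a} y :: complex) = 0"
     using eventually_nhds_in_open[of "{a<..}" x] by (auto elim!: eventually_mono simp: indicator_def)
    then show ?thesis by (simp add: isCont_cong)
   qed
   then have "(%n. \<integral>y. complex_of_real (bump n (y - x)) * indicator {..a} y \<partial>lborel) -->> (indicator {..a} x :: complex)"
    by (intro bump_approx[of _ 1]) (auto simp: indicator_def)
   then show ?case by (rule tendsto_mult_left)
  qed
  show "AE x in lborel. norm (h x * (LBINT y. complex_of_real (bump n (y - x)) * indicator {..a} y)) <= norm (h x)" for n
  proof (rule AE_I2)
   fix x
   have "norm (LBINT y. complex_of_real (bump n (y - x)) * indicator {..a} y) <= (LBINT y. norm (complex_of_real (bump n (y - x)) * indicator {..a} y))"
    by (rule integral_norm_bound)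
   also have "... <= (LBINT y. bump n (y - x))"
    by (rule integral_mono') (auto simp: norm_mult indicator_def lborel_integrable_shift[OF bump_integrable])
   also have "... = 1" using lborel_integral_shift(2)[of "bump n" x] bump_integral by simp
   finally show "norm (h x * (LBINT y. complex_of_real (bump n (y - x)) * indicator {..a} y)) <= norm (h x)"
    by (simp add: norm_mult mult_left_le)
  qed
 qed measurable
 then have "(LBINT x. h x * indicator {..a} x) = 0" unfolding 0 by (simp add: LIMSEQ_const_iff)
 moreover have "indicator {..a} x *\<^sub>R h x = h x * indicator {..a} x" for x by (simp add: indicator_def)
 ultimately show "(LBINT x. indicator {..a} x *\<^sub>R h x) = 0" by simp
qed

lemma gauss_mult: "gauss s c x * gauss s' c' x = gauss (s + s') (c + c') x"
 unfolding gauss_eq exp_add[symmetric] by (rule arg_cong[of _ _ exp]) (simp add: field_simps)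

lemma gauss_separates:
 fixes h :: "real => complex"
 assumes [measurable]: "h \<in> BM"
  and i: "!!s c. s > 0 ==> L1 (%x. h x * gauss s (of_real c) x)"
  and z: "!!s c. s > 0 ==> (LBINT x. h x * gauss s (of_real c) x) = 0"
 shows "AE x in lborel. h x = 0"
proof -
 have "AE x in lborel. h x * gauss 1 (of_real 0) x = 0"
 proof (rule bump_separates[OF i])
  fix a n
  let ?s = "(real (Suc n))^2"
  let ?K = "complex_of_real (real (Suc n) / sqrt (2 * pi) * exp (- ?s * a^2 / 2))"
  have "h x * gauss 1 (of_real 0) x * bump n (x - a) = ?K * (h x * gauss (1 + ?s) (of_real (0 + ?s * a)) x)" for x
   unfolding of_real_add gauss_mult[symmetric] bump_gauss by (simp only: mult_ac)
  then have "(LBINT x. h x * gauss 1 (of_real 0) x * bump n (x - a)) = ?K * (LBINT x. h x * gauss (1 + ?s) (of_real (0 + ?s * a)) x)"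
   by (simp only: integral_mult_right_zero)
  also have "... = 0" using z[of "1 + ?s" "0 + ?s * a"] by (simp add: add_pos_nonneg del: of_real_add)
  finally show "(LBINT x. h x * gauss 1 (of_real 0) x * bump n (x - a)) = 0" .
 qed simp
 then show ?thesis by (auto simp: gauss_eq)
qed

text \<open>Gaussians are Schwartz functions, and their convolutions approximate the indicator of a half-line.\<close>

lemma schwartz_separates:
 assumes "h \<in> BM" "!!f. schwartz f ==> L1 (%x. h x * f x)" "!!f. schwartz f ==> (LBINT x. h x * f x) = 0"
 shows "AE x in lborel. h x = 0"
 using assms schwartz_poly_gauss by (intro gauss_separates) auto

section \<open>Weak derivatives\<close>

lemma sq_integrable_add:
 assumes "sqint f" "sqint g"
 shows "sqint (%x. f x + g x)"
 unfolding sqint_def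
proof
 have [measurable]: "f \<in> BM" "g \<in> BM" using assms by (auto simp: sqint_def)
 show "(%x. f x + g x) \<in> BM" by measurable
 show "L1 (%x. (norm (f x + g x))\<^sup>2)"
 proof (rule L1_bound)
  show "L1 (%x. 2 * ((norm (f x))^2 + (norm (g x))^2))" using assms by (auto simp: sqint_def)
  have "(norm (f x + g x))^2 <= (norm (f x) + norm (g x))^2" for x by (intro power_mono norm_triangle_ineq) simp
  also have "(norm (f x) + norm (g x))^2 <= 2 * ((norm (f x))^2 + (norm (g x))^2)" for x
   using prod_le_half_squares[of "norm (f x)" "norm (g x)"] by (simp add: power2_sum algebra_simps)
  finally show "AE x in lborel. norm ((norm (f x + g x))^2) <= norm (2 * ((norm (f x))^2 + (norm (g x))^2))" by simp
 qed measurable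
qed

lemma sq_integrable_bounded_mult:
 assumes "sqint f" "g \<in> BM" "!!x. norm (g x) <= M"
 shows "sqint (%x. g x * f x)"
 unfolding sqint_def
proof
 have [measurable]: "f \<in> BM" "g \<in> BM" using assms by (auto simp: sqint_def)
 show "(%x. g x * f x) \<in> BM" by measurable
 show "L1 (%x. (norm (g x * f x))\<^sup>2)"
 proof (rule L1_bound)
  show "L1 (%x. M\<^sup>2 * (norm (f x))^2)" using assms by (auto simp: sqint_def)
  show "AE x in lborel. norm ((norm (g x * f x))^2) <= norm (M^2 * (norm (f x))^2)"
   using mult_right_mono[OF power_mono[OF assms(3) norm_ge_zero, of _ 2] zero_le_power2] by (auto simp: norm_mult power_mult_distrib)
 qed measurable
qed

lemma sq_integrable_cmult: "sqint f ==> sqint (%x. c * f x)"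
 by (rule sq_integrable_bounded_mult[where M="norm c"]) auto

lemma sq_integrable_diff: "sqint f ==> sqint g ==> sqint (%x. f x - g x)"
 using sq_integrable_add[of f "%x. - g x"] sq_integrable_cmult[of g "-1"] by simp

text \<open>A test function can be written as a resolvent of a Schwartz function, so duality moves the resolvent to $u$.\<close>

lemma weak_deriv_imp_Rop:
 assumes c: "c ~= 0" and u: "sqint u" and v: "sqint v" and w: "weak_deriv u v"
 shows "AE x in lborel. u x = Rop c (%y. v y + c * u y) x"
proof -
 let ?h = "%y. v y + c * u y"
 have h: "sqint ?h" by (intro sq_integrable_add sq_integrable_cmult u v)
 have "AE x in lborel. u x - Rop c ?h x = 0"
 proof (rule schwartz_separates)
  show "(%x. u x - Rop c ?h x) \<in> BM"
   using sq_integrable_diff[OF u Rop_L2(1)[OF c h]] by (simp add: sqint_def)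
  fix psi assume psi: "schwartz psi"
  have p2: "sqint psi" by (rule schwartz_sq_integrable[OF psi])
  let ?phi = "Rop (- c) psi"
  have c': "- c ~= 0" using c by simp
  have ph: "schwartz ?phi" by (rule Rop_schwartz[OF c' psi])
  have ph2: "sqint ?phi" by (rule schwartz_sq_integrable[OF ph])
  show "L1 (%x. (u x - Rop c ?h x) * psi x)"
   by (rule sq_integrable_mult[OF sq_integrable_diff[OF u Rop_L2(1)[OF c h]] p2])
  have dph: "dx ?phi x = psi x + c * ?phi x" for x
   using vector_derivative_at[OF Rop_dx(1)[OF c' psi], of x] Rop_dx(2)[OF c' psi, of x] by (simp add: dx_def)
  have "(LBINT x. u x * psi x) = (LBINT x. u x * dx ?phi x - c * (u x * ?phi x))"
   by (simp add: dph algebra_simps)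
  also have "... = (LBINT x. u x * dx ?phi x) - c * (LBINT x. u x * ?phi x)"
   using sq_integrable_mult[OF u ph2] sq_integrable_mult[OF u schwartz_sq_integrable[OF schwartz_dx[OF ph]]] by simp
  also have "(LBINT x. u x * dx ?phi x) = - (LBINT x. v x * ?phi x)"
   using w ph unfolding weak_deriv_def by blast
  also have "- (LBINT x. v x * ?phi x) - c * (LBINT x. u x * ?phi x) = - (LBINT x. ?h x * ?phi x)"
   using sq_integrable_mult[OF u ph2] sq_integrable_mult[OF v ph2] by (simp add: distrib_right mult.assoc)
  also have "... = (LBINT x. Rop c ?h x * psi x)"
   using Rop_dual(1)[OF c, of ?h psi] h p2 by simp
  finally show "(LBINT x. (u x - Rop c ?h x) * psi x) = 0"
   using sq_integrable_mult[OF u p2] sq_integrable_mult[OF Rop_L2(1)[OF c h] p2] by (simp add: left_diff_distrib)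
 qed
 then show ?thesis by simp
qed

definition C1_test :: "(real => complex) => (real => complex) => bool" where
 "C1_test zeta zeta' \<longleftrightarrow> (\<forall>x. (zeta hvd zeta' x) (at x)) \<and> cont zeta' \<and>
   (\<exists>C. \<forall>x. norm (zeta x) <= C \<and> norm (zeta' x) <= C) \<and> sqint zeta \<and> sqint zeta'"

definition C1_bounded :: "(real => complex) => (real => complex) => bool" where
 "C1_bounded zeta zeta' \<longleftrightarrow> (\<forall>x. (zeta hvd zeta' x) (at x)) \<and> cont zeta' \<and>
   (\<exists>C. \<forall>x. norm (zeta x) <= C \<and> norm (zeta' x) <= C)"

lemma C1_bounded_continuous: "C1_bounded p p' ==> cont p \<and> cont p'"
 unfolding C1_bounded_def
 by (auto intro!: continuous_at_imp_continuous_on intro: has_vector_derivative_continuous)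

lemma C1_bounded_measurable: "C1_bounded p p' ==> p \<in> BM \<and> p' \<in> BM"
 using C1_bounded_continuous borel_measurable_continuous_onI by blast

lemma schwartz_C1_test: "schwartz phi ==> C1_test phi (dx phi)"
 unfolding C1_test_def
proof (intro conjI allI)
 assume phi: "schwartz phi"
 obtain C D where "!!x. norm (phi x) <= C" "!!x. norm (dx phi x) <= D"
  using schwartz_bounded[OF phi] schwartz_bounded[OF schwartz_dx[OF phi]] by blast
 then have "norm (phi x) <= max C D \<and> norm (dx phi x) <= max C D" for x by (auto simp: le_max_iff_disj)
 then show "\<exists>C. \<forall>x. norm (phi x) <= C \<and> norm (dx phi x) <= C" by blast
qed (auto intro: schwartz_has_derivative_dx schwartz_continuous schwartz_dx schwartz_sq_integrable)

lemma C1_test_mult: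
 assumes p: "C1_bounded p p'" and x: "C1_test zeta zeta'"
 shows "C1_test (%x. p x * zeta x) (%x. p x * zeta' x + p' x * zeta x)"
proof -
 obtain P where P: "!!x. norm (p x) <= P" "!!x. norm (p' x) <= P" using p unfolding C1_bounded_def by blast
 obtain C where C: "!!x. norm (zeta x) <= C" "!!x. norm (zeta' x) <= C" using x unfolding C1_test_def by blast
 have P0: "P \<ge> 0" using order_trans[OF norm_ge_zero P(1)] .
 have pm: "p \<in> BM" "p' \<in> BM" using C1_bounded_measurable[OF p] by auto
 have pc: "cont p" "cont p'" using C1_bounded_continuous[OF p] by auto
 have xc: "cont zeta" "cont zeta'" using x unfolding C1_test_def
  by (auto intro!: continuous_at_imp_continuous_on intro: has_vector_derivative_continuous)
 have b: "norm (p x * zeta x) <= P * C" "norm (p x * zeta' x) <= P * C" "norm (p' x * zeta x) <= P * C" for x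
  unfolding norm_mult using P C P0 by (auto intro!: mult_mono)
 have C0: "P * C \<ge> 0" using order_trans[OF norm_ge_zero b(1)] .
 show ?thesis unfolding C1_test_def
 proof (intro conjI allI)
  show "((%x. p x * zeta x) hvd p x * zeta' x + p' x * zeta x) (at x)" for x
   using p x unfolding C1_bounded_def C1_test_def by (intro has_vector_derivative_mult) auto
  show "cont (%x. p x * zeta' x + p' x * zeta x)" by (intro continuous_intros pc xc)
  have "norm (p x * zeta x) <= 2 * (P * C) \<and> norm (p x * zeta' x + p' x * zeta x) <= 2 * (P * C)" for x
   using b[of x] C0 norm_triangle_ineq[of "p x * zeta' x" "p' x * zeta x"] by linarith
  then show "\<exists>C. \<forall>x. norm (p x * zeta x) <= C \<and> norm (p x * zeta' x + p' x * zeta x) <= C" by blast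
  show "sqint (%x. p x * zeta x)" "sqint (%x. p x * zeta' x + p' x * zeta x)"
   using x pm P unfolding C1_test_def by (auto intro!: sq_integrable_add intro: sq_integrable_bounded_mult)
 qed
qed

lemma Rop_weak:
 assumes c: "c ~= 0" and h: "sqint h" and t: "C1_test zeta zeta'"
 shows "(LBINT x. Rop c h x * zeta' x) = - (LBINT x. (h x - c * Rop c h x) * zeta x)"
proof -
 have c': "- c ~= 0" using c by simp
 obtain C where C: "!!x. norm (zeta x) <= C" "!!x. norm (zeta' x) <= C" using t unfolding C1_test_def by blast
 have t2: "sqint zeta" "sqint zeta'" using t by (auto simp: C1_test_def)
 have R2: "sqint (Rop c h)" by (rule Rop_L2(1)[OF c h])
 have "zeta = Rop (- c) (%y. zeta' y + of_real (- c) * zeta y)"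
  using t by (intro Rop_unique[OF c' _ _ C]) (auto simp: C1_test_def)
 then have e: "zeta x = Rop (- c) (%y. zeta' y + of_real (- c) * zeta y) x" for x by metis
 have "Rop (- c) (%y. zeta' y + of_real (- c) * zeta y) x = Rop (- c) zeta' x + of_real (- c) * Rop (- c) zeta x" for x
  unfolding Rop_def using Rop_integrable_L2[OF c' t2(1), of x] Rop_integrable_L2[OF c' t2(2), of x]
  by (simp add: distrib_left mult.left_commute del: of_real_minus)
 then have e2: "Rop (- c) zeta' x = zeta x + c * Rop (- c) zeta x" for x using e[of x] by simp
 have "(LBINT x. Rop c h x * zeta' x) = - (LBINT x. h x * zeta x + c * (h x * Rop (- c) zeta x))"
  using Rop_dual(1)[OF c, of h zeta'] h t2 by (simp add: e2 algebra_simps)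
 also have "... = - ((LBINT x. h x * zeta x) + c * (LBINT x. h x * Rop (- c) zeta x))"
  using sq_integrable_mult[OF h t2(1)] sq_integrable_mult[OF h Rop_L2(1)[OF c' t2(1)]] by simp
 also have "(LBINT x. h x * Rop (- c) zeta x) = - (LBINT x. Rop c h x * zeta x)"
  using Rop_dual(1)[OF c, of h zeta] h t2 by simp
 finally show ?thesis
  using sq_integrable_mult[OF h t2(1)] sq_integrable_mult[OF R2 t2(1)] by (simp add: left_diff_distrib mult.assoc)
qed

lemma weak_deriv_C1_test:
 assumes u: "sqint u" and v: "sqint v" and w: "weak_deriv u v" and t: "C1_test zeta zeta'"
 shows "(LBINT x. u x * zeta' x) = - (LBINT x. v x * zeta x)"
proof -
 let ?h = "%y. v y + of_real 1 * u y"
 have h: "sqint ?h" by (intro sq_integrable_add sq_integrable_cmult u v)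
 have [measurable]: "u \<in> BM" "v \<in> BM" "zeta \<in> BM" "zeta' \<in> BM"
   using u v t by (auto simp: sqint_def C1_test_def)
 have ae: "AE x in lborel. u x = Rop 1 ?h x" by (rule weak_deriv_imp_Rop[OF _ u v w]) simp
 have "(LBINT x. u x * zeta' x) = (LBINT x. Rop 1 ?h x * zeta' x)"
  by (rule integral_cong_AE) (use ae in auto)
 also have "... = - (LBINT x. (?h x - of_real 1 * Rop 1 ?h x) * zeta x)" by (rule Rop_weak[OF _ h t]) simp
 also have "(LBINT x. (?h x - of_real 1 * Rop 1 ?h x) * zeta x) = (LBINT x. v x * zeta x)"
  by (rule integral_cong_AE) (use ae in auto)
 finally show ?thesis .
qed

lemma weak_deriv_mult:
 assumes u: "sqint u" and v: "sqint v" and w: "weak_deriv u v" and p: "C1_bounded p p'"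
 shows "weak_deriv (%x. p x * u x) (%x. p x * v x + p' x * u x)"
 unfolding weak_deriv_def
proof (intro allI impI)
 fix phi assume phi: "schwartz phi"
 obtain P where P: "!!x. norm (p x) <= P" "!!x. norm (p' x) <= P" using p unfolding C1_bounded_def by blast
 have pm: "p \<in> BM" "p' \<in> BM" using C1_bounded_measurable[OF p] by auto
 have t: "C1_test (%x. p x * phi x) (%x. p x * dx phi x + p' x * phi x)"
  by (rule C1_test_mult[OF p schwartz_C1_test[OF phi]])
 have f: "sqint phi" "sqint (dx phi)" using phi by (auto intro: schwartz_sq_integrable schwartz_dx)
 have i: "L1 (%x. u x * (p x * dx phi x))" "L1 (%x. u x * (p' x * phi x))" "L1 (%x. v x * (p x * phi x))"
  using P pm f u v by (auto intro!: sq_integrable_mult intro: sq_integrable_bounded_mult)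
 have "(LBINT x. p x * u x * dx phi x) = (LBINT x. u x * (p x * dx phi x + p' x * phi x) - u x * (p' x * phi x))"
  by (simp add: algebra_simps)
 also have "... = (LBINT x. u x * (p x * dx phi x + p' x * phi x)) - (LBINT x. u x * (p' x * phi x))"
  using i by (simp add: distrib_left)
 also have "... = - (LBINT x. v x * (p x * phi x)) - (LBINT x. u x * (p' x * phi x))"
  using weak_deriv_C1_test[OF u v w t] by simp
 also have "... = - (LBINT x. v x * (p x * phi x) + u x * (p' x * phi x))" using i by simp
 finally show "(LBINT x. p x * u x * dx phi x) = - (LBINT x. (p x * v x + p' x * u x) * phi x)"
  by (simp add: algebra_simps)
qed

lemma weak_deriv_add:
 assumes u: "sqint u" "sqint u'" and v: "sqint v" "sqint v'" and w: "weak_deriv u v" "weak_deriv u' v'"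
 shows "weak_deriv (%x. u x + u' x) (%x. v x + v' x)"
 unfolding weak_deriv_def
proof (intro allI impI)
 fix phi assume phi: "schwartz phi"
 have f: "sqint phi" "sqint (dx phi)" using phi by (auto intro: schwartz_sq_integrable schwartz_dx)
 have "(LBINT x. u x * dx phi x) = - (LBINT x. v x * phi x)" "(LBINT x. u' x * dx phi x) = - (LBINT x. v' x * phi x)"
  using w phi unfolding weak_deriv_def by blast+
 then show "(LBINT x. (u x + u' x) * dx phi x) = - (LBINT x. (v x + v' x) * phi x)"
  using sq_integrable_mult[OF u(1) f(2)] sq_integrable_mult[OF u(2) f(2)] sq_integrable_mult[OF v(1) f(1)] sq_integrable_mult[OF v(2) f(1)]
  by (simp add: distrib_right)
qed

lemma Rop_weak_deriv:
 assumes c: "c ~= 0" and h: "sqint h"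
 shows "weak_deriv (Rop c h) (%x. h x - c * Rop c h x)"
 unfolding weak_deriv_def using Rop_weak[OF c h schwartz_C1_test] by blast

section \<open>Riccati equations\<close>

lemma contraction_fixed_point:
 fixes F :: "(real => complex) => real => complex"
 assumes K: "K \<ge> 0"
  and self: "!!u. cont u ==> (!!x. norm (u x) <= K) ==> cont (F u) \<and> (\<forall>x. norm (F u x) <= K)"
  and contr: "!!u v D x. cont u ==> cont v ==> (!!x. norm (u x) <= K) ==> (!!x. norm (v x) <= K) ==>
    (!!x. norm (u x - v x) <= D) ==> norm (F u x - F v x) <= D / 2"
 shows "\<exists>u. cont u \<and> (\<forall>x. norm (u x) <= K) \<and> F u = u"
proof -
 let ?S = "{u :: real \<Rightarrow>\<^sub>C complex. \<forall>x. norm (apply_bcontfun u x) <= K}"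
 let ?F = "%u. Bcontfun (F (apply_bcontfun u))"
 have ap: "apply_bcontfun (?F u) = F (apply_bcontfun u)" if "u \<in> ?S" for u
 proof (rule Bcontfun_inverse)
  show "F (apply_bcontfun u) \<in> bcontfun" using self[of "apply_bcontfun u"] that by (intro bcontfun_normI[of _ K]) auto
 qed
 have "\<exists>!u. u \<in> ?S \<and> ?F u = u"
 proof -
  have "?S = PiC UNIV (%_. cball 0 K)" by (auto simp: mem_PiC_iff Pi_iff)
  then have closed: "closed ?S" using closed_PiC[of UNIV "%_. cball (0::complex) K"] by simp
  have "(0 :: real \<Rightarrow>\<^sub>C complex) \<in> ?S" using K by simp
  then have "?S ~= {}" by blast
  moreover have "?F ` ?S \<subseteq> ?S" using ap self by auto
  moreover have "dist (?F u) (?F v) <= 1 / 2 * dist u v" if uv: "u \<in> ?S" "v \<in> ?S" for u v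
  proof (rule dist_bound)
   fix x
   have "dist (apply_bcontfun (?F u) x) (apply_bcontfun (?F v) x) = norm (F (apply_bcontfun u) x - F (apply_bcontfun v) x)"
    unfolding ap[OF uv(1)] ap[OF uv(2)] dist_norm ..
   also have "... <= dist u v / 2"
    using uv dist_bounded[of u _ v] by (intro contr) (auto simp: dist_norm)
   finally show "dist (apply_bcontfun (?F u) x) (apply_bcontfun (?F v) x) <= 1 / 2 * dist u v" by simp
  qed
  ultimately show ?thesis using Banach_fix[OF iffD2[OF complete_eq_closed closed], of "1/2" ?F] by auto
 qed
 then obtain u where u: "u \<in> ?S" "?F u = u" by blast
 then have "F (apply_bcontfun u) = apply_bcontfun u" using ap[OF u(1)] by simp
 then show ?thesis using u(1) by (intro exI[of _ "apply_bcontfun u"]) auto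
qed

text \<open>The constant $1/4$ makes the Riccati map a contraction of the ball of radius $1/2$: it moves $a - b u^2$ with $|u| \le 1/2$ into the ball, and the quadratic part has Lipschitz constant $1/4$.\<close>

definition small_for :: "real => (real => complex) => bool" where
 "small_for c a \<longleftrightarrow> cont a \<and> (\<exists>C. \<forall>x. norm (a x) <= C) \<and>
   (\<forall>f M x. f \<in> BM --> (\<forall>y. norm (f y) <= M) --> norm (Rop c (%y. a y * f y) x) <= M / 4)"

definition riccati :: "real => (real => complex) => (real => complex) => real => complex" where
 "riccati c a b = (SOME u. cont u \<and> (\<forall>x. norm (u x) <= 1 / 2) \<and> Rop c (%y. a y - b y * (u y)^2) = u)"

lemma Rop_diff:
 assumes "c ~= 0" "f \<in> BM" "!!y. norm (f y) <= M" "g \<in> BM" "!!y. norm (g y) <= N"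
 shows "Rop c (%y. f y - g y) x = Rop c f x - Rop c g x"
 unfolding Rop_def using Rop_integrable_bounded[OF assms(1,2,3)] Rop_integrable_bounded[OF assms(1,4,5)]
 by (simp add: right_diff_distrib)

lemma Rop_add:
 assumes "c ~= 0" "f \<in> BM" "!!y. norm (f y) <= M" "g \<in> BM" "!!y. norm (g y) <= N"
 shows "Rop c (%y. f y + g y) x = Rop c f x + Rop c g x"
 unfolding Rop_def using Rop_integrable_bounded[OF assms(1,2,3)] Rop_integrable_bounded[OF assms(1,4,5)]
 by (simp add: distrib_left)

lemma Rop_cmult: "Rop c (%y. k * f y) x = k * Rop c f x"
 unfolding Rop_def integral_mult_right_zero[symmetric] by (simp add: mult_ac)

lemma bounded_mult:
 fixes f g :: "real => complex"
 assumes "\<exists>C. \<forall>x. norm (f x) <= C" "\<exists>C. \<forall>x. norm (g x) <= C"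
 shows "\<exists>C. \<forall>x. norm (f x * g x) <= C"
proof -
 obtain C D where "!!x. norm (f x) <= C" "!!x. norm (g x) <= D" using assms by blast
 then have "norm (f x * g x) <= C * D" for x
  unfolding norm_mult by (intro mult_mono) (auto intro: order_trans[OF norm_ge_zero])
 then show ?thesis by blast
qed

lemma bounded_diff:
 fixes f g :: "real => complex"
 assumes "\<exists>C. \<forall>x. norm (f x) <= C" "\<exists>C. \<forall>x. norm (g x) <= C"
 shows "\<exists>C. \<forall>x. norm (f x - g x) <= C"
 by (meson assms norm_triangle_le_diff add_mono)

lemma bounded_add:
 fixes f g :: "real => complex"
 assumes "\<exists>C. \<forall>x. norm (f x) <= C" "\<exists>C. \<forall>x. norm (g x) <= C"
 shows "\<exists>C. \<forall>x. norm (f x + g x) <= C"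
 by (meson assms norm_triangle_le add_mono)

lemma riccati_exists:
 assumes c: "c ~= 0" and a: "small_for c a" and b: "small_for c b"
 shows "\<exists>u. cont u \<and> (\<forall>x. norm (u x) <= 1 / 2) \<and> Rop c (%y. a y - b y * (u y)^2) = u"
proof (rule contraction_fixed_point)
 have cont: "cont a" "cont b" using a b by (auto simp: small_for_def)
 have [measurable]: "a \<in> BM" "b \<in> BM" using cont by (auto intro: borel_measurable_continuous_onI)
 obtain A B where AB: "!!x. norm (a x) <= A" "!!x. norm (b x) <= B" using a b unfolding small_for_def by blast
 {
  fix u :: "real => complex" assume u: "cont u" "!!x. norm (u x) <= 1 / 2"
  have [measurable]: "u \<in> BM" using u(1) by (rule borel_measurable_continuous_onI)
  have u2: "norm ((u y)^2) <= 1 / 4" for y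
   using power_mono[OF u(2)[of y] norm_ge_zero, of 2] by (simp add: norm_power power_divide)
  have bu: "norm (b y * (u y)^2) <= B * (1 / 4)" for y
   unfolding norm_mult by (intro mult_mono AB u2) (auto intro: order_trans[OF norm_ge_zero AB(2)])
  note u2 bu
 } note facts = this
 {
  fix u :: "real => complex" assume u: "cont u" "!!x. norm (u x) <= 1 / 2"
  have [measurable]: "u \<in> BM" using u(1) by (rule borel_measurable_continuous_onI)
  note f = facts[OF u]
  have meas: "(%y. a y - b y * (u y)^2) \<in> BM" by measurable
  have bnd: "norm (a y - b y * (u y)^2) <= A + B * (1 / 4)" for y
   by (rule order_trans[OF norm_triangle_ineq4 add_mono[OF AB(1) f(2)]])
  have "isCont (Rop c (%y. a y - b y * (u y)^2)) x" for x
   by (rule Rop_isCont[OF c meas bnd])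
  moreover have "norm (Rop c (%y. a y - b y * (u y)^2) x) <= 1 / 2" for x
  proof -
   have "Rop c (%y. a y - b y * (u y)^2) x = Rop c (%y. a y * 1) x - Rop c (%y. b y * (u y)^2) x"
    by (simp, rule Rop_diff[OF c _ AB(1) _ f(2)]) measurable
   also have "norm ... <= norm (Rop c (%y. a y * 1) x) + norm (Rop c (%y. b y * (u y)^2) x)" by (rule norm_triangle_ineq4)
   also have "norm (Rop c (%y. a y * 1) x) <= 1 / 4" using a[unfolded small_for_def, THEN conjunct2, THEN conjunct2, rule_format, of "%_. 1" 1 x] by simp
   also have "norm (Rop c (%y. b y * (u y)^2) x) <= (1 / 4) / 4"
    by (rule b[unfolded small_for_def, THEN conjunct2, THEN conjunct2, rule_format]) (measurable, rule f(1))
   finally show ?thesis by simp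
  qed
  ultimately show "cont (Rop c (%y. a y - b y * (u y)^2)) \<and> (\<forall>x. norm (Rop c (%y. a y - b y * (u y)^2) x) <= 1 / 2)"
   by (simp add: continuous_on_eq_continuous_at)
 }
 fix u v :: "real => complex" and D x
 assume uv: "cont u" "cont v" "!!x. norm (u x) <= 1 / 2" "!!x. norm (v x) <= 1 / 2" and D: "!!x. norm (u x - v x) <= D"
 have [measurable]: "u \<in> BM" "v \<in> BM" using uv by (auto intro: borel_measurable_continuous_onI)
 note fu = facts[OF uv(1,3)] and fv = facts[OF uv(2,4)]
 have "Rop c (%y. a y - b y * (u y)^2) x - Rop c (%y. a y - b y * (v y)^2) x = Rop c (%y. (a y - b y * (u y)^2) - (a y - b y * (v y)^2)) x"
  by (rule Rop_diff[OF c, symmetric]) (measurable, rule order_trans[OF norm_triangle_ineq4 add_mono[OF AB(1) fu(2)]], measurable,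
    rule order_trans[OF norm_triangle_ineq4 add_mono[OF AB(1) fv(2)]])
 also have "... = Rop c (%y. b y * ((v y)^2 - (u y)\<^sup>2)) x" by (simp add: right_diff_distrib)
 also have "norm ... <= D / 4"
 proof (rule b[unfolded small_for_def, THEN conjunct2, THEN conjunct2, rule_format])
  fix y
  have "norm ((v y)^2 - (u y)\<^sup>2) = norm (u y - v y) * norm (u y + v y)"
   by (simp add: power2_eq_square square_diff_square_factored norm_mult norm_minus_commute[of "v y"] add.commute mult.commute)
  also have "... <= D * 1"
   using norm_triangle_ineq[of "u y" "v y"] uv(3)[of y] uv(4)[of y] by (intro mult_mono D) (auto intro: order_trans[OF norm_ge_zero D])
  finally show "norm ((v y)^2 - (u y)\<^sup>2) <= D" by simp
 qed measurable
 also have "D / 4 <= D / 2" using order_trans[OF norm_ge_zero D] by simp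
 finally show "norm (Rop c (%y. a y - b y * (u y)^2) x - Rop c (%y. a y - b y * (v y)^2) x) <= D / 2" .
qed simp

lemma riccati:
 assumes c: "c ~= 0" and a: "small_for c a" and b: "small_for c b"
 shows "cont (riccati c a b)" "norm (riccati c a b x) <= 1 / 2"
  "riccati c a b = Rop c (%y. a y - b y * (riccati c a b y)^2)"
 using someI_ex[OF riccati_exists[OF assms]] unfolding riccati_def[symmetric] by auto

lemma riccati_derivative:
 assumes c: "c ~= 0" and a: "small_for c a" and b: "small_for c b"
 shows "C1_bounded (riccati c a b) (%x. a x - b x * (riccati c a b x)^2 - c * riccati c a b x)"
proof -
 let ?u = "riccati c a b"
 note r = riccati[OF assms]
 have cont: "cont a" "cont b" using a b by (auto simp: small_for_def)
 have ch: "cont (%y. a y - b y * (?u y)^2)" by (intro continuous_intros cont r)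
 have bu: "\<exists>C. \<forall>x. norm (?u x) <= C" using r(2) by blast
 have "\<exists>C. \<forall>x. norm (a x - b x * (?u x)^2) <= C"
  unfolding power2_eq_square using a b bu unfolding small_for_def by (intro bounded_diff bounded_mult) auto
 then obtain M where M: "!!x. norm (a x - b x * (?u x)^2) <= M" by blast
 have "(Rop c (%y. a y - b y * (?u y)^2) hvd a x - b x * (?u x)^2 - c * Rop c (%y. a y - b y * (?u y)^2) x) (at x)" for x
  using ch by (intro Rop_has_derivative[OF c borel_measurable_continuous_onI[OF ch] M]) (auto simp: continuous_on_eq_continuous_at)
 then have d: "(?u hvd a x - b x * (?u x)^2 - c * ?u x) (at x)" for x
  unfolding r(3)[symmetric] .
 have "norm (?u x) <= M + \<bar>c\<bar> + 1 \<and> norm (a x - b x * (?u x)^2 - c * ?u x) <= M + \<bar>c\<bar> + 1" for x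
 proof -
  have M0: "0 <= M" using order_trans[OF norm_ge_zero M] .
  have "norm (a x - b x * (?u x)^2 - c * ?u x) <= norm (a x - b x * (?u x)^2) + norm (c * ?u x)" by (rule norm_triangle_ineq4)
  moreover have "norm (c * ?u x) <= \<bar>c\<bar> * 1" unfolding norm_mult norm_of_real using r(2)[of x] by (intro mult_left_mono) auto
  moreover have "norm (?u x) <= 1" using r(2)[of x] by simp
  ultimately show ?thesis using M[of x] M0 by simp
 qed
 then show ?thesis unfolding C1_bounded_def
  using d ch r(1) by (auto intro!: continuous_intros)
qed

lemma C1_bounded_bounds: "C1_bounded p p' ==> (\<exists>C. \<forall>x. norm (p x) <= C) \<and> (\<exists>C. \<forall>x. norm (p' x) <= C)"
 unfolding C1_bounded_def by blast

lemma C1_bounded_mult: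
 assumes "C1_bounded p p'" "C1_bounded q q'"
 shows "C1_bounded (%x. p x * q x) (%x. p x * q' x + p' x * q x)"
 unfolding C1_bounded_def
proof (intro conjI allI)
 note c = C1_bounded_continuous[OF assms(1)] C1_bounded_continuous[OF assms(2)]
 show "((%x. p x * q x) hvd p x * q' x + p' x * q x) (at x)" for x
  using assms by (intro has_vector_derivative_mult) (auto simp: C1_bounded_def)
 show "cont (%x. p x * q' x + p' x * q x)" using c by (auto intro!: continuous_intros)
 have "\<exists>C. \<forall>x. norm (p x * q x) <= C" "\<exists>C. \<forall>x. norm (p x * q' x + p' x * q x) <= C"
  using C1_bounded_bounds[OF assms(1)] C1_bounded_bounds[OF assms(2)] by (intro bounded_mult bounded_add; simp)+
 then obtain C D where "!!x. norm (p x * q x) <= C" "!!x. norm (p x * q' x + p' x * q x) <= D" by blast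
 then have "norm (p x * q x) <= max C D \<and> norm (p x * q' x + p' x * q x) <= max C D" for x by (simp add: le_max_iff_disj)
 then show "\<exists>C. \<forall>x. norm (p x * q x) <= C \<and> norm (p x * q' x + p' x * q x) <= C" by blast
qed

lemma C1_bounded_inverse:
 assumes "C1_bounded p p'" and e: "e > 0" "!!x. norm (p x) \<ge> e"
 shows "C1_bounded (%x. 1 / p x) (%x. - p' x / (p x)^2)"
 unfolding C1_bounded_def
proof (intro conjI allI)
 note c = C1_bounded_continuous[OF assms(1)]
 have nz: "p x ~= 0" for x using e(2)[of x] e(1) by auto
 show "((%x. 1 / p x) hvd - p' x / (p x)^2) (at x)" for x
 proof -
  have d: "(p hvd p' x) (at x)" using assms(1) by (simp add: C1_bounded_def)
  have "((%z. 1 / z) has_field_derivative - 1 / (p x)^2) (at (p x))"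
   by (auto intro!: derivative_eq_intros simp: nz power2_eq_square divide_inverse)
  from field_vector_diff_chain_at[OF d this] show ?thesis by (simp add: o_def)
 qed
 show "cont (%x. - p' x / (p x)^2)" using c nz by (auto intro!: continuous_intros)
 obtain C where C: "!!x. norm (p' x) <= C" using assms(1) unfolding C1_bounded_def by blast
 have "norm (1 / p x) <= max (1 / e) (C / e^2) \<and> norm (- p' x / (p x)^2) <= max (1 / e) (C / e^2)" for x
 proof -
  have "norm (1 / p x) <= 1 / e" using e by (simp add: norm_divide frac_le)
  moreover have "norm (- p' x / (p x)^2) <= C / e^2"
   unfolding norm_divide norm_power norm_minus_cancel using e C order_trans[OF norm_ge_zero C]
   by (intro frac_le power_mono) auto
  ultimately show ?thesis by (simp add: le_max_iff_disj)
 qed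
 then show "\<exists>C. \<forall>x. norm (1 / p x) <= C \<and> norm (- p' x / (p x)^2) <= C" by blast
qed

lemma C1_bounded_const: "C1_bounded (%_. k) (%_. 0)"
 unfolding C1_bounded_def by (auto intro!: exI[of _ "norm k"])

lemma C1_bounded_diff:
 assumes "C1_bounded p p'" "C1_bounded q q'"
 shows "C1_bounded (%x. p x - q x) (%x. p' x - q' x)"
 unfolding C1_bounded_def
proof (intro conjI allI)
 note c = C1_bounded_continuous[OF assms(1)] C1_bounded_continuous[OF assms(2)]
 show "((%x. p x - q x) hvd p' x - q' x) (at x)" for x
  using assms by (intro has_vector_derivative_diff) (auto simp: C1_bounded_def)
 show "cont (%x. p' x - q' x)" using c by (auto intro!: continuous_intros)
 have "\<exists>C. \<forall>x. norm (p x - q x) <= C" "\<exists>C. \<forall>x. norm (p' x - q' x) <= C"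
  using C1_bounded_bounds[OF assms(1)] C1_bounded_bounds[OF assms(2)] by (intro bounded_diff; simp)+
 then obtain C D where "!!x. norm (p x - q x) <= C" "!!x. norm (p' x - q' x) <= D" by blast
 then have "norm (p x - q x) <= max C D \<and> norm (p' x - q' x) <= max C D" for x by (simp add: le_max_iff_disj)
 then show "\<exists>C. \<forall>x. norm (p x - q x) <= C \<and> norm (p' x - q' x) <= C" by blast
qed

text \<open>Integrability bounds the antiderivative, so that the integrating factor and its inverse are both bounded.\<close>

lemma C1_bounded_exp_antiderivative:
 fixes f :: "real => complex"
 assumes f: "cont f" "L1 f" "!!x. norm (f x) <= C"
 shows "\<exists>E. C1_bounded E (%x. f x * E x) \<and> C1_bounded (%x. 1 / E x) (%x. - f x / E x) \<and> (\<forall>x. E x ~= 0)"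
proof -
 have m[measurable]: "f \<in> BM" using f(1) by (rule borel_measurable_continuous_onI)
 have int: "L1 (%y. indicator {..z} y *\<^sub>R f y)" for z :: real
  using f(2) by (intro integrable_mult_indicator) auto
 define F where "F z = (LBINT y. indicator {..z} y *\<^sub>R f y)" for z
 have dF: "(F hvd f x) (at x)" for x
  unfolding F_def by (rule halfline_integral(2)[OF m int]) (use f(1) in \<open>simp add: continuous_on_eq_continuous_at\<close>)
 let ?I = "\<integral>y. norm (f y) \<partial>lborel"
 have FB: "norm (F x) <= ?I" for x
 proof -
  have "norm (F x) <= (LBINT y. norm (indicator {..x} y *\<^sub>R f y))" unfolding F_def by (rule integral_norm_bound)
  also have "... <= ?I" by (rule integral_mono) (use integrable_norm[OF int[of x]] f(2) in \<open>auto simp: indicator_def\<close>)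
  finally show ?thesis .
 qed
 have dE: "((%x. exp (k * F x)) hvd k * f x * exp (k * F x)) (at x)" for x k
 proof -
  have "((%z. exp (k * z)) has_field_derivative exp (k * F x) * k) (at (F x))" by (auto intro!: derivative_eq_intros)
  from field_vector_diff_chain_at[OF dF this] show ?thesis by (simp add: o_def mult_ac)
 qed
 have Fc: "cont F" using dF by (auto intro!: continuous_at_imp_continuous_on intro: has_vector_derivative_continuous)
 have bE: "norm (exp (k * F x)) <= exp ?I" if "norm k = 1" for k x
 proof -
  have "Re (k * F x) <= norm (k * F x)" by (rule complex_Re_le_cmod)
  also have "... <= ?I" using FB that by (simp add: norm_mult)
  finally show ?thesis by simp
 qed
 have C0: "C \<ge> 0" using order_trans[OF norm_ge_zero f(3)] .
 have cb: "C1_bounded (%x. exp (k * F x)) (%x. k * f x * exp (k * F x))" if k: "norm k = 1" for k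
  unfolding C1_bounded_def
 proof (intro conjI allI)
  show "((%x. exp (k * F x)) hvd k * f x * exp (k * F x)) (at x)" for x by (rule dE)
  show "cont (%x. k * f x * exp (k * F x))" by (intro continuous_intros f Fc)
  have "norm (exp (k * F x)) <= (1 + C) * exp ?I \<and> norm (k * f x * exp (k * F x)) <= (1 + C) * exp ?I" for x
  proof
   have "1 * norm (exp (k * F x)) <= (1 + C) * exp ?I" using bE[OF k, of x] C0 by (intro mult_mono) auto
   then show "norm (exp (k * F x)) <= (1 + C) * exp ?I" by simp
   show "norm (k * f x * exp (k * F x)) <= (1 + C) * exp ?I"
    unfolding norm_mult k using bE[OF k, of x] C0 f(3)[of x] by (intro mult_mono) auto
  qed
  then show "\<exists>C. \<forall>x. norm (exp (k * F x)) <= C \<and> norm (k * f x * exp (k * F x)) <= C" by blast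
 qed
 have "C1_bounded (%x. exp (F x)) (%x. f x * exp (F x))" using cb[of 1] by simp
 moreover have "C1_bounded (%x. 1 / exp (F x)) (%x. - f x / exp (F x))" using cb[of "-1"] by (simp add: exp_minus divide_inverse)
 ultimately show ?thesis by (intro exI[of _ "%x. exp (F x)"]) auto
qed

section \<open>Vector-valued square-integrable functions\<close>

lemma vec2_measurable_iff:
 fixes f :: "real => complex^2"
 shows "f \<in> BM \<longleftrightarrow> (\<forall>i. (%x. f x $ i) \<in> BM)"
proof
 assume [measurable]: "f \<in> BM"
 have [measurable]: "(%v :: complex^2. v $ i) \<in> BM" for i
  by (intro borel_measurable_continuous_onI continuous_intros)
 show "\<forall>i. (%x. f x $ i) \<in> BM" by measurable
next
 assume a[measurable]: "\<forall>i. (%x. f x $ i) \<in> BM"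
 have "(%x. f x \<bullet> b) \<in> BM" if "b \<in> Basis" for b
 proof -
  obtain i u where b: "b = axis i u" using \<open>b \<in> Basis\<close> by (auto simp: Basis_vec_def)
  show ?thesis unfolding b inner_axis using a by (intro borel_measurable_inner) auto
 qed
 then show "f \<in> BM" by (subst borel_measurable_euclidean_space) auto
qed

lemma norm_vec2_sq: "(norm (v :: complex^2))^2 = (norm (v $ 1))^2 + (norm (v $ 2))^2"
 unfolding norm_vec_def L2_set_def by (simp add: sum_2 add_nonneg_nonneg)

lemma norm_vec2_le: "norm (v :: complex^2) <= norm (v $ 1) + norm (v $ 2)"
 unfolding norm_vec_def using L2_set_le_sum[of UNIV "%i. norm (v $ i)"] by (simp add: sum_2)

lemma L2_vec2_iff: "(f :: real => complex^2) \<in> L2 \<longleftrightarrow> sqint (%x. f x $ 1) \<and> sqint (%x. f x $ 2)"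
proof
 assume f: "f \<in> L2"
 have m: "(%x. f x $ i) \<in> BM" for i using f vec2_measurable_iff by (simp add: L2_def)
 have "L1 (%x. (norm (f x $ i))\<^sup>2)" for i
 proof (rule L1_bound)
  show "L1 (%x. (norm (f x))\<^sup>2)" using f by (simp add: L2_def)
  show "(%x. (norm (f x $ i))\<^sup>2) \<in> borel_measurable lborel" using m[of i] by measurable
  show "AE x in lborel. norm ((norm (f x $ i))^2) <= norm ((norm (f x))^2)" by (intro AE_I2) (simp add: power_mono Finite_Cartesian_Product.norm_nth_le)
 qed
 then show "sqint (%x. f x $ 1) \<and> sqint (%x. f x $ 2)" using m by (simp add: sqint_def)
next
 assume a: "sqint (%x. f x $ 1) \<and> sqint (%x. f x $ 2)"
 then have "f \<in> BM" by (simp add: vec2_measurable_iff forall_2 sqint_def)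
 then show "f \<in> L2" using a unfolding L2_def norm_vec2_sq by (simp add: sqint_def)
qed

lemma L2_norm_vec2:
 assumes "(f :: real => complex^2) \<in> L2"
 shows "(L2_norm f)^2 = (L2_norm (%x. f x $ 1))^2 + (L2_norm (%x. f x $ 2))^2"
 using assms unfolding L2_vec2_iff L2_norm_def norm_vec2_sq by (simp add: sqint_def add_nonneg_nonneg)

lemma L2_norm_vec2_le:
 assumes "(f :: real => complex^2) \<in> L2"
 shows "L2_norm (%x. f x $ i) <= L2_norm f" "L2_norm f <= L2_norm (%x. f x $ 1) + L2_norm (%x. f x $ 2)"
proof -
 have "(L2_norm (%x. f x $ i))^2 <= (L2_norm f)^2" unfolding L2_norm_vec2[OF assms] using exhaust_2[of i] by auto
 then show "L2_norm (%x. f x $ i) <= L2_norm f" by (rule power2_le_imp_le) simp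
 have "(L2_norm f)^2 <= (L2_norm (%x. f x $ 1) + L2_norm (%x. f x $ 2))^2" unfolding L2_norm_vec2[OF assms] power2_sum by simp
 then show "L2_norm f <= L2_norm (%x. f x $ 1) + L2_norm (%x. f x $ 2)" by (rule power2_le_imp_le) simp
qed

lemma integrable_vec2:
 fixes f :: "real => complex^2"
 assumes "L1 (%x. f x $ 1)" "L1 (%x. f x $ 2)"
 shows "L1 f"
proof (rule L1_bound)
 show "L1 (%x. norm (f x $ 1) + norm (f x $ 2))" using assms by simp
 show "f \<in> borel_measurable lborel" using assms by (simp add: vec2_measurable_iff forall_2 borel_measurable_integrable)
 show "AE x in lborel. norm (f x) <= norm (norm (f x $ 1) + norm (f x $ 2))" using norm_vec2_le by auto
qed

lemma integral_vec2_nth: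
 fixes f :: "real => complex^2"
 assumes "L1 f"
 shows "(LBINT x. f x) $ i = (LBINT x. f x $ i)" and "L1 (%x. f x $ i)"
 using integral_bounded_linear[OF bounded_linear_vec_nth assms, of i] integrable_bounded_linear[OF bounded_linear_vec_nth assms, of i]
 by simp_all

lemma mat2_mult_vec: "((vector [vector [a, b], vector [c, d]] :: complex^2^2) *v u) $ 1 = a * u $ 1 + b * u $ 2"
 "((vector [vector [a, b], vector [c, d]] :: complex^2^2) *v u) $ 2 = c * u $ 1 + d * u $ 2"
 by (simp_all add: matrix_vector_mult_def sum_2 vector_2)

lemma L2_norm_triangle:
 assumes f: "sqint f" and g: "sqint g"
 shows "L2_norm (%x. f x + g x) <= L2_norm f + L2_norm g"
proof -
 have i: "L1 (%x. (norm (f x))\<^sup>2)" "L1 (%x. (norm (g x))\<^sup>2)" using f g by (auto simp: sqint_def)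
 have ifg: "L1 (%x. norm (f x) * norm (g x))" using integrable_norm[OF sq_integrable_mult[OF f g]] by (simp add: norm_mult)
 have sq: "(L2_norm h)^2 = (LBINT x. (norm (h x))\<^sup>2)" for h :: "real => complex" by (simp add: L2_norm_def)
 have "(L2_norm (%x. f x + g x))^2 <= (LBINT x. (norm (f x))\<^sup>2 + 2 * (norm (f x) * norm (g x)) + (norm (g x))^2)"
  unfolding sq
 proof (rule integral_mono)
  show "L1 (%x. (norm (f x + g x))\<^sup>2)" using sq_integrable_add[OF f g] by (simp add: sqint_def)
  show "L1 (%x. (norm (f x))\<^sup>2 + 2 * (norm (f x) * norm (g x)) + (norm (g x))^2)" using i ifg by simp
  show "(norm (f x + g x))^2 <= (norm (f x))^2 + 2 * (norm (f x) * norm (g x)) + (norm (g x))^2" for x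
   using power_mono[OF norm_triangle_ineq[of "f x" "g x"] norm_ge_zero, of 2] by (simp add: power2_sum algebra_simps)
 qed
 also have "... = (L2_norm f)^2 + 2 * (LBINT x. norm (f x) * norm (g x)) + (L2_norm g)^2"
  unfolding sq using i ifg by simp
 also have "... <= (L2_norm f + L2_norm g)^2" using Cauchy_Schwarz_integral[OF f g] by (simp add: power2_sum)
 finally show ?thesis by (rule power2_le_imp_le) simp
qed

lemma L2_norm_bounded_mult:
 assumes f: "sqint f" and g: "g \<in> BM" "!!x. norm (g x) <= M"
 shows "L2_norm (%x. g x * f x) <= M * L2_norm f"
proof -
 have M: "M \<ge> 0" using order_trans[OF norm_ge_zero g(2)] .
 have "(LBINT x. (norm (g x * f x))\<^sup>2) <= (LBINT x. M\<^sup>2 * (norm (f x))^2)"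
  using sq_integrable_bounded_mult[OF f g] f mult_right_mono[OF power_mono[OF g(2) norm_ge_zero, of _ 2] zero_le_power2]
  by (intro integral_mono) (auto simp: sqint_def norm_mult power_mult_distrib)
 also have "... = M^2 * (LBINT x. (norm (f x))\<^sup>2)" by simp
 finally have "L2_norm (%x. g x * f x) <= sqrt (M^2 * (LBINT x. (norm (f x))\<^sup>2))" unfolding L2_norm_def by simp
 also have "... = M * L2_norm f" using M by (simp add: L2_norm_def real_sqrt_mult)
 finally show ?thesis .
qed

lemma C1_bounded_sq_integrable:
 assumes "C1_bounded p p'" "sqint f"
 shows "sqint (%x. p x * f x)" "sqint (%x. p' x * f x)"
proof -
 obtain C D where "!!x. norm (p x) <= C" "!!x. norm (p' x) <= D" using C1_bounded_bounds[OF assms(1)] by blast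
 then show "sqint (%x. p x * f x)" "sqint (%x. p' x * f x)"
  using sq_integrable_bounded_mult[OF assms(2)] C1_bounded_measurable[OF assms(1)] by blast+
qed

section \<open>Diagonalisation of the Lax operator\<close>

text \<open>Here $b$ is a bounded fundamental matrix of the Lax equation with the free exponentials removed, and $a$ is its inverse. Conjugation by $b$ transforms the Lax operator into the free one.\<close>

locale gauge =
 fixes kap :: complex and sig :: real and q r b11 b12 b21 b22 a11 a12 a21 a22 :: "real => complex"
 assumes kappa: "\<i> * kap^2 = of_real sig" and sigma: "sig ~= 0"
  and pot: "cont q" "cont r" "\<exists>C. \<forall>x. norm (q x) <= C" "\<exists>C. \<forall>x. norm (r x) <= C"
  and b: "C1_bounded b11 (%x. kap * q x * b21 x)" "C1_bounded b12 (%x. kap * q x * b22 x - 2 * sig * b12 x)"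
   "C1_bounded b21 (%x. kap * r x * b11 x + 2 * sig * b21 x)" "C1_bounded b22 (%x. kap * r x * b12 x)"
  and a: "C1_bounded a11 (%x. - kap * r x * a12 x)" "C1_bounded a12 (%x. - kap * q x * a11 x - 2 * sig * a12 x)"
   "C1_bounded a21 (%x. 2 * sig * a21 x - kap * r x * a22 x)" "C1_bounded a22 (%x. - kap * q x * a21 x)"
  and ba: "!!x. b11 x * a11 x + b12 x * a21 x = 1" "!!x. b11 x * a12 x + b12 x * a22 x = 0"
   "!!x. b21 x * a11 x + b22 x * a21 x = 0" "!!x. b21 x * a12 x + b22 x * a22 x = 1"
begin

definition sol :: "(real => complex^2) => real => complex^2" where
 "sol F x = vector
   [b11 x * Rop sig (%y. a11 y * F y $ 1 + a12 y * F y $ 2) x + b12 x * Rop (- sig) (%y. a21 y * F y $ 1 + a22 y * F y $ 2) x,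
   b21 x * Rop sig (%y. a11 y * F y $ 1 + a12 y * F y $ 2) x + b22 x * Rop (- sig) (%y. a21 y * F y $ 1 + a22 y * F y $ 2) x]"

definition G :: "real => real => complex^2^2" where
 "G x y = vector
   [vector [b11 x * ker sig (x - y) * a11 y + b12 x * ker (- sig) (x - y) * a21 y, b11 x * ker sig (x - y) * a12 y + b12 x * ker (- sig) (x - y) * a22 y],
   vector [b21 x * ker sig (x - y) * a11 y + b22 x * ker (- sig) (x - y) * a21 y, b21 x * ker sig (x - y) * a12 y + b22 x * ker (- sig) (x - y) * a22 y]]"

lemma meas [measurable]: "b11 \<in> BM" "b12 \<in> BM" "b21 \<in> BM" "b22 \<in> BM"
 "a11 \<in> BM" "a12 \<in> BM" "a21 \<in> BM" "a22 \<in> BM"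
 "q \<in> BM" "r \<in> BM"
 by (rule C1_bounded_measurable[OF b(1), THEN conjunct1] C1_bounded_measurable[OF b(2), THEN conjunct1] C1_bounded_measurable[OF b(3), THEN conjunct1] C1_bounded_measurable[OF b(4), THEN conjunct1] C1_bounded_measurable[OF a(1), THEN conjunct1] C1_bounded_measurable[OF a(2), THEN conjunct1] C1_bounded_measurable[OF a(3), THEN conjunct1] C1_bounded_measurable[OF a(4), THEN conjunct1]
  borel_measurable_continuous_onI[OF pot(1)] borel_measurable_continuous_onI[OF pot(2)])+

lemma sq_mult:
 assumes "sqint f"
 shows "sqint (%x. b11 x * f x)" "sqint (%x. b12 x * f x)" "sqint (%x. b21 x * f x)" "sqint (%x. b22 x * f x)"
  "sqint (%x. a11 x * f x)" "sqint (%x. a12 x * f x)" "sqint (%x. a21 x * f x)" "sqint (%x. a22 x * f x)"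
  "sqint (%x. q x * f x)" "sqint (%x. r x * f x)"
proof -
 have *: "sqint (%x. g x * f x)" if "g \<in> BM" "\<exists>C. \<forall>x. norm (g x) <= C" for g
  using sq_integrable_bounded_mult[OF assms that(1)] that(2) by blast
 show "sqint (%x. b11 x * f x)" using *[OF meas(1)] C1_bounded_bounds[OF b(1)] by blast
 show "sqint (%x. b12 x * f x)" using *[OF meas(2)] C1_bounded_bounds[OF b(2)] by blast
 show "sqint (%x. b21 x * f x)" using *[OF meas(3)] C1_bounded_bounds[OF b(3)] by blast
 show "sqint (%x. b22 x * f x)" using *[OF meas(4)] C1_bounded_bounds[OF b(4)] by blast
 show "sqint (%x. a11 x * f x)" using *[OF meas(5)] C1_bounded_bounds[OF a(1)] by blast
 show "sqint (%x. a12 x * f x)" using *[OF meas(6)] C1_bounded_bounds[OF a(2)] by blast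
 show "sqint (%x. a21 x * f x)" using *[OF meas(7)] C1_bounded_bounds[OF a(3)] by blast
 show "sqint (%x. a22 x * f x)" using *[OF meas(8)] C1_bounded_bounds[OF a(4)] by blast
 show "sqint (%x. q x * f x)" using *[OF meas(9)] pot(3) by blast
 show "sqint (%x. r x * f x)" using *[OF meas(10)] pot(4) by blast
qed

context
 fixes F :: "real => complex^2" assumes F: "F \<in> L2"
begin

abbreviation "h1 \<equiv> %y. a11 y * F y $ 1 + a12 y * F y $ 2"
abbreviation "h2 \<equiv> %y. a21 y * F y $ 1 + a22 y * F y $ 2"

lemma F_sq: "sqint (%y. F y $ 1)" "sqint (%y. F y $ 2)" using F by (simp_all add: L2_vec2_iff)

lemma h_sq: "sqint h1" "sqint h2"
 by (intro sq_integrable_add sq_mult F_sq)+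

lemma R_sq: "sqint (Rop sig h1)" "sqint (Rop (- sig) h2)"
 using Rop_L2(1)[OF _ h_sq(1), of sig] Rop_L2(1)[OF _ h_sq(2), of "-sig"] sigma by auto

lemma Ginner: "L1 (%y. G x y *v F y)" "sol F x = (LBINT y. G x y *v F y)"
proof -
 have s': "- sig ~= 0" using sigma by simp
 have i1: "L1 (%y. ker sig (x - y) * h1 y)" by (rule Rop_integrable_L2[OF sigma h_sq(1)])
 have i2: "L1 (%y. ker (- sig) (x - y) * h2 y)" by (rule Rop_integrable_L2[OF s' h_sq(2)])
 have e: "(G x y *v F y) $ 1 = b11 x * (ker sig (x - y) * h1 y) + b12 x * (ker (- sig) (x - y) * h2 y)"
  "(G x y *v F y) $ 2 = b21 x * (ker sig (x - y) * h1 y) + b22 x * (ker (- sig) (x - y) * h2 y)" for y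
  unfolding G_def mat2_mult_vec by (simp_all add: algebra_simps)
 show I: "L1 (%y. G x y *v F y)"
  by (rule integrable_vec2; unfold e; intro Bochner_Integration.integrable_add integrable_mult_right i1 i2)
 have "sol F x $ 1 = (LBINT y. (G x y *v F y) $ 1)" "sol F x $ 2 = (LBINT y. (G x y *v F y) $ 2)"
  unfolding e sol_def Rop_def using i1 i2 by (simp_all add: vector_2)
 then show "sol F x = (LBINT y. G x y *v F y)"
  using integral_vec2_nth(1)[OF I] by (simp add: vec_eq_iff forall_2)
qed

lemma sol_L2: "sol F \<in> L2"
 unfolding L2_vec2_iff sol_def vector_2 by (intro conjI sq_integrable_add sq_mult R_sq)

lemma sol_lax: "lax kap q r (sol F) F"
proof -
 have s': "- sig ~= 0" using sigma by simp
 let ?z1 = "Rop sig h1" and ?z2 = "Rop (- sig) h2"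
 let ?d1 = "%x. h1 x - sig * ?z1 x" and ?d2 = "%x. h2 x - of_real (- sig) * ?z2 x"
 have w1: "weak_deriv ?z1 ?d1" by (rule Rop_weak_deriv[OF sigma h_sq(1)])
 have w2: "weak_deriv ?z2 ?d2" by (rule Rop_weak_deriv[OF s' h_sq(2)])
 have d1: "sqint ?d1" by (intro sq_integrable_diff h_sq sq_integrable_cmult R_sq)
 have d2: "sqint ?d2" by (intro sq_integrable_diff h_sq sq_integrable_cmult R_sq)
 have bm: "sqint (%x. p x * f x)" "sqint (%x. p' x * f x)" if "C1_bounded p p'" "sqint f" for p p' f
  by (rule C1_bounded_sq_integrable[OF that])+
 define v :: "real => complex^2" where "v x = vector [F x $ 1 - (\<i> * kap^2 * sol F x $ 1 - kap * q x * sol F x $ 2), F x $ 2 - (- kap * r x * sol F x $ 1 - \<i> * kap^2 * sol F x $ 2)]" for x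
 have hF: "b11 x * h1 x + b12 x * h2 x = F x $ 1" "b21 x * h1 x + b22 x * h2 x = F x $ 2" for x
 proof -
  have "b11 x * h1 x + b12 x * h2 x = (b11 x * a11 x + b12 x * a21 x) * F x $ 1 + (b11 x * a12 x + b12 x * a22 x) * F x $ 2"
   by (simp only: algebra_simps)
  then show "b11 x * h1 x + b12 x * h2 x = F x $ 1" unfolding ba by simp
  have "b21 x * h1 x + b22 x * h2 x = (b21 x * a11 x + b22 x * a21 x) * F x $ 1 + (b21 x * a12 x + b22 x * a22 x) * F x $ 2"
   by (simp only: algebra_simps)
  then show "b21 x * h1 x + b22 x * h2 x = F x $ 2" unfolding ba by simp
 qed
 have v1: "v x $ 1 = (b11 x * h1 x + b12 x * h2 x) - (sig * sol F x $ 1 - kap * q x * sol F x $ 2)"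
  and v2: "v x $ 2 = (b21 x * h1 x + b22 x * h2 x) - (- kap * r x * sol F x $ 1 - sig * sol F x $ 2)" for x
  unfolding hF v_def vector_2 by (simp_all add: kappa)
 have e1: "(b11 x * ?d1 x + kap * q x * b21 x * ?z1 x) + (b12 x * ?d2 x + (kap * q x * b22 x - 2 * sig * b12 x) * ?z2 x) = v x $ 1" for x
  unfolding v1 sol_def vector_2 by (simp add: algebra_simps)
 have e2: "(b21 x * ?d1 x + (kap * r x * b11 x + 2 * sig * b21 x) * ?z1 x) + (b22 x * ?d2 x + kap * r x * b12 x * ?z2 x) = v x $ 2" for x
  unfolding v2 sol_def vector_2 by (simp add: algebra_simps)
 have c1: "sqint (%x. v x $ 1)" "weak_deriv (%x. sol F x $ 1) (%x. v x $ 1)"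
  unfolding e1[symmetric] unfolding sol_def vector_2
  by (intro sq_integrable_add bm[OF b(1)] bm[OF b(2)] R_sq d1 d2 weak_deriv_add weak_deriv_mult[OF _ _ _ b(1)] weak_deriv_mult[OF _ _ _ b(2)] w1 w2)+
 have c2: "sqint (%x. v x $ 2)" "weak_deriv (%x. sol F x $ 2) (%x. v x $ 2)"
  unfolding e2[symmetric] unfolding sol_def vector_2
  by (intro sq_integrable_add bm[OF b(3)] bm[OF b(4)] R_sq d1 d2 weak_deriv_add weak_deriv_mult[OF _ _ _ b(3)] weak_deriv_mult[OF _ _ _ b(4)] w1 w2)+
 show ?thesis unfolding lax_def
 proof (intro conjI bexI[of _ v])
  show "v \<in> L2" using c1 c2 by (simp add: L2_vec2_iff)
  show "\<forall>i. weak_deriv (%x. sol F x $ i) (%x. v x $ i)" using c1 c2 by (simp add: forall_2)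
  show "AE x in lborel. F x = v x + (vector [vector [\<i> * kap^2, - kap * q x], vector [- kap * r x, - \<i> * kap^2]] :: complex^2^2) *v sol F x"
   by (rule AE_I2) (simp add: vec_eq_iff forall_2 mat2_mult_vec v_def vector_2)
 qed (rule sol_L2, rule F)
qed

lemma sol_unique:
 assumes "lax kap q r u F"
 shows "AE x in lborel. u x = sol F x"
proof -
 have s': "- sig ~= 0" using sigma by simp
 obtain v where u: "u \<in> L2" and v: "v \<in> L2" "!!i. weak_deriv (%x. u x $ i) (%x. v x $ i)"
  and eq: "AE x in lborel. F x = v x + (vector [vector [\<i> * kap^2, - kap * q x], vector [- kap * r x, - \<i> * kap^2]] :: complex^2^2) *v u x"
  using assms unfolding lax_def by blast
 have bm: "sqint (%x. p x * f x)" "sqint (%x. p' x * f x)" if "C1_bounded p p'" "sqint f" for p p' f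
  by (rule C1_bounded_sq_integrable[OF that])+
 have us: "sqint (%x. u x $ 1)" "sqint (%x. u x $ 2)" "sqint (%x. v x $ 1)" "sqint (%x. v x $ 2)"
  using u v by (simp_all add: L2_vec2_iff)
 let ?z1 = "%x. a11 x * u x $ 1 + a12 x * u x $ 2" and ?z2 = "%x. a21 x * u x $ 1 + a22 x * u x $ 2"
 let ?d1 = "%x. (a11 x * v x $ 1 + - kap * r x * a12 x * u x $ 1) + (a12 x * v x $ 2 + (- kap * q x * a11 x - 2 * sig * a12 x) * u x $ 2)"
 let ?d2 = "%x. (a21 x * v x $ 1 + (2 * sig * a21 x - kap * r x * a22 x) * u x $ 1) + (a22 x * v x $ 2 + - kap * q x * a21 x * u x $ 2)"
 have w1: "weak_deriv ?z1 ?d1"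
  by (intro weak_deriv_add weak_deriv_mult[OF _ _ _ a(1)] weak_deriv_mult[OF _ _ _ a(2)] sq_integrable_add bm[OF a(1)] bm[OF a(2)] us v(2))
 have w2: "weak_deriv ?z2 ?d2"
  by (intro weak_deriv_add weak_deriv_mult[OF _ _ _ a(3)] weak_deriv_mult[OF _ _ _ a(4)] sq_integrable_add bm[OF a(3)] bm[OF a(4)] us v(2))
 have z1: "sqint ?z1" "sqint ?d1" by (intro sq_integrable_add bm[OF a(1)] bm[OF a(2)] us)+
 have z2: "sqint ?z2" "sqint ?d2" by (intro sq_integrable_add bm[OF a(3)] bm[OF a(4)] us)+
 have F12: "AE x in lborel. F x $ 1 = v x $ 1 + (of_real sig * u x $ 1 - kap * q x * u x $ 2) \<and> F x $ 2 = v x $ 2 + (- kap * r x * u x $ 1 - of_real sig * u x $ 2)"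
  using eq by eventually_elim (simp add: mat2_mult_vec kappa)
 have k1: "AE x in lborel. ?d1 x + sig * ?z1 x = h1 x" using F12
 proof eventually_elim
  case (elim x)
  show ?case unfolding conjunct1[OF elim] conjunct2[OF elim] by (simp add: algebra_simps)
 qed
 have k2: "AE x in lborel. ?d2 x + of_real (- sig) * ?z2 x = h2 x" using F12
 proof eventually_elim
  case (elim x)
  show ?case unfolding conjunct1[OF elim] conjunct2[OF elim] by (simp add: algebra_simps)
 qed
 have m1: "(%x. ?d1 x + sig * ?z1 x) \<in> BM" using sq_integrable_add[OF z1(2) sq_integrable_cmult[OF z1(1)]] by (rule sq_integrable_measurable)
 have m2: "(%x. ?d2 x + of_real (- sig) * ?z2 x) \<in> BM" using sq_integrable_add[OF z2(2) sq_integrable_cmult[OF z2(1)]] by (rule sq_integrable_measurable)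
 have "AE x in lborel. ?z1 x = Rop sig (%x. ?d1 x + sig * ?z1 x) x" by (rule weak_deriv_imp_Rop[OF sigma z1 w1])
 then have r1: "AE x in lborel. ?z1 x = Rop sig h1 x" unfolding Rop_cong_AE[OF k1 m1 sq_integrable_measurable[OF h_sq(1)]] .
 have "AE x in lborel. ?z2 x = Rop (- sig) (%x. ?d2 x + of_real (- sig) * ?z2 x) x" by (rule weak_deriv_imp_Rop[OF s' z2 w2])
 then have r2: "AE x in lborel. ?z2 x = Rop (- sig) h2 x" unfolding Rop_cong_AE[OF k2 m2 sq_integrable_measurable[OF h_sq(2)]] .
 show ?thesis using r1 r2
 proof eventually_elim
  case (elim x)
  have "sol F x $ 1 = (b11 x * a11 x + b12 x * a21 x) * u x $ 1 + (b11 x * a12 x + b12 x * a22 x) * u x $ 2"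
   unfolding sol_def vector_2 elim[symmetric] by (simp only: algebra_simps)
  moreover have "sol F x $ 2 = (b21 x * a11 x + b22 x * a21 x) * u x $ 1 + (b21 x * a12 x + b22 x * a22 x) * u x $ 2"
   unfolding sol_def vector_2 elim[symmetric] by (simp only: algebra_simps)
  ultimately show ?case unfolding ba by (simp add: vec_eq_iff forall_2)
 qed
qed

end

lemma sol_bound: "\<exists>C. \<forall>F\<in>L2. L2_norm (sol F) <= C * L2_norm F"
proof -
 have s': "- sig ~= 0" using sigma by simp
 obtain B1 where B1: "!!x. norm (b11 x) <= B1" using C1_bounded_bounds[OF b(1)] by blast
 obtain B2 where B2: "!!x. norm (b12 x) <= B2" using C1_bounded_bounds[OF b(2)] by blast
 obtain B3 where B3: "!!x. norm (b21 x) <= B3" using C1_bounded_bounds[OF b(3)] by blast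
 obtain B4 where B4: "!!x. norm (b22 x) <= B4" using C1_bounded_bounds[OF b(4)] by blast
 obtain A1 where A1: "!!x. norm (a11 x) <= A1" using C1_bounded_bounds[OF a(1)] by blast
 obtain A2 where A2: "!!x. norm (a12 x) <= A2" using C1_bounded_bounds[OF a(2)] by blast
 obtain A3 where A3: "!!x. norm (a21 x) <= A3" using C1_bounded_bounds[OF a(3)] by blast
 obtain A4 where A4: "!!x. norm (a22 x) <= A4" using C1_bounded_bounds[OF a(4)] by blast
 have nn: "0 <= A1" "0 <= A2" "0 <= A3" "0 <= A4" "0 <= B1" "0 <= B2" "0 <= B3" "0 <= B4"
  by (rule order_trans[OF norm_ge_zero A1] order_trans[OF norm_ge_zero A2] order_trans[OF norm_ge_zero A3] order_trans[OF norm_ge_zero A4]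
   order_trans[OF norm_ge_zero B1] order_trans[OF norm_ge_zero B2] order_trans[OF norm_ge_zero B3] order_trans[OF norm_ge_zero B4])+
 define P where "P = A1 + A2 + A3 + A4 + B1 + B2 + B3 + B4"
 have le: "A1 <= P" "A2 <= P" "A3 <= P" "A4 <= P" "B1 <= P" "B2 <= P" "B3 <= P" "B4 <= P" unfolding P_def using nn by linarith+
 note BP = order_trans[OF B1 le(5)] order_trans[OF B2 le(6)] order_trans[OF B3 le(7)] order_trans[OF B4 le(8)]
 note AP = order_trans[OF A1 le(1)] order_trans[OF A2 le(2)] order_trans[OF A3 le(3)] order_trans[OF A4 le(4)]
 have P0: "P \<ge> 0" using order_trans[OF norm_ge_zero BP(1)] .
 have "L2_norm (sol F) <= 8 * P^2 / \<bar>sig\<bar> * L2_norm F" if F: "F \<in> L2" for F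
 proof -
  note Fs = F_sq[OF F] and hs = h_sq[OF F] and Rs = R_sq[OF F]
  have h: "L2_norm (h1 F) <= 2 * P * L2_norm F" "L2_norm (h2 F) <= 2 * P * L2_norm F"
  proof -
   have "L2_norm (h1 F) <= P * L2_norm (%x. F x $ 1) + P * L2_norm (%x. F x $ 2)"
    by (rule order_trans[OF L2_norm_triangle add_mono]; (intro sq_mult Fs L2_norm_bounded_mult AP meas)?)
   also have "... <= P * L2_norm F + P * L2_norm F" by (intro add_mono mult_left_mono L2_norm_vec2_le F P0)
   finally show "L2_norm (h1 F) <= 2 * P * L2_norm F" by simp
   have "L2_norm (h2 F) <= P * L2_norm (%x. F x $ 1) + P * L2_norm (%x. F x $ 2)"
    by (rule order_trans[OF L2_norm_triangle add_mono]; (intro sq_mult Fs L2_norm_bounded_mult AP meas)?)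
   also have "... <= P * L2_norm F + P * L2_norm F" by (intro add_mono mult_left_mono L2_norm_vec2_le F P0)
   finally show "L2_norm (h2 F) <= 2 * P * L2_norm F" by simp
  qed
  define K where "K = 2 * P * L2_norm F / \<bar>sig\<bar>"
  have R: "L2_norm (Rop sig (h1 F)) <= K" "L2_norm (Rop (- sig) (h2 F)) <= K"
   using order_trans[OF Rop_L2(2)[OF sigma hs(1)] divide_right_mono[OF h(1)]] order_trans[OF Rop_L2(2)[OF s' hs(2)] divide_right_mono[OF h(2), of "\<bar>- sig\<bar>"]]
   unfolding K_def by simp_all
  have "L2_norm (%x. sol F x $ 1) <= P * L2_norm (Rop sig (h1 F)) + P * L2_norm (Rop (- sig) (h2 F))"
   unfolding sol_def vector_2 by (rule order_trans[OF L2_norm_triangle add_mono]; (intro sq_mult Rs L2_norm_bounded_mult BP meas)?)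
  also have "... <= P * K + P * K" by (intro add_mono mult_left_mono R P0)
  finally have s1: "L2_norm (%x. sol F x $ 1) <= 2 * P * K" by (simp add: mult_ac)
  have "L2_norm (%x. sol F x $ 2) <= P * L2_norm (Rop sig (h1 F)) + P * L2_norm (Rop (- sig) (h2 F))"
   unfolding sol_def vector_2 by (rule order_trans[OF L2_norm_triangle add_mono]; (intro sq_mult Rs L2_norm_bounded_mult BP meas)?)
  also have "... <= P * K + P * K" by (intro add_mono mult_left_mono R P0)
  finally have "L2_norm (%x. sol F x $ 2) <= 2 * P * K" by (simp add: mult_ac)
  then have "L2_norm (sol F) <= 2 * P * K + 2 * P * K" using L2_norm_vec2_le(2)[OF sol_L2[OF F]] s1 by linarith
  then show ?thesis by (simp add: K_def power2_eq_square)
 qed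
 then show ?thesis by blast
qed

theorem green_kernel_G: "green_kernel kap q r G"
 unfolding green_kernel_def
proof (intro conjI allI impI)
 obtain C where C: "!!F. F \<in> L2 ==> L2_norm (sol F) <= C * L2_norm F" using sol_bound by blast
 show "lax_invertible kap q r" unfolding lax_invertible_def
  using C sol_lax sol_unique by (intro exI[of _ C] ballI) blast
 have [measurable]: "(%p. case p of (x, y) => b11 x * ker sig (x - y) * a11 y + b12 x * ker (- sig) (x - y) * a21 y) \<in> borel_measurable (lborel \<Otimes>\<^sub>M lborel)"
   "(%p. case p of (x, y) => b11 x * ker sig (x - y) * a12 y + b12 x * ker (- sig) (x - y) * a22 y) \<in> borel_measurable (lborel \<Otimes>\<^sub>M lborel)"
   "(%p. case p of (x, y) => b21 x * ker sig (x - y) * a11 y + b22 x * ker (- sig) (x - y) * a21 y) \<in> borel_measurable (lborel \<Otimes>\<^sub>M lborel)"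
   "(%p. case p of (x, y) => b21 x * ker sig (x - y) * a12 y + b22 x * ker (- sig) (x - y) * a22 y) \<in> borel_measurable (lborel \<Otimes>\<^sub>M lborel)"
  by measurable
 show "(%(x, y). G x y) \<in> borel_measurable (lborel \<Otimes>\<^sub>M lborel)"
 proof (subst borel_measurable_euclidean_space, rule ballI)
  fix bb :: "complex^2^2" assume "bb \<in> Basis"
  then obtain i j u where bb: "bb = axis i (axis j u)" by (auto simp: Basis_vec_def)
  have e: "(case p of (x, y) => G x y) \<bullet> bb = (case p of (x, y) => G x y $ i $ j) \<bullet> u" for p by (cases p) (simp add: bb inner_axis)
  have "(%p. case p of (x, y) => G x y $ i $ j) \<in> borel_measurable (lborel \<Otimes>\<^sub>M lborel)"
   using exhaust_2[of i] exhaust_2[of j] by (auto simp: G_def vector_2)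
  then show "(%p. (case p of (x, y) => G x y) \<bullet> bb) \<in> borel_measurable (lborel \<Otimes>\<^sub>M lborel)" unfolding e by measurable
 qed
 fix u F assume l: "lax kap q r u F"
 then have F: "F \<in> L2" by (simp add: lax_def)
 show "AE x in lborel. L1 (%y. G x y *v F y) \<and> u x = (LBINT y. G x y *v F y)"
  using sol_unique[OF F l] Ginner[OF F] by auto
qed

end

section \<open>The continuous version of the kernel\<close>

lemma integral_rational_halflines_zero:
 fixes h :: "real => complex"
 assumes h: "L1 h" and z: "!!a. a \<in> \<rat> ==> (LBINT x. indicator {..a} x *\<^sub>R h x) = 0"
 shows "AE x in lborel. h x = 0"
proof (rule integral_halflines_zero[OF h])
 fix a :: real
 have [measurable]: "h \<in> BM" using h by auto
 have "\<exists>q\<in>\<rat>. a < q \<and> q < a + 1 / real (Suc n)" for n using Rats_dense_in_real[of a "a + 1 / real (Suc n)"] by auto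
 then obtain q where q: "!!n. q n \<in> \<rat>" "!!n. a < q n" "!!n. q n < a + 1 / real (Suc n)" by metis
 have ql: "q -->> a"
 proof (rule tendsto_sandwich[of "%_. a" _ _ "%n. a + 1 / real (Suc n)"])
  show "(%n. a + 1 / real (Suc n)) -->> a" using tendsto_add[OF tendsto_const[of a] LIMSEQ_inverse_real_of_nat] by (simp add: inverse_eq_divide)
 qed (use q(2,3) in \<open>auto intro!: always_eventually less_imp_le\<close>)
 have "(%n. \<integral>x. indicator {..q n} x *\<^sub>R h x \<partial>lborel) -->> (LBINT x. indicator {..a} x *\<^sub>R h x)"
 proof (rule integral_dominated_convergence)
  show "L1 (%x. norm (h x))" using h by simp
  show "AE x in lborel. (%n. indicator {..q n} x *\<^sub>R h x) -->> indicator {..a} x *\<^sub>R h x"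
  proof (rule AE_I2)
   fix x :: real
   have "\<forall>\<^sub>F n in sequentially. indicator {..q n} x *\<^sub>R h x = indicator {..a} x *\<^sub>R h x"
   proof (cases "x <= a")
    case True
    then have "x <= q n" for n using q(2)[of n] by simp
    then show ?thesis using True by simp
   next
    case False
    then have "\<forall>\<^sub>F n in sequentially. q n < x" using order_tendstoD(2)[OF ql, of x] by simp
    then show ?thesis by (rule eventually_mono) (use False in \<open>simp add: indicator_def\<close>)
   qed
   then show "(%n. indicator {..q n} x *\<^sub>R h x) -->> indicator {..a} x *\<^sub>R h x" by (rule tendsto_eventually)
  qed
 qed (auto simp: indicator_def)
 then show "(LBINT x. indicator {..a} x *\<^sub>R h x) = 0" unfolding z[OF q(1)] by (simp add: LIMSEQ_const_iff)
qed

lemma continuous_eq_AE: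
 fixes f g :: "real => 'a::real_normed_vector"
 assumes f: "cont f" and g: "cont g" and ae: "AE x in lborel. f x = g x"
 shows "f x = g x"
proof (rule ccontr)
 assume ne: "f x ~= g x"
 let ?N = "{x. f x ~= g x}"
 have o: "open ?N" by (rule open_Collect_neq[OF f g])
 have "?N \<in> null_sets lborel" using ae o AE_iff_null_sets[of ?N lborel] by simp
 then have "negligible ?N" by (simp add: negligible_iff_null_sets null_sets_completionI)
 then show False using ne o open_not_negligible[of ?N] by blast
qed

lemma indicator_vec_L2: "(%y. indicator {a..b} y *\<^sub>R axis j 1 :: complex^2) \<in> L2" for a b :: real
proof -
 have "L1 (%y. indicator {a..b} y :: real)"
  by (intro integrable_real_indicator) (auto simp: emeasure_lborel_Icc_eq)
 then have "L1 (%y. (indicator {a..b} y)\<^sup>2 :: real)"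
  by (rule Bochner_Integration.integrable_cong[THEN iffD1, rotated -1]) (auto simp: indicator_def)
 then show ?thesis unfolding L2_def by (simp add: norm_axis_1 power_mult_distrib)
qed

text \<open>Testing against indicator functions of intervals with rational endpoints determines a kernel almost everywhere.\<close>

lemma green_kernel_unique:
 assumes G: "green_kernel kap q r G" and G': "green_kernel kap q r G'"
 shows "AE x in lborel. AE y in lborel. G x y = G' x y"
proof -
 let ?F = "%(N::nat) b j y. indicator {- real N..b} y *\<^sub>R axis j 1 :: complex^2"
 have "AE x in lborel. L1 (%y. G x y *v ?F N b j y) \<and> L1 (%y. G' x y *v ?F N b j y) \<and>
   (LBINT y. G x y *v ?F N b j y) = (LBINT y. G' x y *v ?F N b j y)" for N b j
 proof -
  obtain u where u: "lax kap q r u (?F N b j)"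
   using G indicator_vec_L2[of "- real N" b j] unfolding green_kernel_def lax_invertible_def by blast
  have "AE x in lborel. L1 (%y. G x y *v ?F N b j y) \<and> u x = (LBINT y. G x y *v ?F N b j y)"
   "AE x in lborel. L1 (%y. G' x y *v ?F N b j y) \<and> u x = (LBINT y. G' x y *v ?F N b j y)"
   using G G' u unfolding green_kernel_def by blast+
  then show ?thesis by eventually_elim auto
 qed
 then have "AE x in lborel. \<forall>(N, b, j)\<in>UNIV \<times> \<rat> \<times> UNIV. L1 (%y. G x y *v ?F N b j y) \<and> L1 (%y. G' x y *v ?F N b j y) \<and>
   (LBINT y. G x y *v ?F N b j y) = (LBINT y. G' x y *v ?F N b j y)"
  by (subst AE_ball_countable) (auto intro: countable_rat)
 then show ?thesis
 proof eventually_elim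
  case (elim x)
  have e: "(M *v (c *\<^sub>R axis j 1)) $ i = indicator S y *\<^sub>R M $ i $ j" if "c = indicator S y" for M :: "complex^2^2" and c i j S and y :: real
   unfolding that by (simp add: matrix_vector_mult_def axis_def indicator_def if_distrib cong: if_cong)
  have "AE y in lborel. G x y $ i $ j - G' x y $ i $ j = 0" for i j
  proof -
   define h where "h y = G x y $ i $ j - G' x y $ i $ j" for y
   have hi: "L1 (%y. indicator {- real N..b} y *\<^sub>R h y)" "(LBINT y. indicator {- real N..b} y *\<^sub>R h y) = 0"
    if b: "b \<in> \<rat>" for N b
   proof -
    have I: "L1 (%y. G x y *v ?F N b j y)" "L1 (%y. G' x y *v ?F N b j y)"
     "(LBINT y. G x y *v ?F N b j y) = (LBINT y. G' x y *v ?F N b j y)"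
     using elim b by auto
    have eq: "indicator {- real N..b} y *\<^sub>R h y = (G x y *v ?F N b j y) $ i - (G' x y *v ?F N b j y) $ i" for y
     unfolding e[OF refl] h_def by (simp add: scaleR_right_diff_distrib)
    show "L1 (%y. indicator {- real N..b} y *\<^sub>R h y)" "(LBINT y. indicator {- real N..b} y *\<^sub>R h y) = 0"
     unfolding eq using integral_vec2_nth[OF I(1), of i] integral_vec2_nth[OF I(2), of i] I(3) by simp_all
   qed
   have "AE y in lborel. indicator {- real N..real N} y *\<^sub>R h y = 0" for N
   proof (rule integral_rational_halflines_zero[OF hi(1)])
    show "real N \<in> \<rat>" by simp
    fix a :: real assume a: "a \<in> \<rat>"
    have "indicator {..a} y *\<^sub>R indicator {- real N..real N} y *\<^sub>R h y = indicator {- real N..min a (real N)} y *\<^sub>R h y" for y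
     by (auto simp: indicator_def)
    moreover have "min a (real N) \<in> \<rat>" using a by (simp add: min_def)
    ultimately show "(LBINT y. indicator {..a} y *\<^sub>R indicator {- real N..real N} y *\<^sub>R h y) = 0" using hi(2) by presburger
   qed
   then have "AE y in lborel. \<forall>N. indicator {- real N..real N} y *\<^sub>R h y = 0" by (subst AE_all_countable) blast
   then show ?thesis
   proof eventually_elim
    case (elim y)
    obtain N where "\<bar>y\<bar> <= real N" using real_arch_simple by blast
    then have "indicator {- real N..real N} y = (1 :: real)" by (auto simp: indicator_def)
    then show ?case using elim[rule_format, of N] by (simp add: h_def)
   qed
  qed
  then have "AE y in lborel. \<forall>i j. G x y $ i $ j - G' x y $ i $ j = 0" by (simp add: AE_all_countable)
  then show ?case by eventually_elim (simp add: vec_eq_iff)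
 qed
qed

lemma green_diff_eqI:
 assumes D: "cont (%(x, y). D x y)" and G: "green_kernel kap q r G" and G0: "green_kernel kap (%_. 0) (%_. 0) G0"
  and eq: "!!x y. D x y = G x y - G0 x y"
 shows "green_diff kap q r = D"
 unfolding green_diff_def
proof (rule the_equality)
 fix D' assume "cont (%(x, y). D' x y) \<and>
   (\<exists>G G\<^sub>0. green_kernel kap q r G \<and> green_kernel kap (%_. 0) (%_. 0) G\<^sub>0 \<and> (\<forall>x y. D' x y = G x y - G\<^sub>0 x y))"
 then obtain G' G0' where D': "cont (%(x, y). D' x y)" and G': "green_kernel kap q r G'" and G0': "green_kernel kap (%_. 0) (%_. 0) G0'"
  and eq': "!!x y. D' x y = G' x y - G0' x y" by blast
 have c: "cont (D x)" "cont (%x. D x y)" if "cont (%(x, y). D x y)" for D :: "real => real => complex^2^2" and x y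
 proof -
  have "cont (%y. (x, y))" "cont (%x. (x, y))" by (intro continuous_intros)+
  then show "cont (D x)" "cont (%x. D x y)"
   using continuous_on_compose2[OF that, of UNIV "%y. (x, y)"] continuous_on_compose2[OF that, of UNIV "%x. (x, y)"] by auto
 qed
 have "AE x in lborel. AE y in lborel. D' x y = D x y"
  using green_kernel_unique[OF G G'] green_kernel_unique[OF G0 G0']
 proof eventually_elim
  case (elim x)
  show ?case using elim(1) elim(2) by eventually_elim (simp add: eq eq')
 qed
 then have "AE x in lborel. \<forall>y. D' x y = D x y"
  by eventually_elim (use continuous_eq_AE[OF c(1)[OF D'] c(1)[OF D]] in blast)
 then have "AE x in lborel. D' x y = D x y" for y by eventually_elim simp
 then have "D' x y = D x y" for x y using continuous_eq_AE[OF c(2)[OF D'] c(2)[OF D]] by blast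
 then show "D' = D" by (intro ext)
qed (use assms in blast)

lemma ker_jump_continuous_pos:
 fixes A C :: "real \<times> real => complex"
 assumes c: "c > 0" and A: "cont A" and C: "cont C" and d: "!!x. A (x, x) = - C (x, x)"
 shows "cont (%p. A p * ker c (fst p - snd p) + C p * ker (- c) (fst p - snd p))"
proof -
 have eq: "(%p. A p * ker c (fst p - snd p) + C p * ker (- c) (fst p - snd p)) =
   (%p. if snd p - fst p <= 0 then A p * of_real (exp (- (c * (fst p - snd p)))) else - C p * of_real (exp (c * (fst p - snd p))))"
  using c by (auto simp: ker_def fun_eq_iff)
 show ?thesis unfolding eq
 proof (rule continuous_on_cases_le)
  show "A t * of_real (exp (- (c * (fst t - snd t)))) = - C t * of_real (exp (c * (fst t - snd t)))" if "snd t - fst t = 0" for t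
   using d[of "fst t"] that by (cases t) simp
 qed (intro continuous_intros continuous_on_subset[OF A] continuous_on_subset[OF C]; simp)+
qed

text \<open>The two kernels jump in opposite directions on the diagonal, so the sum is continuous when the coefficients cancel there.\<close>

lemma ker_jump_continuous:
 fixes A C :: "real \<times> real => complex"
 assumes c: "c ~= 0" and A: "cont A" and C: "cont C" and d: "!!x. A (x, x) = - C (x, x)"
 shows "cont (%p. A p * ker c (fst p - snd p) + C p * ker (- c) (fst p - snd p))"
proof (cases "c > 0")
 case True
 then show ?thesis using ker_jump_continuous_pos assms by blast
next
 case False
 then have "cont (%p. C p * ker (- c) (fst p - snd p) + A p * ker (- (- c)) (fst p - snd p))"
  using c d by (intro ker_jump_continuous_pos A C) auto
 then show ?thesis by (simp add: add.commute)
qed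

lemma ker_0: "c ~= 0 ==> ker c 0 = (if 0 < c then 1 else 0)" by (simp add: ker_def)

context gauge
begin

lemma free_gauge: "gauge kap sig (%_. 0) (%_. 0) (%_. 1) (%_. 0) (%_. 0) (%_. 1) (%_. 1) (%_. 0) (%_. 0) (%_. 1)"
 by unfold_locales (use kappa sigma C1_bounded_const in auto)

lemma continuous_ab: "cont b11" "cont b12" "cont b21" "cont b22"
 "cont a11" "cont a12" "cont a21" "cont a22"
 by (rule C1_bounded_continuous[OF b(1), THEN conjunct1] C1_bounded_continuous[OF b(2), THEN conjunct1]
  C1_bounded_continuous[OF b(3), THEN conjunct1] C1_bounded_continuous[OF b(4), THEN conjunct1]
  C1_bounded_continuous[OF a(1), THEN conjunct1] C1_bounded_continuous[OF a(2), THEN conjunct1]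
  C1_bounded_continuous[OF a(3), THEN conjunct1] C1_bounded_continuous[OF a(4), THEN conjunct1])+

definition D :: "real => real => complex^2^2" where
 "D x y = vector
   [vector [(b11 x * a11 y - 1) * ker sig (x - y) + (b12 x * a21 y) * ker (- sig) (x - y), (b11 x * a12 y) * ker sig (x - y) + (b12 x * a22 y) * ker (- sig) (x - y)],
   vector [(b21 x * a11 y) * ker sig (x - y) + (b22 x * a21 y) * ker (- sig) (x - y), (b21 x * a12 y) * ker sig (x - y) + (b22 x * a22 y - 1) * ker (- sig) (x - y)]]"

lemma D_continuous: "cont (%(x, y). D x y)"
proof -
 have s: "cont (%p :: real \<times> real. f (fst p))" "cont (%p :: real \<times> real. f (snd p))"
  if "cont f" for f :: "real => complex"
  by (rule continuous_on_compose2[OF that]; auto intro!: continuous_intros)+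
 note ss = s[OF continuous_ab(1)] s[OF continuous_ab(2)] s[OF continuous_ab(3)] s[OF continuous_ab(4)]
  s[OF continuous_ab(5)] s[OF continuous_ab(6)] s[OF continuous_ab(7)] s[OF continuous_ab(8)]
 have c11: "cont (%p. (b11 (fst p) * a11 (snd p) - 1) * ker sig (fst p - snd p) + (b12 (fst p) * a21 (snd p)) * ker (- sig) (fst p - snd p))"
  by (rule ker_jump_continuous[OF sigma]) (intro continuous_intros ss, intro continuous_intros ss, use ba in \<open>simp add: algebra_simps\<close>)
 have c12: "cont (%p. (b11 (fst p) * a12 (snd p)) * ker sig (fst p - snd p) + (b12 (fst p) * a22 (snd p)) * ker (- sig) (fst p - snd p))"
  by (rule ker_jump_continuous[OF sigma]) (intro continuous_intros ss, intro continuous_intros ss, use ba in \<open>simp add: eq_neg_iff_add_eq_0\<close>)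
 have c21: "cont (%p. (b21 (fst p) * a11 (snd p)) * ker sig (fst p - snd p) + (b22 (fst p) * a21 (snd p)) * ker (- sig) (fst p - snd p))"
  by (rule ker_jump_continuous[OF sigma]) (intro continuous_intros ss, intro continuous_intros ss, use ba in \<open>simp add: eq_neg_iff_add_eq_0\<close>)
 have c22: "cont (%p. (b21 (fst p) * a12 (snd p)) * ker sig (fst p - snd p) + (b22 (fst p) * a22 (snd p) - 1) * ker (- sig) (fst p - snd p))"
  by (rule ker_jump_continuous[OF sigma]) (intro continuous_intros ss, intro continuous_intros ss, use ba(4) in \<open>simp add: eq_diff_eq\<close>)
 show ?thesis
  unfolding split_beta
 proof (rule continuous_on_componentwise[THEN iffD2], rule ballI)
  fix bb :: "complex^2^2" assume "bb \<in> Basis"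
  then obtain i j u where bb: "bb = axis i (axis j u)" by (auto simp: Basis_vec_def)
  have "cont (%p. D (fst p) (snd p) $ i $ j)"
   using exhaust_2[of i] exhaust_2[of j] c11 c12 c21 c22 by (auto simp: D_def vector_2)
  then show "cont (%p. D (fst p) (snd p) \<bullet> bb)" unfolding bb inner_axis by (intro continuous_on_inner continuous_on_const)
 qed
qed

lemma green_diff_D: "green_diff kap q r = D"
proof (rule green_diff_eqI[OF D_continuous green_kernel_G gauge.green_kernel_G[OF free_gauge]])
 show "D x y = G x y - gauge.G sig (%_. 1) (%_. 0) (%_. 0) (%_. 1) (%_. 1) (%_. 0) (%_. 0) (%_. 1) x y" for x y
  unfolding D_def G_def gauge.G_def[OF free_gauge] by (simp add: vec_eq_iff forall_2 vector_2 algebra_simps)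
qed

lemma sgn_kappa: "sgn (\<i> * kap^2) = of_real (sgn sig)"
 unfolding kappa by (rule sgn_of_real)

lemma diagonal: "g12 kap q r x = b11 x * a12 x" "g21 kap q r x = b21 x * a11 x" "gam kap q r x = b11 x * a11 x - b21 x * a12 x - 1"
proof -
 have 1: "sgn (\<i> * kap^2) * (u * ker sig 0 + v * ker (- sig) 0) = u" if "u = - v" for u v
  unfolding sgn_kappa that using sigma by (simp add: ker_0 sgn_if)
 have b12: "b12 x * a21 x = 1 - b11 x * a11 x" "b12 x * a22 x = - (b11 x * a12 x)" "b22 x * a21 x = - (b21 x * a11 x)" "b22 x * a22 x = 1 - b21 x * a12 x"
  using ba[of x] by (simp_all add: algebra_simps eq_neg_iff_add_eq_0)
 show "g12 kap q r x = b11 x * a12 x" unfolding g12_def green_diff_D D_def vector_2 diff_self b12 by (rule 1) simp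
 show "g21 kap q r x = b21 x * a11 x" unfolding g21_def green_diff_D D_def vector_2 diff_self b12 by (rule 1) simp
 show "gam kap q r x = b11 x * a11 x - b21 x * a12 x - 1" unfolding gam_def green_diff_D D_def vector_2 diff_self b12 right_diff_distrib
  by (subst 1, simp, subst 1, simp, simp)
qed

end

context gauge
begin

lemma g12_C1: "C1_bounded (g12 kap q r) (%x. - 2 * sig * g12 kap q r x - kap * q x * (gam kap q r x + 1))"
 and g21_C1: "C1_bounded (g21 kap q r) (%x. 2 * sig * g21 kap q r x + kap * r x * (gam kap q r x + 1))"
 and gam_C1: "C1_bounded (gam kap q r) (%x. 2 * (kap * q x * g21 kap q r x - kap * r x * g12 kap q r x))"
proof -
 have cong: "C1_bounded p p' ==> (!!x. p x = s x) ==> (!!x. p' x = s' x) ==> C1_bounded s s'" for p p' s s'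
  by (metis (full_types) ext)
 show "C1_bounded (g12 kap q r) (%x. - 2 * sig * g12 kap q r x - kap * q x * (gam kap q r x + 1))"
  by (rule cong[OF C1_bounded_mult[OF b(1) a(2)]]) (simp_all add: diagonal algebra_simps)
 show "C1_bounded (g21 kap q r) (%x. 2 * sig * g21 kap q r x + kap * r x * (gam kap q r x + 1))"
  by (rule cong[OF C1_bounded_mult[OF b(3) a(1)]]) (simp_all add: diagonal algebra_simps)
 show "C1_bounded (gam kap q r) (%x. 2 * (kap * q x * g21 kap q r x - kap * r x * g12 kap q r x))"
  by (rule cong[OF C1_bounded_diff[OF C1_bounded_diff[OF C1_bounded_mult[OF b(1) a(1)] C1_bounded_mult[OF b(3) a(2)]] C1_bounded_const[of 1]]])
   (simp_all add: diagonal algebra_simps)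
qed

end

section \<open>The diagonal Green functions of small potentials\<close>

definition potential :: "(real => complex) => bool" where
 "potential q \<longleftrightarrow> cont q \<and> (\<exists>C. \<forall>x. norm (q x) <= C) \<and> L1 q"

lemma potential_sq_integrable: "potential q ==> sqint q"
 unfolding potential_def using bounded_integrable_sq_integrable by blast

locale lax_potential =
 fixes kap :: complex and sig :: real and q r :: "real => complex"
 assumes kappa: "\<i> * kap^2 = of_real sig" and sigma: "1 <= \<bar>sig\<bar>"
  and q: "potential q" "L2_norm q <= 1 / 2" and r: "potential r" "L2_norm r <= 1 / 2"
begin

lemma norm_kappa: "(norm kap)^2 = \<bar>sig\<bar>"
proof -
 have "norm (\<i> * kap^2) = \<bar>sig\<bar>" unfolding kappa by simp
 then show ?thesis by (simp add: norm_mult norm_power)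
qed

lemma sigma_nz: "sig ~= 0" "2 * sig ~= 0" "- (2 * sig) ~= 0" using sigma by auto

lemma small_for_potential:
 assumes p: "potential p" "L2_norm p <= 1 / 2" and c: "\<bar>c\<bar> = 2 * \<bar>sig\<bar>"
 shows "small_for c (%x. kap * p x)"
 unfolding small_for_def
proof (intro conjI allI impI)
 show "cont (%x. kap * p x)" using p unfolding potential_def by (intro continuous_intros) auto
 show "\<exists>C. \<forall>x. norm (kap * p x) <= C" using p unfolding potential_def by (intro bounded_mult) auto
 fix f :: "real => complex" and M x assume f: "f \<in> BM" "\<forall>y. norm (f y) <= M"
 have M: "M \<ge> 0" using order_trans[OF norm_ge_zero f(2)[rule_format]] .
 have c0: "c ~= 0" using c sigma by auto
 have k0: "norm kap > 0" using norm_kappa sigma by auto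
 have "L2_norm (%x. kap * p x) <= norm kap * (1 / 2)"
  by (rule order_trans[OF L2_norm_bounded_mult[OF potential_sq_integrable[OF p(1)], where M = "norm kap"] mult_left_mono[OF p(2)]]) auto
 moreover have "sqrt (2 * \<bar>c\<bar>) = 2 * norm kap"
 proof -
  have "2 * \<bar>c\<bar> = (2 * norm kap)^2" unfolding c norm_kappa[symmetric] by (simp add: power_mult_distrib)
  then show ?thesis by (simp add: real_sqrt_mult)
 qed
 ultimately have "L2_norm (%x. kap * p x) / sqrt (2 * \<bar>c\<bar>) <= norm kap * (1 / 2) / (2 * norm kap)" using k0 by (intro frac_le) auto
 also have "... <= 1 / 4" by simp
 finally have "M * (L2_norm (%x. kap * p x) / sqrt (2 * \<bar>c\<bar>)) <= M * (1 / 4)" using M by (rule mult_left_mono)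
 moreover have "norm (Rop c (%y. kap * p y * f y) x) <= M * (L2_norm (%x. kap * p x) / sqrt (2 * \<bar>c\<bar>))"
  by (rule Rop_bound_L2[OF c0 sq_integrable_cmult[OF potential_sq_integrable[OF p(1)]] f(1)]) (use f(2) in blast)
 ultimately show "norm (Rop c (%y. kap * p y * f y) x) <= M / 4" by linarith
qed

definition m where "m = riccati (- (2 * sig)) (%x. kap * r x) (%x. kap * q x)"
definition n where "n = riccati (2 * sig) (%x. kap * q x) (%x. kap * r x)"

lemma small: "small_for (- (2 * sig)) (%x. kap * r x)" "small_for (- (2 * sig)) (%x. kap * q x)"
 "small_for (2 * sig) (%x. kap * r x)" "small_for (2 * sig) (%x. kap * q x)"
 using q r by (auto intro!: small_for_potential)

lemma m_bound: "norm (m x) <= 1 / 2" and n_bound: "norm (n x) <= 1 / 2"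
 unfolding m_def n_def using riccati(2) small sigma_nz by blast+

lemma m_eq: "m = Rop (- (2 * sig)) (%x. kap * r x - kap * q x * (m x)^2)"
 and n_eq: "n = Rop (2 * sig) (%x. kap * q x - kap * r x * (n x)^2)"
 unfolding m_def n_def using riccati(3)[OF sigma_nz(3) small(1,2)] riccati(3)[OF sigma_nz(2) small(4,3)] .

lemma m_C1: "C1_bounded m (%x. kap * r x - kap * q x * (m x)^2 + 2 * sig * m x)"
 and n_C1: "C1_bounded n (%x. kap * q x - kap * r x * (n x)^2 - 2 * sig * n x)"
 using riccati_derivative[OF sigma_nz(3) small(1,2)] riccati_derivative[OF sigma_nz(2) small(4,3)]
 unfolding m_def[symmetric] n_def[symmetric] by simp_all

lemma mn_bound: "norm (m x * n x) <= 1 / 4"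
 unfolding norm_mult using mult_mono[OF m_bound n_bound] by simp

lemma det_bound: "norm (1 - m x * n x) \<ge> 3 / 4"
 using norm_triangle_ineq2[of 1 "m x * n x"] mn_bound[of x] by simp

lemma det_nz: "1 - m x * n x ~= 0" using det_bound[of x] by auto

lemma continuous_integrable_mult:
 assumes "potential p" "C1_bounded u u'"
 shows "cont (%x. kap * p x * u x)" "L1 (%x. kap * p x * u x)" "\<exists>C. \<forall>x. norm (kap * p x * u x) <= C"
proof -
 have c: "cont u" "cont p" using assms C1_bounded_continuous[OF assms(2)] unfolding potential_def by auto
 have bd: "\<exists>C. \<forall>x. norm (u x) <= C" "\<exists>C. \<forall>x. norm (p x) <= C" using assms C1_bounded_bounds[OF assms(2)] unfolding potential_def by auto
 show "cont (%x. kap * p x * u x)" by (intro continuous_intros c)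
 show "\<exists>C. \<forall>x. norm (kap * p x * u x) <= C" by (intro bounded_mult bd) auto
 obtain C where C: "!!x. norm (u x) <= C" using bd(1) by blast
 show "L1 (%x. kap * p x * u x)"
 proof (rule L1_bound)
  show "L1 (%x. norm kap * C * norm (p x))" using assms(1) by (simp add: potential_def)
  show "(%x. kap * p x * u x) \<in> borel_measurable lborel"
   using borel_measurable_continuous_onI[OF c(1)] borel_measurable_continuous_onI[OF c(2)] by simp
  show "AE x in lborel. norm (kap * p x * u x) <= norm (norm kap * C * norm (p x))"
  proof (rule AE_I2)
   fix x
   have "norm (kap * p x * u x) <= norm kap * norm (p x) * C" unfolding norm_mult using C by (intro mult_left_mono) auto
   also have "... <= norm (norm kap * C * norm (p x))" using order_trans[OF norm_ge_zero C] by (simp add: abs_mult mult_ac)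
   finally show "norm (kap * p x * u x) <= norm (norm kap * C * norm (p x))" .
  qed
 qed
qed

lemma C1_bounded_cong: "C1_bounded p p' ==> (!!x. p x = s x) ==> (!!x. p' x = s' x) ==> C1_bounded s s'"
 by (metis (full_types) ext)

lemma exp_antiderivative:
 fixes f :: "real => complex"
 assumes "cont f" "L1 f" "\<exists>C. \<forall>x. norm (f x) <= C"
 shows "\<exists>E. C1_bounded E (%x. f x * E x) \<and> C1_bounded (%x. 1 / E x) (%x. - f x / E x) \<and> (\<forall>x. E x ~= 0)"
proof -
 obtain C where "!!x. norm (f x) <= C" using assms(3) by blast
 then show ?thesis by (rule C1_bounded_exp_antiderivative[OF assms(1,2)])
qed

text \<open>The columns are $(1, m) E_1$ and $(n, 1) E_2$, where $E_1$ and $E_2$ are the exponentials of antiderivatives of $\kappa q m$ and $\kappa r n$.\<close>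

lemma gauge_exists:
 "\<exists>E1 E2. gauge kap sig q r E1 (%x. n x * E2 x) (%x. m x * E1 x) E2
   (%x. 1 / (1 - m x * n x) * (1 / E1 x)) (%x. - n x * (1 / (1 - m x * n x) * (1 / E1 x)))
   (%x. - m x * (1 / (1 - m x * n x) * (1 / E2 x))) (%x. 1 / (1 - m x * n x) * (1 / E2 x)) \<and> (\<forall>x. E1 x ~= 0 \<and> E2 x ~= 0)"
proof -
 obtain E1 where E1: "C1_bounded E1 (%x. kap * q x * m x * E1 x)" "C1_bounded (%x. 1 / E1 x) (%x. - (kap * q x * m x) / E1 x)" "!!x. E1 x ~= 0"
  using exp_antiderivative[OF continuous_integrable_mult[OF q(1) m_C1]] by blast
 obtain E2 where E2: "C1_bounded E2 (%x. kap * r x * n x * E2 x)" "C1_bounded (%x. 1 / E2 x) (%x. - (kap * r x * n x) / E2 x)" "!!x. E2 x ~= 0"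
  using exp_antiderivative[OF continuous_integrable_mult[OF r(1) n_C1]] by blast
 note md = C1_bounded_diff[OF C1_bounded_const[of 1] C1_bounded_mult[OF m_C1 n_C1]]
 have dd: "C1_bounded (%x. 1 - m x * n x) (%x. - (1 - m x * n x) * (kap * r x * n x + kap * q x * m x))"
  by (rule C1_bounded_cong[OF md]) (auto simp: algebra_simps power2_eq_square)
 have di: "C1_bounded (%x. 1 / (1 - m x * n x)) (%x. (kap * r x * n x + kap * q x * m x) / (1 - m x * n x))"
 proof (rule C1_bounded_cong[OF C1_bounded_inverse[OF dd, of "3/4"]])
  fix x
  define d where "d = 1 - m x * n x"
  have "d ~= 0" unfolding d_def by (rule det_nz)
  then show "- (- (1 - m x * n x) * (kap * r x * n x + kap * q x * m x)) / (1 - m x * n x)^2 = (kap * r x * n x + kap * q x * m x) / (1 - m x * n x)"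
   unfolding d_def[symmetric] by (simp add: power2_eq_square)
 qed (use det_bound in auto)
 have a11: "C1_bounded (%x. 1 / (1 - m x * n x) * (1 / E1 x)) (%x. kap * r x * n x * (1 / (1 - m x * n x) * (1 / E1 x)))"
 proof (rule C1_bounded_cong[OF C1_bounded_mult[OF di E1(2)]])
  show "1 / (1 - m x * n x) * (- (kap * q x * m x) / E1 x) + (kap * r x * n x + kap * q x * m x) / (1 - m x * n x) * (1 / E1 x) =
    kap * r x * n x * (1 / (1 - m x * n x) * (1 / E1 x))" for x
   by (simp add: add_divide_distrib)
 qed simp
 have a22: "C1_bounded (%x. 1 / (1 - m x * n x) * (1 / E2 x)) (%x. kap * q x * m x * (1 / (1 - m x * n x) * (1 / E2 x)))"
 proof (rule C1_bounded_cong[OF C1_bounded_mult[OF di E2(2)]])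
  show "1 / (1 - m x * n x) * (- (kap * r x * n x) / E2 x) + (kap * r x * n x + kap * q x * m x) / (1 - m x * n x) * (1 / E2 x) =
    kap * q x * m x * (1 / (1 - m x * n x) * (1 / E2 x))" for x
   by (simp add: add_divide_distrib)
 qed simp
 have nm: "C1_bounded (%x. - n x) (%x. - (kap * q x - kap * r x * (n x)^2 - 2 * sig * n x))"
  by (rule C1_bounded_cong[OF C1_bounded_diff[OF C1_bounded_const[of 0] n_C1]]) auto
 have mm: "C1_bounded (%x. - m x) (%x. - (kap * r x - kap * q x * (m x)^2 + 2 * sig * m x))"
  by (rule C1_bounded_cong[OF C1_bounded_diff[OF C1_bounded_const[of 0] m_C1]]) auto
 have "gauge kap sig q r E1 (%x. n x * E2 x) (%x. m x * E1 x) E2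
   (%x. 1 / (1 - m x * n x) * (1 / E1 x)) (%x. - n x * (1 / (1 - m x * n x) * (1 / E1 x)))
   (%x. - m x * (1 / (1 - m x * n x) * (1 / E2 x))) (%x. 1 / (1 - m x * n x) * (1 / E2 x))"
 proof
  show "\<i> * kap^2 = of_real sig" by (rule kappa)
  show "sig ~= 0" by (rule sigma_nz)
  show "cont q" "cont r" "\<exists>C. \<forall>x. norm (q x) <= C" "\<exists>C. \<forall>x. norm (r x) <= C"
   using q r by (simp_all add: potential_def)
  show "C1_bounded E1 (%x. kap * q x * (m x * E1 x))" by (rule C1_bounded_cong[OF E1(1)]) auto
  show "C1_bounded E2 (%x. kap * r x * (n x * E2 x))" by (rule C1_bounded_cong[OF E2(1)]) auto
  show "C1_bounded (%x. n x * E2 x) (%x. kap * q x * E2 x - 2 * sig * (n x * E2 x))"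
   by (rule C1_bounded_cong[OF C1_bounded_mult[OF n_C1 E2(1)]]) (auto simp: algebra_simps power2_eq_square)
  show "C1_bounded (%x. m x * E1 x) (%x. kap * r x * E1 x + 2 * sig * (m x * E1 x))"
   by (rule C1_bounded_cong[OF C1_bounded_mult[OF m_C1 E1(1)]]) (auto simp: algebra_simps power2_eq_square)
  show "C1_bounded (%x. 1 / (1 - m x * n x) * (1 / E1 x)) (%x. - kap * r x * (- n x * (1 / (1 - m x * n x) * (1 / E1 x))))"
   by (rule C1_bounded_cong[OF a11]) auto
  show "C1_bounded (%x. 1 / (1 - m x * n x) * (1 / E2 x)) (%x. - kap * q x * (- m x * (1 / (1 - m x * n x) * (1 / E2 x))))"
   by (rule C1_bounded_cong[OF a22]) auto
  show "C1_bounded (%x. - n x * (1 / (1 - m x * n x) * (1 / E1 x)))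
    (%x. - kap * q x * (1 / (1 - m x * n x) * (1 / E1 x)) - 2 * sig * (- n x * (1 / (1 - m x * n x) * (1 / E1 x))))"
  proof (rule C1_bounded_cong[OF C1_bounded_mult[OF nm a11]])
   fix x
   define k where "k = 1 / (1 - m x * n x) * (1 / E1 x)"
   show "- n x * (kap * r x * n x * (1 / (1 - m x * n x) * (1 / E1 x))) + - (kap * q x - kap * r x * (n x)^2 - 2 * sig * n x) * (1 / (1 - m x * n x) * (1 / E1 x)) =
    - kap * q x * (1 / (1 - m x * n x) * (1 / E1 x)) - 2 * sig * (- n x * (1 / (1 - m x * n x) * (1 / E1 x)))"
    unfolding k_def[symmetric] by (simp add: algebra_simps power2_eq_square)
  qed simp
  show "C1_bounded (%x. - m x * (1 / (1 - m x * n x) * (1 / E2 x)))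
    (%x. 2 * sig * (- m x * (1 / (1 - m x * n x) * (1 / E2 x))) - kap * r x * (1 / (1 - m x * n x) * (1 / E2 x)))"
  proof (rule C1_bounded_cong[OF C1_bounded_mult[OF mm a22]])
   fix x
   define k where "k = 1 / (1 - m x * n x) * (1 / E2 x)"
   show "- m x * (kap * q x * m x * (1 / (1 - m x * n x) * (1 / E2 x))) + - (kap * r x - kap * q x * (m x)^2 + 2 * sig * m x) * (1 / (1 - m x * n x) * (1 / E2 x)) =
    2 * sig * (- m x * (1 / (1 - m x * n x) * (1 / E2 x))) - kap * r x * (1 / (1 - m x * n x) * (1 / E2 x))"
    unfolding k_def[symmetric] by (simp add: algebra_simps power2_eq_square)
  qed simp
  fix x
  have nz: "1 - m x * n x ~= 0" "E1 x ~= 0" "E2 x ~= 0" using det_nz E1(3) E2(3) by auto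
  define d where "d = 1 - m x * n x"
  have d: "d ~= 0" "m x * n x = 1 - d" using nz by (auto simp: d_def)
  show "E1 x * (1 / (1 - m x * n x) * (1 / E1 x)) + n x * E2 x * (- m x * (1 / (1 - m x * n x) * (1 / E2 x))) = 1"
   using nz d unfolding d_def[symmetric] by (simp add: field_simps)
  show "E1 x * (- n x * (1 / (1 - m x * n x) * (1 / E1 x))) + n x * E2 x * (1 / (1 - m x * n x) * (1 / E2 x)) = 0"
   using nz by simp
  show "m x * E1 x * (1 / (1 - m x * n x) * (1 / E1 x)) + E2 x * (- m x * (1 / (1 - m x * n x) * (1 / E2 x))) = 0"
   using nz by simp
  show "m x * E1 x * (- n x * (1 / (1 - m x * n x) * (1 / E1 x))) + E2 x * (1 / (1 - m x * n x) * (1 / E2 x)) = 1"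
   using nz d unfolding d_def[symmetric] by (simp add: field_simps)
 qed
 then show ?thesis using E1(3) E2(3) by blast
qed

theorem diagonal_green:
 "g12 kap q r x = - n x / (1 - m x * n x)" "g21 kap q r x = m x / (1 - m x * n x)" "gam kap q r x = 2 * m x * n x / (1 - m x * n x)"
proof -
 obtain E1 E2 where g: "gauge kap sig q r E1 (%x. n x * E2 x) (%x. m x * E1 x) E2
   (%x. 1 / (1 - m x * n x) * (1 / E1 x)) (%x. - n x * (1 / (1 - m x * n x) * (1 / E1 x)))
   (%x. - m x * (1 / (1 - m x * n x) * (1 / E2 x))) (%x. 1 / (1 - m x * n x) * (1 / E2 x))" and nz: "!!x. E1 x ~= 0 \<and> E2 x ~= 0"
  using gauge_exists by blast
 have c: "E1 x * (k * (1 / d * (1 / E1 x))) = k / d" "E1 x * (1 / d * (1 / E1 x)) = 1 / d" "m x * E1 x * (k * (1 / d * (1 / E1 x))) = m x * k / d" "m x * E1 x * (1 / d * (1 / E1 x)) = m x / d" for k d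
  using nz[of x] by simp_all
 show "g12 kap q r x = - n x / (1 - m x * n x)" "g21 kap q r x = m x / (1 - m x * n x)"
  unfolding gauge.diagonal(1,2)[OF g, of x] c by (rule refl)+
 have "gam kap q r x = 1 / (1 - m x * n x) + m x * n x / (1 - m x * n x) - 1"
  unfolding gauge.diagonal(3)[OF g, of x] c by simp
 also have "... = 2 * m x * n x / (1 - m x * n x)" using det_nz[of x] by (simp add: field_simps)
 finally show "gam kap q r x = 2 * m x * n x / (1 - m x * n x)" .
qed

lemma green_C1: "C1_bounded (g12 kap q r) (%x. - 2 * sig * g12 kap q r x - kap * q x * (gam kap q r x + 1))"
 "C1_bounded (g21 kap q r) (%x. 2 * sig * g21 kap q r x + kap * r x * (gam kap q r x + 1))"
 "C1_bounded (gam kap q r) (%x. 2 * (kap * q x * g21 kap q r x - kap * r x * g12 kap q r x))"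
proof -
 obtain E1 E2 where g: "gauge kap sig q r E1 (%x. n x * E2 x) (%x. m x * E1 x) E2
   (%x. 1 / (1 - m x * n x) * (1 / E1 x)) (%x. - n x * (1 / (1 - m x * n x) * (1 / E1 x)))
   (%x. - m x * (1 / (1 - m x * n x) * (1 / E2 x))) (%x. 1 / (1 - m x * n x) * (1 / E2 x))"
  using gauge_exists by blast
 show "C1_bounded (g12 kap q r) (%x. - 2 * sig * g12 kap q r x - kap * q x * (gam kap q r x + 1))"
  by (rule gauge.g12_C1[OF g])
 show "C1_bounded (g21 kap q r) (%x. 2 * sig * g21 kap q r x + kap * r x * (gam kap q r x + 1))"
  by (rule gauge.g21_C1[OF g])
 show "C1_bounded (gam kap q r) (%x. 2 * (kap * q x * g21 kap q r x - kap * r x * g12 kap q r x))"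
  by (rule gauge.gam_C1[OF g])
qed

end

section \<open>Algebraic identities of the flow\<close>

lemma Theta_Xi:
 assumes "kap^2 ~= mu^2"
 shows "kap * Xi mu kap = mu * Theta mu kap" "kap * Theta mu kap - mu * kap^2 = mu * Xi mu kap"
proof -
 have d: "kap^2 - mu\<^sup>2 ~= 0" using assms by simp
 show "kap * Xi mu kap = mu * Theta mu kap" unfolding Theta_def Xi_def by (simp add: power2_eq_square power3_eq_cube)
 show "kap * Theta mu kap - mu * kap^2 = mu * Xi mu kap" unfolding Theta_def Xi_def
  using d by (simp add: field_simps) (simp add: power2_eq_square power3_eq_cube power4_eq_xxxx algebra_simps)
qed

lemma flow_identity_m:
 fixes kap mu T X u q r a b g g12 g21 g12' g21' gam' m m' w w' :: complex
 assumes "kap * X = mu * T" "kap * T - mu * kap^2 = mu * X"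
  and "g12' = - 2 * (u * kap^2) * g12 - kap * q * g" "g21' = 2 * (u * kap^2) * g21 + kap * r * g"
  and "gam' = 2 * (kap * q * g21 - kap * r * g12)" "m' = mu * r - mu * q * m^2 + 2 * (u * mu^2) * m"
  and "w = - T * g21 + X * g * m + T * g12 * m^2"
  and "w' = - T * g21' + (X * gam' * m + X * g * m') + (T * g12' * m^2 + T * g12 * (2 * m * m'))"
 shows "w' = mu * (- kap * g21') - mu * (- kap * g12') * m^2 - 2 * mu * q * m * w + 2 * (u * mu^2) * w"
 using assms by algebra

lemma flow_identity_n:
 fixes kap mu T X u q r a b g g12 g21 g12' g21' gam' n n' w w' :: complex
 assumes "kap * X = mu * T" "kap * T - mu * kap^2 = mu * X"
  and "g12' = - 2 * (u * kap^2) * g12 - kap * q * g" "g21' = 2 * (u * kap^2) * g21 + kap * r * g"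
  and "gam' = 2 * (kap * q * g21 - kap * r * g12)" "n' = mu * q - mu * r * n^2 - 2 * (u * mu^2) * n"
  and "w = - T * g12 - X * g * n + T * g21 * n^2"
  and "w' = - T * g12' - (X * gam' * n + X * g * n') + (T * g21' * n^2 + T * g21 * (2 * n * n'))"
 shows "w' = mu * (- kap * g12') - mu * (- kap * g21') * n^2 - 2 * mu * r * n * w - 2 * (u * mu^2) * w"
 using assms by algebra

lemma rho_identity:
 fixes kap mu T X u q r g g12 g21 g12' g21' gam' m m' wm n n' wn :: complex
 assumes "kap * X = mu * T" "kap * T - mu * kap^2 = mu * X"
  and "g12' = - 2 * (u * kap^2) * g12 - kap * q * g" "g21' = 2 * (u * kap^2) * g21 + kap * r * g"
  and "m' = mu * r - mu * q * m^2 + 2 * (u * mu^2) * m" "n' = mu * q - mu * r * n^2 - 2 * (u * mu^2) * n"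
  and "wm = - T * g21 + X * g * m + T * g12 * m^2"
  and "wn = - T * g12 - X * g * n + T * g21 * n^2"
 shows "- mu * ((- kap * g12') * m + q * wm - ((- kap * g21') * n + r * wn)) +
  (- T * ((g12' * m + g12 * m') - (n' * g21 + n * g21')) - T * mu * (2 * (q * g21 - r * g12))) = 0"
 using assms by algebra

section \<open>Dependence on a parameter\<close>

definition bmeas :: "(real => complex) => bool" where
 "bmeas f \<longleftrightarrow> f \<in> BM \<and> (\<exists>M. \<forall>x. norm (f x) <= M)"

lemma bmeas_intros:
 "bmeas (%_. k)" "bmeas f ==> bmeas g ==> bmeas (%x. f x + g x)" "bmeas f ==> bmeas g ==> bmeas (%x. f x - g x)"
 "bmeas f ==> bmeas g ==> bmeas (%x. f x * g x)" "bmeas f ==> bmeas (%x. f x / k)" "bmeas f ==> bmeas (%x. (f x)\<^sup>2)"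
proof -
 show "bmeas (%_. k)" unfolding bmeas_def by auto
 show "bmeas f ==> bmeas g ==> bmeas (%x. f x + g x)" unfolding bmeas_def using bounded_add[of f g] by auto
 show "bmeas f ==> bmeas g ==> bmeas (%x. f x - g x)" unfolding bmeas_def using bounded_diff[of f g] by auto
 show m: "bmeas f ==> bmeas g ==> bmeas (%x. f x * g x)" for f g unfolding bmeas_def using bounded_mult[of f g] by auto
 show "bmeas f ==> bmeas (%x. (f x)\<^sup>2)" using m[of f f] by (simp add: power2_eq_square)
 have "bmeas (%_. 1 / k)" unfolding bmeas_def by auto
 then show "bmeas f ==> bmeas (%x. f x / k)" using m[of f "%_. 1 / k"] by simp
qed

lemma bmeas_continuous: "cont f ==> (!!x. norm (f x) <= M) ==> bmeas f"
 unfolding bmeas_def using borel_measurable_continuous_onI by blast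

lemma Rop_bdiff: "c ~= 0 ==> bmeas f ==> bmeas g ==> Rop c (%y. f y - g y) x = Rop c f x - Rop c g x"
 unfolding bmeas_def using Rop_diff by blast

lemma self_bound:
 fixes f :: "real => complex"
 assumes b: "\<exists>M. \<forall>x. norm (f x) <= M" and s: "!!M x. (!!x. norm (f x) <= M) ==> norm (f x) <= C + M / 4" and C: "C \<ge> 0"
 shows "norm (f x) <= 2 * C"
proof -
 define S where "S = (SUP x. norm (f x))"
 have bdd: "bdd_above (range (%x. norm (f x)))" using b by (auto simp: bdd_above_def)
 have le: "norm (f x) <= S" for x unfolding S_def by (rule cSUP_upper[OF _ bdd]) simp
 have "S <= C + S / 4" unfolding S_def[symmetric] by (subst S_def, rule cSUP_least) (use s[OF le] in auto)
 then show ?thesis using le[of x] C by linarith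
qed

text \<open>The difference quotient solves the same fixed-point equation as $w$ up to an error that tends to zero uniformly; the contraction absorbs the remaining terms.\<close>

lemma riccati_parameter_derivative:
 fixes a b :: "real => real => complex"
 assumes c: "c ~= 0" and at: "small_for c (a t)" and bt: "small_for c (b t)"
  and ev: "\<forall>\<^sub>F tau in at t. small_for c (a tau) \<and> small_for c (b tau)"
  and ad: "uniform_limit UNIV (%tau x. (a tau x - a t x) / of_real (tau - t)) ad (at t)"
  and bd: "uniform_limit UNIV (%tau x. (b tau x - b t x) / of_real (tau - t)) bd (at t)"
  and bm: "bmeas ad" "bmeas bd" "bmeas w"
  and w: "w = Rop c (%y. ad y - bd y * (riccati c (a t) (b t) y)^2 - 2 * b t y * riccati c (a t) (b t) y * w y)"
 shows "uniform_limit UNIV (%tau x. (riccati c (a tau) (b tau) x - riccati c (a t) (b t) x) / of_real (tau - t)) w (at t)"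
proof -
 define u where "u = riccati c (a t) (b t)"
 define U where "U tau = riccati c (a tau) (b tau)" for tau
 obtain Ka where Ka: "!!x. norm (ad x) <= Ka" using bm(1) unfolding bmeas_def by blast
 obtain Kb where Kb: "!!x. norm (bd x) <= Kb" using bm(2) unfolding bmeas_def by blast
 obtain W where W: "!!x. norm (w x) <= W" using bm(3) unfolding bmeas_def by blast
 obtain B where B: "!!x. norm (b t x) <= B" using bt unfolding small_for_def by blast
 have nn: "0 <= Ka" "0 <= Kb" "0 <= W" "0 <= B" using order_trans[OF norm_ge_zero Ka] order_trans[OF norm_ge_zero Kb] order_trans[OF norm_ge_zero W] order_trans[OF norm_ge_zero B] .
 define C0 where "C0 = (Ka + Kb + 2) / \<bar>c\<bar>"
 have C0: "C0 \<ge> 0" using nn by (simp add: C0_def)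
 have sb: "bmeas f" if "small_for c f" for f using that bmeas_continuous unfolding small_for_def by blast
 have rb: "bmeas (riccati c f g)" if "small_for c f" "small_for c g" for f g
  using riccati[OF c that] bmeas_continuous by blast
 have ub: "bmeas u" "norm (u x) <= 1 / 2" for x unfolding u_def using rb[OF at bt] riccati(2)[OF c at bt] by auto
 have key: "norm ((U tau x - u x) / of_real (tau - t) - w x) <= 2 * ((2 * eta + (Kb + B * W) * (2 * C0 * \<bar>tau - t\<bar>)) / \<bar>c\<bar>)"
  if s: "small_for c (a tau)" "small_for c (b tau)" and ne: "tau ~= t" and eta: "0 < eta" "eta <= 1"
   and da: "!!x. norm ((a tau x - a t x) / of_real (tau - t) - ad x) <= eta" and db: "!!x. norm ((b tau x - b t x) / of_real (tau - t) - bd x) <= eta"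
  for tau x eta
 proof -
  define d :: complex where "d = of_real (tau - t)"
  have d: "d ~= 0" "norm d = \<bar>tau - t\<bar>" unfolding d_def norm_of_real using ne by auto
  define \<alpha> where "\<alpha> x = (a tau x - a t x) / d" for x
  define \<beta> where "\<beta> x = (b tau x - b t x) / d" for x
  define N where "N x = (U tau x - u x) / d" for x
  have ba: "bmeas (a tau)" "bmeas (b tau)" "bmeas (a t)" "bmeas (b t)" using sb s at bt by auto
  have Ub: "bmeas (U tau)" "norm (U tau x) <= 1 / 2" for x unfolding U_def using rb[OF s] riccati(2)[OF c s] by auto
  have bb: "bmeas \<alpha>" "bmeas \<beta>" "bmeas N" unfolding \<alpha>_def[abs_def] \<beta>_def[abs_def] N_def[abs_def] by (intro bmeas_intros ba Ub ub)+
  have Nx: "N x = Rop c (%y. \<alpha> y - \<beta> y * (U tau y)^2) x - Rop c (%y. b t y * ((U tau y + u y) * N y)) x" for x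
  proof -
   have "U tau x - u x = Rop c (%y. (a tau y - b tau y * (U tau y)^2) - (a t y - b t y * (u y)^2)) x"
   proof -
    have "U tau x = Rop c (%y. a tau y - b tau y * (U tau y)^2) x" using riccati(3)[OF c s] unfolding U_def[symmetric] by metis
    moreover have "u x = Rop c (%y. a t y - b t y * (u y)^2) x" using riccati(3)[OF c at bt] unfolding u_def[symmetric] by metis
    ultimately show ?thesis by (subst Rop_bdiff[OF c]) (auto intro!: bmeas_intros ba Ub ub)
   qed
   also have "... = Rop c (%y. d * ((\<alpha> y - \<beta> y * (U tau y)^2) - b t y * ((U tau y + u y) * N y))) x"
   proof (rule arg_cong[where f = "%f. Rop c f x"], rule ext)
    fix y
    have e: "a tau y = a t y + d * \<alpha> y" "b tau y = b t y + d * \<beta> y" "U tau y = u y + d * N y"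
     using d by (simp_all add: \<alpha>_def \<beta>_def N_def)
    show "(a tau y - b tau y * (U tau y)^2) - (a t y - b t y * (u y)^2) = d * ((\<alpha> y - \<beta> y * (U tau y)^2) - b t y * ((U tau y + u y) * N y))"
     unfolding e(1,2) using e(3) by algebra
   qed
   also have "... = d * (Rop c (%y. \<alpha> y - \<beta> y * (U tau y)^2) x - Rop c (%y. b t y * ((U tau y + u y) * N y)) x)"
    unfolding Rop_cmult by (subst Rop_bdiff[OF c]) (auto intro!: bmeas_intros ba Ub ub bb)
   finally show ?thesis using d by (simp add: N_def)
  qed
  have U2: "norm ((U tau y)^2) <= 1" for y
   using power_mono[OF Ub(2)[of y] norm_ge_zero, of 2] by (simp add: norm_power power_divide)
  have Uu: "norm (U tau y + u y) <= 1" for y using norm_triangle_ineq[of "U tau y" "u y"] Ub(2)[of y] ub(2)[of y] by linarith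
  have contr: "norm (Rop c (%y. b t y * ((U tau y + u y) * f y)) x) <= M / 4" if "bmeas f" "!!y. norm (f y) <= M" for f M x
  proof -
   have "norm ((U tau y + u y) * f y) <= 1 * M" for y unfolding norm_mult using Uu that(2) by (intro mult_mono) auto
   moreover have "(%y. (U tau y + u y) * f y) \<in> BM" using bmeas_intros(4)[OF bmeas_intros(2)[OF Ub(1) ub(1)] that(1)] by (simp add: bmeas_def)
   ultimately show ?thesis using bt unfolding small_for_def by simp
  qed
  have N2: "norm (N x) <= 2 * C0" for x
  proof (rule self_bound[OF _ _ C0])
   show "\<exists>M. \<forall>x. norm (N x) <= M" using bb(3) unfolding bmeas_def by blast
   fix M x assume M: "!!x. norm (N x) <= M"
   have "norm (Rop c (%y. \<alpha> y - \<beta> y * (U tau y)^2) x) <= (Ka + Kb + 2) / \<bar>c\<bar>"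
   proof (rule Rop_bound_sup[OF c])
    show "(%y. \<alpha> y - \<beta> y * (U tau y)^2) \<in> BM" using bmeas_intros(3)[OF bb(1) bmeas_intros(4)[OF bb(2) bmeas_intros(6)[OF Ub(1)]]] by (simp add: bmeas_def)
    fix y
    have "norm (\<alpha> y) <= Ka + 1" using norm_triangle_ineq[of "\<alpha> y - ad y" "ad y"] da[of y] Ka[of y] eta by (simp add: \<alpha>_def d_def)
    moreover have b1: "norm (\<beta> y) <= Kb + 1" using norm_triangle_ineq[of "\<beta> y - bd y" "bd y"] db[of y] Kb[of y] eta by (simp add: \<beta>_def d_def)
    have "norm (\<beta> y * (U tau y)^2) <= (Kb + 1) * 1" unfolding norm_mult by (intro mult_mono b1 U2) (use nn in auto)
    ultimately have "norm (\<alpha> y) + norm (\<beta> y * (U tau y)^2) <= (Ka + 1) + (Kb + 1) * 1" by (rule add_mono)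
    then have le: "norm (\<alpha> y) + norm (\<beta> y * (U tau y)^2) <= Ka + Kb + 2" by simp
    show "norm (\<alpha> y - \<beta> y * (U tau y)^2) <= Ka + Kb + 2" by (rule order_trans[OF norm_triangle_ineq4 le])
   qed
   moreover have "norm (Rop c (%y. b t y * ((U tau y + u y) * N y)) x) <= M / 4" by (rule contr[OF bb(3) M])
   ultimately show "norm (N x) <= C0 + M / 4"
    unfolding Nx[of x] C0_def using norm_triangle_ineq4[of "Rop c (%y. \<alpha> y - \<beta> y * (U tau y)^2) x" "Rop c (%y. b t y * ((U tau y + u y) * N y)) x"] by linarith
  qed
  have dU: "norm (U tau y - u y) <= 2 * C0 * \<bar>tau - t\<bar>" for y
  proof -
   have "U tau y - u y = N y * d" using d by (simp add: N_def)
   then have "norm (U tau y - u y) = norm (N y) * \<bar>tau - t\<bar>" by (simp only: norm_mult d(2))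
   also have "... <= 2 * C0 * \<bar>tau - t\<bar>" by (intro mult_right_mono N2) simp
   finally show ?thesis .
  qed
  define e where "e x = N x - w x" for x
  define \<rho> where "\<rho> y = (\<alpha> y - ad y) - (\<beta> y * (U tau y)^2 - bd y * (u y)^2) - b t y * ((U tau y - u y) * w y)" for y
  have be: "bmeas e" unfolding e_def[abs_def] by (intro bmeas_intros bb bm)
  have br: "bmeas \<rho>" unfolding \<rho>_def[abs_def] by (intro bmeas_intros bb bm Ub ub ba)
  have ex: "e x = Rop c \<rho> x - Rop c (%y. b t y * ((U tau y + u y) * e y)) x" for x
  proof -
   have wx: "w x = Rop c (%y. ad y - bd y * (u y)^2 - 2 * b t y * u y * w y) x" using w unfolding u_def by metis
   have "e x = Rop c (%y. ((\<alpha> y - \<beta> y * (U tau y)^2) - b t y * ((U tau y + u y) * N y)) - (ad y - bd y * (u y)^2 - 2 * b t y * u y * w y)) x"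
    unfolding e_def Nx[of x] wx
    by (subst Rop_bdiff[OF c], (intro bmeas_intros bb bm Ub ub ba)+, subst Rop_bdiff[OF c], (intro bmeas_intros bb bm Ub ub ba)+, simp)
   also have "... = Rop c (%y. \<rho> y - b t y * ((U tau y + u y) * e y)) x"
    by (rule arg_cong[where f = "%f. Rop c f x"], rule ext) (simp add: \<rho>_def e_def algebra_simps)
   also have "... = Rop c \<rho> x - Rop c (%y. b t y * ((U tau y + u y) * e y)) x"
    by (rule Rop_bdiff[OF c br]) (intro bmeas_intros be Ub ub ba)
   finally show ?thesis .
  qed
  define P where "P = 2 * eta + (Kb + B * W) * (2 * C0 * \<bar>tau - t\<bar>)"
  have P0: "P \<ge> 0" unfolding P_def using eta nn C0 by simp
  have \<rho>b: "norm (\<rho> y) <= P" for y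
  proof -
   have 1: "norm (\<alpha> y - ad y) <= eta" using da[of y] by (simp add: \<alpha>_def d_def)
   have 2: "norm (\<beta> y * (U tau y)^2 - bd y * (u y)^2) <= eta + Kb * (2 * C0 * \<bar>tau - t\<bar>)"
   proof -
    have "\<beta> y * (U tau y)^2 - bd y * (u y)^2 = (\<beta> y - bd y) * (U tau y)^2 + bd y * ((U tau y - u y) * (U tau y + u y))"
     by (simp add: algebra_simps power2_eq_square)
    also have "norm ... <= norm (\<beta> y - bd y) * norm ((U tau y)^2) + norm (bd y) * (norm (U tau y - u y) * norm (U tau y + u y))"
     by (rule order_trans[OF norm_triangle_ineq]) (simp only: norm_mult order_refl)
    also have "... <= eta * 1 + Kb * ((2 * C0 * \<bar>tau - t\<bar>) * 1)"
     using db[of y] by (intro add_mono mult_mono U2 Kb dU Uu) (use eta nn C0 in \<open>auto simp: \<beta>_def d_def\<close>)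
    finally show ?thesis by simp
   qed
   have 3: "norm (b t y * ((U tau y - u y) * w y)) <= B * ((2 * C0 * \<bar>tau - t\<bar>) * W)"
    unfolding norm_mult by (intro mult_mono B dU W) (use nn C0 in auto)
   have "norm (\<rho> y) <= norm (\<alpha> y - ad y) + norm (\<beta> y * (U tau y)^2 - bd y * (u y)^2) + norm (b t y * ((U tau y - u y) * w y))"
    unfolding \<rho>_def by (rule order_trans[OF norm_triangle_ineq4 add_right_mono[OF norm_triangle_ineq4]])
   also have "... <= P" using 1 2 3 by (simp add: P_def algebra_simps)
   finally show ?thesis .
  qed
  have "norm (e x) <= 2 * (P / \<bar>c\<bar>)"
  proof (rule self_bound)
   show "\<exists>M. \<forall>x. norm (e x) <= M" using be unfolding bmeas_def by blast
   fix M x assume M: "!!x. norm (e x) <= M"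
   have "norm (Rop c \<rho> x) <= P / \<bar>c\<bar>" using br \<rho>b by (intro Rop_bound_sup[OF c]) (auto simp: bmeas_def)
   moreover have "norm (Rop c (%y. b t y * ((U tau y + u y) * e y)) x) <= M / 4" by (rule contr[OF be M])
   ultimately show "norm (e x) <= P / \<bar>c\<bar> + M / 4"
    unfolding ex[of x] using norm_triangle_ineq4[of "Rop c \<rho> x" "Rop c (%y. b t y * ((U tau y + u y) * e y)) x"] by linarith
  qed (use P0 in simp)
  then show ?thesis unfolding e_def N_def P_def d_def .
 qed
 show ?thesis
  unfolding u_def[symmetric] uniform_limit_iff dist_norm
 proof (intro allI impI)
  fix \<epsilon> :: real assume \<epsilon>: "\<epsilon> > 0"
  define eta where "eta = min 1 (\<epsilon> * \<bar>c\<bar> / 16)"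
  have eta: "0 < eta" "eta <= 1" "4 * eta / \<bar>c\<bar> <= \<epsilon> / 4" using \<epsilon> c by (auto simp: eta_def min_def field_simps)
  have "((%tau. 2 * ((Kb + B * W) * (2 * C0 * \<bar>tau - t\<bar>)) / \<bar>c\<bar>) \<longlongrightarrow> 2 * ((Kb + B * W) * (2 * C0 * \<bar>t - t\<bar>)) / \<bar>c\<bar>) (at t)"
   using c by (intro tendsto_intros) auto
  then have lim: "\<forall>\<^sub>F tau in at t. 2 * ((Kb + B * W) * (2 * C0 * \<bar>tau - t\<bar>)) / \<bar>c\<bar> < \<epsilon> / 2"
   by (rule order_tendstoD) (use \<epsilon> in simp)
  have ne: "\<forall>\<^sub>F tau in at t. tau ~= t" by (simp add: eventually_at_filter)
  show "\<forall>\<^sub>F tau in at t. \<forall>x\<in>UNIV. norm ((riccati c (a tau) (b tau) x - u x) / of_real (tau - t) - w x) < \<epsilon>"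
   using ev ne lim uniform_limitD[OF ad eta(1)] uniform_limitD[OF bd eta(1)]
  proof eventually_elim
   case (elim tau)
   show ?case unfolding U_def[symmetric]
   proof
    fix x
    have "norm ((U tau x - u x) / of_real (tau - t) - w x) <= 2 * ((2 * eta + (Kb + B * W) * (2 * C0 * \<bar>tau - t\<bar>)) / \<bar>c\<bar>)"
     by (rule key) (use elim eta in \<open>auto simp: dist_norm intro: less_imp_le\<close>)
    also have "... = 4 * eta / \<bar>c\<bar> + 2 * ((Kb + B * W) * (2 * C0 * \<bar>tau - t\<bar>)) / \<bar>c\<bar>" by (simp add: add_divide_distrib distrib_left)
    also have "... < \<epsilon>" using elim eta(3) \<epsilon> by linarith
    finally show "norm ((U tau x - u x) / of_real (tau - t) - w x) < \<epsilon>" .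
   qed
  qed
 qed
qed

section \<open>The flow\<close>

lemma has_vector_derivative_quotientI:
 fixes f :: "real => complex"
 assumes "((%tau. (f tau - f t) / of_real (tau - t)) \<longlongrightarrow> D) (at t)"
 shows "(f hvd D) (at t)"
proof -
 have "((%tau. norm ((f tau - f t) / of_real (tau - t) - D)) \<longlongrightarrow> 0) (at t)"
  using assms by (simp add: tendsto_norm_zero_iff LIM_zero_iff)
 moreover have "\<forall>\<^sub>F tau in at t. norm ((f tau - f t) / of_real (tau - t) - D) = norm (f tau - f t - (tau - t) *\<^sub>R D) / norm (tau - t)"
  unfolding eventually_at_filter
 proof (intro always_eventually allI impI)
  fix tau assume "tau ~= t"
  then have "(f tau - f t) / of_real (tau - t) - D = (f tau - f t - (tau - t) *\<^sub>R D) / of_real (tau - t)"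
   by (simp add: field_simps scaleR_conv_of_real)
  then show "norm ((f tau - f t) / of_real (tau - t) - D) = norm (f tau - f t - (tau - t) *\<^sub>R D) / norm (tau - t)"
   by (simp only: norm_divide norm_of_real real_norm_def)
 qed
 ultimately have "((%tau. norm (f tau - f t - (tau - t) *\<^sub>R D) / norm (tau - t)) \<longlongrightarrow> 0) (at t)"
  by (rule Lim_transform_eventually)
 then show ?thesis unfolding has_vector_derivative_def has_derivative_iff_norm by (simp add: bounded_linear_scaleR_left)
qed

lemma has_vector_derivative_divide_complex:
 fixes f g :: "real => complex"
 assumes f: "(f hvd f') (at t)" and g: "(g hvd g') (at t)" and nz: "g t ~= 0"
 shows "((%t. f t / g t) hvd (f' * g t - f t * g') / (g t)^2) (at t)"
proof -
 have "((%z. 1 / z) has_field_derivative - 1 / (g t)^2) (at (g t))"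
  by (auto intro!: derivative_eq_intros simp: nz power2_eq_square divide_inverse)
 from field_vector_diff_chain_at[OF g this] have i: "((%t. 1 / g t) hvd g' * (- 1 / (g t)^2)) (at t)" by (simp add: o_def)
 have "((%t. f t * (1 / g t)) hvd f t * (g' * (- 1 / (g t)^2)) + f' * (1 / g t)) (at t)"
  by (rule has_vector_derivative_mult[OF f i])
 moreover have "f t * (g' * (- 1 / (g t)^2)) + f' * (1 / g t) = (f' * g t - f t * g') / (g t)^2"
  using nz by (simp add: field_simps power2_eq_square)
 ultimately show ?thesis by simp
qed

lemma has_vector_derivative_cong_at:
 assumes "(f hvd D) (at t)" "\<forall>\<^sub>F tau in at t. f tau = g tau" "f t = g t"
 shows "(g hvd D) (at t)"
 using assms has_derivative_transform_eventually[of f _ t UNIV g] unfolding has_vector_derivative_def by auto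

lemma C1_bounded_add:
 assumes "C1_bounded p p'" "C1_bounded q q'"
 shows "C1_bounded (%x. p x + q x) (%x. p' x + q' x)"
 using C1_bounded_diff[OF assms(1) C1_bounded_diff[OF C1_bounded_const[of 0] assms(2)]] by simp

lemma C1_bounded_bmeas: "C1_bounded p p' ==> bmeas p" "C1_bounded p p' ==> bmeas p'"
 unfolding bmeas_def using C1_bounded_measurable[of p p'] C1_bounded_bounds[of p p'] by auto

lemma C1_bounded_dx: "C1_bounded p p' ==> dx p = p'"
 unfolding C1_bounded_def dx_def by (auto intro!: vector_derivative_at)

lemma C1_bounded_has_derivative: "C1_bounded p p' ==> (p hvd p' x) (at x)"
 by (simp add: C1_bounded_def)

lemma gamma_identity:
 fixes kap mu T X D q r g g12 g21 h h12 h21 c3 c4 :: complex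
 assumes "T * D = mu * kap ^ 3" "X * D = mu^2 * kap^2" "D = kap^2 - mu\<^sup>2" "D ~= 0"
  and c: "c3 * D^2 = kap ^ 3 * (kap^2 + mu^2)" "c4 * D^2 = kap ^ 4 * mu"
  and kk: "g12' = - 2 * (\<i> * kap^2) * g12 - kap * q * g" "g21' = 2 * (\<i> * kap^2) * g21 + kap * r * g"
  "g' = 2 * (kap * q * g21 - kap * r * g12)"
  and mm: "h12' = - 2 * (\<i> * mu^2) * h12 - mu * q * h" "h21' = 2 * (\<i> * mu^2) * h21 + mu * r * h"
  "h' = 2 * (mu * q * h21 - mu * r * h12)"
  and t: "ht = - 2 * T * (g12 * h21 - g21 * h12)" "h12t = - X * h12 * g + T * g12 * h" "h21t = X * h21 * g - T * g21 * h"
 shows "2 * \<i> * mu * ht - ((q * h21t + - kap * g12' * h21) + (r * h12t + - kap * g21' * h12))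
   + (- c3 * ((g12 * h21' + g12' * h21) + (g21 * h12' + g21' * h12)) - (c4 * g * h' + c4 * g' * h)) = 0" (is "?A + (- c3 * ?B - (c4 * g * h' + c4 * g' * h)) = 0")
proof -
 have "D^2 * (?A + (- c3 * ?B - (c4 * g * h' + c4 * g' * h))) = D^2 * ?A + (- (c3 * D^2) * ?B - (c4 * D^2) * (g * h' + g' * h))"
  by (simp add: algebra_simps)
 also have "... = 0" unfolding c kk mm t using assms(1-3) by algebra
 finally show ?thesis using assms(4) by simp
qed

text \<open>The candidate derivatives of $m$ and $n$ are bounded solutions of the linearised Riccati equations by the algebraic identities above, so they are the derivatives.\<close>

theorem flow_derivatives:
 fixes Q R :: "real => real => complex"
 assumes A: "lax_potential mu s (Q t) (R t)" and K: "lax_potential kap s' (Q t) (R t)" and ne: "kap^2 ~= mu^2"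
  and ev: "\<forall>\<^sub>F tau in at t. lax_potential mu s (Q tau) (R tau)"
  and dq: "uniform_limit UNIV (%tau x. (Q tau x - Q t x) / of_real (tau - t)) (%x. - kap * dx (g12 kap (Q t) (R t)) x) (at t)"
  and dr: "uniform_limit UNIV (%tau x. (R tau x - R t x) / of_real (tau - t)) (%x. - kap * dx (g21 kap (Q t) (R t)) x) (at t)"
 defines "q \<equiv> Q t" and "r \<equiv> R t"
 shows "((%tau. g12 mu (Q tau) (R tau) x) has_vector_derivative
      - Xi mu kap * g12 mu q r x * (gam kap q r x + 1) + Theta mu kap * g12 kap q r x * (gam mu q r x + 1)) (at t)"
  and "((%tau. g21 mu (Q tau) (R tau) x) has_vector_derivative
      Xi mu kap * g21 mu q r x * (gam kap q r x + 1) - Theta mu kap * g21 kap q r x * (gam mu q r x + 1)) (at t)"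
  and "((%tau. gam mu (Q tau) (R tau) x) has_vector_derivative
      - 2 * Theta mu kap * (g12 kap q r x * g21 mu q r x - g21 kap q r x * g12 mu q r x)) (at t)"
  and "\<exists>a b. ((%tau. gamma_density mu (Q tau) (R tau) x) hvd a) (at t)
        \<and> ((%y. j_gamma mu kap q r y) hvd b) (at x) \<and> a + b = 0"
  and "\<exists>a b. ((%tau. rho_density mu (Q tau) (R tau) x) hvd a) (at t)
        \<and> ((%y. j_A mu kap q r y) hvd b) (at x) \<and> a + b = 0"
proof -
 interpret A: lax_potential mu s q r using A by (simp add: q_def r_def)
 interpret K: lax_potential kap s' q r using K by (simp add: q_def r_def)
 let ?T = "Theta mu kap" and ?X = "Xi mu kap"
 note TX = Theta_Xi[OF ne]
 define M where "M tau = lax_potential.m mu s (Q tau) (R tau)" for tau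
 define N where "N tau = lax_potential.n mu s (Q tau) (R tau)" for tau
 have Mt: "M t = A.m" and Nt: "N t = A.n" by (simp_all add: M_def N_def q_def r_def)
 define G12 where "G12 = g12 kap q r" define G21 where "G21 = g21 kap q r" define Ga where "Ga = (%x. gam kap q r x + 1)"
 define G12' where "G12' x = - 2 * s' * G12 x - kap * q x * Ga x" for x
 define G21' where "G21' x = 2 * s' * G21 x + kap * r x * Ga x" for x
 define Ga' where "Ga' x = 2 * (kap * q x * G21 x - kap * r x * G12 x)" for x
 have C12: "C1_bounded G12 G12'" and C21: "C1_bounded G21 G21'"
  unfolding G12'_def[abs_def] G21'_def[abs_def] G12_def G21_def Ga_def using K.green_C1 by simp_all
 have Cg: "C1_bounded Ga Ga'"
  by (rule K.C1_bounded_cong[OF C1_bounded_add[OF K.green_C1(3) C1_bounded_const[of 1]]]) (simp_all add: Ga_def Ga'_def G12_def G21_def)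
 define m' where "m' x = mu * r x - mu * q x * (A.m x)^2 + 2 * s * A.m x" for x
 define n' where "n' x = mu * q x - mu * r x * (A.n x)^2 - 2 * s * A.n x" for x
 have Cm: "C1_bounded A.m m'" and Cn: "C1_bounded A.n n'"
  unfolding m'_def[abs_def] n'_def[abs_def] by (rule A.m_C1 A.n_C1)+
 define wm where "wm x = - ?T * G21 x + ?X * Ga x * A.m x + ?T * G12 x * (A.m x)^2" for x
 define wn where "wn x = - ?T * G12 x - ?X * Ga x * A.n x + ?T * G21 x * (A.n x)^2" for x
 define wm' where "wm' x = - ?T * G21' x + (?X * Ga' x * A.m x + ?X * Ga x * m' x) + (?T * G12' x * (A.m x)^2 + ?T * G12 x * (2 * A.m x * m' x))" for x
 define wn' where "wn' x = - ?T * G12' x - (?X * Ga' x * A.n x + ?X * Ga x * n' x) + (?T * G21' x * (A.n x)^2 + ?T * G21 x * (2 * A.n x * n' x))" for x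
 have Cwm: "C1_bounded wm wm'"
  by (rule K.C1_bounded_cong[OF C1_bounded_add[OF C1_bounded_add[OF C1_bounded_mult[OF C1_bounded_const[of "- ?T"] C21]
     C1_bounded_mult[OF C1_bounded_mult[OF C1_bounded_const[of ?X] Cg] Cm]]
     C1_bounded_mult[OF C1_bounded_mult[OF C1_bounded_const[of ?T] C12] C1_bounded_mult[OF Cm Cm]]]])
   (simp_all add: wm_def wm'_def power2_eq_square algebra_simps)
 have Cwn: "C1_bounded wn wn'"
  by (rule K.C1_bounded_cong[OF C1_bounded_add[OF C1_bounded_diff[OF C1_bounded_mult[OF C1_bounded_const[of "- ?T"] C12]
     C1_bounded_mult[OF C1_bounded_mult[OF C1_bounded_const[of ?X] Cg] Cn]]
     C1_bounded_mult[OF C1_bounded_mult[OF C1_bounded_const[of ?T] C21] C1_bounded_mult[OF Cn Cn]]]])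
   (simp_all add: wn_def wn'_def power2_eq_square algebra_simps)
 have s1: "of_real s = \<i> * mu^2" "of_real s' = \<i> * kap^2"
  "of_real (2 * s) = 2 * (\<i> * mu^2)" "of_real (2 * s') = 2 * (\<i> * kap^2)" "of_real (- 2 * s) = - 2 * (\<i> * mu^2)" "of_real (- 2 * s') = - 2 * (\<i> * kap^2)"
  "of_real (- (2 * s)) = - (2 * (\<i> * mu^2))"
  using A.kappa K.kappa by simp_all
 have em: "wm' x + of_real (- (2 * s)) * wm x = mu * (- kap * G21' x) - mu * (- kap * G12' x) * (A.m x)^2 - 2 * (mu * q x) * A.m x * wm x" for x
 proof -
  have "wm' x = mu * (- kap * G21' x) - mu * (- kap * G12' x) * (A.m x)^2 - 2 * mu * q x * A.m x * wm x + 2 * (\<i> * mu^2) * wm x"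
   by (rule flow_identity_m[where u = "\<i>" and g = "Ga x", OF TX _ _ _ _ wm_def wm'_def])
    (simp_all only: G12'_def G21'_def Ga'_def m'_def s1)
  then show ?thesis unfolding s1 by (simp add: algebra_simps)
 qed
 have en: "wn' x + of_real (2 * s) * wn x = mu * (- kap * G12' x) - mu * (- kap * G21' x) * (A.n x)^2 - 2 * (mu * r x) * A.n x * wn x" for x
 proof -
  have "wn' x = mu * (- kap * G12' x) - mu * (- kap * G21' x) * (A.n x)^2 - 2 * mu * r x * A.n x * wn x - 2 * (\<i> * mu^2) * wn x"
   by (rule flow_identity_n[where u = "\<i>" and g = "Ga x", OF TX _ _ _ _ wn_def wn'_def])
    (simp_all only: G12'_def G21'_def Ga'_def n'_def s1)
  then show ?thesis unfolding s1 by (simp add: algebra_simps)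
 qed
 have Rw: "w = Rop c (%y. w' y + c * w y)" if cw: "C1_bounded w w'" "c ~= 0" for w w' c
 proof -
  obtain C where C: "!!x. norm (w x) <= C" "!!x. norm (w' x) <= C" using cw(1) unfolding C1_bounded_def by blast
  show ?thesis by (rule Rop_unique[OF cw(2) _ _ C]) (use cw(1) in \<open>auto simp: C1_bounded_def\<close>)
 qed
 have dq': "uniform_limit UNIV (%tau x. (Q tau x - Q t x) / of_real (tau - t)) (%x. - kap * G12' x) (at t)"
  using dq unfolding q_def[symmetric] r_def[symmetric] G12_def[symmetric] C1_bounded_dx[OF C12] .
 have dr': "uniform_limit UNIV (%tau x. (R tau x - R t x) / of_real (tau - t)) (%x. - kap * G21' x) (at t)"
  using dr unfolding q_def[symmetric] r_def[symmetric] G21_def[symmetric] C1_bounded_dx[OF C21] .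
 have mu: "uniform_limit UNIV (%tau x. (mu * F tau x - mu * F t x) / of_real (tau - t)) (%x. mu * f x) (at t)"
  if "uniform_limit UNIV (%tau x. (F tau x - F t x) / of_real (tau - t)) f (at t)" for F f
  using bounded_linear.uniform_limit[OF bounded_linear_mult_right that, of mu] by (simp add: right_diff_distrib[symmetric])
 have bmd: "bmeas (%x. mu * (- kap * G12' x))" "bmeas (%x. mu * (- kap * G21' x))"
  by (intro bmeas_intros C1_bounded_bmeas[OF C12] C1_bounded_bmeas[OF C21])+
 have evs: "\<forall>\<^sub>F tau in at t. small_for (- (2 * s)) (%x. mu * R tau x) \<and> small_for (- (2 * s)) (%x. mu * Q tau x)"
  "\<forall>\<^sub>F tau in at t. small_for (2 * s) (%x. mu * Q tau x) \<and> small_for (2 * s) (%x. mu * R tau x)"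
  using ev by (rule eventually_mono, use lax_potential.small in blast)+
 have Mdef: "M tau = riccati (- (2 * s)) (%x. mu * R tau x) (%x. mu * Q tau x)" and Ndef: "N tau = riccati (2 * s) (%x. mu * Q tau x) (%x. mu * R tau x)"
  if "lax_potential mu s (Q tau) (R tau)" for tau
  unfolding M_def N_def lax_potential.m_def[OF that] lax_potential.n_def[OF that] by (rule refl)+
 have UM: "uniform_limit UNIV (%tau x. (riccati (- (2 * s)) (%x. mu * R tau x) (%x. mu * Q tau x) x - riccati (- (2 * s)) (%x. mu * R t x) (%x. mu * Q t x) x) / of_real (tau - t)) wm (at t)"
 proof (rule riccati_parameter_derivative[OF A.sigma_nz(3) _ _ evs(1) mu[OF dr'] mu[OF dq'] bmd(2) bmd(1) C1_bounded_bmeas(1)[OF Cwm]])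
  show "wm = Rop (- (2 * s)) (%y. mu * (- kap * G21' y) - mu * (- kap * G12' y) * (riccati (- (2 * s)) (%x. mu * R t x) (%x. mu * Q t x) y)^2
    - 2 * (mu * Q t y) * riccati (- (2 * s)) (%x. mu * R t x) (%x. mu * Q t x) y * wm y)"
   using Rw[OF Cwm A.sigma_nz(3)] unfolding em unfolding A.m_def unfolding q_def r_def .
 qed (use A.small in \<open>simp_all add: q_def r_def\<close>)
 have UN: "uniform_limit UNIV (%tau x. (riccati (2 * s) (%x. mu * Q tau x) (%x. mu * R tau x) x - riccati (2 * s) (%x. mu * Q t x) (%x. mu * R t x) x) / of_real (tau - t)) wn (at t)"
 proof (rule riccati_parameter_derivative[OF A.sigma_nz(2) _ _ evs(2) mu[OF dq'] mu[OF dr'] bmd(1) bmd(2) C1_bounded_bmeas(1)[OF Cwn]])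
  show "wn = Rop (2 * s) (%y. mu * (- kap * G12' y) - mu * (- kap * G21' y) * (riccati (2 * s) (%x. mu * Q t x) (%x. mu * R t x) y)^2
    - 2 * (mu * R t y) * riccati (2 * s) (%x. mu * Q t x) (%x. mu * R t x) y * wn y)"
   using Rw[OF Cwn A.sigma_nz(2)] unfolding en unfolding A.n_def unfolding q_def r_def .
 qed (use A.small in \<open>simp_all add: q_def r_def\<close>)
 note lim = tendsto_uniform_limitI[OF UM UNIV_I] tendsto_uniform_limitI[OF UN UNIV_I] tendsto_uniform_limitI[OF dq' UNIV_I] tendsto_uniform_limitI[OF dr' UNIV_I]
 have dM: "((%tau. M tau x) hvd wm x) (at t)"
  by (rule has_vector_derivative_cong_at[OF has_vector_derivative_quotientI[OF lim(1)]])
   (rule eventually_mono[OF ev], simp add: Mdef, simp add: Mdef[OF assms(1)])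
 have dN: "((%tau. N tau x) hvd wn x) (at t)"
  by (rule has_vector_derivative_cong_at[OF has_vector_derivative_quotientI[OF lim(2)]])
   (rule eventually_mono[OF ev], simp add: Ndef, simp add: Ndef[OF assms(1)])
 have dQ: "((%tau. Q tau x) hvd - kap * G12' x) (at t)" by (rule has_vector_derivative_quotientI[OF lim(3)])
 have dR: "((%tau. R tau x) hvd - kap * G21' x) (at t)" by (rule has_vector_derivative_quotientI[OF lim(4)])
 define d where "d = 1 - A.m x * A.n x"
 have d: "d ~= 0" unfolding d_def by (rule A.det_nz)
 have mn: "A.m x * A.n x = 1 - d" by (simp add: d_def)
 have dMN: "((%tau. 1 - M tau x * N tau x) hvd 0 - (M t x * wn x + wm x * N t x)) (at t)"
  by (rule has_vector_derivative_diff[OF has_vector_derivative_const has_vector_derivative_mult[OF dM dN]])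
 have dtn: "1 - M t x * N t x ~= 0" unfolding Mt Nt by (rule A.det_nz)
 have dt: "1 - M t x * N t x = d" unfolding Mt Nt d_def ..
 have diag: "g12 mu (Q tau) (R tau) x = - N tau x / (1 - M tau x * N tau x)" "g21 mu (Q tau) (R tau) x = M tau x / (1 - M tau x * N tau x)"
   "gam mu (Q tau) (R tau) x = 2 * M tau x * N tau x / (1 - M tau x * N tau x)" "1 - M tau x * N tau x ~= 0"
  if "lax_potential mu s (Q tau) (R tau)" for tau
  unfolding M_def N_def using lax_potential.diagonal_green[OF that] lax_potential.det_nz[OF that] by auto
 have diagt: "g12 mu q r x = - A.n x / d" "g21 mu q r x = A.m x / d" "gam mu q r x + 1 = (2 - d) / d"
 proof -
  show "g12 mu q r x = - A.n x / d" "g21 mu q r x = A.m x / d" using A.diagonal_green(1,2)[of x] unfolding d_def by auto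
  have "gam mu q r x + 1 = 2 * (A.m x * A.n x) / d + 1" using A.diagonal_green(3)[of x] unfolding d_def[symmetric] by simp
  then show "gam mu q r x + 1 = (2 - d) / d" unfolding mn using d by (simp add: field_simps)
 qed
 have mN: "((%tau. - N tau x) hvd - wn x) (at t)" by (rule has_vector_derivative_minus[OF dN])
 have nd: "z / (d * d) = k / d" if "z = k * d" for z k using that d by simp
 have e12: "((- wn x) * (1 - M t x * N t x) - (- N t x) * (0 - (M t x * wn x + wm x * N t x))) / (1 - M t x * N t x)^2 =
   - ?X * g12 mu q r x * Ga x + ?T * G12 x * (gam mu q r x + 1)"
 proof -
  have E: "(- wn x) * d - (- A.n x) * (0 - (A.m x * wn x + wm x * A.n x)) = (?X * A.n x * Ga x + ?T * G12 x * (2 - d)) * d"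
   unfolding wm_def wn_def using mn by algebra
  show ?thesis unfolding dt unfolding Mt Nt diagt power2_eq_square nd[OF E] by (simp add: d algebra_simps diff_divide_distrib add_divide_distrib)
 qed
 show g12t: "((%tau. g12 mu (Q tau) (R tau) x) has_vector_derivative
      - Xi mu kap * g12 mu q r x * (gam kap q r x + 1) + Theta mu kap * g12 kap q r x * (gam mu q r x + 1)) (at t)"
  using has_vector_derivative_cong_at[OF has_vector_derivative_divide_complex[OF mN dMN dtn] eventually_mono[OF ev diag(1)[symmetric]] diag(1)[OF assms(1), symmetric]]
  unfolding e12 unfolding Ga_def G12_def .
 have e21: "(wm x * (1 - M t x * N t x) - M t x * (0 - (M t x * wn x + wm x * N t x))) / (1 - M t x * N t x)^2 =
   ?X * g21 mu q r x * Ga x - ?T * G21 x * (gam mu q r x + 1)"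
 proof -
  have E: "wm x * d - A.m x * (0 - (A.m x * wn x + wm x * A.n x)) = (?X * A.m x * Ga x - ?T * G21 x * (2 - d)) * d"
   unfolding wm_def wn_def using mn by algebra
  show ?thesis unfolding dt unfolding Mt Nt diagt power2_eq_square nd[OF E] by (simp add: d algebra_simps diff_divide_distrib add_divide_distrib)
 qed
 show g21t: "((%tau. g21 mu (Q tau) (R tau) x) has_vector_derivative
      Xi mu kap * g21 mu q r x * (gam kap q r x + 1) - Theta mu kap * g21 kap q r x * (gam mu q r x + 1)) (at t)"
  using has_vector_derivative_cong_at[OF has_vector_derivative_divide_complex[OF dM dMN dtn] eventually_mono[OF ev diag(2)[symmetric]] diag(2)[OF assms(1), symmetric]]
  unfolding e21 unfolding Ga_def G21_def .
 have d2: "((%tau. 2 * M tau x * N tau x) hvd 2 * M t x * wn x + 2 * wm x * N t x) (at t)"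
  by (rule has_vector_derivative_mult[OF _ dN]) (rule has_vector_derivative_mult_right[OF dM])
 have eg: "((2 * M t x * wn x + 2 * wm x * N t x) * (1 - M t x * N t x) - 2 * M t x * N t x * (0 - (M t x * wn x + wm x * N t x))) / (1 - M t x * N t x)^2 =
   - 2 * ?T * (G12 x * g21 mu q r x - G21 x * g12 mu q r x)"
 proof -
  have E: "(2 * A.m x * wn x + 2 * wm x * A.n x) * d - 2 * A.m x * A.n x * (0 - (A.m x * wn x + wm x * A.n x)) = - 2 * ?T * (G12 x * A.m x + G21 x * A.n x) * d"
   unfolding wm_def wn_def using mn by algebra
  show ?thesis unfolding dt unfolding Mt Nt diagt power2_eq_square nd[OF E] by (simp add: d algebra_simps diff_divide_distrib add_divide_distrib)
 qed
 show gamt: "((%tau. gam mu (Q tau) (R tau) x) has_vector_derivative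
      - 2 * Theta mu kap * (g12 kap q r x * g21 mu q r x - g21 kap q r x * g12 mu q r x)) (at t)"
  using has_vector_derivative_cong_at[OF has_vector_derivative_divide_complex[OF d2 dMN dtn] eventually_mono[OF ev diag(3)[symmetric]] diag(3)[OF assms(1), symmetric]]
  unfolding eg unfolding G12_def G21_def .
 define D where "D = kap^2 - mu\<^sup>2"
 have D: "D ~= 0" "?T * D = mu * kap ^ 3" "?X * D = mu^2 * kap^2" using ne unfolding Theta_def Xi_def D_def by auto
 show "\<exists>a b. ((%tau. gamma_density mu (Q tau) (R tau) x) hvd a) (at t)
        \<and> ((%y. j_gamma mu kap q r y) hvd b) (at x) \<and> a + b = 0"
 proof (intro exI conjI)
  show "((%tau. gamma_density mu (Q tau) (R tau) x) has_vector_derivative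
    2 * \<i> * mu * (- 2 * ?T * (g12 kap q r x * g21 mu q r x - g21 kap q r x * g12 mu q r x)) -
    ((Q t x * (Xi mu kap * g21 mu q r x * (gam kap q r x + 1) - Theta mu kap * g21 kap q r x * (gam mu q r x + 1)) + (- kap * G12' x) * g21 mu (Q t) (R t) x)
    + (R t x * (- Xi mu kap * g12 mu q r x * (gam kap q r x + 1) + Theta mu kap * g12 kap q r x * (gam mu q r x + 1)) + (- kap * G21' x) * g12 mu (Q t) (R t) x))) (at t)"
   unfolding gamma_density_def
   by (rule has_vector_derivative_diff[OF has_vector_derivative_mult_right[OF gamt] has_vector_derivative_add[OF has_vector_derivative_mult[OF dQ g21t] has_vector_derivative_mult[OF dR g12t]]])
  note h = C1_bounded_has_derivative[OF A.green_C1(1), of x] C1_bounded_has_derivative[OF A.green_C1(2), of x] C1_bounded_has_derivative[OF A.green_C1(3), of x]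
  note k = C1_bounded_has_derivative[OF C12, unfolded G12_def, of x] C1_bounded_has_derivative[OF C21, unfolded G21_def, of x] C1_bounded_has_derivative[OF K.green_C1(3), of x]
  note h1 = has_vector_derivative_add[OF h(3) has_vector_derivative_const[of 1]] and k1 = has_vector_derivative_add[OF k(3) has_vector_derivative_const[of 1]]
  show "((%y. j_gamma mu kap q r y) has_vector_derivative
   - (kap ^ 3 * (kap^2 + mu^2) / (kap^2 - mu\<^sup>2)\<^sup>2) *
    ((g12 kap q r x * (2 * s * g21 mu q r x + mu * r x * (gam mu q r x + 1)) + G12' x * g21 mu q r x) +
    (g21 kap q r x * (- 2 * s * g12 mu q r x - mu * q x * (gam mu q r x + 1)) + G21' x * g12 mu q r x))
   - ((kap ^ 4 * mu / (kap^2 - mu\<^sup>2)\<^sup>2) * (gam kap q r x + 1) * (2 * (mu * q x * g21 mu q r x - mu * r x * g12 mu q r x) + 0) +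
    (kap ^ 4 * mu / (kap^2 - mu\<^sup>2)\<^sup>2) * (2 * (kap * q x * g21 kap q r x - kap * r x * g12 kap q r x) + 0) * (gam mu q r x + 1))) (at x)"
   unfolding j_gamma_def
   by (rule has_vector_derivative_diff[OF has_vector_derivative_mult_right[OF has_vector_derivative_add[OF has_vector_derivative_mult[OF k(1) h(2)] has_vector_derivative_mult[OF k(2) h(1)]]]
     has_vector_derivative_mult[OF has_vector_derivative_mult_right[OF k1] h1]])
  show "2 * \<i> * mu * (- 2 * ?T * (g12 kap q r x * g21 mu q r x - g21 kap q r x * g12 mu q r x)) -
    ((Q t x * (Xi mu kap * g21 mu q r x * (gam kap q r x + 1) - Theta mu kap * g21 kap q r x * (gam mu q r x + 1)) + (- kap * G12' x) * g21 mu (Q t) (R t) x)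
    + (R t x * (- Xi mu kap * g12 mu q r x * (gam kap q r x + 1) + Theta mu kap * g12 kap q r x * (gam mu q r x + 1)) + (- kap * G21' x) * g12 mu (Q t) (R t) x)) +
   (- (kap ^ 3 * (kap^2 + mu^2) / (kap^2 - mu\<^sup>2)\<^sup>2) *
    ((g12 kap q r x * (2 * s * g21 mu q r x + mu * r x * (gam mu q r x + 1)) + G12' x * g21 mu q r x) +
    (g21 kap q r x * (- 2 * s * g12 mu q r x - mu * q x * (gam mu q r x + 1)) + G21' x * g12 mu q r x))
   - ((kap ^ 4 * mu / (kap^2 - mu\<^sup>2)\<^sup>2) * (gam kap q r x + 1) * (2 * (mu * q x * g21 mu q r x - mu * r x * g12 mu q r x) + 0) +
    (kap ^ 4 * mu / (kap^2 - mu\<^sup>2)\<^sup>2) * (2 * (kap * q x * g21 kap q r x - kap * r x * g12 kap q r x) + 0) * (gam mu q r x + 1))) = 0"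
   unfolding q_def[symmetric] r_def[symmetric]
  proof (rule gamma_identity[OF D(2,3) D_def D(1)])
   show "kap ^ 3 * (kap^2 + mu^2) / (kap^2 - mu\<^sup>2)\<^sup>2 * D^2 = kap ^ 3 * (kap^2 + mu^2)" "kap ^ 4 * mu / (kap^2 - mu\<^sup>2)\<^sup>2 * D^2 = kap ^ 4 * mu"
    using D(1) unfolding D_def[symmetric] by simp_all
  qed (simp_all only: q_def[symmetric] r_def[symmetric] G12'_def G21'_def Ga_def G12_def G21_def s1 add_0_right)
 qed
 show "\<exists>a b. ((%tau. rho_density mu (Q tau) (R tau) x) hvd a) (at t)
        \<and> ((%y. j_A mu kap q r y) hvd b) (at x) \<and> a + b = 0"
 proof (intro exI conjI)
  have q2: "(- N tau y / e) / (2 + 2 * M tau y * N tau y / e) = - N tau y / 2" "(M tau y / e) / (2 + 2 * M tau y * N tau y / e) = M tau y / 2"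
   if "e = 1 - M tau y * N tau y" "e ~= 0" for tau y e
  proof -
   have mn: "M tau y * N tau y = 1 - e" using that by simp
   have "2 + 2 * M tau y * N tau y / e = 2 + 2 * (M tau y * N tau y) / e" by (simp add: mult.assoc)
   also have "... = 2 / e" unfolding mn using that(2) by (simp add: field_simps)
   finally have "2 + 2 * M tau y * N tau y / e = 2 / e" .
   then show "(- N tau y / e) / (2 + 2 * M tau y * N tau y / e) = - N tau y / 2" "(M tau y / e) / (2 + 2 * M tau y * N tau y / e) = M tau y / 2"
    using that(2) by simp_all
  qed
  have comb: "(a * b + c * e) / k = a * (b / k) + c * (e / k)" for a b c e k :: complex by (simp add: add_divide_distrib)
  have rho: "rho_density mu (Q tau) (R tau) x = - mu / 2 * (Q tau x * M tau x - R tau x * N tau x)" if "lax_potential mu s (Q tau) (R tau)" for tau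
   unfolding rho_density_def diag(1-3)[OF that] comb q2[OF refl diag(4)[OF that]] by (simp add: algebra_simps)
  have "((%tau. - mu / 2 * (Q tau x * M tau x - R tau x * N tau x)) hvd - mu / 2 * ((Q t x * wm x + (- kap * G12' x) * M t x) - (R t x * wn x + (- kap * G21' x) * N t x))) (at t)"
   by (rule has_vector_derivative_mult_right[OF has_vector_derivative_diff[OF has_vector_derivative_mult[OF dQ dM] has_vector_derivative_mult[OF dR dN]]])
  then show "((%tau. rho_density mu (Q tau) (R tau) x) hvd - mu / 2 * ((Q t x * wm x + (- kap * G12' x) * M t x) - (R t x * wn x + (- kap * G21' x) * N t x))) (at t)"
  proof (rule has_vector_derivative_cong_at)
   show "\<forall>\<^sub>F tau in at t. - mu / 2 * (Q tau x * M tau x - R tau x * N tau x) = rho_density mu (Q tau) (R tau) x"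
    using ev by (rule eventually_mono) (rule rho[symmetric])
   show "- mu / 2 * (Q t x * M t x - R t x * N t x) = rho_density mu (Q t) (R t) x" by (rule rho[OF assms(1), symmetric])
  qed
  have jA: "j_A mu kap q r y = - ?T / 2 * (G12 y * A.m y - A.n y * G21 y) - ?T * (mu / (2 * kap)) * gam kap q r y" for y
  proof -
   have h: "(- A.n y / (1 - A.m y * A.n y)) / (2 + 2 * A.m y * A.n y / (1 - A.m y * A.n y)) = - A.n y / 2" "(A.m y / (1 - A.m y * A.n y)) / (2 + 2 * A.m y * A.n y / (1 - A.m y * A.n y)) = A.m y / 2"
    using q2[OF refl, of t y] A.det_nz[of y] unfolding Mt Nt by auto
   have e: "(g12 kap q r y * g21 mu q r y + g12 mu q r y * g21 kap q r y) / (2 + gam mu q r y) = G12 y * (A.m y / 2) + G21 y * (- A.n y / 2)"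
    unfolding mult.commute[of "g12 mu q r y" "g21 kap q r y"]
    unfolding comb A.diagonal_green h G12_def G21_def ..
   show ?thesis unfolding j_A_def e by (simp add: algebra_simps)
  qed
  show "((%y. j_A mu kap q r y) hvd - ?T / 2 * ((G12 x * m' x + G12' x * A.m x) - (A.n x * G21' x + n' x * G21 x))
    - ?T * (mu / (2 * kap)) * (2 * (kap * q x * g21 kap q r x - kap * r x * g12 kap q r x))) (at x)"
   unfolding jA
   by (rule has_vector_derivative_diff[OF has_vector_derivative_mult_right[OF has_vector_derivative_diff[OF has_vector_derivative_mult has_vector_derivative_mult]] has_vector_derivative_mult_right];
    rule C1_bounded_has_derivative; rule C12 C21 Cm Cn K.green_C1)
  have k0: "kap ~= 0" using K.norm_kappa K.sigma by auto
  have gg: "?T * (mu / (2 * kap)) * (2 * (kap * q x * g21 kap q r x - kap * r x * g12 kap q r x)) = ?T * mu * (q x * G21 x - r x * G12 x)"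
   using k0 by (simp add: G12_def G21_def field_simps)
  have "- mu * ((- kap * G12' x) * A.m x + q x * wm x - ((- kap * G21' x) * A.n x + r x * wn x)) +
   (- ?T * ((G12' x * A.m x + G12 x * m' x) - (n' x * G21 x + A.n x * G21' x)) - ?T * mu * (2 * (q x * G21 x - r x * G12 x))) = 0"
   by (rule rho_identity[where u = "\<i>" and g = "Ga x", OF TX _ _ _ _ wm_def wn_def]) (simp_all only: G12'_def G21'_def m'_def n'_def s1)
  moreover have half: "- a / 2 * X + (- b / 2 * Y - b * a * Z) = (- a * X + (- b * Y - b * a * (2 * Z))) / 2" for a b X Y Z :: complex
   by (simp add: add_divide_distrib diff_divide_distrib)
  moreover have "(q x * wm x + (- kap * G12' x) * A.m x) - (r x * wn x + (- kap * G21' x) * A.n x) = (- kap * G12' x) * A.m x + q x * wm x - ((- kap * G21' x) * A.n x + r x * wn x)"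
   "(G12 x * m' x + G12' x * A.m x) - (A.n x * G21' x + n' x * G21 x) = (G12' x * A.m x + G12 x * m' x) - (n' x * G21 x + A.n x * G21' x)"
   by simp_all
  ultimately show "- mu / 2 * ((Q t x * wm x + (- kap * G12' x) * M t x) - (R t x * wn x + (- kap * G21' x) * N t x)) +
   (- ?T / 2 * ((G12 x * m' x + G12' x * A.m x) - (A.n x * G21' x + n' x * G21 x))
    - ?T * (mu / (2 * kap)) * (2 * (kap * q x * g21 kap q r x - kap * r x * g12 kap q r x))) = 0"
   unfolding gg Mt Nt q_def[symmetric] r_def[symmetric] half by (simp only: div_0)
 qed
qed

section \<open>The Hilbert space of square-integrable functions\<close>

abbreviation ip :: "(real => complex) => (real => complex) => complex" where
 "ip \<equiv> L2_inner"

lemma sq_integrable_cnj: "sqint f ==> sqint (%x. cnj (f x))"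
proof -
 assume f: "sqint f"
 have "cnj \<in> BM" by (intro borel_measurable_continuous_onI continuous_intros)
 from measurable_compose[OF sq_integrable_measurable[OF f] this] show ?thesis using f unfolding sqint_def by simp
qed

lemma ip_integrable: "sqint f ==> sqint g ==> L1 (%x. cnj (f x) * g x)"
 by (intro sq_integrable_mult sq_integrable_cnj)

lemma ip_add_right: "sqint f ==> sqint g ==> sqint h ==> ip f (%x. g x + h x) = ip f g + ip f h"
 unfolding L2_inner_def using ip_integrable[of f g] ip_integrable[of f h] by (simp add: distrib_left)

lemma ip_diff_right: "sqint f ==> sqint g ==> sqint h ==> ip f (%x. g x - h x) = ip f g - ip f h"
 unfolding L2_inner_def using ip_integrable[of f g] ip_integrable[of f h] by (simp add: right_diff_distrib)

lemma ip_cmult_right: "ip f (%x. k * g x) = k * ip f g"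
 unfolding L2_inner_def integral_mult_right_zero[symmetric] by (simp add: mult_ac)

lemma ip_cnj: "cnj (ip f g) = ip g f"
 unfolding L2_inner_def by (simp add: mult.commute flip: Bochner_Integration.integral_cnj)

lemma ip_self: "ip f f = of_real ((L2_norm f)^2)"
proof -
 have "ip f f = (LBINT x. of_real ((norm (f x))^2))"
  unfolding L2_inner_def by (rule int_cong) (auto simp: complex_norm_square mult.commute simp del: of_real_power)
 also have "... = of_real ((L2_norm f)^2)" unfolding L2_norm_def by (simp del: of_real_power)
 finally show ?thesis .
qed

lemma ip_bound: "sqint f ==> sqint g ==> norm (ip f g) <= L2_norm f * L2_norm g"
proof -
 assume "sqint f" "sqint g"
 then have "norm (LBINT x. cnj (f x) * g x) <= L2_norm (%x. cnj (f x)) * L2_norm g" by (intro norm_integral_mult_le sq_integrable_cnj)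
 moreover have "L2_norm (%x. cnj (f x)) = L2_norm f" by (simp add: L2_norm_def)
 ultimately show ?thesis by (simp add: L2_inner_def)
qed

lemma ip_cong_AE:
 assumes "AE x in lborel. f x = f' x" "AE x in lborel. g x = g' x" "sqint f" "sqint f'" "sqint g" "sqint g'"
 shows "ip f g = ip f' g'"
 unfolding L2_inner_def
proof (rule integral_cong_AE)
 show "AE x in lborel. cnj (f x) * g x = cnj (f' x) * g' x" using assms(1,2) by eventually_elim simp
qed (use ip_integrable[OF assms(3,5)] ip_integrable[OF assms(4,6)] in auto)

lemma L2_norm_cong_AE:
 assumes "AE x in lborel. f x = f' x" "sqint f" "sqint f'"
 shows "L2_norm f = L2_norm f'"
 unfolding L2_norm_def using assms by (intro arg_cong[where f = sqrt] integral_cong_AE) (auto simp: sqint_def)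

lemma L2_norm_zero_AE:
 assumes "sqint f" "L2_norm f = 0"
 shows "AE x in lborel. f x = 0"
proof -
 have "(LBINT x. (norm (f x))\<^sup>2) = 0" using assms(2) by (simp add: L2_norm_def)
 then have "AE x in lborel. (norm (f x))\<^sup>2 = 0"
  by (subst (asm) integral_nonneg_eq_0_iff_AE) (use assms in \<open>auto simp: sqint_def\<close>)
 then show ?thesis by eventually_elim simp
qed

lemma L2_norm_minus: "L2_norm (%x. f x - g x) = L2_norm (%x. g x - f x)"
 unfolding L2_norm_def by (simp add: norm_minus_commute)

lemma L2_norm_cmult:
 fixes k :: complex
 shows "L2_norm (%x. k * f x) = norm k * L2_norm f"
 unfolding L2_norm_def by (simp add: norm_mult power_mult_distrib real_sqrt_mult)

text \<open>A subsequence whose increments decay like $4^{-k}$ converges almost everywhere, and the limit in norm follows from the lemma of Fatou.\<close>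

lemma L2_complete:
 fixes f :: "nat => real => complex"
 assumes f: "!!n. sqint (f n)" and cauchy: "!!e. e > 0 ==> \<exists>N. \<forall>m\<ge>N. \<forall>n\<ge>N. L2_norm (%x. f m x - f n x) <= e"
 shows "\<exists>g. sqint g \<and> (%n. L2_norm (%x. f n x - g x)) -->> 0"
proof -
 have [measurable]: "f n \<in> BM" for n using f by (simp add: sqint_def)
 obtain N where N: "!!k m n. m \<ge> N k ==> n \<ge> N k ==> L2_norm (%x. f m x - f n x) <= (1/4) ^ k"
  using cauchy[of "(1/4) ^ k" for k] by (metis zero_less_divide_1_iff zero_less_numeral zero_less_power)
 define s where "s k = Max (N ` {..k})" for k
 have s1: "s k \<ge> N k" for k unfolding s_def by (rule Max_ge) auto
 have s2: "s k <= s (Suc k)" for k unfolding s_def by (rule Max_mono) auto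
 have s3: "k <= l ==> s k <= s l" for k l by (rule lift_Suc_mono_le[of s]) (rule s2)
 have sd: "sqint (%x. f m x - f n x)" for m n by (intro sq_integrable_diff f)
 have i: "(\<integral>\<^sup>+x. ennreal ((norm (f m x - f n x))^2) \<partial>lborel) = ennreal ((L2_norm (%x. f m x - f n x))^2)" for m n
  using sd[of m n] unfolding sqint_def L2_norm_def by (subst nn_integral_eq_integral) auto
 let ?d = "%k x. 4 ^ k * (norm (f (s (Suc k)) x - f (s k) x))^2"
 have "(\<integral>\<^sup>+x. (\<Sum>k. ennreal (?d k x)) \<partial>lborel) = (\<Sum>k. \<integral>\<^sup>+x. ennreal (?d k x) \<partial>lborel)"
  by (rule nn_integral_suminf) auto
 also have "... <= (\<Sum>k. ennreal ((1/4) ^ k))"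
 proof (rule suminf_le)
  fix k
  have "(\<integral>\<^sup>+x. ennreal (?d k x) \<partial>lborel) = ennreal (4 ^ k) * (\<integral>\<^sup>+x. ennreal ((norm (f (s (Suc k)) x - f (s k) x))^2) \<partial>lborel)"
   by (subst nn_integral_cmult[symmetric]) (auto simp: ennreal_mult)
  also have "... = ennreal (4 ^ k * (L2_norm (%x. f (s (Suc k)) x - f (s k) x))^2)"
   unfolding i by (simp add: ennreal_mult)
  also have "... <= ennreal (4 ^ k * ((1/4) ^ k)^2)"
   by (intro ennreal_leI mult_left_mono power_mono N order_trans[OF s1 s2] s1) auto
  also have "4 ^ k * ((1/4) ^ k)^2 = ((1/4) ^ k :: real)" by (simp add: power2_eq_square power_divide)
  finally show "(\<integral>\<^sup>+x. ennreal (?d k x) \<partial>lborel) <= ennreal ((1/4) ^ k)" .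
 qed auto
 also have "... = ennreal (\<Sum>k. (1/4) ^ k)" by (rule suminf_ennreal2) (auto intro: summable_geometric)
 also have "... < \<infinity>" by simp
 finally have fin: "(\<integral>\<^sup>+x. (\<Sum>k. ennreal (?d k x)) \<partial>lborel) ~= \<infinity>" by simp
 have ae: "AE x in lborel. convergent (%k. f (s k) x)"
 proof -
  have "AE x in lborel. (\<Sum>k. ennreal (?d k x)) ~= \<infinity>" by (rule nn_integral_PInf_AE[OF _ fin]) measurable
  then show ?thesis
 proof eventually_elim
  case (elim x)
  have "summable (%k. ?d k x)"
   by (rule summable_suminf_not_top) (use elim in auto)
  then have "(%k. ?d k x) -->> 0" by (rule summable_LIMSEQ_zero)
  then have "Bseq (%k. ?d k x)" by (intro convergent_imp_Bseq convergentI)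
  then obtain C where C: "C > 0" "!!k. norm (?d k x) <= C" unfolding Bseq_def by blast
  have "norm (f (s (Suc k)) x - f (s k) x) <= sqrt C * (1/2) ^ k" for k
  proof -
   have "(2 ^ k * norm (f (s (Suc k)) x - f (s k) x))^2 <= C"
   proof -
    have "((2::real) ^ k)^2 = 4 ^ k" by (simp add: power2_eq_square flip: power_mult_distrib)
    then show ?thesis using C(2)[of k] by (simp add: power_mult_distrib)
   qed
   then have "2 ^ k * norm (f (s (Suc k)) x - f (s k) x) <= sqrt C" by (rule real_le_rsqrt)
   then show ?thesis by (simp add: field_simps power_divide)
  qed
  then have "summable (%k. f (s (Suc k)) x - f (s k) x)"
   by (intro summable_comparison_test'[OF summable_mult[OF summable_geometric], of "1/2" 0 _ "sqrt C"]) simp_all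
  then have "convergent (%n. \<Sum>k<n. f (s (Suc k)) x - f (s k) x)" by (simp only: summable_iff_convergent)
  then have "convergent (%n. f (s n) x - f (s 0) x)" by (simp only: sum_lessThan_telescope[of "%k. f (s k) x"])
  then obtain l where "(%n. f (s n) x - f (s 0) x) -->> l" by (auto simp: convergent_def)
  from tendsto_add[OF this tendsto_const[of "f (s 0) x"]] show ?case by (auto simp: convergent_def)
 qed
 qed
 define g where "g x = lim (%k. f (s k) x)" for x
 have gm[measurable]: "g \<in> BM" unfolding g_def by measurable
 have gl: "AE x in lborel. (%k. f (s k) x) -->> g x" using ae unfolding g_def by eventually_elim (simp add: convergent_LIMSEQ_iff)
 have est: "(\<integral>\<^sup>+x. ennreal ((norm (f n x - g x))^2) \<partial>lborel) <= ennreal (((1/4) ^ k)^2)" if n: "n \<ge> N k" for n k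
 proof -
  have "(\<integral>\<^sup>+x. ennreal ((norm (f n x - g x))^2) \<partial>lborel) <= (\<integral>\<^sup>+x. liminf (%l. ennreal ((norm (f n x - f (s l) x))^2)) \<partial>lborel)"
  proof (rule nn_integral_mono_AE)
   show "AE x in lborel. ennreal ((norm (f n x - g x))^2) <= liminf (%l. ennreal ((norm (f n x - f (s l) x))^2))"
    using gl
   proof eventually_elim
    case (elim x)
    have "(%l. ennreal ((norm (f n x - f (s l) x))^2)) -->> ennreal ((norm (f n x - g x))^2)"
     by (intro tendsto_ennrealI tendsto_intros elim)
    then have "liminf (%l. ennreal ((norm (f n x - f (s l) x))^2)) = ennreal ((norm (f n x - g x))^2)"
     by (rule lim_imp_Liminf[rotated]) simp
    then show ?case by simp
   qed
  qed
  also have "... <= liminf (%l. \<integral>\<^sup>+x. ennreal ((norm (f n x - f (s l) x))^2) \<partial>lborel)" by (rule nn_integral_liminf) auto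
  also have "... <= ennreal (((1/4) ^ k)^2)"
  proof (rule Liminf_le)
   show "\<forall>\<^sub>F l in sequentially. (\<integral>\<^sup>+x. ennreal ((norm (f n x - f (s l) x))^2) \<partial>lborel) <= ennreal (((1/4) ^ k)^2)"
    using eventually_ge_at_top[of k]
   proof eventually_elim
    case (elim l)
    have "s l \<ge> N k" using order_trans[OF s1 s3[OF elim]] .
    then show ?case unfolding i using N[OF n] by (intro ennreal_leI power_mono) auto
   qed
  qed simp
  finally show ?thesis .
 qed
 have sg: "sqint (%x. f n x - g x)" "L2_norm (%x. f n x - g x) <= (1/4) ^ k" if n: "n \<ge> N k" for n k
 proof -
  have "(\<integral>\<^sup>+x. ennreal ((norm (f n x - g x))^2) \<partial>lborel) < \<infinity>" using est[OF n] by (simp add: order_le_less_trans)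
  then show s: "sqint (%x. f n x - g x)" unfolding sqint_def by (auto intro!: integrableI_nonneg)
  have "ennreal (LBINT x. (norm (f n x - g x))\<^sup>2) = (\<integral>\<^sup>+x. ennreal ((norm (f n x - g x))^2) \<partial>lborel)"
   using s unfolding sqint_def by (intro nn_integral_eq_integral[symmetric]) auto
  then have "ennreal (LBINT x. (norm (f n x - g x))\<^sup>2) <= ennreal (((1/4) ^ k)^2)" using est[OF n] by metis
  then have "(LBINT x. (norm (f n x - g x))\<^sup>2) <= ((1/4) ^ k)^2" by (subst (asm) ennreal_le_iff) auto
  then show "L2_norm (%x. f n x - g x) <= (1/4) ^ k" unfolding L2_norm_def by (intro real_le_lsqrt) auto
 qed
 have "sqint g" using sq_integrable_diff[OF f[of "N 0"] sg(1)[of 0 "N 0"]] by simp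
 moreover have "(%n. L2_norm (%x. f n x - g x)) -->> 0"
 proof (rule LIMSEQ_I)
  fix e :: real assume "e > 0"
  then obtain k where k: "(1/4) ^ k < e" using real_arch_pow_inv[of e "1/4"] by auto
  show "\<exists>no. \<forall>n\<ge>no. norm (L2_norm (%x. f n x - g x) - 0) < e"
   using sg(2)[of k] k by (intro exI[of _ "N k"]) force
 qed
 ultimately show ?thesis by blast
qed

lemma ip_tendsto:
 assumes e: "sqint e" and f: "!!n. sqint (f n)" and g: "sqint g" and lim: "(%n. L2_norm (%x. f n x - g x)) -->> 0"
 shows "(%n. ip e (f n)) -->> ip e g"
proof -
 have "(%n. L2_norm e * L2_norm (%x. f n x - g x)) -->> 0" using tendsto_mult_left[OF lim, of "L2_norm e"] by simp
 then have "(%n. ip e (f n) - ip e g) -->> 0"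
 proof (rule Lim_null_comparison[rotated])
  show "\<forall>\<^sub>F n in sequentially. norm (ip e (f n) - ip e g) <= L2_norm e * L2_norm (%x. f n x - g x)"
   using ip_bound[OF e sq_integrable_diff[OF f g]] by (simp add: ip_diff_right[OF e f g])
 qed
 then show ?thesis by (simp add: LIM_zero_iff)
qed

lemma sq_integrable_zero: "sqint (%_. 0)" unfolding sqint_def by simp

lemma sq_integrable_sum: "(!!i. i \<in> I ==> sqint (f i)) ==> sqint (%x. \<Sum>i\<in>I. f i x)"
 by (induction I rule: infinite_finite_induct) (auto intro: sq_integrable_zero sq_integrable_add)

lemma ip_zero_right: "ip f (%_. 0) = 0" unfolding L2_inner_def by simp

lemma ip_sum_right: "sqint g ==> (!!i. i \<in> I ==> sqint (f i)) ==> ip g (%x. \<Sum>i\<in>I. f i x) = (\<Sum>i\<in>I. ip g (f i))"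
proof (induction I rule: infinite_finite_induct)
 case (insert i I)
 then show ?case by (simp add: ip_add_right sq_integrable_sum)
qed (simp_all add: ip_zero_right)

lemma mult_self_le_imp_le: "a * a <= b * a ==> 0 <= a ==> 0 <= b ==> a <= (b :: real)"
 by (cases "a = 0") (simp_all add: mult_le_cancel_right)

lemma L2_basis_sq: "L2_basis e ==> sqint (e n)"
 unfolding L2_basis_def L2_complex_iff[symmetric] by blast

definition pexpand :: "(nat => real => complex) => (real => complex) => nat => real => complex" where
 "pexpand e f N x = (\<Sum>n<N. ip (e n) f * e n x)"

lemma pexpand_sq: "L2_basis e ==> sqint (pexpand e f N)"
 unfolding pexpand_def[abs_def] by (intro sq_integrable_sum sq_integrable_cmult L2_basis_sq)

lemma ip_pexpand:
 assumes e: "L2_basis e" and f: "sqint f"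
 shows "ip (e n) (pexpand e f N) = (if n < N then ip (e n) f else 0)"
proof -
 have o: "ip (e m) (e n) = (if m = n then 1 else 0)" for m n using e by (simp add: L2_basis_def)
 have "ip (e n) (pexpand e f N) = (\<Sum>k<N. ip (e k) f * ip (e n) (e k))"
  unfolding pexpand_def[abs_def]
  by (subst ip_sum_right) (auto intro!: sq_integrable_cmult L2_basis_sq[OF e] simp: ip_cmult_right)
 also have "... = (\<Sum>k<N. if k = n then ip (e n) f else 0)" by (rule sum.cong) (auto simp: o)
 also have "... = (if n < N then ip (e n) f else 0)" by (simp add: sum.delta)
 finally show ?thesis .
qed

lemma pexpand_orth:
 assumes e: "L2_basis e" and f: "sqint f" and "M <= N"
 shows "(L2_norm (%x. pexpand e f N x - pexpand e f M x))^2 = (\<Sum>n\<in>{M..<N}. (norm (ip (e n) f))\<^sup>2)"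
proof -
 let ?g = "%x. \<Sum>n\<in>{M..<N}. ip (e n) f * e n x"
 have g: "(%x. pexpand e f N x - pexpand e f M x) = ?g"
  unfolding pexpand_def using assms(3) by (auto simp: sum_diff[symmetric] lessThan_minus_lessThan fun_eq_iff)
 have sg: "sqint ?g" by (intro sq_integrable_sum sq_integrable_cmult L2_basis_sq e)
 have ig: "ip (e n) ?g = ip (e n) f" if "n \<in> {M..<N}" for n
  unfolding g[symmetric] using that ip_pexpand[OF e f]
  by (subst ip_diff_right) (auto intro: L2_basis_sq e pexpand_sq)
 have "of_real ((L2_norm ?g)^2) = ip ?g ?g" by (rule ip_self[symmetric])
 also have "... = (\<Sum>n\<in>{M..<N}. ip (e n) f * ip ?g (e n))"
  by (subst ip_sum_right[OF sg, of "{M..<N}" "%n x. ip (e n) f * e n x"]) (auto intro!: sq_integrable_cmult L2_basis_sq[OF e] simp: ip_cmult_right)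
 also have "... = (\<Sum>n\<in>{M..<N}. of_real ((norm (ip (e n) f))^2))"
 proof (rule sum.cong[OF refl])
  fix n assume "n \<in> {M..<N}"
  then have "ip ?g (e n) = cnj (ip (e n) f)" using ig ip_cnj[of "e n" ?g] by simp
  then show "ip (e n) f * ip ?g (e n) = of_real ((norm (ip (e n) f))^2)" by (simp add: complex_norm_square del: of_real_power)
 qed
 also have "... = of_real (\<Sum>n\<in>{M..<N}. (norm (ip (e n) f))\<^sup>2)" by simp
 finally show ?thesis unfolding g of_real_eq_iff .
qed

lemma Bessel:
 assumes e: "L2_basis e" and f: "sqint f"
 shows "(\<Sum>n<N. (norm (ip (e n) f))\<^sup>2) <= (L2_norm f)^2" and "L2_norm (pexpand e f N) <= L2_norm f"
proof -
 let ?s = "pexpand e f N"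
 have s: "sqint ?s" by (rule pexpand_sq[OF e])
 have ns: "(L2_norm ?s)^2 = (\<Sum>n<N. (norm (ip (e n) f))\<^sup>2)"
  using pexpand_orth[OF e f, of 0 N] by (simp add: pexpand_def[abs_def] lessThan_atLeast0)
 have fs: "ip f ?s = of_real ((L2_norm ?s)^2)"
 proof -
  have "ip f ?s = (\<Sum>n<N. ip (e n) f * ip f (e n))" unfolding pexpand_def[abs_def]
   by (subst ip_sum_right[OF f]) (auto intro!: sq_integrable_cmult L2_basis_sq[OF e] simp: ip_cmult_right)
  also have "... = (\<Sum>n<N. of_real ((norm (ip (e n) f))^2))"
   by (rule sum.cong[OF refl]) (simp add: complex_norm_square flip: ip_cnj[of "e _" f] del: of_real_power)
  finally show ?thesis by (simp add: ns)
 qed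
 have "norm (ip f ?s) <= L2_norm f * L2_norm ?s" by (rule ip_bound[OF f s])
 then have "L2_norm ?s * L2_norm ?s <= L2_norm f * L2_norm ?s" unfolding fs norm_of_real by (simp add: power2_eq_square)
 then show le: "L2_norm ?s <= L2_norm f" by (rule mult_self_le_imp_le) simp_all
 show "(\<Sum>n<N. (norm (ip (e n) f))\<^sup>2) <= (L2_norm f)^2" unfolding ns[symmetric] by (rule power_mono[OF le]) simp
qed

lemma basis_expansion:
 assumes e: "L2_basis e" and f: "sqint f"
 shows "(%N. L2_norm (%x. pexpand e f N x - f x)) -->> 0"
proof -
 let ?s = "pexpand e f"
 have s: "sqint (?s N)" for N by (rule pexpand_sq[OF e])
 have sm: "summable (%n. (norm (ip (e n) f))\<^sup>2)"
  by (rule summableI_nonneg_bounded[where x = "(L2_norm f)^2"]) (use Bessel(1)[OF e f] in auto)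
 have "\<exists>g. sqint g \<and> (%n. L2_norm (%x. ?s n x - g x)) -->> 0"
 proof (rule L2_complete[OF s])
  fix \<epsilon> :: real assume "\<epsilon> > 0"
  then have "\<epsilon>\<^sup>2 > 0" by simp
  then obtain N where N: "!!m n. m \<ge> N ==> norm (\<Sum>i\<in>{m..<n}. (norm (ip (e i) f))\<^sup>2) < \<epsilon>\<^sup>2" using sm unfolding summable_Cauchy by blast
  have le: "L2_norm (%x. ?s n x - ?s m x) <= \<epsilon>" if "N <= m" "m <= n" for m n
  proof (rule power2_le_imp_le)
   show "(L2_norm (%x. ?s n x - ?s m x))^2 <= \<epsilon>\<^sup>2" unfolding pexpand_orth[OF e f that(2)]
    using N[OF that(1), of n] by (simp add: sum_nonneg)
  qed (use \<open>\<epsilon> > 0\<close> in simp)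
  have "L2_norm (%x. ?s m x - ?s n x) <= \<epsilon>" if "m \<ge> N" "n \<ge> N" for m n
   using le[of m n] le[of n m] that L2_norm_minus[of "?s m" "?s n"] by (cases "m <= n") auto
  then show "\<exists>N. \<forall>m\<ge>N. \<forall>n\<ge>N. L2_norm (%x. ?s m x - ?s n x) <= \<epsilon>" by blast
 qed
 then obtain g where g: "sqint g" "(%n. L2_norm (%x. ?s n x - g x)) -->> 0" by blast
 have "ip (e n) (%x. g x - f x) = 0" for n
 proof -
  have "(%N. ip (e n) (?s N)) -->> ip (e n) g" by (rule ip_tendsto[OF L2_basis_sq[OF e] s g])
  moreover have "(%N. ip (e n) (?s N)) -->> ip (e n) f"
  proof (rule tendsto_eventually)
   show "\<forall>\<^sub>F N in sequentially. ip (e n) (?s N) = ip (e n) f"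
    using eventually_gt_at_top[of n] by (rule eventually_mono) (simp add: ip_pexpand[OF e f])
  qed
  ultimately have "ip (e n) g = ip (e n) f" by (rule LIMSEQ_unique)
  then show ?thesis unfolding ip_diff_right[OF L2_basis_sq[OF e] g(1) f] by simp
 qed
 moreover have gf: "sqint (%x. g x - f x)" by (rule sq_integrable_diff[OF g(1) f])
 ultimately have "AE x in lborel. g x - f x = 0" using e[unfolded L2_basis_def, THEN conjunct2, THEN conjunct2, rule_format, of "%x. g x - f x"] by (simp add: L2_complex_iff)
 then have ae: "AE x in lborel. ?s N x - g x = ?s N x - f x" for N by (rule eventually_mono) simp
 have "L2_norm (%x. ?s N x - g x) = L2_norm (%x. ?s N x - f x)" for N
  by (rule L2_norm_cong_AE[OF ae]) (intro sq_integrable_diff s g f)+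
 then show ?thesis using g(2) by presburger
qed

definition orthonormal :: "(real => complex) set => bool" where
 "orthonormal E \<longleftrightarrow> (\<forall>f\<in>E. sqint f) \<and> (\<forall>f\<in>E. \<forall>g\<in>E. ip f g = (if f = g then 1 else 0))"

lemma orthonormal_Bessel:
 assumes E: "orthonormal E" and f: "sqint f" and F: "finite F" "F \<subseteq> E"
 shows "(\<Sum>e\<in>F. (norm (ip e f))\<^sup>2) <= (L2_norm f)^2"
proof -
 let ?g = "%x. \<Sum>e\<in>F. ip e f * e x"
 have eF: "sqint e" if "e \<in> F" for e using that E F unfolding orthonormal_def by blast
 have g: "sqint ?g" by (intro sq_integrable_sum sq_integrable_cmult eF)
 have eg: "ip e ?g = ip e f" if "e \<in> F" for e
 proof -
  have "ip e ?g = (\<Sum>k\<in>F. ip k f * ip e k)" by (subst ip_sum_right) (auto intro!: sq_integrable_cmult[OF eF] eF[OF that] simp: ip_cmult_right)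
  also have "... = (\<Sum>k\<in>F. if k = e then ip e f else 0)"
   using E F that unfolding orthonormal_def by (intro sum.cong) (auto simp: subset_eq)
  finally show ?thesis using F that by (simp add: sum.delta)
 qed
 define S where "S = (\<Sum>e\<in>F. (norm (ip e f))\<^sup>2)"
 have fg: "ip h ?g = of_real S" if "sqint h" "!!e. e \<in> F ==> ip e h = ip e f" for h
 proof -
  have "ip h ?g = (\<Sum>e\<in>F. ip e f * ip h e)" by (subst ip_sum_right[OF that(1)]) (auto intro!: sq_integrable_cmult[OF eF] simp: ip_cmult_right)
  also have "... = (\<Sum>e\<in>F. of_real ((norm (ip e f))^2))"
   by (rule sum.cong[OF refl]) (simp add: complex_norm_square that(2) flip: ip_cnj[of _ h] del: of_real_power)
  finally show ?thesis by (simp add: S_def)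
 qed
 have gg: "(L2_norm ?g)^2 = S" using fg[OF g eg] unfolding ip_self of_real_eq_iff .
 have S0: "S \<ge> 0" unfolding S_def by (intro sum_nonneg) simp
 have "norm (ip f ?g) <= L2_norm f * L2_norm ?g" by (rule ip_bound[OF f g])
 then have "L2_norm ?g * L2_norm ?g <= L2_norm f * L2_norm ?g" unfolding fg[OF f refl] norm_of_real gg[symmetric] by (simp add: power2_eq_square)
 then have le: "L2_norm ?g <= L2_norm f" by (rule mult_self_le_imp_le) simp_all
 show ?thesis unfolding S_def[symmetric] gg[symmetric] by (rule power_mono[OF le]) simp
qed

lemma orthonormal_countable_support:
 assumes E: "orthonormal E" and f: "sqint f"
 shows "countable {e\<in>E. ip e f ~= 0}"
proof -
 have "finite {e\<in>E. (norm (ip e f))\<^sup>2 > 1 / real (Suc n)}" for n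
 proof (rule ccontr)
  assume inf: "infinite {e\<in>E. (norm (ip e f))\<^sup>2 > 1 / real (Suc n)}"
  obtain k :: nat where k: "(L2_norm f)^2 * real (Suc n) < real k" using reals_Archimedean2 by blast
  obtain F where F: "finite F" "card F = k" "F \<subseteq> {e\<in>E. (norm (ip e f))\<^sup>2 > 1 / real (Suc n)}" using infinite_arbitrarily_large[OF inf] by blast
  have "real k * (1 / real (Suc n)) = (\<Sum>e\<in>F. 1 / real (Suc n))" using F by simp
  also have "... <= (\<Sum>e\<in>F. (norm (ip e f))\<^sup>2)" using F(3) by (intro sum_mono) auto
  also have "... <= (L2_norm f)^2" using F by (intro orthonormal_Bessel[OF E f]) auto
  finally show False using k by (simp add: field_simps)
 qed
 then have "countable (\<Union>n. {e\<in>E. (norm (ip e f))\<^sup>2 > 1 / real (Suc n)})" by (intro countable_UN) (auto intro: countable_finite)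
 moreover have "{e\<in>E. ip e f ~= 0} \<subseteq> (\<Union>n. {e\<in>E. (norm (ip e f))\<^sup>2 > 1 / real (Suc n)})"
 proof clarsimp
  fix e assume "e \<in> E" "ip e f ~= 0"
  then have "0 < (norm (ip e f))\<^sup>2" by simp
  then show "\<exists>n. 1 / (1 + real n) < (norm (ip e f))\<^sup>2" using reals_Archimedean[of "(norm (ip e f))^2"] by (auto simp: inverse_eq_divide)
 qed
 ultimately show ?thesis by (rule countable_subset[rotated])
qed

definition box_fun :: "real => real => real => complex" where
 "box_fun a b x = indicator {a..b} x"

lemma box_sq: "sqint (box_fun a b)"
proof -
 have "L1 (%y. indicator {a..b} y :: real)"
  by (intro integrable_real_indicator) (auto simp: emeasure_lborel_Icc_eq)
 moreover have "(norm (box_fun a b x))^2 = indicator {a..b} x" for x by (simp add: box_fun_def indicator_def)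
 moreover have "box_fun a b \<in> BM" unfolding box_fun_def[abs_def] by measurable
 ultimately show ?thesis unfolding sqint_def by simp
qed

lemma boxes_total:
 assumes h: "sqint h" and z: "!!N b. b \<in> \<rat> ==> ip h (box_fun (- real N) b) = 0"
 shows "AE x in lborel. h x = 0"
proof -
 have "AE x in lborel. box_fun (- real N) (real N) x * h x = 0" for N
 proof (rule integral_rational_halflines_zero)
  show "L1 (%x. box_fun (- real N) (real N) x * h x)" by (rule sq_integrable_mult[OF box_sq h])
  fix a :: real assume a: "a \<in> \<rat>"
  have m: "min a (real N) \<in> \<rat>" using a by (simp add: min_def)
  have "indicator {..a} x *\<^sub>R (box_fun (- real N) (real N) x * h x) = cnj (cnj (h x) * box_fun (- real N) (min a (real N)) x)" for x
   by (auto simp: box_fun_def indicator_def)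
  then have "(LBINT x. indicator {..a} x *\<^sub>R (box_fun (- real N) (real N) x * h x)) = cnj (ip h (box_fun (- real N) (min a (real N))))"
   unfolding L2_inner_def by (simp only: Bochner_Integration.integral_cnj[symmetric])
  then show "(LBINT x. indicator {..a} x *\<^sub>R (box_fun (- real N) (real N) x * h x)) = 0" using z[OF m] by simp
 qed
 then have "AE x in lborel. \<forall>N. box_fun (- real N) (real N) x * h x = 0" by (subst AE_all_countable) blast
 then show ?thesis
 proof eventually_elim
  case (elim x)
  obtain N where "\<bar>x\<bar> <= real N" using real_arch_simple by blast
  then have "box_fun (- real N) (real N) x = 1" by (auto simp: box_fun_def indicator_def abs_le_iff)
  then show ?case using elim[rule_format, of N] by simp
 qed
qed

lemma unit_boxes_orthonormal: "orthonormal (range (%n::nat. box_fun (3 * real n) (3 * real n + 1)))" and unit_boxes_inj: "inj (%n::nat. box_fun (3 * real n) (3 * real n + 1))"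
proof -
 have ip: "ip (box_fun (3 * real m) (3 * real m + 1)) (box_fun (3 * real n) (3 * real n + 1)) = (if m = n then 1 else 0)" for m n
 proof (cases "m = n")
  case True
  have "cnj (box_fun a (a + 1) x) * box_fun a (a + 1) x = of_real (indicator {a..a + 1} x)" for a x by (simp add: box_fun_def indicator_def)
  then show ?thesis using True unfolding L2_inner_def by simp
 next
  case False
  have z: "cnj (box_fun (3 * real m) (3 * real m + 1) x) * box_fun (3 * real n) (3 * real n + 1) x = 0" for x
  proof (rule ccontr)
   assume "cnj (box_fun (3 * real m) (3 * real m + 1) x) * box_fun (3 * real n) (3 * real n + 1) x ~= 0"
   then have "3 * real m <= x" "x <= 3 * real m + 1" "3 * real n <= x" "x <= 3 * real n + 1" by (auto simp: box_fun_def indicator_def split: if_splits)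
   then show False using False by linarith
  qed
  show ?thesis unfolding L2_inner_def z using False by simp
 qed
 then show inj: "inj (%n::nat. box_fun (3 * real n) (3 * real n + 1))" by (intro injI) (metis zero_neq_one)
 show "orthonormal (range (%n::nat. box_fun (3 * real n) (3 * real n + 1)))"
  unfolding orthonormal_def using box_sq ip inj by (auto simp: inj_eq[OF inj])
qed

text \<open>A maximal orthonormal set is total. It is countable because every indicator of a rational box has only countably many nonzero coefficients, and these functions are total; it is infinite since a maximal set can be chosen to contain the disjoint unit boxes.\<close>

lemma L2_basis_exists: "\<exists>e. L2_basis e"
proof -
 let ?E0 = "range (%n::nat. box_fun (3 * real n) (3 * real n + 1))"
 let ?A = "{E. orthonormal E \<and> ?E0 \<subseteq> E}"
 have "\<exists>M\<in>?A. \<forall>X\<in>?A. M \<subseteq> X --> X = M"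
 proof (rule subset_Zorn_nonempty)
  show "?A ~= {}" using unit_boxes_orthonormal by blast
  fix C assume C: "C ~= {}" "subset.chain ?A C"
  have CA: "X \<in> ?A" if "X \<in> C" for X using C(2) that unfolding subset.chain_def by blast
  have "orthonormal (\<Union>C)" unfolding orthonormal_def
  proof (intro conjI ballI)
   fix f assume "f \<in> \<Union>C"
   then show "sqint f" using CA unfolding orthonormal_def by blast
  next
   fix f g assume "f \<in> \<Union>C" "g \<in> \<Union>C"
   then obtain X Y where XY: "X \<in> C" "Y \<in> C" "f \<in> X" "g \<in> Y" by blast
   then have "X \<subseteq> Y \<or> Y \<subseteq> X" using C(2) unfolding subset.chain_def by blast
   then obtain Z where "Z \<in> C" "f \<in> Z" "g \<in> Z" using XY by blast
   then show "ip f g = (if f = g then 1 else 0)" using CA[of Z] unfolding orthonormal_def by blast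
  qed
  then show "\<Union>C \<in> ?A" using C(1) CA by blast
 qed
 then obtain E where EA: "E \<in> ?A" and mx: "\<forall>X\<in>?A. E \<subseteq> X --> X = E" by (rule bexE)
 have E: "orthonormal E" "?E0 \<subseteq> E" using EA by simp_all
 have max: "X = E" if "orthonormal X" "E \<subseteq> X" for X
  using mx[rule_format, of X] that order_trans[OF E(2) that(2)] by simp
 have total: "AE x in lborel. f x = 0" if f: "sqint f" and o: "!!e. e \<in> E ==> ip e f = 0" for f
 proof (rule L2_norm_zero_AE[OF f], rule ccontr)
  assume nz: "L2_norm f ~= 0"
  let ?f = "%x. of_real (1 / L2_norm f) * f x"
  have sf: "sqint ?f" by (rule sq_integrable_cmult[OF f])
  have o1: "ip e ?f = 0" if "e \<in> E" for e using o[OF that] by (simp only: ip_cmult_right) simp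
  have o2: "ip ?f e = 0" if "e \<in> E" for e using o1[OF that] ip_cnj[of e ?f] by simp
  have "L2_norm ?f = 1" unfolding L2_norm_cmult norm_of_real using nz by (simp add: L2_norm_def)
  then have n1: "ip ?f ?f = 1" unfolding ip_self by simp
  have "orthonormal (insert ?f E)"
   unfolding orthonormal_def
  proof (intro conjI ballI)
   fix g assume "g \<in> insert ?f E"
   then show "sqint g" using sf E(1) unfolding orthonormal_def by blast
  next
   fix g h assume gh: "g \<in> insert ?f E" "h \<in> insert ?f E"
   have nE: "?f \<notin> E" using o1[of ?f] n1 by auto
   show "ip g h = (if g = h then 1 else 0)"
   proof (cases "g = ?f")
    case True
    show ?thesis
    proof (cases "h = ?f")
     case True
     show ?thesis unfolding \<open>g = ?f\<close> \<open>h = ?f\<close> n1 by simp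
    next
     case False
     then have "h \<in> E" using gh by blast
     then have "ip ?f h = 0" "h ~= ?f" using o2 False by auto
     then show ?thesis unfolding \<open>g = ?f\<close> by auto
    qed
   next
    case False
    then have g: "g \<in> E" using gh by blast
    show ?thesis
    proof (cases "h = ?f")
     case True
     show ?thesis using o1[OF g] False unfolding True by auto
    next
     case False
     then have "h \<in> E" using gh by blast
     then show ?thesis using g E(1) unfolding orthonormal_def by blast
    qed
   qed
  qed
  then have "?f \<in> E" using max[of "insert ?f E"] by blast
  then show False using o1[of ?f] n1 by simp
 qed
 have "countable E"
 proof -
  have "E \<subseteq> (\<Union>(N, b)\<in>UNIV \<times> \<rat>. {e\<in>E. ip e (box_fun (- real N) b) ~= 0})"
  proof
   fix e assume e: "e \<in> E"
   have se: "sqint e" using e E(1) unfolding orthonormal_def by blast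
   have "ip e e = 1" using e E(1) unfolding orthonormal_def by simp
   show "e \<in> (\<Union>(N, b)\<in>UNIV \<times> \<rat>. {e\<in>E. ip e (box_fun (- real N) b) ~= 0})"
   proof (rule ccontr)
    assume "e \<notin> (\<Union>(N, b)\<in>UNIV \<times> \<rat>. {e\<in>E. ip e (box_fun (- real N) b) ~= 0})"
    then have "ip e (box_fun (- real N) b) = 0" if "b \<in> \<rat>" for N b using e that by blast
    then have "AE x in lborel. e x = 0" by (rule boxes_total[OF se])
    then have "ip e e = ip (%_. 0) (%_. 0)" by (intro ip_cong_AE) (auto intro: se sq_integrable_zero)
    then show False using \<open>ip e e = 1\<close> by (simp add: ip_zero_right)
   qed
  qed
  moreover have "countable (\<Union>(N, b)\<in>UNIV \<times> \<rat>. {e\<in>E. ip e (box_fun (- real N) b) ~= 0})"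
   by (intro countable_UN) (auto intro: countable_rat orthonormal_countable_support[OF E(1) box_sq])
  ultimately show ?thesis by (rule countable_subset)
 qed
 moreover have "infinite E" using E(2) unit_boxes_inj finite_subset range_inj_infinite by blast
 ultimately obtain e :: "nat => real => complex" where e: "bij_betw e UNIV E" using countableE_infinite[of E] bij_betw_inv by metis
 have "L2_basis e" unfolding L2_basis_def L2_complex_iff
 proof (intro conjI allI ballI impI)
  have eE: "e n \<in> E" for n using e by (auto simp: bij_betw_def)
  show "sqint (e n)" for n using eE[of n] E(1) unfolding orthonormal_def by blast
  show "ip (e m) (e n) = (if m = n then 1 else 0)" for m n
  proof -
   have "e m = e n \<longleftrightarrow> m = n" using e unfolding bij_betw_def by (auto dest: injD)
   moreover have "ip (e m) (e n) = (if e m = e n then 1 else 0)" using E(1) eE unfolding orthonormal_def by blast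
   ultimately show ?thesis by simp
  qed
  fix f :: "real => complex" assume f: "f \<in> L2" and o: "\<forall>n. ip (e n) f = 0"
  have "ip g f = 0" if "g \<in> E" for g
  proof -
   obtain n where "g = e n" using e \<open>g \<in> E\<close> unfolding bij_betw_def by blast
   then show ?thesis using o by simp
  qed
  then show "AE x in lborel. f x = 0" using f by (intro total) (simp_all add: L2_complex_iff)
 qed
 then show ?thesis by blast
qed

section \<open>The Fourier transform\<close>

definition wave :: "real => real => complex" where "wave xi x = exp (\<i> * of_real (x * xi))"

lemma norm_wave [simp]: "norm (wave xi x) = 1" unfolding wave_def by (rule norm_exp_i_times)

lemma wave_measurable [measurable]: "(%(x, y). wave x y) \<in> borel_measurable (borel \<Otimes>\<^sub>M borel)" "wave xi \<in> BM"
 unfolding wave_def[abs_def] by measurable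

lemma wave_sym: "wave x y = wave y x" by (simp add: wave_def mult.commute)
lemma wave_add: "wave xi (x + y) = wave xi x * wave xi y" unfolding wave_def by (simp add: distrib_right distrib_left exp_add)
lemma wave_minus: "wave (- xi) x = cnj (wave xi x)" "wave xi (- x) = cnj (wave xi x)" unfolding wave_def by (simp_all add: exp_cnj)
lemma wave_add_left: "wave (xi + eta) x = wave xi x * wave eta x" unfolding wave_def by (simp add: distrib_right distrib_left exp_add)

definition c0 :: complex where "c0 = of_real (1 / sqrt (2 * pi))"

lemma fourier_wave: "fourier f xi = c0 * (LBINT x. wave (- xi) x * f x)"
 unfolding fourier_def wave_def c0_def by simp

lemma norm_c0: "norm c0 = 1 / sqrt (2 * pi)" unfolding c0_def norm_of_real by simp
lemma c0_le_1: "norm c0 <= 1" unfolding norm_c0 using pi_ge_two by (simp add: field_simps real_le_rsqrt)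
lemma c0_sq: "c0 * c0 = of_real (1 / (2 * pi))" unfolding c0_def of_real_mult[symmetric] by (simp add: field_simps flip: real_sqrt_mult)
lemma c0_nz: "c0 ~= 0" unfolding c0_def by simp

lemma wave_integrable: "L1 f ==> L1 (%x. wave xi x * f x)"
 by (rule L1_bound[of _ f]) (auto simp: norm_mult)

lemma fourier_measurable [measurable]:
 assumes [measurable]: "f \<in> BM"
 shows "fourier f \<in> BM"
 unfolding fourier_wave[abs_def] by measurable

lemma fourier_bound: "L1 f ==> norm (fourier f xi) <= (LBINT x. norm (f x))"
proof -
 assume f: "L1 f"
 have "norm (LBINT x. wave (- xi) x * f x) <= (LBINT x. norm (wave (- xi) x * f x))" by (rule integral_norm_bound)
 also have "... = (LBINT x. norm (f x))" by (simp add: norm_mult)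
 finally show ?thesis unfolding fourier_wave norm_mult
  using mult_mono[OF c0_le_1, of "norm (LBINT x. wave (- xi) x * f x)" "\<integral>x. norm (f x) \<partial>lborel"] by simp
qed

lemma prod_integrable:
 fixes f g :: "real => complex" and k :: "real => real => complex"
 assumes f: "L1 f" and g: "L1 g" and k: "(%(x, y). k x y) \<in> borel_measurable (borel \<Otimes>\<^sub>M borel)" "!!x y. norm (k x y) <= C"
 shows "integrable (lborel \<Otimes>\<^sub>M lborel) (%(x, y). k x y * f x * g y)"
proof (rule L1_bound)
 have [measurable]: "f \<in> BM" "g \<in> BM" "(%(x, y). k x y) \<in> borel_measurable (borel \<Otimes>\<^sub>M borel)" using f g k by auto
 show "integrable (lborel \<Otimes>\<^sub>M lborel) (%(x, y). C * (norm (f x) * norm (g y)))"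
 proof (rule lborel_pair.Fubini_integrable)
  show "(%(x, y). C * (norm (f x) * norm (g y))) \<in> borel_measurable (lborel \<Otimes>\<^sub>M lborel)" by measurable
  show "L1 (%x. \<integral>y. norm (case (x, y) of (x, y) => C * (norm (f x) * norm (g y))) \<partial>lborel)" using f by (simp add: abs_mult)
  show "AE x in lborel. L1 (%y. case (x, y) of (x, y) => C * (norm (f x) * norm (g y)))" using g by simp
 qed
 show "(%(x, y). k x y * f x * g y) \<in> borel_measurable (lborel \<Otimes>\<^sub>M lborel)" by measurable
 show "AE p in lborel \<Otimes>\<^sub>M lborel. norm (case p of (x, y) => k x y * f x * g y) <= norm (case p of (x, y) => C * (norm (f x) * norm (g y)))"
 proof (rule AE_I2)
  fix p :: "real \<times> real"
  obtain x y where p: "p = (x, y)" by (cases p)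
  have "norm (k x y * f x * g y) <= C * (norm (f x) * norm (g y))"
   unfolding norm_mult mult.assoc by (intro mult_right_mono k) simp
  also have "... <= norm (C * (norm (f x) * norm (g y)))" by simp
  finally show "norm (case p of (x, y) => k x y * f x * g y) <= norm (case p of (x, y) => C * (norm (f x) * norm (g y)))" by (simp add: p)
 qed
qed

lemma prod_swap:
 fixes f g :: "real => complex" and k :: "real => real => complex"
 assumes f: "L1 f" and g: "L1 g" and k: "(%(x, y). k x y) \<in> borel_measurable (borel \<Otimes>\<^sub>M borel)" "!!x y. norm (k x y) <= C"
 shows "(LBINT x. f x * (LBINT y. k x y * g y)) = (LBINT y. g y * (LBINT x. k x y * f x))"
proof -
 have "(LBINT x. f x * (LBINT y. k x y * g y)) = (LBINT x. \<integral>y. k x y * f x * g y \<partial>lborel)"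
  by (simp flip: integral_mult_right_zero add: mult_ac)
 also have "... = (LBINT y. \<integral>x. k x y * f x * g y \<partial>lborel)"
  by (rule lborel_pair.Fubini_integral[OF prod_integrable[OF assms], symmetric])
 also have "... = (LBINT y. g y * (LBINT x. k x y * f x))"
  by (simp flip: integral_mult_right_zero add: mult_ac)
 finally show ?thesis .
qed

lemma fourier_mult_formula:
 assumes f: "L1 f" and g: "L1 g"
 shows "(LBINT x. fourier f x * g x) = (LBINT x. f x * fourier g x)"
proof -
 have m: "(%(x, y). wave (- x) y) \<in> borel_measurable (borel \<Otimes>\<^sub>M borel)" by measurable
 have "(LBINT x. fourier f x * g x) = c0 * (LBINT x. g x * (LBINT y. wave (- x) y * f y))"
  unfolding fourier_wave integral_mult_right_zero[symmetric, of c0] by (rule int_cong) simp_all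
 also have "(LBINT x. g x * (LBINT y. wave (- x) y * f y)) = (LBINT y. f y * (LBINT x. wave (- x) y * g x))"
  by (rule prod_swap[OF g f m, where C = 1]) simp
 also have "c0 * (LBINT y. f y * (LBINT x. wave (- x) y * g x)) = (LBINT y. f y * fourier g y)"
  unfolding fourier_wave integral_mult_right_zero[symmetric, of c0] by (rule int_cong) (simp_all add: wave_def mult.commute)
 finally show ?thesis .
qed

lemma std_normal_fourier: "(LBINT x. wave t x * of_real (std_normal_density x)) = of_real (exp (- t\<^sup>2 / 2))"
proof -
 have "char std_normal_distribution t = (LBINT x. wave t x * of_real (std_normal_density x))"
  unfolding char_def wave_def by (subst integral_density) (auto simp: scaleR_conv_of_real mult_ac)
 then show ?thesis by (simp add: char_std_normal_distribution)
qed

text \<open>A Gaussian cut-off in frequency, the Fourier transform of the approximate identity.\<close>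

definition reg :: "nat => real => real" where "reg n xi = exp (- (xi / real (Suc n))\<^sup>2 / 2)"

lemma reg_le_1: "reg n xi <= 1" "0 < reg n xi" "0 <= reg n xi" unfolding reg_def by simp_all

lemma reg_measurable [measurable]: "reg n \<in> BM" unfolding reg_def[abs_def] by measurable

lemma reg_tendsto: "(%n. reg n xi) -->> 1"
proof -
 have "(%n. xi / real (Suc n)) -->> 0" using LIMSEQ_Suc[OF lim_const_over_n] .
 then have "(%n. exp (- (xi / real (Suc n))\<^sup>2 / 2)) -->> exp (- 0\<^sup>2 / 2)" by (intro tendsto_intros) auto
 then show ?thesis unfolding reg_def by simp
qed

lemma reg_std: "reg n xi = sqrt (2 * pi) * std_normal_density (xi / real (Suc n))"
 unfolding reg_def std_normal_density_def by simp

lemma reg_integrable: "L1 (reg n)"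
 unfolding reg_std[abs_def] using lborel_integrable_real_affine[of std_normal_density "1 / real (Suc n)" 0] by simp

lemma reg_fourier: "(LBINT xi. wave u xi * of_real (reg n xi)) = of_real (2 * pi * bump n u)"
proof -
 let ?N = "real (Suc n)"
 have "(LBINT xi. wave u xi * of_real (reg n xi)) = \<bar>?N\<bar> *\<^sub>R (LBINT x. wave u (0 + ?N * x) * of_real (reg n (0 + ?N * x)))"
  by (rule lborel_integral_real_affine) simp
 also have "(LBINT x. wave u (0 + ?N * x) * of_real (reg n (0 + ?N * x))) = (LBINT x. of_real (sqrt (2 * pi)) * (wave (?N * u) x * of_real (std_normal_density x)))"
  by (rule int_cong) (auto simp: reg_std wave_def mult_ac simp del: of_nat_Suc)
 also have "... = of_real (sqrt (2 * pi)) * of_real (exp (- (?N * u)\<^sup>2 / 2))" unfolding integral_mult_right_zero std_normal_fourier ..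
 also have "\<bar>?N\<bar> *\<^sub>R ... = of_real (2 * pi * bump n u)"
 proof -
  have "sqrt (2 * pi) = 2 * pi * (1 / sqrt (2 * pi))" by (simp add: real_div_sqrt)
  moreover have "A = 2 * pi * B ==> N * (A * E) = 2 * pi * (N * (B * E))" for A B N E :: real by simp
  ultimately have "?N * (sqrt (2 * pi) * exp (- (?N * u)\<^sup>2 / 2)) = 2 * pi * bump n u" unfolding bump_def std_normal_density_def by blast
  then show ?thesis by (simp only: abs_of_nat scaleR_conv_of_real of_real_mult[symmetric])
 qed
 finally show ?thesis .
qed

text \<open>The Gaussian cut-off turns the integral over frequencies into $\int\int f(x) \overline{f(y)} \beta(y-x)$ with a probability density $\beta$, which is bounded by the inequality of arithmetic and geometric means.\<close>

lemma plancherel_regularized: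
 assumes f: "L1 f" and f2: "sqint f"
 shows "(LBINT xi. reg n xi * (norm (fourier f xi))^2) <= (L2_norm f)^2" and "L1 (%xi. reg n xi * (norm (fourier f xi))^2)"
proof -
 have [measurable]: "f \<in> BM" using f by auto
 let ?C = "\<integral>x. norm (f x) \<partial>lborel"
 show i: "L1 (%xi. reg n xi * (norm (fourier f xi))^2)"
 proof (rule L1_bound)
  show "L1 (%xi. ?C\<^sup>2 * reg n xi)" using reg_integrable by simp
  show "AE xi in lborel. norm (reg n xi * (norm (fourier f xi))^2) <= norm (?C\<^sup>2 * reg n xi)"
   using fourier_bound[OF f] reg_le_1(3) by (intro AE_I2) (simp add: abs_mult mult.commute mult_left_mono power_mono)
 qed measurable
 let ?g = "%xi. of_real (reg n xi) * cnj (fourier f xi)"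
 have g: "L1 ?g"
 proof (rule L1_bound)
  show "L1 (%xi. ?C * reg n xi)" using reg_integrable by simp
  have "cnj \<in> BM" by (intro borel_measurable_continuous_onI continuous_intros)
  then have [measurable]: "(%x. cnj (fourier f x)) \<in> BM" by (rule measurable_compose[rotated]) measurable
  show "?g \<in> borel_measurable lborel" by measurable
  show "AE xi in lborel. norm (?g xi) <= norm (?C * reg n xi)"
   using fourier_bound[OF f] reg_le_1(3) by (intro AE_I2) (simp add: norm_mult abs_mult mult.commute mult_left_mono mult_right_mono)
 qed
 have fg: "fourier ?g x = (LBINT y. bump n (y - x) * cnj (f y))" for x
 proof -
  let ?k = "%xi y. wave xi y"
  have cf: "cnj (fourier f xi) = c0 * (LBINT y. wave xi y * cnj (f y))" for xi
   unfolding fourier_wave by (simp add: wave_minus c0_def flip: Bochner_Integration.integral_cnj)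
  have "cnj \<in> BM" by (intro borel_measurable_continuous_onI continuous_intros)
  then have cfi: "L1 (%y. cnj (f y))" using f by simp
  have ri: "L1 (%xi. wave (- x) xi * of_real (reg n xi))" by (rule wave_integrable) (simp add: reg_integrable)
  have "fourier ?g x = c0 * c0 * (LBINT xi. (wave (- x) xi * of_real (reg n xi)) * (LBINT y. wave xi y * cnj (f y)))"
   by (simp only: fourier_wave[of ?g]) (simp add: cf mult_ac)
  also have "(LBINT xi. (wave (- x) xi * of_real (reg n xi)) * (LBINT y. wave xi y * cnj (f y))) =
    (LBINT y. cnj (f y) * (LBINT xi. wave xi y * (wave (- x) xi * of_real (reg n xi))))"
   by (rule prod_swap[OF ri cfi, where C = 1]) auto
  also have "(%y. \<integral>xi. wave xi y * (wave (- x) xi * of_real (reg n xi)) \<partial>lborel) = (%y. of_real (2 * pi * bump n (y - x)))"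
  proof
   fix y
   have "wave xi y * (wave (- x) xi * of_real (reg n xi)) = wave (y - x) xi * of_real (reg n xi)" for xi
    using wave_add_left[of y "- x" xi] by (simp add: wave_sym[of xi y])
   then show "(LBINT xi. wave xi y * (wave (- x) xi * of_real (reg n xi))) = of_real (2 * pi * bump n (y - x))" by (simp only: reg_fourier)
  qed
  also have "c0 * c0 * (LBINT y. cnj (f y) * of_real (2 * pi * bump n (y - x))) = (LBINT y. bump n (y - x) * cnj (f y))"
   unfolding c0_sq integral_mult_right_zero[symmetric] by (rule int_cong) auto
  finally show ?thesis .
 qed
 have bi: "L1 (bump n)" by (rule bump_integrable)
 have f2': "L1 (%x. (norm (f x))\<^sup>2)" using f2 by (simp add: sqint_def)
 have p1: "integrable (lborel \<Otimes>\<^sub>M lborel) (%(x, y). bump n (y - x) * (norm (f x))^2)" and p2: "integrable (lborel \<Otimes>\<^sub>M lborel) (%(x, y). bump n (y - x) * (norm (f y))^2)"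
 proof -
  show "integrable (lborel \<Otimes>\<^sub>M lborel) (%(x, y). bump n (y - x) * (norm (f x))^2)" by (rule conv_integrable(2)[OF bi f2'])
  have sy: "bump n (y - x) = bump n (x - y)" for x y using bump_minus[of n "x - y"] by simp
  have "(%(x, y). bump n (y - x) * (norm (f y))^2) = (%(x, y). bump n (x - y) * (norm (f y))^2)"
   by (rule ext, clarify) (simp only: prod.case sy)
  then show "integrable (lborel \<Otimes>\<^sub>M lborel) (%(x, y). bump n (y - x) * (norm (f y))^2)" using conv_integrable(1)[OF bi f2'] by simp
 qed
 have b1: "(LBINT x. \<integral>y. bump n (y - x) * (norm (f x))^2 \<partial>lborel) = (L2_norm f)^2"
  using lborel_integral_shift(2)[of "bump n"] bump_integral by (simp add: L2_norm_def)
 have b2: "(LBINT x. \<integral>y. bump n (y - x) * (norm (f y))^2 \<partial>lborel) = (L2_norm f)^2"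
  using lborel_pair.Fubini_integral[OF p2, symmetric] lborel_integral_shift(1)[of "bump n"] bump_integral by (simp add: L2_norm_def)
 have "of_real (LBINT xi. reg n xi * (norm (fourier f xi))^2) = (LBINT xi. fourier f xi * ?g xi)"
 proof -
  have pw: "complex_of_real (a * (norm z)^2) = z * (of_real a * cnj z)" for a z
   unfolding of_real_mult complex_norm_square by (simp only: mult_ac)
  show ?thesis unfolding integral_complex_of_real[symmetric] pw ..
 qed
 also have "... = (LBINT x. f x * (LBINT y. bump n (y - x) * cnj (f y)))" unfolding fourier_mult_formula[OF f g] fg ..
 finally have "norm (complex_of_real (LBINT xi. reg n xi * (norm (fourier f xi))^2)) <= (LBINT x. norm (f x * (LBINT y. bump n (y - x) * cnj (f y))))"
  by (simp only: integral_norm_bound)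
 moreover have "0 <= (LBINT xi. reg n xi * (norm (fourier f xi))^2)" using reg_le_1(3) by (intro Bochner_Integration.integral_nonneg) simp
 ultimately have "(LBINT xi. reg n xi * (norm (fourier f xi))^2) <= (LBINT x. norm (f x * (LBINT y. bump n (y - x) * cnj (f y))))" by (simp only: norm_of_real abs_of_nonneg)
 also have "... <= (LBINT x. (LBINT y. bump n (y - x) * (norm (f x))^2) / 2 + (LBINT y. bump n (y - x) * (norm (f y))^2) / 2)"
 proof (rule integral_mono_AE')
  show "L1 (%x. (LBINT y. bump n (y - x) * (norm (f x))^2) / 2 + (LBINT y. bump n (y - x) * (norm (f y))^2) / 2)"
   using lborel_pair.integrable_fst[OF p1] lborel_pair.integrable_fst[OF p2] by simp
  show "AE x in lborel. norm (f x * (LBINT y. bump n (y - x) * cnj (f y))) <= (LBINT y. bump n (y - x) * (norm (f x))^2) / 2 + (LBINT y. bump n (y - x) * (norm (f y))^2) / 2"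
   using lborel_pair.AE_integrable_fst[OF p2]
  proof eventually_elim
   case (elim x)
   have bx: "L1 (%y. bump n (y - x) * (norm (f x))^2)" using lborel_integrable_shift(2)[OF bi] by simp
   have "norm (f x * (LBINT y. bump n (y - x) * cnj (f y))) = norm (LBINT y. f x * (bump n (y - x) * cnj (f y)))" by simp
   also have "... <= (LBINT y. norm (f x * (bump n (y - x) * cnj (f y))))" by (rule integral_norm_bound)
   also have "... <= (LBINT y. bump n (y - x) * (norm (f x))^2 / 2 + bump n (y - x) * (norm (f y))^2 / 2)"
   proof (rule integral_mono_AE')
    show "AE y in lborel. norm (f x * (bump n (y - x) * cnj (f y))) <= bump n (y - x) * (norm (f x))^2 / 2 + bump n (y - x) * (norm (f y))^2 / 2"
    proof (rule AE_I2)
     fix y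
     have "norm (f x * (bump n (y - x) * cnj (f y))) = bump n (y - x) * (norm (f x) * norm (f y))" by (simp add: norm_mult mult_ac)
     also have "... <= bump n (y - x) * (((norm (f x))^2 + (norm (f y))^2) / 2)" by (intro mult_left_mono prod_le_half_squares) simp
     finally show "norm (f x * (bump n (y - x) * cnj (f y))) <= bump n (y - x) * (norm (f x))^2 / 2 + bump n (y - x) * (norm (f y))^2 / 2" by (simp add: distrib_left add_divide_distrib)
    qed
   qed (use bx elim in auto)
   also have "... = (LBINT y. bump n (y - x) * (norm (f x))^2) / 2 + (LBINT y. bump n (y - x) * (norm (f y))^2) / 2" using bx elim by simp
   finally show ?case .
  qed
 qed auto
 also have "... = (L2_norm f)^2" using lborel_pair.integrable_fst[OF p1] lborel_pair.integrable_fst[OF p2] b1 b2 by simp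
 finally show "(LBINT xi. reg n xi * (norm (fourier f xi))^2) <= (L2_norm f)^2" .
qed

lemma plancherel_le:
 assumes f: "L1 f" and f2: "sqint f"
 shows "sqint (fourier f)" and "L2_norm (fourier f) <= L2_norm f"
proof -
 have [measurable]: "f \<in> BM" using f by auto
 have "(\<integral>\<^sup>+xi. ennreal ((norm (fourier f xi))^2) \<partial>lborel) <= (\<integral>\<^sup>+xi. liminf (%n. ennreal (reg n xi * (norm (fourier f xi))^2)) \<partial>lborel)"
 proof (rule nn_integral_mono)
  fix xi
  have "(%n. ennreal (reg n xi * (norm (fourier f xi))^2)) -->> ennreal (1 * (norm (fourier f xi))^2)"
   by (intro tendsto_ennrealI tendsto_intros reg_tendsto)
  then have "liminf (%n. ennreal (reg n xi * (norm (fourier f xi))^2)) = ennreal (1 * (norm (fourier f xi))^2)"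
   by (rule lim_imp_Liminf[rotated]) simp
  then show "ennreal ((norm (fourier f xi))^2) <= liminf (%n. ennreal (reg n xi * (norm (fourier f xi))^2))" by simp
 qed
 also have "... <= liminf (%n. \<integral>\<^sup>+xi. ennreal (reg n xi * (norm (fourier f xi))^2) \<partial>lborel)" by (rule nn_integral_liminf) measurable
 also have "... <= ennreal ((L2_norm f)^2)"
 proof (rule Liminf_le)
  have "(\<integral>\<^sup>+xi. ennreal (reg n xi * (norm (fourier f xi))^2) \<partial>lborel) <= ennreal ((L2_norm f)^2)" for n
   using plancherel_regularized[OF f f2, of n] reg_le_1(3) by (subst nn_integral_eq_integral) (auto intro!: ennreal_leI)
  then show "\<forall>\<^sub>F n in sequentially. (\<integral>\<^sup>+xi. ennreal (reg n xi * (norm (fourier f xi))^2) \<partial>lborel) <= ennreal ((L2_norm f)^2)" by simp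
 qed simp
 finally have le: "(\<integral>\<^sup>+xi. ennreal ((norm (fourier f xi))^2) \<partial>lborel) <= ennreal ((L2_norm f)^2)" .
 then have "(\<integral>\<^sup>+xi. ennreal ((norm (fourier f xi))^2) \<partial>lborel) < \<infinity>" by (simp add: order_le_less_trans)
 then show s: "sqint (fourier f)" unfolding sqint_def by (auto intro!: integrableI_nonneg)
 have "ennreal (LBINT xi. (norm (fourier f xi))\<^sup>2) <= ennreal ((L2_norm f)^2)"
  using le s unfolding sqint_def by (subst (asm) nn_integral_eq_integral) auto
 then have "(LBINT xi. (norm (fourier f xi))\<^sup>2) <= (L2_norm f)^2" by simp
 then show "L2_norm (fourier f) <= L2_norm f" unfolding L2_norm_def[of "fourier f"] by (intro real_le_lsqrt) auto
qed

lemma fourier_inversion: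
 assumes f: "L1 f" "!!x. norm (f x) <= C" "isCont f x" and F: "L1 (fourier f)"
 shows "f x = c0 * (LBINT xi. wave x xi * fourier f xi)"
proof -
 have [measurable]: "f \<in> BM" using f by auto
 have e: "c0 * (LBINT xi. wave x xi * of_real (reg n xi) * fourier f xi) = (LBINT y. bump n (y - x) * f y)" for n
 proof -
  have ri: "L1 (%xi. wave x xi * of_real (reg n xi))" by (rule wave_integrable) (simp add: reg_integrable)
  have "c0 * (LBINT xi. wave x xi * of_real (reg n xi) * fourier f xi) = c0 * (LBINT y. f y * fourier (%xi. wave x xi * of_real (reg n xi)) y)"
   using fourier_mult_formula[OF f(1) ri] by (simp add: mult.commute)
  also have "... = (LBINT y. bump n (y - x) * f y)"
  proof -
   have "fourier (%xi. wave x xi * of_real (reg n xi)) y = c0 * of_real (2 * pi * bump n (y - x))" for y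
   proof -
    have "wave (- y) xi * (wave x xi * of_real (reg n xi)) = wave (x - y) xi * of_real (reg n xi)" for xi
     using wave_add_left[of x "- y" xi] by (simp add: mult_ac)
    then have "fourier (%xi. wave x xi * of_real (reg n xi)) y = c0 * of_real (2 * pi * bump n (x - y))" unfolding fourier_wave by (simp only: reg_fourier)
    then show ?thesis using bump_minus[of n "y - x"] by simp
   qed
   then have "c0 * (f y * fourier (%xi. wave x xi * of_real (reg n xi)) y) = bump n (y - x) * f y" for y
    using c0_sq by (simp add: mult_ac) (simp add: mult.assoc[symmetric])
   then show ?thesis unfolding integral_mult_right_zero[symmetric] by presburger
  qed
  finally show ?thesis .
 qed
 have "(%n. c0 * (LBINT xi. wave x xi * of_real (reg n xi) * fourier f xi)) -->> c0 * (LBINT xi. wave x xi * fourier f xi)"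
 proof (intro tendsto_mult_left integral_dominated_convergence[where w = "%xi. norm (fourier f xi)"])
  show "L1 (%xi. norm (fourier f xi))" using F by simp
  show "AE xi in lborel. (%n. wave x xi * of_real (reg n xi) * fourier f xi) -->> wave x xi * fourier f xi"
  proof (rule AE_I2)
   fix xi
   have "(%n. wave x xi * of_real (reg n xi) * fourier f xi) -->> wave x xi * of_real 1 * fourier f xi" by (intro tendsto_intros reg_tendsto)
   then show "(%n. wave x xi * of_real (reg n xi) * fourier f xi) -->> wave x xi * fourier f xi" by simp
  qed
  show "AE xi in lborel. norm (wave x xi * of_real (reg n xi) * fourier f xi) <= norm (fourier f xi)" for n
   using reg_le_1 by (intro AE_I2) (simp add: norm_mult mult_left_le_one_le)
 qed measurable
 moreover have "(%n. \<integral>y. bump n (y - x) * f y \<partial>lborel) -->> f x" by (rule bump_approx[OF _ f(2,3)]) measurable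
 ultimately show ?thesis unfolding e using LIMSEQ_unique by blast
qed

lemma wave_continuous: "cont (wave xi)"
 unfolding wave_def[abs_def] by (intro continuous_intros)

lemma Rop_wave:
 assumes c: "c ~= 0"
 shows "Rop c (wave xi) = (%x. wave xi x / (\<i> * of_real xi + of_real c))"
proof -
 have nz: "\<i> * of_real xi + complex_of_real c ~= 0" using c by (auto simp: complex_eq_iff)
 let ?z = "\<i> * of_real xi + complex_of_real c"
 have d: "((%x. wave xi x / ?z) hvd (\<i> * of_real xi) * (wave xi y / ?z)) (at y)" for y
 proof -
  have "((%x. exp (x *\<^sub>R (\<i> * of_real xi)) * (1 / ?z)) hvd ((\<i> * of_real xi) * exp (y *\<^sub>R (\<i> * of_real xi))) * (1 / ?z)) (at y)"
   by (intro has_vector_derivative_mult_left exp_scaleR_has_vector_derivative_left)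
  then show ?thesis by (simp add: wave_def scaleR_conv_of_real mult_ac)
 qed
 have "(%x. wave xi x / ?z) = Rop c (%y. (\<i> * of_real xi) * (wave xi y / ?z) + of_real c * (wave xi y / ?z))"
  by (intro Rop_unique[OF c d, where K = "1 / norm ?z" and K' = "norm xi * (1 / norm ?z)"] continuous_intros wave_continuous) (use nz in \<open>auto simp: norm_mult norm_divide\<close>)
 also have "(%y. (\<i> * of_real xi) * (wave xi y / ?z) + of_real c * (wave xi y / ?z)) = wave xi"
  using nz by (simp add: fun_eq_iff flip: distrib_right add_divide_distrib)
 finally show ?thesis ..
qed

lemma fourier_Rop:
 assumes c: "c ~= 0" and h: "L1 h"
 shows "fourier (Rop c h) xi = fourier h xi / (\<i> * of_real xi + of_real c)"
proof -
 have nz: "\<i> * of_real xi + complex_of_real c ~= 0" using c by (auto simp: complex_eq_iff)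
 have "(LBINT x. Rop c h x * wave (- xi) x) = - (LBINT x. h x * Rop (- c) (wave (- xi)) x)"
  by (rule Rop_dual(1)[OF c, where M = 1]) (use h in auto)
 also have "... = (LBINT x. (h x * wave (- xi) x) / (\<i> * of_real xi + of_real c))"
  unfolding Bochner_Integration.integral_minus[symmetric]
 proof (rule int_cong)
  fix x
  have e: "\<i> * of_real (- xi) + complex_of_real (- c) = - (\<i> * of_real xi + of_real c)" by simp
  have gen: "- (a * (w / - z)) = a * w / z" for a w z :: complex by simp
  show "- (h x * Rop (- c) (wave (- xi)) x) = h x * wave (- xi) x / (\<i> * of_real xi + of_real c)"
   using c by (subst Rop_wave, simp) (simp only: e gen)
 qed simp
 also have "... = (LBINT x. h x * wave (- xi) x) / (\<i> * of_real xi + of_real c)" by simp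
 finally show ?thesis unfolding fourier_wave by (simp add: mult.commute)
qed

lemma fourier_diff: "L1 f ==> L1 g ==> fourier (%x. f x - g x) xi = fourier f xi - fourier g xi"
 unfolding fourier_wave using wave_integrable[of f "- xi"] wave_integrable[of g "- xi"] by (simp add: right_diff_distrib)

lemma fourier_cmult: "fourier (%x. k * f x) xi = k * fourier f xi"
 unfolding fourier_wave integral_mult_right_zero[symmetric] by (simp add: mult_ac)

lemma fourier_dx:
 assumes f: "schwartz f"
 shows "fourier (dx f) xi = \<i> * of_real xi * fourier f xi"
proof -
 have i: "L1 f" "L1 (dx f)" using f schwartz_dx schwartz_integrable by auto
 have nz: "\<i> * of_real xi + (1::complex) ~= 0" by (auto simp: complex_eq_iff)
 have "(%x. f x - Rop 1 f x) = Rop 1 (dx f)" using Rop_dx(2)[OF _ f, of 1] by auto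
 then have "fourier f xi - fourier (Rop 1 f) xi = fourier (Rop 1 (dx f)) xi"
  using fourier_diff[OF i(1) Rop_L1[OF _ i(1)], of 1 xi] by simp
 then have e: "fourier f xi - fourier f xi / (\<i> * of_real xi + 1) = fourier (dx f) xi / (\<i> * of_real xi + 1)"
  using fourier_Rop[OF _ i(1), of 1 xi] fourier_Rop[OF _ i(2), of 1 xi] by simp
 have "A - A / z = B / z ==> z ~= 0 ==> B = A * z - A" for A B z :: complex by (simp add: field_simps)
 from this[OF e nz] show ?thesis by (simp add: algebra_simps)
qed

lemma schwartz_fourier_decay:
 assumes f: "schwartz f"
 shows "\<exists>C. \<forall>xi. norm (fourier f xi) <= C / (1 + xi^2)"
proof (intro exI allI)
 fix xi :: real
 let ?A = "\<integral>x. norm (f x) \<partial>lborel" and ?B = "\<integral>x. norm (dx (dx f) x) \<partial>lborel"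
 have "norm (fourier f xi) <= ?A" by (rule fourier_bound[OF schwartz_integrable[OF f]])
 moreover have "norm (fourier (dx (dx f)) xi) <= ?B" by (intro fourier_bound schwartz_integrable schwartz_dx f)
 then have "xi^2 * norm (fourier f xi) <= ?B" using f by (simp add: fourier_dx schwartz_dx norm_mult power2_eq_square)
 ultimately have "(1 + xi^2) * norm (fourier f xi) <= ?A + ?B" by (simp add: distrib_right)
 then show "norm (fourier f xi) <= (?A + ?B) / (1 + xi^2)" by (simp add: field_simps add_pos_nonneg)
qed

lemma decay_sq_integrable:
 assumes "f \<in> BM" "!!x. norm (f x) <= C / (1 + x^2)"
 shows "L1 f" "sqint f"
proof -
 show i: "L1 f" by (rule decay_integrable[OF assms])
 have "C \<ge> 0" using order_trans[OF norm_ge_zero assms(2)[of 0]] by simp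
 then have "C / (1 + x^2) <= C" for x :: real by (simp add: field_simps add_pos_nonneg)
 then show "sqint f" by (intro bounded_integrable_sq_integrable[OF i, of C] order_trans[OF assms(2)])
qed

lemma schwartz_fourier_integrable: "schwartz f ==> L1 (fourier f)" "schwartz f ==> sqint (fourier f)"
 using schwartz_fourier_decay[of f] decay_sq_integrable[of "fourier f"] fourier_measurable[OF schwartz_measurable[of f]] by blast+

lemma schwartz_fourier_twice:
 assumes f: "schwartz f"
 shows "fourier (fourier f) x = f (- x)" and "fourier (%xi. fourier f (- xi)) x = f x"
proof -
 obtain C where C: "!!x. norm (f x) <= C" using schwartz_bounded[OF f] by blast
 have c: "isCont f x" for x using schwartz_continuous[OF f] by (simp add: continuous_on_eq_continuous_at)
 note inv = fourier_inversion[OF schwartz_integrable[OF f] C c schwartz_fourier_integrable(1)[OF f]]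
 show "fourier (fourier f) x = f (- x)" unfolding inv[of "- x"] fourier_wave[of "fourier f"] ..
 have "fourier (%xi. fourier f (- xi)) x = c0 * (LBINT xi. wave (- x) (- xi) * fourier f (- (- xi)))"
  unfolding fourier_wave[of "%xi. fourier f (- xi)"] by (subst lborel_integral_shift(3)[symmetric]) simp
 also have "... = f x" unfolding inv[of x] by (simp add: wave_minus)
 finally show "fourier (%xi. fourier f (- xi)) x = f x" .
qed

lemma sq_integrable_reflect:
 assumes "sqint f"
 shows "sqint (%x. f (- x))"
proof -
 have [measurable]: "f \<in> BM" using assms by auto
 have "(%x. f (- x)) \<in> BM" by measurable
 then show ?thesis using assms lborel_integrable_shift(3)[of "%x. (norm (f x))\<^sup>2"] unfolding sqint_def by simp
qed

lemma L2_norm_reflect: "L2_norm (%x. f (- x)) = L2_norm f"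
 unfolding L2_norm_def by (subst lborel_integral_shift(3)[symmetric]) simp

lemma truncation:
 assumes f: "sqint f"
 defines "g \<equiv> %n x. of_real (indicator {- real n..real n} x) * f x"
 shows "L1 (g n)" "sqint (g n)" "L2_norm (g n) <= L2_norm f" "(%n. L2_norm (%x. g n x - f x)) -->> 0"
proof -
 have [measurable]: "f \<in> BM" using f by auto
 have i2: "L1 (%x. (norm (f x))\<^sup>2)" using f by (simp add: sqint_def)
 have "L1 (%x::real. complex_of_real (indicator {- real n..real n} x))"
  by (intro integrable_of_real integrable_real_indicator) auto
 then have "sqint (%x::real. complex_of_real (indicator {- real n..real n} x))"
  by (rule bounded_integrable_sq_integrable[of _ 1]) (simp add: indicator_def)
 then show "L1 (g n)" unfolding g_def using f by (rule sq_integrable_mult)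
 show s: "sqint (g n)" for n unfolding g_def by (rule sq_integrable_bounded_mult[OF f, where M = 1]) (auto simp: indicator_def)
 show "L2_norm (g n) <= L2_norm f" unfolding g_def by (rule order_trans[OF L2_norm_bounded_mult[OF f, where M = 1]]) (auto simp: indicator_def)
 have "(%n. \<integral>x. (norm (g n x - f x))\<^sup>2 \<partial>lborel) -->> lebesgue_integral lborel (%x::real. 0::real)"
 proof (rule integral_dominated_convergence[where w = "%x. (norm (f x))\<^sup>2"])
  show "L1 (%x. (norm (f x))\<^sup>2)" by (rule i2)
  show "AE x in lborel. (%n. (norm (g n x - f x))\<^sup>2) -->> 0"
  proof (rule AE_I2, rule tendsto_eventually)
   fix x :: real
   show "\<forall>\<^sub>F n in sequentially. (norm (g n x - f x))\<^sup>2 = 0"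
    using eventually_ge_at_top[of "nat \<lceil>\<bar>x\<bar>\<rceil>"]
   proof eventually_elim
    case (elim n)
    then have "x \<in> {- real n..real n}" by (simp add: nat_ceiling_le_eq abs_le_iff)
    then show ?case by (simp add: g_def)
   qed
  qed
  show "AE x in lborel. norm ((norm (g n x - f x))^2) <= (norm (f x))^2" for n by (intro AE_I2) (auto simp: g_def indicator_def)
 qed (auto simp: g_def)
 then show "(%n. L2_norm (%x. g n x - f x)) -->> 0" unfolding L2_norm_def using tendsto_real_sqrt by fastforce
qed

lemma integral_mult_tendsto:
 assumes "!!n. sqint (f n)" "sqint F" "(%n. L2_norm (%x. f n x - F x)) -->> 0" "sqint g"
 shows "(%n. \<integral>x. f n x * g x \<partial>lborel) -->> (LBINT x. F x * g x)"
 using ip_tendsto[OF sq_integrable_cnj[OF assms(4)] assms(1,2,3)] by (simp add: L2_inner_def mult.commute)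

text \<open>The transforms of truncations form a Cauchy sequence by the Plancherel inequality.\<close>

lemma L2_fourier_exists:
 assumes f: "sqint f"
 shows "\<exists>F. sqint F \<and> L2_norm F <= L2_norm f \<and>
  (\<forall>phi. L1 phi \<and> sqint phi --> (LBINT xi. F xi * phi xi) = (LBINT x. f x * fourier phi x))"
proof -
 define g where "g = (%n x. of_real (indicator {- real n..real n} x) * f x)"
 have g: "L1 (g n)" "sqint (g n)" "L2_norm (g n) <= L2_norm f" for n
  unfolding g_def by (rule truncation[OF f])+
 have g4: "(%n. L2_norm (%x. g n x - f x)) -->> 0" unfolding g_def by (rule truncation[OF f])
 have P: "sqint (fourier (g n))" "L2_norm (fourier (g n)) <= L2_norm (g n)" for n using plancherel_le[OF g(1,2)] .
 have "\<exists>N. \<forall>m\<ge>N. \<forall>n\<ge>N. L2_norm (%x. fourier (g m) x - fourier (g n) x) <= e" if e: "e > 0" for e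
 proof -
  have "\<forall>\<^sub>F n in sequentially. L2_norm (%x. g n x - f x) < e / 2" using order_tendstoD(2)[OF g4, of "e/2"] e by simp
  then obtain N where N: "!!n. n \<ge> N ==> L2_norm (%x. g n x - f x) < e / 2" unfolding eventually_sequentially by blast
  have "L2_norm (%x. fourier (g m) x - fourier (g n) x) <= e" if mn: "m \<ge> N" "n \<ge> N" for m n
  proof -
   have "L2_norm (%x. fourier (g m) x - fourier (g n) x) = L2_norm (fourier (%x. g m x - g n x))" by (intro arg_cong[where f = L2_norm] ext fourier_diff[symmetric] g(1))
   also have "... <= L2_norm (%x. g m x - g n x)" using g(1,2) by (intro plancherel_le sq_integrable_diff Bochner_Integration.integrable_diff)
   also have "... = L2_norm (%x. (g m x - f x) + (f x - g n x))" by simp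
   also have "... <= L2_norm (%x. g m x - f x) + L2_norm (%x. f x - g n x)" by (intro L2_norm_triangle sq_integrable_diff g(2) f)
   also have "... <= e" using N[OF mn(1)] N[OF mn(2)] L2_norm_minus[of "g n" f] by simp
   finally show ?thesis .
  qed
  then show ?thesis by blast
 qed
 from L2_complete[OF P(1) this] obtain F where F: "sqint F" "(%n. L2_norm (%x. fourier (g n) x - F x)) -->> 0" by blast
 have "L2_norm F <= L2_norm (%x. fourier (g n) x - F x) + L2_norm f" for n
 proof -
  have "L2_norm F = L2_norm (%x. (F x - fourier (g n) x) + fourier (g n) x)" by simp
  also have "... <= L2_norm (%x. F x - fourier (g n) x) + L2_norm (fourier (g n))" by (intro L2_norm_triangle sq_integrable_diff P F(1))
  finally show ?thesis using P(2)[of n] g(3)[of n] L2_norm_minus[of F "fourier (g n)"] by simp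
 qed
 then have "L2_norm F <= 0 + L2_norm f" by (intro LIMSEQ_le_const[OF tendsto_add[OF F(2) tendsto_const]]) blast
 moreover have "(LBINT xi. F xi * phi xi) = (LBINT x. f x * fourier phi x)" if "L1 phi" "sqint phi" for phi
  using integral_mult_tendsto[OF P(1) F that(2)] integral_mult_tendsto[OF g(2) f g4 plancherel_le(1)[OF that]]
  unfolding fourier_mult_formula[OF g(1) that(1)] using LIMSEQ_unique by blast
 ultimately show ?thesis using F(1) by auto
qed

lemma L2_fourier_sq: "L2_fourier f F ==> sqint f" "L2_fourier f F ==> sqint F"
 unfolding L2_fourier_def L2_complex_iff by auto

lemma L2_fourier_unique:
 assumes "L2_fourier f F" "L2_fourier f F'"
 shows "AE x in lborel. F x = F' x"
proof -
 note s = assms[THEN L2_fourier_sq(2)]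
 have i: "L1 (%x. F x * phi x)" "L1 (%x. F' x * phi x)" if "schwartz phi" for phi
  using s schwartz_sq_integrable[OF that] by (auto intro: sq_integrable_mult)
 have "AE x in lborel. F x - F' x = 0"
 proof (rule schwartz_separates)
  show "(%x. F x - F' x) \<in> BM" using s by auto
  show "L1 (%x. (F x - F' x) * phi x)" if "schwartz phi" for phi using i[OF that] by (simp add: left_diff_distrib)
  show "(LBINT x. (F x - F' x) * phi x) = 0" if "schwartz phi" for phi
   using i[OF that] assms that by (simp add: left_diff_distrib L2_fourier_def)
 qed
 then show ?thesis by simp
qed

lemma L2_fourier_extended:
 assumes "L2_fourier f F"
 shows "L2_norm F <= L2_norm f" "L1 phi ==> sqint phi ==> (LBINT xi. F xi * phi xi) = (LBINT x. f x * fourier phi x)"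
proof -
 note s = L2_fourier_sq[OF assms]
 obtain G where G: "sqint G" "L2_norm G <= L2_norm f" "!!phi. L1 phi ==> sqint phi ==> (LBINT xi. G xi * phi xi) = (LBINT x. f x * fourier phi x)"
  using L2_fourier_exists[OF s(1)] by blast
 have "L2_fourier f G" unfolding L2_fourier_def L2_complex_iff using G(1,3) s(1) schwartz_integrable schwartz_sq_integrable by blast
 then have ae: "AE x in lborel. F x = G x" using L2_fourier_unique[OF assms] by blast
 show "L2_norm F <= L2_norm f" using L2_norm_cong_AE[OF ae s(2) G(1)] G(2) by simp
 assume p: "L1 phi" "sqint phi"
 have "(LBINT xi. F xi * phi xi) = (LBINT xi. G xi * phi xi)"
  using s(2) G(1) p by (intro integral_cong_AE) (auto intro: AE_mp[OF ae])
 then show "(LBINT xi. F xi * phi xi) = (LBINT x. f x * fourier phi x)" using G(3)[OF p] by simp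
qed

text \<open>Since the transform of a Schwartz function is an admissible test function, applying the defining identity twice gives reflection. Isometry, injectivity and surjectivity follow from this.\<close>

lemma L2_fourier_twice:
 assumes "L2_fourier f F"
 shows "L2_fourier F (%x. f (- x))"
 unfolding L2_fourier_def L2_complex_iff
proof (intro conjI allI impI)
 show "sqint F" "sqint (%x. f (- x))" using L2_fourier_sq[OF assms] sq_integrable_reflect by auto
 fix phi assume p: "schwartz phi"
 have "(LBINT x. F x * fourier phi x) = (LBINT x. f x * phi (- x))"
  using L2_fourier_extended(2)[OF assms schwartz_fourier_integrable[OF p]] by (simp add: schwartz_fourier_twice(1)[OF p])
 also have "... = (LBINT xi. f (- xi) * phi xi)" by (subst lborel_integral_shift(3)[symmetric]) simp
 finally show "(LBINT xi. f (- xi) * phi xi) = (LBINT x. F x * fourier phi x)" ..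
qed

lemma L2_fourier_isometry: "L2_fourier f F ==> L2_norm F = L2_norm f"
 using L2_fourier_extended(1)[of f F] L2_fourier_extended(1)[OF L2_fourier_twice, of f F] L2_norm_reflect[of f] by auto

lemma L2_fourier_total: "sqint f ==> \<exists>F. L2_fourier f F"
 using L2_fourier_exists[of f] schwartz_integrable schwartz_sq_integrable unfolding L2_fourier_def L2_complex_iff by meson

lemma L2_fourier_surj:
 assumes "sqint F"
 shows "\<exists>f. L2_fourier f F"
proof -
 obtain K where K: "L2_fourier F K" using L2_fourier_total[OF assms] by blast
 have "L2_fourier (%x. K (- x)) (%x. F (- (- x)))" by (intro L2_fourier_twice K)
 then show ?thesis by auto
qed

lemma L2_fourier_diff_cmult:
 assumes "L2_fourier f F" "L2_fourier g G"
 shows "L2_fourier (%x. f x - k * g x) (%x. F x - k * G x)"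
 unfolding L2_fourier_def L2_complex_iff
proof (intro conjI allI impI)
 note s = L2_fourier_sq[OF assms(1)] L2_fourier_sq[OF assms(2)]
 show "sqint (%x. f x - k * g x)" "sqint (%x. F x - k * G x)" using s by (auto intro: sq_integrable_diff sq_integrable_cmult)
 fix phi assume p: "schwartz phi"
 have i: "L1 (%x. h x * phi x)" "L1 (%x. h x * fourier phi x)" if "sqint h" for h
  using that p schwartz_sq_integrable schwartz_fourier_integrable sq_integrable_mult by blast+
 show "(LBINT xi. (F xi - k * G xi) * phi xi) = (LBINT x. (f x - k * g x) * fourier phi x)"
  using i[OF s(1)] i[OF s(2)] i[OF s(3)] i[OF s(4)] assms p by (simp add: left_diff_distrib mult.assoc L2_fourier_def)
qed

lemma L2_fourier_inj:
 assumes "L2_fourier f F" "L2_fourier g G" "AE x in lborel. F x = G x"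
 shows "AE x in lborel. f x = g x"
proof -
 note d = L2_fourier_diff_cmult[OF assms(1,2), of 1]
 have "L2_norm (%x. F x - 1 * G x) = L2_norm (%x. 0 :: complex)"
  by (rule L2_norm_cong_AE[OF _ L2_fourier_sq(2)[OF d] sq_integrable_zero]) (use assms(3) in \<open>auto elim: AE_mp\<close>)
 then have "L2_norm (%x. f x - 1 * g x) = 0" using L2_fourier_isometry[OF d] by (simp add: L2_norm_def)
 from L2_norm_zero_AE[OF L2_fourier_sq(1)[OF d] this] show ?thesis by simp
qed

lemma L2_fourier_cong:
 assumes "L2_fourier f F" "AE x in lborel. F x = F' x" "F' \<in> BM"
 shows "L2_fourier f F'"
proof -
 note s = L2_fourier_sq[OF assms(1)]
 have [measurable]: "F \<in> BM" "F' \<in> BM" using s assms(3) by auto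
 have "L1 (%x. (norm (F' x))\<^sup>2) = L1 (%x. (norm (F x))\<^sup>2)"
  by (intro integrable_cong_AE) (use assms(2) in \<open>auto elim: AE_mp\<close>)
 then have s': "sqint F'" using s(2) by (simp add: sqint_def)
 have "(LBINT xi. F' xi * phi xi) = (LBINT xi. F xi * phi xi)" if "schwartz phi" for phi
  using schwartz_measurable[OF that] by (intro integral_cong_AE) (use assms(2) in \<open>auto elim: AE_mp\<close>)
 then show ?thesis using assms(1) s s' unfolding L2_fourier_def L2_complex_iff by simp
qed

lemma L2_fourier_classical:
 assumes "L1 f" "sqint f"
 shows "L2_fourier f (fourier f)"
 unfolding L2_fourier_def L2_complex_iff
 using assms plancherel_le[OF assms] fourier_mult_formula[OF assms(1) schwartz_integrable] by blast

lemma ip_polarization: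
 assumes f: "sqint f" and g: "sqint g"
 shows "4 * ip f g = of_real ((L2_norm (%x. f x - (- 1) * g x))^2) - of_real ((L2_norm (%x. f x - 1 * g x))^2)
  + \<i> * of_real ((L2_norm (%x. f x - \<i> * g x))^2) - \<i> * of_real ((L2_norm (%x. f x - (- \<i>) * g x))^2)"
proof -
 have s: "sqint (%x. f x - k * g x)" for k by (intro sq_integrable_diff sq_integrable_cmult f g)
 have i: "L1 (%x. cnj (f x - k * g x) * (f x - k * g x))" for k by (rule ip_integrable[OF s s])
 have gen: "(LBINT x. A x - B x + \<i> * C x - \<i> * D x) = (LBINT x. A x) - (LBINT x. B x) + \<i> * (LBINT x. C x) - \<i> * (LBINT x. D x)"
  if "L1 A" "L1 B" "L1 C" "L1 D" for A B C D :: "real => complex"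
  using that by simp
 have "4 * ip f g = (LBINT x. 4 * (cnj (f x) * g x))" unfolding L2_inner_def by simp
 also have "... = (LBINT x. cnj (f x - (- 1) * g x) * (f x - (- 1) * g x) - cnj (f x - 1 * g x) * (f x - 1 * g x)
   + \<i> * (cnj (f x - \<i> * g x) * (f x - \<i> * g x)) - \<i> * (cnj (f x - (- \<i>) * g x) * (f x - (- \<i>) * g x)))"
  by (rule int_cong) (simp_all add: algebra_simps)
 also have "... = ip (%x. f x - (- 1) * g x) (%x. f x - (- 1) * g x) - ip (%x. f x - 1 * g x) (%x. f x - 1 * g x)
   + \<i> * ip (%x. f x - \<i> * g x) (%x. f x - \<i> * g x) - \<i> * ip (%x. f x - (- \<i>) * g x) (%x. f x - (- \<i>) * g x)"
  unfolding L2_inner_def by (rule gen[OF i i i i])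
 finally show ?thesis unfolding ip_self .
qed

lemma parseval:
 assumes "L2_fourier f F" "L2_fourier g G"
 shows "ip f g = ip F G"
proof -
 have "4 * ip f g = 4 * ip F G"
  unfolding ip_polarization[OF L2_fourier_sq(1)[OF assms(1)] L2_fourier_sq(1)[OF assms(2)]] ip_polarization[OF L2_fourier_sq(2)[OF assms(1)] L2_fourier_sq(2)[OF assms(2)]]
   L2_fourier_isometry[OF L2_fourier_diff_cmult[OF assms]] ..
 then show ?thesis by simp
qed

lemma fourier_multiplier_works:
 assumes m [measurable]: "m \<in> BM" and M: "!!xi. norm (m xi) <= M" and f: "sqint f"
 shows "\<exists>F. L2_fourier f F \<and> L2_fourier (fourier_multiplier m f) (%xi. m xi * F xi)"
proof -
 obtain F where F: "L2_fourier f F" using L2_fourier_total[OF f] by blast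
 have "sqint (%xi. m xi * F xi)" by (rule sq_integrable_bounded_mult[OF L2_fourier_sq(2)[OF F] m M])
 then have "\<exists>g F. L2_fourier f F \<and> L2_fourier g (%xi. m xi * F xi)" using F L2_fourier_surj by blast
 from someI_ex[OF this] show ?thesis unfolding fourier_multiplier_def .
qed

lemma fourier_multiplier_fourier:
 assumes m [measurable]: "m \<in> BM" and M: "!!xi. norm (m xi) <= M" and f: "L2_fourier f F"
 shows "L2_fourier (fourier_multiplier m f) (%xi. m xi * F xi)"
proof -
 obtain G where G: "L2_fourier f G" "L2_fourier (fourier_multiplier m f) (%xi. m xi * G xi)"
  using fourier_multiplier_works[OF m M L2_fourier_sq(1)[OF f]] by blast
 have [measurable]: "F \<in> BM" using L2_fourier_sq(2)[OF f] by auto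
 show ?thesis by (rule L2_fourier_cong[OF G(2)]) (use L2_fourier_unique[OF G(1) f] in \<open>auto elim: AE_mp\<close>)
qed

lemma fourier_multiplier_cong:
 assumes "AE x in lborel. f x = g x" "sqint f" "sqint g"
 shows "fourier_multiplier m f = fourier_multiplier m g"
proof -
 have "(LBINT x. f x * fourier phi x) = (LBINT x. g x * fourier phi x)" if "schwartz phi" for phi
 proof (rule integral_cong_AE)
  have [measurable]: "phi \<in> BM" using schwartz_measurable[OF that] .
  show "(%x. f x * fourier phi x) \<in> borel_measurable lborel" "(%x. g x * fourier phi x) \<in> borel_measurable lborel" using assms(2,3) by auto
 qed (use assms(1) in \<open>auto elim: AE_mp\<close>)
 then have "L2_fourier f = L2_fourier g" using assms(2,3) by (auto simp: L2_fourier_def L2_complex_iff fun_eq_iff)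
 then show ?thesis unfolding fourier_multiplier_def by simp
qed

lemma fourier_multiplier_square:
 assumes m: "m \<in> BM" "!!xi. norm (m xi) <= M" and sq: "!!xi. m xi * m xi = 1 / (\<i> * of_real xi + of_real c)"
  and c: "c ~= 0" and h: "L1 h" "sqint h"
 shows "AE x in lborel. fourier_multiplier m (fourier_multiplier m h) x = Rop c h x"
proof (rule L2_fourier_inj)
 show "L2_fourier (Rop c h) (fourier (Rop c h))" by (intro L2_fourier_classical Rop_L1 Rop_L2 c h)
 show "L2_fourier (fourier_multiplier m (fourier_multiplier m h)) (%xi. m xi * (m xi * fourier h xi))"
  by (intro fourier_multiplier_fourier[OF m] L2_fourier_classical h)
 show "AE xi in lborel. m xi * (m xi * fourier h xi) = fourier (Rop c h) xi"
  by (simp add: fourier_Rop[OF c h(1)] mult.assoc[symmetric] sq)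
qed

definition half :: "real => real => complex" where "half c xi = (\<i> * of_real xi + of_real c) powr (- 1 / 2)"

lemma half_measurable [measurable]: "half c \<in> BM"
proof (rule borel_measurable_continuous_countable_exceptions[of "{0}"])
 have "continuous_on (- {0}) (%xi. exp (- 1 / 2 * Ln (\<i> * of_real xi + of_real c)))"
  by (intro continuous_intros) (auto simp: complex_nonpos_Reals_iff)
 then show "continuous_on (- {0}) (half c)"
  by (rule continuous_on_eq) (auto simp: half_def powr_def complex_eq_iff)
qed simp

lemma half_sq: "half c xi * half c xi = 1 / (\<i> * of_real xi + of_real c)"
proof (cases "\<i> * of_real xi + complex_of_real c = 0")
 case False
 have "half c xi * half c xi = (\<i> * of_real xi + of_real c) powr (- 1)"
  unfolding half_def powr_add[symmetric] by simp
 then show ?thesis using False by (simp add: powr_minus field_simps)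
qed (simp add: half_def)

lemma norm_half_sq: "(norm (half c xi))^2 = 1 / sqrt (xi^2 + c^2)"
proof -
 have "(norm (half c xi))^2 = norm (half c xi * half c xi)" by (simp add: norm_mult power2_eq_square)
 also have "... = 1 / sqrt (xi^2 + c^2)" unfolding half_sq norm_divide norm_one by (simp add: cmod_def add.commute)
 finally show ?thesis .
qed

lemma norm_half_bound: "\<bar>c\<bar> \<ge> 1 ==> (norm (half c xi))\<^sup>2 <= 1 / sqrt (1 + xi^2)" "\<bar>c\<bar> \<ge> 1 ==> norm (half c xi) <= 1"
proof -
 assume c: "\<bar>c\<bar> \<ge> 1"
 then have "1 <= c^2" by (simp add: abs_le_square_iff[of 1 c, simplified])
 then have "sqrt (1 + xi^2) <= sqrt (xi^2 + c^2)" by simp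
 then show a: "(norm (half c xi))^2 <= 1 / sqrt (1 + xi^2)" unfolding norm_half_sq by (intro frac_le) (auto intro: add_pos_nonneg)
 have "1 / sqrt (1 + xi^2) <= 1 / 1" by (intro frac_le) auto
 then have "(norm (half c xi))^2 <= 1^2" using a by simp
 then show "norm (half c xi) <= 1" by (rule power2_le_imp_le) simp
qed

section \<open>Traces of products of multiplication and resolvent operators\<close>

definition hop :: "real => (real => complex) => (real => complex) => real => complex" where
 "hop c a f = Rop c (%y. a y * f y)"

text \<open>Bounded operators on bounded functions that commute with integrals over a parameter and respect dominated convergence. This replaces an explicit integral kernel for products of resolvents.\<close>

definition good_op :: "((real => complex) => real => complex) => real => bool" where
 "good_op V C \<longleftrightarrow> 0 <= C \<and>
  (\<forall>phi M. phi \<in> BM --> (\<forall>y. norm (phi y) <= M) --> V phi \<in> BM \<and> (\<forall>x. norm (V phi x) <= C * M)) \<and>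
  (\<forall>w \<Phi> M. L1 w --> (%(eta, y). \<Phi> eta y) \<in> borel_measurable (borel \<Otimes>\<^sub>M borel) --> (\<forall>eta y. norm (\<Phi> eta y) <= M) -->
   (%(eta, x). V (\<Phi> eta) x) \<in> borel_measurable (borel \<Otimes>\<^sub>M borel) \<and>
   V (%y. LBINT eta. w eta * \<Phi> (eta::real) y) = (%x. LBINT eta. w eta * V (\<Phi> eta) x)) \<and>
  (\<forall>phi psi M x. (\<forall>n::nat. phi n \<in> BM \<and> (\<forall>y. norm (phi n y) <= M)) --> psi \<in> BM -->
   (AE y in lborel. (%n. phi n y) -->> psi y) --> (%n. V (phi n) x) -->> V psi x)"

lemma good_op_hop:
 assumes c: "c ~= 0" and a: "L1 a"
 shows "good_op (hop c a) (LBINT x. norm (a x))"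
 unfolding good_op_def
proof (intro conjI allI impI)
 have [measurable]: "a \<in> BM" using a by auto
 have ka: "L1 (%y. ker c (x - y) * a y)" for x by (rule Rop_integrable_L1[OF a])
 show "0 <= (LBINT x. norm (a x))" by simp
 {
  fix phi :: "real => complex" and M x assume [measurable]: "phi \<in> BM" and M: "\<forall>y. norm (phi y) <= M"
  show "hop c a phi \<in> BM" unfolding hop_def by measurable
  have b: "norm (a y * phi y) <= norm (a y) * M" for y unfolding norm_mult using M by (intro mult_left_mono) auto
  have i: "L1 (%y. a y * phi y)"
   by (rule L1_bound[of _ "%y. norm (a y) * M"]) (use a in \<open>auto intro!: order_trans[OF b]\<close>)
  have "norm (hop c a phi x) <= (LBINT y. norm (a y * phi y))" unfolding hop_def by (rule Rop_bound_L1[OF i])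
  also have "... <= (LBINT y. norm (a y) * M)" by (intro integral_mono b) (use i a in auto)
  finally show "norm (hop c a phi x) <= (LBINT x. norm (a x)) * M" by simp
 }
 {
  fix w :: "real => complex" and \<Phi> :: "real => real => complex" and M assume w: "L1 w" and P [measurable]: "(%(eta, y). \<Phi> eta y) \<in> borel_measurable (borel \<Otimes>\<^sub>M borel)" and M: "\<forall>eta y. norm (\<Phi> (eta::real) y) <= M"
  show "(%(eta, x). hop c a (\<Phi> eta) x) \<in> borel_measurable (borel \<Otimes>\<^sub>M borel)" unfolding hop_def Rop_def by measurable
  show "hop c a (%y. LBINT eta. w eta * \<Phi> eta y) = (%x. LBINT eta. w eta * hop c a (\<Phi> eta) x)"
  proof
   fix x
   have m: "(%(y, eta). \<Phi> eta y) \<in> borel_measurable (borel \<Otimes>\<^sub>M borel)" by measurable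
   have "hop c a (%y. LBINT eta. w eta * \<Phi> eta y) x = (LBINT y. (ker c (x - y) * a y) * (LBINT eta. \<Phi> eta y * w eta))"
    unfolding hop_def Rop_def by (simp add: mult_ac)
   also have "... = (LBINT eta. w eta * (LBINT y. \<Phi> eta y * (ker c (x - y) * a y)))"
    by (rule prod_swap[OF ka w m]) (use M in blast)
   finally show "hop c a (%y. LBINT eta. w eta * \<Phi> eta y) x = (LBINT eta. w eta * hop c a (\<Phi> eta) x)"
    unfolding hop_def Rop_def by (simp add: mult_ac)
  qed
 }
 {
  fix phi :: "nat => real => complex" and psi M x
  assume P: "\<forall>n::nat. phi n \<in> BM \<and> (\<forall>y. norm (phi n y) <= M)" and [measurable]: "psi \<in> BM" and l: "AE y in lborel. (%n. phi n y) -->> psi y"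
  have [measurable]: "phi n \<in> BM" for n using P by blast
  show "(%n. hop c a (phi n) x) -->> hop c a psi x"
   unfolding hop_def Rop_def
  proof (rule integral_dominated_convergence[where w = "%y. norm (ker c (x - y) * a y) * M"])
   show "L1 (%y. norm (ker c (x - y) * a y) * M)" using ka by simp
   show "AE y in lborel. (%n. ker c (x - y) * (a y * phi n y)) -->> ker c (x - y) * (a y * psi y)"
    using l by eventually_elim (intro tendsto_intros)
   show "AE y in lborel. norm (ker c (x - y) * (a y * phi n y)) <= norm (ker c (x - y) * a y) * M" for n
    unfolding mult.assoc[symmetric] norm_mult[of "_ * _" "phi n _"] using P by (intro AE_I2 mult_left_mono) auto
  qed measurable
 }
qed

lemma good_op_comp:
 assumes V: "good_op V C" and W: "good_op W D"
 shows "good_op (%phi. V (W phi)) (C * D)"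
 unfolding good_op_def
proof (intro conjI allI impI)
 note V1 = V[unfolded good_op_def, THEN conjunct2, THEN conjunct1, rule_format]
 note W1 = W[unfolded good_op_def, THEN conjunct2, THEN conjunct1, rule_format]
 note V2 = V[unfolded good_op_def, THEN conjunct2, THEN conjunct2, THEN conjunct1, rule_format]
 note W2 = W[unfolded good_op_def, THEN conjunct2, THEN conjunct2, THEN conjunct1, rule_format]
 note V3 = V[unfolded good_op_def, THEN conjunct2, THEN conjunct2, THEN conjunct2, rule_format]
 note W3 = W[unfolded good_op_def, THEN conjunct2, THEN conjunct2, THEN conjunct2, rule_format]
 show "0 <= C * D" using V W unfolding good_op_def by simp
 {
  fix phi :: "real => complex" and M x assume p: "phi \<in> BM" "\<forall>y. norm (phi y) <= M"
  have w: "W phi \<in> BM" "!!x. norm (W phi x) <= D * M" using W1[OF p(1)] p(2) by blast+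
  show "V (W phi) \<in> BM" "norm (V (W phi) x) <= C * D * M" using V1[OF w] by (auto simp: mult.assoc)
 }
 {
  fix w :: "real => complex" and \<Phi> :: "real => real => complex" and M assume w: "L1 w" and P: "(%(eta, y). \<Phi> eta y) \<in> borel_measurable (borel \<Otimes>\<^sub>M borel)" and M: "\<forall>eta y. norm (\<Phi> (eta::real) y) <= M"
  note W2' = W2[OF w P M[rule_format]]
  have "\<Phi> eta \<in> BM" for eta using measurable_compose[OF measurable_Pair1'[of eta borel borel] P] by simp
  then have b: "norm (W (\<Phi> eta) y) <= D * M" for eta y using W1 M by blast
  note V2' = V2[OF w W2'[THEN conjunct1] b]
  show "(%(eta, x). V (W (\<Phi> eta)) x) \<in> borel_measurable (borel \<Otimes>\<^sub>M borel)" using V2' by blast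
  show "V (W (%y. LBINT eta. w eta * \<Phi> eta y)) = (%x. LBINT eta. w eta * V (W (\<Phi> eta)) x)"
   using V2' W2' by simp
 }
 {
  fix phi :: "nat => real => complex" and psi M x
  assume P: "\<forall>n::nat. phi n \<in> BM \<and> (\<forall>y. norm (phi n y) <= M)" and m: "psi \<in> BM" and l: "AE y in lborel. (%n. phi n y) -->> psi y"
  have w: "W (phi n) \<in> BM \<and> (\<forall>y. norm (W (phi n) y) <= D * M)" for n using W1[of "phi n" M] P by blast
  have lim: "(%n. W (phi n) x) -->> W psi x" for x using W3[OF _ m l, of M] P by blast
  have "W psi \<in> BM" using w by (intro borel_measurable_LIMSEQ_metric[OF _ lim]) blast
  then show "(%n. V (W (phi n)) x) -->> V (W psi) x" using V3[OF _ _ AE_I2, of "%n. W (phi n)" "D * M" "W psi"] w lim by blast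
 }
qed

lemma hop_sq:
 assumes c: "c ~= 0" and a: "a \<in> BM" "!!x. norm (a x) <= A" and f: "sqint f"
 shows "sqint (hop c a f)" "L2_norm (hop c a f) <= A / \<bar>c\<bar> * L2_norm f"
proof -
 have s: "sqint (%y. a y * f y)" by (rule sq_integrable_bounded_mult[OF f a])
 show "sqint (hop c a f)" unfolding hop_def by (rule Rop_L2(1)[OF c s])
 have "L2_norm (hop c a f) <= L2_norm (%y. a y * f y) / \<bar>c\<bar>" unfolding hop_def by (rule Rop_L2(2)[OF c s])
 also have "... <= (A * L2_norm f) / \<bar>c\<bar>" by (intro divide_right_mono L2_norm_bounded_mult[OF f a]) auto
 finally show "L2_norm (hop c a f) <= A / \<bar>c\<bar> * L2_norm f" by simp
qed

lemma hop_cong_AE: "AE x in lborel. f x = g x ==> f \<in> BM ==> g \<in> BM ==> a \<in> BM ==> hop c a f = hop c a g"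
 unfolding hop_def by (rule Rop_cong_AE) (auto elim: AE_mp)

lemma hop_linear:
 assumes c: "c ~= 0" and a: "a \<in> BM" "!!x. norm (a x) <= A" and f: "sqint f" and g: "sqint g"
 shows "hop c a (%x. f x - k * g x) = (%x. hop c a f x - k * hop c a g x)"
proof
 fix x
 have "sqint (%y. a y * f y)" "sqint (%y. a y * g y)" using sq_integrable_bounded_mult[OF f a] sq_integrable_bounded_mult[OF g a] .
 then have i: "L1 (%y. ker c (x - y) * (a y * f y))" "L1 (%y. ker c (x - y) * (a y * g y))"
  using Rop_integrable_L2[OF c] by blast+
 have "hop c a (%x. f x - k * g x) x = (LBINT y. ker c (x - y) * (a y * f y) - k * (ker c (x - y) * (a y * g y)))"
  unfolding hop_def Rop_def by (rule int_cong) (simp_all add: algebra_simps)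
 also have "... = hop c a f x - k * hop c a g x" unfolding hop_def Rop_def using i by simp
 finally show "hop c a (%x. f x - k * g x) x = hop c a f x - k * hop c a g x" .
qed

lemma three_quarters_integrable: "L1 (%eta::real. (1 + eta^2) powr (- 3 / 4))"
proof (rule L1_bound)
 let ?p = "%x::real. indicator {1..} x * x powr (- 3 / 2)"
 have "(%x::real. x powr (- 3 / 2)) integrable_on {1..}" using has_integral_powr_to_inf[of "- 3 / 2" 1] by (auto simp: integrable_on_def)
 then have "(%x::real. x powr (- 3 / 2)) absolutely_integrable_on {1..}" by (rule nonnegative_absolutely_integrable_1) simp
 then have "integrable (completion lborel) ?p" unfolding set_integrable_def by simp
 then have p: "L1 ?p" by (subst (asm) integrable_completion) auto
 show "L1 (%eta. ?p eta + ?p (- eta) + indicator {- 1..1} eta)"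
  using lborel_integrable_shift(3)[OF p] p by (intro Bochner_Integration.integrable_add integrable_real_indicator) auto
 show "AE eta in lborel. norm ((1 + eta^2) powr (- 3 / 4)) <= norm (?p eta + ?p (- eta) + indicator {- 1..1} eta)"
 proof (rule AE_I2)
  fix eta :: real
  have nn: "0 <= ?p x" for x by simp
  have big: "(1 + eta^2) powr (- 3 / 4) <= \<bar>eta\<bar> powr (- 3 / 2)" if "\<bar>eta\<bar> \<ge> 1"
  proof -
   have "(1 + eta^2) powr (- 3 / 4) <= (\<bar>eta\<bar> powr 2) powr (- 3 / 4)" using that by (intro powr_mono2') (auto simp: powr_numeral)
   then show ?thesis by (simp only: powr_powr) simp
  qed
  have "(1 + eta^2) powr (- 3 / 4) <= ?p eta + ?p (- eta) + indicator {- 1..1} eta"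
  proof (cases "\<bar>eta\<bar> <= 1")
   case True
   have "(1 + eta^2) powr (- 3 / 4) <= 1 powr (- 3 / 4)" by (intro powr_mono2') auto
   moreover have "indicator {- 1..1} eta = (1::real)" using True by (simp add: abs_le_iff)
   ultimately show ?thesis using nn[of eta] nn[of "- eta"] by (simp only: powr_one_eq_one)
  next
   case False
   then consider "eta > 1" | "eta < - 1" by linarith
   then show ?thesis using big by cases auto
  qed
  then show "norm ((1 + eta^2) powr (- 3 / 4)) <= norm (?p eta + ?p (- eta) + indicator {- 1..1} eta)" by simp
 qed
qed measurable

text \<open>Weights at different frequencies are comparable up to a power of their distance.\<close>

lemma peetre: "1 / sqrt (1 + xi^2) <= sqrt 2 * (1 + (xi - eta)^2) * (1 / sqrt (1 + eta^2))"
proof -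
 have "1 + eta^2 <= 2 * (1 + (xi - eta)^2) * (1 + xi^2)"
 proof -
  have "eta^2 <= 2 * (xi - eta)^2 + 2 * xi^2" using zero_le_power2[of "2 * xi - eta"] by (simp add: power2_eq_square algebra_simps)
  moreover have "2 * (1 + d) * (1 + x) = 2 + 2 * d + 2 * x + 2 * (d * x)" for d x :: real by (simp add: algebra_simps)
  moreover have "0 <= (xi - eta)^2 * xi^2" by simp
  ultimately show ?thesis by (smt (verit))
 qed
 also have "... <= 2 * (1 + (xi - eta)^2)\<^sup>2 * (1 + xi^2)"
 proof -
  have "1 + d <= (1 + d)^2" if "0 <= d" for d :: real using that by (simp add: power2_eq_square algebra_simps)
  then show ?thesis by (intro mult_mono) auto
 qed
 finally have "sqrt (1 + eta^2) <= sqrt (2 * (1 + (xi - eta)^2)\<^sup>2 * (1 + xi^2))" by simp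
 also have "... = sqrt 2 * (1 + (xi - eta)^2) * sqrt (1 + xi^2)" unfolding real_sqrt_mult real_sqrt_abs by (simp add: abs_of_nonneg)
 finally have "sqrt (1 + eta^2) / (sqrt (1 + xi^2) * sqrt (1 + eta^2)) <= sqrt 2 * (1 + (xi - eta)^2) * sqrt (1 + xi^2) / (sqrt (1 + xi^2) * sqrt (1 + eta^2))"
  by (rule divide_right_mono) simp
 moreover have "sqrt (1 + xi^2) ~= 0" "sqrt (1 + eta^2) ~= 0" by (simp_all add: add_nonneg_eq_0_iff)
 ultimately show ?thesis by simp
qed

text \<open>Decay of the transform of $a$ makes the square roots of the resolvents Hilbert--Schmidt after multiplication by $a$; $b$ only has to be bounded and integrable.\<close>

locale trace_setup =
 fixes sig :: real and a b :: "real => complex"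
 assumes sigma: "1 <= \<bar>sig\<bar>" and pa: "potential a" and pb: "potential b"
  and decay: "\<exists>C. \<forall>xi. norm (fourier a xi) <= C / (1 + xi^2)"
begin

abbreviation "P \<equiv> fourier_multiplier (half sig)"
abbreviation "N \<equiv> fourier_multiplier (half (- sig))"
abbreviation "T \<equiv> hop sig a"
abbreviation "S \<equiv> hop (- sig) b"
definition "W n = (T \<circ> S) ^^ n"

lemma W_0 [simp]: "W 0 f = f" and W_Suc [simp]: "W (Suc n) f = T (S (W n f))"
 unfolding W_def by simp_all

lemma s0: "sig ~= 0" "- sig ~= 0" using sigma by auto

lemma a: "L1 a" "a \<in> BM" "sqint a" "\<exists>A. \<forall>x. norm (a x) <= A"
 and b: "L1 b" "b \<in> BM" "sqint b" "\<exists>B. \<forall>x. norm (b x) <= B"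
 using pa pb potential_sq_integrable unfolding potential_def by auto

lemma [measurable]: "a \<in> BM" "b \<in> BM" by (rule a b)+

lemma half1: "norm (half sig xi) <= 1" "norm (half (- sig) xi) <= 1" using sigma by (simp_all add: norm_half_bound)

lemma P_fourier: "L2_fourier f F ==> L2_fourier (P f) (%xi. half sig xi * F xi)"
 by (rule fourier_multiplier_fourier[OF half_measurable half1(1)])

lemma P_sq: "sqint f ==> sqint (P f)"
 using L2_fourier_total P_fourier L2_fourier_sq by blast

lemma P_norm: "sqint f ==> L2_norm (P f) <= L2_norm f"
proof -
 assume "sqint f"
 then obtain F where F: "L2_fourier f F" using L2_fourier_total by blast
 have "L2_norm (P f) <= 1 * L2_norm F" unfolding L2_fourier_isometry[OF P_fourier[OF F], symmetric]
  by (rule L2_norm_bounded_mult[OF L2_fourier_sq(2)[OF F] half_measurable half1(1)])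
 then show ?thesis using L2_fourier_isometry[OF F] by simp
qed

lemma P_linear:
 assumes "sqint f" "sqint g"
 shows "AE x in lborel. P (%x. f x - k * g x) x = P f x - k * P g x"
proof -
 obtain F G where F: "L2_fourier f F" "L2_fourier g G" using L2_fourier_total assms by blast
 show ?thesis
  by (rule L2_fourier_inj[OF P_fourier[OF L2_fourier_diff_cmult[OF F]] L2_fourier_diff_cmult[OF P_fourier[OF F(1)] P_fourier[OF F(2)]]])
   (simp add: algebra_simps)
qed

lemma PP: "L1 h ==> sqint h ==> AE x in lborel. P (P h) x = Rop sig h x"
 by (rule fourier_multiplier_square[OF half_measurable half1(1) half_sq s0(1)])

lemma NN: "L1 h ==> sqint h ==> AE x in lborel. N (N h) x = Rop (- sig) h x"
 by (rule fourier_multiplier_square[OF half_measurable half1(2) half_sq s0(2)])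

lemma mult_L1_L2:
 assumes "sqint f"
 shows "L1 (%x. a x * f x)" "sqint (%x. a x * f x)" "L1 (%x. b x * f x)" "sqint (%x. b x * f x)"
 using assms a b sq_integrable_mult sq_integrable_bounded_mult by blast+

lemma T_sq: "sqint f ==> sqint (T f)" and S_sq: "sqint f ==> sqint (S f)"
 using hop_sq(1) a b s0 by blast+

lemma W_sq: "sqint f ==> sqint (W n f)"
 by (induction n) (auto intro: T_sq S_sq)

lemma W_bound: "\<exists>K\<ge>0. \<forall>f. sqint f --> L2_norm (W n f) <= K * L2_norm f"
proof (induction n)
 case (Suc n)
 then obtain K where K: "K \<ge> 0" "!!f. sqint f ==> L2_norm (W n f) <= K * L2_norm f" by blast
 obtain A where A: "!!x. norm (a x) <= A" using a(4) by blast
 obtain B where B: "!!x. norm (b x) <= B" using b(4) by blast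
 have AB: "A \<ge> 0" "B \<ge> 0" using order_trans[OF norm_ge_zero A] order_trans[OF norm_ge_zero B] .
 have "L2_norm (W (Suc n) f) <= (A / \<bar>sig\<bar> * (B / \<bar>- sig\<bar> * K)) * L2_norm f" if f: "sqint f" for f
 proof -
  have "L2_norm (W (Suc n) f) <= A / \<bar>sig\<bar> * L2_norm (S (W n f))" using hop_sq(2)[OF s0(1) a(2) A S_sq[OF W_sq[OF f]]] by simp
  also have "... <= A / \<bar>sig\<bar> * (B / \<bar>- sig\<bar> * L2_norm (W n f))" using AB by (intro mult_left_mono hop_sq(2)[OF s0(2) b(2) B W_sq[OF f]]) auto
  also have "... <= A / \<bar>sig\<bar> * (B / \<bar>- sig\<bar> * (K * L2_norm f))" using AB by (intro mult_left_mono K f) auto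
  finally show ?thesis by (simp add: mult.assoc)
 qed
 then show ?case using AB K(1) by (intro exI[of _ "A / \<bar>sig\<bar> * (B / \<bar>- sig\<bar> * K)"]) auto
qed (auto intro!: exI[of _ 1])

lemma W_cong_AE: "AE x in lborel. f x = g x ==> sqint f ==> sqint g ==> AE x in lborel. W n f x = W n g x"
proof (induction n)
 case (Suc n)
 have "S (W n f) = S (W n g)" by (rule hop_cong_AE[OF Suc.IH[OF Suc.prems]]) (use Suc.prems W_sq b(2) in auto)
 then show ?case by simp
qed simp

lemma W_linear:
 assumes f: "sqint f" and g: "sqint g"
 shows "AE x in lborel. W n (P (%x. f x - k * g x)) x = W n (P f) x - k * W n (P g) x"
proof (induction n)
 case 0
 show ?case using P_linear[OF f g] by simp
next
 case (Suc n)
 obtain A where A: "!!x. norm (a x) <= A" using a(4) by blast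
 obtain B where B: "!!x. norm (b x) <= B" using b(4) by blast
 have s: "sqint (W n (P f))" "sqint (W n (P g))" "sqint (W n (P (%x. f x - k * g x)))"
  by (intro W_sq P_sq sq_integrable_diff sq_integrable_cmult f g)+
 have s': "sqint (%x. W n (P f) x - k * W n (P g) x)" by (intro sq_integrable_diff sq_integrable_cmult s)
 have "S (W n (P (%x. f x - k * g x))) = S (%x. W n (P f) x - k * W n (P g) x)"
  by (intro hop_cong_AE Suc b) (use s s' in auto)
 then show ?case using hop_linear[OF s0(2) b(2) B s(1,2), of k] hop_linear[OF s0(1) a(2) A S_sq[OF s(1)] S_sq[OF s(2)], of k] by simp
qed

text \<open>The functional that reads off one frequency of the innermost part of $(\Lambda\Gamma)^{n+1}$.\<close>

definition ell :: "nat => real => (real => complex) => complex" where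
 "ell n eta f = fourier (%x. b x * W n (P f) x) eta"

lemma u_L1_L2: "sqint f ==> L1 (%x. b x * W n (P f) x)" "sqint f ==> sqint (%x. b x * W n (P f) x)"
 by (intro mult_L1_L2 W_sq P_sq; assumption)+

lemma fourier_cong_AE: "AE x in lborel. f x = g x ==> f \<in> BM ==> g \<in> BM ==> fourier f eta = fourier g eta"
 unfolding fourier_wave by (intro arg_cong[where f = "(*) c0"] integral_cong_AE) (auto elim: AE_mp)

lemma ell_linear:
 assumes f: "sqint f" and g: "sqint g"
 shows "ell n eta (%x. f x - k * g x) = ell n eta f - k * ell n eta g"
proof -
 have s: "sqint (%x. f x - k * g x)" by (intro sq_integrable_diff sq_integrable_cmult f g)
 have "ell n eta (%x. f x - k * g x) = fourier (%x. b x * W n (P f) x - k * (b x * W n (P g) x)) eta"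
  unfolding ell_def
 proof (rule fourier_cong_AE)
  show "AE x in lborel. b x * W n (P (%x. f x - k * g x)) x = b x * W n (P f) x - k * (b x * W n (P g) x)"
   using W_linear[OF f g, of n k] by eventually_elim (simp add: right_diff_distrib mult.left_commute)
 qed (use u_L1_L2(2)[OF f] u_L1_L2(2)[OF g] u_L1_L2(2)[OF s] in auto)
 also have "... = ell n eta f - k * ell n eta g"
  unfolding ell_def using fourier_diff[OF u_L1_L2(1)[OF f] integrable_mult_right[OF u_L1_L2(1)[OF g], of k]] fourier_cmult by simp
 finally show ?thesis .
qed

lemma ell_bound: "\<exists>K\<ge>0. \<forall>f eta. sqint f --> norm (ell n eta f) <= K * L2_norm f"
proof -
 obtain K where K: "K \<ge> 0" "!!f. sqint f ==> L2_norm (W n f) <= K * L2_norm f" using W_bound by blast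
 have "norm (ell n eta f) <= (L2_norm b * K) * L2_norm f" if f: "sqint f" for f eta
 proof -
  have "norm (ell n eta f) <= (LBINT x. norm (b x) * norm (W n (P f) x))" unfolding ell_def norm_mult[symmetric] by (rule fourier_bound[OF u_L1_L2(1)[OF f]])
  also have "... <= L2_norm b * L2_norm (W n (P f))" by (intro Cauchy_Schwarz_integral b W_sq P_sq f)
  also have "... <= L2_norm b * (K * L2_norm f)" by (intro mult_left_mono order_trans[OF K(2)[OF P_sq[OF f]]] P_norm f K(1)) auto
  finally show ?thesis by (simp add: mult.assoc)
 qed
 then show ?thesis using K(1) by (intro exI[of _ "L2_norm b * K"]) auto
qed

lemma ell_expansion:
 assumes e: "L2_basis e"
 shows "ell n eta (pexpand e f M) = (\<Sum>j<M. ip (e j) f * ell n eta (e j))"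
proof (induction M)
 case 0
 have "ell n eta (%x. 0 - 1 * 0) = ell n eta (%_. 0) - 1 * ell n eta (%_. 0)" by (rule ell_linear[OF sq_integrable_zero sq_integrable_zero])
 then show ?case by (simp add: pexpand_def)
next
 case (Suc M)
 have "pexpand e f (Suc M) = (%x. pexpand e f M x - (- ip (e M) f) * e M x)" by (simp add: pexpand_def fun_eq_iff)
 then show ?case using ell_linear[OF pexpand_sq[OF e] L2_basis_sq[OF e], of n eta f M "- ip (e M) f" M] Suc by simp
qed

definition X :: "real => real => complex" where "X eta = P (%x. a x * wave eta x)"

lemma aw: "L1 (%x. a x * wave eta x)" "sqint (%x. a x * wave eta x)"
 using wave_integrable[OF a(1), of eta] sq_integrable_bounded_mult[OF a(3), of "wave eta" 1] by (simp_all add: mult.commute)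

lemma X_sq: "sqint (X eta)" unfolding X_def by (intro P_sq aw)

text \<open>The half power of the resolvent gains $\xi^{-1/2}$, and the decay of the transform of $a$ transfers this weight to $\eta$.\<close>

lemma X_bound: "\<exists>K\<ge>0. \<forall>eta. L2_norm (X eta) <= K * (1 + eta^2) powr (- 1 / 4)"
proof -
 obtain C where C: "!!xi. norm (fourier a xi) <= C / (1 + xi^2)" using decay by blast
 have C0: "C \<ge> 0" using order_trans[OF norm_ge_zero C[of 0]] by simp
 let ?I = "LBINT u. 1 / (1 + (u::real)^2)"
 let ?K = "sqrt (C^2 * sqrt 2 * ?I)"
 have I0: "?I \<ge> 0" by simp
 have "L2_norm (X eta) <= ?K * (1 + eta^2) powr (- 1 / 4)" for eta
 proof -
  have F: "fourier (%x. a x * wave eta x) xi = fourier a (xi - eta)" for xi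
  proof -
   have ww: "wave (- xi) x * (a x * wave eta x) = wave (- (xi - eta)) x * a x" for x using wave_add_left[of "- xi" eta x] by (simp add: mult_ac)
   show ?thesis unfolding fourier_wave ww ..
  qed
  have LX: "L2_fourier (X eta) (%xi. half sig xi * fourier a (xi - eta))"
   unfolding X_def F[symmetric] by (intro P_fourier L2_fourier_classical aw)
  have "(L2_norm (X eta))^2 = (LBINT xi. (norm (half sig xi * fourier a (xi - eta)))\<^sup>2)"
   unfolding L2_fourier_isometry[OF LX, symmetric] unfolding L2_norm_def by simp
  also have "... <= (LBINT xi. (C^2 * sqrt 2 * (1 / sqrt (1 + eta^2))) * (1 / (1 + (xi - eta)^2)))"
  proof (rule integral_mono)
   show "L1 (%xi. (norm (half sig xi * fourier a (xi - eta)))\<^sup>2)" using L2_fourier_sq(2)[OF LX] by (simp add: sqint_def)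
   show "L1 (%xi. (C^2 * sqrt 2 * (1 / sqrt (1 + eta^2))) * (1 / (1 + (xi - eta)^2)))"
    by (intro integrable_mult_right lborel_integrable_shift(2)[OF inverse_square_integrable])
   fix xi :: real
   have p: "1 + (xi - eta)^2 > 0" by (simp add: add_pos_nonneg)
   have "(norm (half sig xi * fourier a (xi - eta)))^2 = (norm (half sig xi))^2 * (norm (fourier a (xi - eta)))^2" by (simp add: norm_mult power_mult_distrib)
   also have "... <= (sqrt 2 * (1 + (xi - eta)^2) * (1 / sqrt (1 + eta^2))) * (C / (1 + (xi - eta)^2))\<^sup>2"
    using C0 p by (intro mult_mono order_trans[OF norm_half_bound(1)[OF sigma] peetre] power_mono C) auto
   also have "... = (C^2 * sqrt 2 * (1 / sqrt (1 + eta^2))) * (1 / (1 + (xi - eta)^2))"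
   proof -
    have gen: "s * d * h * (C / d)^2 = C^2 * s * h * (1 / d)" if "d ~= 0" for s d h :: real using that by (simp add: power2_eq_square field_simps)
    show ?thesis by (rule gen) (use p in simp)
   qed
   finally show "(norm (half sig xi * fourier a (xi - eta)))^2 <= ..." .
  qed
  also have "... = (C^2 * sqrt 2 * (1 / sqrt (1 + eta^2))) * ?I" unfolding integral_mult_right_zero lborel_integral_shift(2)[of "%u. 1 / (1 + u^2)" eta] ..
  also have "... = (?K * (1 + eta^2) powr (- 1 / 4))\<^sup>2"
  proof -
   have "((1 + eta^2) powr (- 1 / 4))\<^sup>2 = (1 + eta^2) powr (- 1 / 2)" unfolding power2_eq_square powr_add[symmetric] by simp
   also have "... = 1 / sqrt (1 + eta^2)" by (simp add: powr_minus_divide powr_half_sqrt add_nonneg_nonneg)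
   finally have e: "((1 + eta^2) powr (- 1 / 4))\<^sup>2 = 1 / sqrt (1 + eta^2)" .
   have K2: "?K\<^sup>2 = C^2 * sqrt 2 * ?I" using I0 by (intro real_sqrt_pow2 mult_nonneg_nonneg) auto
   have K3: "(?K * y)^2 = (C^2 * sqrt 2 * ?I) * y^2" for y unfolding power_mult_distrib[of ?K y] K2 ..
   show ?thesis unfolding K3 e by (simp only: mult_ac)
  qed
  finally show ?thesis by (rule power2_le_imp_le) simp
 qed
 moreover have "?K \<ge> 0" using I0 by (intro real_sqrt_ge_zero mult_nonneg_nonneg) auto
 ultimately show ?thesis by blast
qed

lemma resolvent_bound: "norm (1 / (\<i> * of_real eta + of_real (- sig)) :: complex) <= (1 + eta^2) powr (- 1 / 2)"
proof -
 have "norm (1 / (\<i> * of_real eta + of_real (- sig)) :: complex) = (norm (half (- sig) eta))^2" unfolding half_sq[symmetric] by (simp add: norm_mult power2_eq_square)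
 also have "... <= 1 / sqrt (1 + eta^2)" using sigma by (intro norm_half_bound) simp
 also have "... = (1 + eta^2) powr (- 1 / 2)" by (simp add: powr_minus_divide powr_half_sqrt add_nonneg_nonneg)
 finally show ?thesis .
qed

definition adj :: "(real => complex) => real => complex" where "adj = fourier_multiplier (%xi. cnj (half sig xi))"

lemma cnj_half [measurable]: "(%xi. cnj (half sig xi)) \<in> BM"
proof -
 have "cnj \<in> BM" by (intro borel_measurable_continuous_onI continuous_intros)
 from measurable_compose[OF half_measurable this] show ?thesis .
qed

lemma adj:
 assumes "sqint e"
 shows "sqint (adj e)" "sqint V ==> ip e (P V) = ip (adj e) V"
proof -
 obtain E where E: "L2_fourier e E" using L2_fourier_total[OF assms] by blast
 have A: "L2_fourier (adj e) (%xi. cnj (half sig xi) * E xi)" unfolding adj_def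
  by (rule fourier_multiplier_fourier[OF cnj_half, of 1]) (use half1 E in auto)
 then show "sqint (adj e)" by (rule L2_fourier_sq)
 assume "sqint V"
 then obtain F where F: "L2_fourier V F" using L2_fourier_total by blast
 show "ip e (P V) = ip (adj e) V" unfolding parseval[OF E P_fourier[OF F]] parseval[OF A F] by (simp add: L2_inner_def mult_ac)
qed

definition probe :: "(real => complex) => real => complex" where "probe e = fourier (%x. cnj (a x) * adj e x)"

lemma probe:
 assumes e: "sqint e"
 shows "cnj (probe e eta) = c0 * ip e (X eta)" "sqint (probe e)" "probe e \<in> BM"
  "L2_fourier (%x. cnj (a x) * adj e x) (probe e)"
proof -
 have i: "L1 (%x. cnj (a x) * adj e x)" using ip_integrable[OF a(3) adj(1)[OF e]] .
 obtain A where A: "!!x. norm (a x) <= A" using a(4) by blast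
 have s: "sqint (%x. cnj (a x) * adj e x)"
  by (rule sq_integrable_bounded_mult[OF adj(1)[OF e], where M = A]) (use A sq_integrable_cnj[OF a(3)] in auto)
 show L: "L2_fourier (%x. cnj (a x) * adj e x) (probe e)" unfolding probe_def by (rule L2_fourier_classical[OF i s])
 then show "sqint (probe e)" by (rule L2_fourier_sq)
 then show "probe e \<in> BM" by auto
 show "cnj (probe e eta) = c0 * ip e (X eta)"
  unfolding probe_def fourier_wave X_def adj(2)[OF e aw(2)] unfolding L2_inner_def
  by (simp add: wave_minus c0_def mult_ac flip: Bochner_Integration.integral_cnj)
qed

text \<open>Parseval in the variable of the resolvent exhibits the operator as an integral of the rank-one operators $f \mapsto \ell_\eta(f) X_\eta$.\<close>

lemma ip_rank_one:
 assumes e: "sqint e" and f: "sqint f"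
 shows "ip e (P (%x. a x * S (W n (P f)) x)) = (LBINT eta. c0 * (ip e (X eta) * ell n eta f) / (\<i> * of_real eta + of_real (- sig)))"
  and "L1 (%eta. c0 * (ip e (X eta) * ell n eta f) / (\<i> * of_real eta + of_real (- sig)))"
proof -
 let ?u = "%x. b x * W n (P f) x"
 note u = u_L1_L2[OF f, of n]
 have sS: "sqint (S (W n (P f)))" by (intro S_sq W_sq P_sq f)
 have R: "L2_fourier (S (W n (P f))) (fourier (Rop (- sig) ?u))"
  unfolding hop_def[of "- sig" b "W n (P f)"] by (intro L2_fourier_classical Rop_L1 Rop_L2 s0 u)
 have pt: "cnj (probe e eta) * fourier (Rop (- sig) ?u) eta = c0 * (ip e (X eta) * ell n eta f) / (\<i> * of_real eta + of_real (- sig))" for eta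
  unfolding probe(1)[OF e] fourier_Rop[OF s0(2) u(1)] ell_def by simp
 have "ip e (P (%x. a x * S (W n (P f)) x)) = ip (adj e) (%x. a x * S (W n (P f)) x)" by (rule adj(2)[OF e mult_L1_L2(2)[OF sS]])
 also have "... = ip (%x. cnj (a x) * adj e x) (S (W n (P f)))" by (simp add: L2_inner_def mult_ac)
 also have "... = ip (probe e) (fourier (Rop (- sig) ?u))" by (rule parseval[OF probe(4)[OF e] R])
 finally show "ip e (P (%x. a x * S (W n (P f)) x)) = (LBINT eta. c0 * (ip e (X eta) * ell n eta f) / (\<i> * of_real eta + of_real (- sig)))"
  unfolding L2_inner_def[of "probe e"] pt .
 show "L1 (%eta. c0 * (ip e (X eta) * ell n eta f) / (\<i> * of_real eta + of_real (- sig)))"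
  unfolding pt[symmetric] by (rule ip_integrable[OF probe(2)[OF e] L2_fourier_sq(2)[OF R]])
qed

definition symb :: "nat => real => complex" where
 "symb n eta = c0 * ell n eta (X eta) / (\<i> * of_real eta + of_real (- sig))"

text \<open>The partial sums are $\ell_\eta$ applied to the expansion of $X_\eta$ in the basis. They converge to $\ell_\eta(X_\eta)$ and are dominated by $(1+\eta^2)^{-3/4}$.\<close>

lemma trace_sums:
 assumes e: "L2_basis e"
 shows "(%j. ip (e j) (P (%x. a x * S (W n (P (e j))) x))) sums (LBINT eta. symb n eta)" and "L1 (symb n)"
proof -
 note es = L2_basis_sq[OF e]
 obtain K where K: "K \<ge> 0" "!!f eta. sqint f ==> norm (ell n eta f) <= K * L2_norm f" using ell_bound by blast
 obtain L where L: "L \<ge> 0" "!!eta. L2_norm (X eta) <= L * (1 + eta^2) powr (- 1 / 4)" using X_bound by blast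
 let ?s = "%M eta. c0 * ell n eta (pexpand e (X eta) M) / (\<i> * of_real eta + of_real (- sig))"
 have se: "?s M = (%eta. \<Sum>j<M. c0 * (ip (e j) (X eta) * ell n eta (e j)) / (\<i> * of_real eta + of_real (- sig)))" for M
  unfolding ell_expansion[OF e] by (simp add: sum_distrib_left sum_divide_distrib)
 have i: "L1 (?s M)" for M unfolding se by (intro Bochner_Integration.integrable_sum ip_rank_one(2) es)
 have w: "L1 (%eta::real. (K * L) * (1 + eta^2) powr (- 3 / 4))" by (intro integrable_mult_right three_quarters_integrable)
 have lim: "(%M. ?s M eta) -->> symb n eta" for eta
 proof -
  have "(%M. ell n eta (pexpand e (X eta) M) - ell n eta (X eta)) -->> 0"
  proof (rule Lim_null_comparison)
   have "norm (ell n eta (%x. pexpand e (X eta) M x - 1 * X eta x)) <= K * L2_norm (%x. pexpand e (X eta) M x - 1 * X eta x)" for M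
    by (intro K(2) sq_integrable_diff sq_integrable_cmult pexpand_sq[OF e] X_sq)
   then show "\<forall>\<^sub>F M in sequentially. norm (ell n eta (pexpand e (X eta) M) - ell n eta (X eta)) <= K * L2_norm (%x. pexpand e (X eta) M x - X eta x)"
    unfolding ell_linear[OF pexpand_sq[OF e] X_sq] by simp
   show "(%M. K * L2_norm (%x. pexpand e (X eta) M x - X eta x)) -->> 0"
    using tendsto_mult_left[OF basis_expansion[OF e X_sq], of K eta] by simp
  qed
  then have "(%M. ell n eta (pexpand e (X eta) M)) -->> ell n eta (X eta)" by (simp add: LIM_zero_iff)
  then have "(%M. c0 * ell n eta (pexpand e (X eta) M) * (1 / (\<i> * of_real eta + of_real (- sig)))) -->> c0 * ell n eta (X eta) * (1 / (\<i> * of_real eta + of_real (- sig)))"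
   by (intro tendsto_mult tendsto_const)
  then show ?thesis unfolding symb_def by simp
 qed
 have bd: "norm (?s M eta) <= (K * L) * (1 + eta^2) powr (- 3 / 4)" for M eta
 proof -
  have "norm (ell n eta (pexpand e (X eta) M)) <= K * L2_norm (X eta)"
   by (rule order_trans[OF K(2)[OF pexpand_sq[OF e]]]) (intro mult_left_mono Bessel[OF e X_sq] K(1))
  also have "... <= K * (L * (1 + eta^2) powr (- 1 / 4))" by (intro mult_left_mono L K(1))
  finally have 1: "norm (ell n eta (pexpand e (X eta) M)) <= K * (L * (1 + eta^2) powr (- 1 / 4))" .
  have "norm (?s M eta) = norm c0 * norm (ell n eta (pexpand e (X eta) M)) * norm (1 / (\<i> * of_real eta + of_real (- sig)) :: complex)"
   by (simp add: norm_mult norm_divide)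
  also have "... <= 1 * (K * (L * (1 + eta^2) powr (- 1 / 4))) * (1 + eta^2) powr (- 1 / 2)"
   using K(1) L(1) by (intro mult_mono c0_le_1 1 resolvent_bound) auto
  also have "... = (K * L) * ((1 + eta^2) powr (- 1 / 4) * (1 + eta^2) powr (- 1 / 2))" by simp
  also have "(1 + eta^2) powr (- 1 / 4) * (1 + eta^2) powr (- 1 / 2) = (1 + eta^2) powr (- 3 / 4)" unfolding powr_add[symmetric] by simp
  finally show ?thesis .
 qed
 have sm: "symb n \<in> borel_measurable lborel" using i by (intro borel_measurable_LIMSEQ_metric[OF _ lim]) auto
 show "L1 (symb n)"
  by (rule integrable_dominated_convergence[OF sm _ w, of ?s]) (use i lim bd in auto)
 have "(%M. LBINT eta. ?s M eta) -->> (LBINT eta. symb n eta)"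
  by (rule integral_dominated_convergence[OF sm _ w]) (use i lim bd in auto)
 moreover have "(LBINT eta. ?s M eta) = (\<Sum>j<M. ip (e j) (P (%x. a x * S (W n (P (e j))) x)))" for M
  unfolding se using ip_rank_one[OF es es, of _ n] by simp
 ultimately show "(%j. ip (e j) (P (%x. a x * S (W n (P (e j))) x))) sums (LBINT eta. symb n eta)" unfolding sums_def by simp
qed

lemma symb_eq: "symb n eta = c0 * fourier (%x. b x * W n (T (wave eta)) x) eta / (\<i> * of_real eta + of_real (- sig))"
proof -
 have ae: "AE x in lborel. W n (P (X eta)) x = W n (T (wave eta)) x"
  unfolding X_def hop_def[of _ _ "wave eta"]
  by (intro W_cong_AE PP[OF aw] Rop_L2 s0 aw P_sq)
 have s: "sqint (W n (T (wave eta)))" unfolding hop_def[of _ _ "wave eta"] by (intro W_sq Rop_L2 s0 aw)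
 have "ell n eta (X eta) = fourier (%x. b x * W n (T (wave eta)) x) eta" unfolding ell_def
  by (rule fourier_cong_AE) (use ae u_L1_L2(2)[OF X_sq] mult_L1_L2(4)[OF s] in \<open>auto elim: AE_mp\<close>)
 then show ?thesis unfolding symb_def by simp
qed

lemma good_WT: "\<exists>C. good_op (%phi. W n (T phi)) C"
proof (induction n)
 case 0
 show ?case using good_op_hop[OF s0(1) a(1)] by (intro exI) simp
next
 case (Suc n)
 then obtain C where C: "good_op (%phi. W n (T phi)) C" by blast
 from good_op_comp[OF good_op_hop[OF s0(1) a(1)] good_op_comp[OF good_op_hop[OF s0(2) b(1)] C]]
 show ?case by (intro exI) simp
qed

lemma smoothed_kernel: "Rop (- sig) (%y. of_real (bump n y)) u = (LBINT eta. (c0 * c0 * of_real (reg n eta) / (\<i> * of_real eta + of_real (- sig))) * wave eta u)"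
proof -
 have ki: "L1 (%y. ker (- sig) (u - y))" by (rule lborel_integrable_shift(1)[OF ker_integrable[OF s0(2)]])
 have ri: "L1 (%eta. complex_of_real (reg n eta))" using reg_integrable by (intro integrable_of_real)
 have b: "complex_of_real (bump n y) = c0 * c0 * (LBINT eta. wave y eta * of_real (reg n eta))" for y unfolding reg_fourier c0_sq by simp
 have "Rop (- sig) (%y. of_real (bump n y)) u = c0 * c0 * (LBINT y. ker (- sig) (u - y) * (LBINT eta. wave y eta * of_real (reg n eta)))"
  unfolding Rop_def b integral_mult_right_zero[symmetric, of "c0 * c0"] by (rule int_cong) simp_all
 also have "(LBINT y. ker (- sig) (u - y) * (LBINT eta. wave y eta * of_real (reg n eta))) = (LBINT eta. of_real (reg n eta) * (LBINT y. wave y eta * ker (- sig) (u - y)))"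
  by (rule prod_swap[OF ki ri, where C = 1]) auto
 also have "... = (LBINT eta. of_real (reg n eta) * Rop (- sig) (wave eta) u)"
  unfolding Rop_def by (simp add: wave_sym mult.commute)
 also have "c0 * c0 * ... = (LBINT eta. (c0 * c0 * of_real (reg n eta) / (\<i> * of_real eta + of_real (- sig))) * wave eta u)"
  unfolding Rop_wave[OF s0(2)] integral_mult_right_zero[symmetric, of "c0 * c0"] by (rule int_cong) simp_all
 finally show ?thesis .
qed

lemma smoothed_kernel_tendsto: "u ~= 0 ==> (%n. Rop (- sig) (%y. of_real (bump n y)) u) -->> ker (- sig) u"
 and smoothed_kernel_bound: "norm (Rop (- sig) (%y. of_real (bump n y)) u) <= 1"
proof -
 have bi: "L1 (%y. complex_of_real (bump n y))" for n using bump_integrable by (intro integrable_of_real)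
 show "norm (Rop (- sig) (%y. of_real (bump n y)) u) <= 1" using Rop_bound_L1[OF bi] bump_integral by simp
 assume u: "u ~= 0"
 have "Rop (- sig) (%y. of_real (bump n y)) u = (LBINT z. bump n (z - u) * ker (- sig) z)" for n
  unfolding Rop_def by (subst lborel_integral_shift(1)[of _ u, symmetric]) (simp add: bump_minus[of n "_ - u", symmetric] mult.commute)
 moreover have "isCont (ker (- sig)) u"
 proof (rule isCont_cong[THEN iffD1])
  let ?f = "%v. if 0 < - sig then (if 0 <= u then of_real (exp (- (- sig * v))) else 0) else (if u < 0 then - complex_of_real (exp (- (- sig * v))) else 0)"
  show "isCont ?f u" by (cases "sig < 0"; cases "0 <= u") (auto intro!: continuous_intros)
  have "\<forall>\<^sub>F v in nhds u. (0 <= u) = (0 <= v) \<and> (u < 0) = (v < 0)"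
  proof (cases "u > 0")
   case True
   then show ?thesis using eventually_nhds_in_open[of "{0<..}" u] by (auto elim: eventually_mono)
  next
   case False
   then show ?thesis using u eventually_nhds_in_open[of "{..<0}" u] by (auto elim: eventually_mono)
  qed
  then show "\<forall>\<^sub>F v in nhds u. ?f v = ker (- sig) v" by eventually_elim (auto simp: ker_def)
 qed
 ultimately show "(%n. Rop (- sig) (%y. of_real (bump n y)) u) -->> ker (- sig) u" using bump_approx[of "ker (- sig)" 1 u] norm_ker_le_1 by simp
qed

text \<open>Without a cut-off the frequency integral is the kernel of the resolvent, which is not an absolutely convergent integral. With the Gaussian cut-off the order of integration can be exchanged, and the smoothed kernels converge boundedly off the diagonal.\<close>

lemma trace_integral: "(LBINT eta. symb m eta) = (LBINT x. b x * W m (T (%y. ker (- sig) (y - x))) x)"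
 and diagonal_measurable: "(%x. W m (T (%y. ker (- sig) (y - x))) x) \<in> BM"
proof -
 define V where "V phi = W m (T phi)" for phi
 obtain C where V: "good_op V C" using good_WT unfolding V_def[abs_def] by blast
 note V1 = V[unfolded good_op_def, THEN conjunct2, THEN conjunct1, rule_format]
 note V2 = V[unfolded good_op_def, THEN conjunct2, THEN conjunct2, THEN conjunct1, rule_format]
 note V3 = V[unfolded good_op_def, THEN conjunct2, THEN conjunct2, THEN conjunct2, rule_format]
 let ?k = "%n u. Rop (- sig) (%y. of_real (bump n y)) u"
 let ?w = "%n eta. c0 * c0 * of_real (reg n eta) / (\<i> * of_real eta + of_real (- sig))"
 have si: "L1 (symb m)" using trace_sums(2) L2_basis_exists by blast
 have wi: "L1 (?w n)" for n
 proof (rule L1_bound[OF reg_integrable[of n]])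
  show "?w n \<in> borel_measurable lborel" by measurable
  have "norm (?w n eta) <= reg n eta" for eta
  proof -
   have "norm (?w n eta) = norm c0 * norm c0 * reg n eta * norm (1 / (\<i> * of_real eta + of_real (- sig)) :: complex)" using reg_le_1(3)[of n eta] by (simp add: norm_mult norm_divide)
   also have "... <= 1 * 1 * reg n eta * 1"
    using reg_le_1(3)[of n eta] order_trans[OF resolvent_bound[of eta] powr_mono2'[of "- 1 / 2" 1 "1 + eta^2"]] by (intro mult_mono c0_le_1) auto
   finally show ?thesis by simp
  qed
  then show "AE eta in lborel. norm (?w n eta) <= norm (reg n eta)" using reg_le_1(3) by simp
 qed
 have wm: "(%(eta, y). wave eta y) \<in> borel_measurable (borel \<Otimes>\<^sub>M borel)" by measurable
 have jm [measurable]: "(%(eta, x). V (wave eta) x) \<in> borel_measurable (borel \<Otimes>\<^sub>M borel)" using V2[OF wi wm, of 1] by simp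
 have Vb: "norm (V (wave eta) x) <= C * 1" for eta x using V1[of "wave eta" 1] by simp
 have step: "(LBINT eta. of_real (reg n eta) * symb m eta) = (LBINT x. b x * V (%y. ?k n (y - x)) x)" for n
 proof -
  have "(LBINT eta. of_real (reg n eta) * symb m eta) = (LBINT eta. ?w n eta * (LBINT x. (wave (- eta) x * V (wave eta) x) * b x))"
   unfolding symb_eq fourier_wave V_def[symmetric] by (rule int_cong) (simp_all add: mult_ac)
  also have "... = (LBINT x. b x * (LBINT eta. (wave (- eta) x * V (wave eta) x) * ?w n eta))"
   by (rule prod_swap[OF wi b(1), where C = "C * 1"]) (use Vb in \<open>simp_all add: norm_mult\<close>)
  also have "(%x. LBINT eta. (wave (- eta) x * V (wave eta) x) * ?w n eta) = (%x. V (%y. ?k n (y - x)) x)"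
  proof
   fix x
   have i: "L1 (%eta. wave (- x) eta * ?w n eta)" by (rule wave_integrable[OF wi])
   have "V (%y. LBINT eta. (wave (- x) eta * ?w n eta) * wave eta y) x = (LBINT eta. (wave (- x) eta * ?w n eta) * V (wave eta) x)"
    using V2[OF i wm, of 1] by simp
   also have "(%y. LBINT eta. (wave (- x) eta * ?w n eta) * wave eta y) = (%y. ?k n (y - x))"
   proof
    fix y
    have "(wave (- x) eta * ?w n eta) * wave eta y = ?w n eta * wave eta (y - x)" for eta
     using wave_add[of eta y "- x"] by (simp add: wave_sym[of "- x"])
    then show "(LBINT eta. (wave (- x) eta * ?w n eta) * wave eta y) = ?k n (y - x)" unfolding smoothed_kernel by presburger
   qed
   finally have e: "V (%y. ?k n (y - x)) x = (LBINT eta. (wave (- x) eta * ?w n eta) * V (wave eta) x)" .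
   have "wave (- eta) x = wave (- x) eta" for eta by (simp add: wave_def mult.commute)
   then show "(LBINT eta. (wave (- eta) x * V (wave eta) x) * ?w n eta) = V (%y. ?k n (y - x)) x" unfolding e by (simp add: mult_ac)
  qed
  finally show ?thesis .
 qed
 have l1: "(%n. LBINT eta. of_real (reg n eta) * symb m eta) -->> (LBINT eta. symb m eta)"
 proof (rule integral_dominated_convergence[where w = "%eta. norm (symb m eta)"])
  show "AE eta in lborel. (%n. of_real (reg n eta) * symb m eta) -->> symb m eta"
  proof (rule AE_I2)
   fix eta
   have "(%n. of_real (reg n eta) * symb m eta) -->> of_real 1 * symb m eta" by (intro tendsto_intros reg_tendsto)
   then show "(%n. of_real (reg n eta) * symb m eta) -->> symb m eta" by simp
  qed
  show "AE eta in lborel. norm (of_real (reg n eta) * symb m eta) <= norm (symb m eta)" for n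
   using reg_le_1 by (intro AE_I2) (simp add: norm_mult mult_left_le_one_le)
 qed (use si in auto)
 have kb: "(%y. ?k n (y - x)) \<in> BM" "norm (?k n (y - x)) <= 1" for n x y using smoothed_kernel_bound by auto
 have pw: "(%n. V (%y. ?k n (y - x)) x) -->> V (%y. ker (- sig) (y - x)) x" for x
 proof (rule V3[of _ 1])
  show "AE y in lborel. (%n. ?k n (y - x)) -->> ker (- sig) (y - x)"
   using AE_lborel_neq[of x] by eventually_elim (rule smoothed_kernel_tendsto, simp)
 qed (use kb in auto)
 have Vm: "(%x. V (%y. ?k n (y - x)) x) \<in> BM" for n
 proof -
  have "(%x. V (%y. ?k n (y - x)) x) = (%x. LBINT eta. (wave (- x) eta * ?w n eta) * V (wave eta) x)"
  proof
   fix x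
   have i: "L1 (%eta. wave (- x) eta * ?w n eta)" by (rule wave_integrable[OF wi])
   have "(wave (- x) eta * ?w n eta) * wave eta y = ?w n eta * wave eta (y - x)" for eta y
    using wave_add[of eta y "- x"] by (simp add: wave_sym[of "- x"])
   then have "(%y. LBINT eta. (wave (- x) eta * ?w n eta) * wave eta y) = (%y. ?k n (y - x))" unfolding smoothed_kernel by presburger
   then show "V (%y. ?k n (y - x)) x = (LBINT eta. (wave (- x) eta * ?w n eta) * V (wave eta) x)" using V2[OF i wm, of 1] by simp
  qed
  also have "... \<in> BM" by measurable
  finally show ?thesis .
 qed
 have l2: "(%n. LBINT x. b x * V (%y. ?k n (y - x)) x) -->> (LBINT x. b x * V (%y. ker (- sig) (y - x)) x)"
 proof (rule integral_dominated_convergence[where w = "%x. norm (b x) * C"])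
  have "(%x. V (%y. ker (- sig) (y - x)) x) \<in> BM" using Vm by (rule borel_measurable_LIMSEQ_metric[OF _ pw])
  then show "(%x. b x * V (%y. ker (- sig) (y - x)) x) \<in> borel_measurable lborel" by measurable
  show "(%x. b x * V (%y. ?k n (y - x)) x) \<in> borel_measurable lborel" for n using Vm by measurable
  show "L1 (%x. norm (b x) * C)" using b(1) by simp
  show "AE x in lborel. (%n. b x * V (%y. ?k n (y - x)) x) -->> b x * V (%y. ker (- sig) (y - x)) x" by (intro AE_I2 tendsto_mult_left pw)
  show "AE x in lborel. norm (b x * V (%y. ?k n (y - x)) x) <= norm (b x) * C" for n
  proof (rule AE_I2)
   fix x
   have "norm (V (%y. ?k n (y - x)) x) <= C * 1" using V1[OF kb] by blast
   then show "norm (b x * V (%y. ?k n (y - x)) x) <= norm (b x) * C" by (simp add: norm_mult mult_left_mono)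
  qed
 qed
 show "(LBINT eta. symb m eta) = (LBINT x. b x * W m (T (%y. ker (- sig) (y - x))) x)" using LIMSEQ_unique[OF l1[unfolded step] l2] unfolding V_def .
 show "(%x. W m (T (%y. ker (- sig) (y - x))) x) \<in> BM"
  unfolding V_def[symmetric] using Vm by (rule borel_measurable_LIMSEQ_metric[OF _ pw])
qed

lemma op_trace_eq:
 assumes A: "!!f. sqint f ==> A f = P (%x. a x * S (W m (P f)) x)"
 shows "op_trace A = (LBINT x. b x * W m (T (%y. ker (- sig) (y - x))) x)"
proof -
 have s: "(%n. ip (e n) (A (e n))) sums (LBINT eta. symb m eta)" if "L2_basis e" for e
  using trace_sums(1)[OF that, of m] by (simp add: A L2_basis_sq[OF that])
 obtain e where "L2_basis e" using L2_basis_exists by blast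
 then have "op_trace A = (LBINT eta. symb m eta)" unfolding op_trace_def using s sums_unique2 by (intro the_equality) blast+
 then show ?thesis unfolding trace_integral .
qed

lemma power_formula:
 assumes L: "!!f. L f = P (%x. a x * N f x)" and G: "!!f. G f = N (%x. b x * P f x)" and f: "sqint f"
 shows "((L \<circ> G) ^^ Suc m) f = P (%x. a x * S (W m (P f)) x)"
proof -
 have LG: "L (G f) = P (%x. a x * S (P f) x)" if f: "sqint f" for f
 proof -
  note h = mult_L1_L2(3,4)[OF P_sq[OF f]]
  have s: "sqint (N (N (%x. b x * P f x)))"
   using L2_fourier_total[OF h(2)] fourier_multiplier_fourier[OF half_measurable half1(2)] L2_fourier_sq(1) by blast
  show ?thesis unfolding L G
   by (rule fourier_multiplier_cong) (use NN[OF h] mult_L1_L2(2)[OF s] mult_L1_L2(2)[OF S_sq[OF P_sq[OF f]]] in \<open>auto simp: hop_def elim: AE_mp\<close>)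
 qed
 show ?thesis
 proof (induction m)
  case 0
  show ?case by (simp add: LG f)
 next
  case (Suc m)
  let ?h = "%x. a x * S (W m (P f)) x"
  have h: "L1 ?h" "sqint ?h" by (intro mult_L1_L2 S_sq W_sq P_sq f)+
  have "S (P (P ?h)) = S (Rop sig ?h)"
   by (intro hop_cong_AE PP h b sq_integrable_measurable P_sq Rop_L2 s0)
  also have "Rop sig ?h = T (S (W m (P f)))" by (simp add: hop_def)
  finally have A: "L (G (P ?h)) = P (%x. a x * S (W (Suc m) (P f)) x)" unfolding LG[OF P_sq[OF h(2)]] by simp
  have B: "((L \<circ> G) ^^ Suc (Suc m)) f = L (G (((L \<circ> G) ^^ Suc m) f))" by simp
  show ?case unfolding B Suc by (rule A)
 qed
qed

end

theorem trace_formula: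
 assumes k: "\<i> * kap^2 = of_real sig" and s: "trace_setup sig (%x. kap * q x) (%x. kap * r x)"
 shows "op_trace ((Lambda_op kap q \<circ> Gamma_op kap r) ^^ Suc m) =
  (LBINT x. kap * r x * ((hop sig (%x. kap * q x) \<circ> hop (- sig) (%x. kap * r x)) ^^ m) (hop sig (%x. kap * q x) (%y. ker (- sig) (y - x))) x)"
proof -
 interpret trace_setup sig "%x. kap * q x" "%x. kap * r x" by (rule s)
 have p: "inv_sqrt_plus kap = fourier_multiplier (half sig)" "inv_sqrt_minus kap = fourier_multiplier (half (- sig))"
  unfolding inv_sqrt_plus_def inv_sqrt_minus_def k half_def[abs_def] by simp_all
 have "Lambda_op kap q f = fourier_multiplier (half sig) (%x. kap * q x * fourier_multiplier (half (- sig)) f x)"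
  "Gamma_op kap r f = fourier_multiplier (half (- sig)) (%x. kap * r x * fourier_multiplier (half sig) f x)" for f
  unfolding Lambda_op_def Gamma_op_def p by simp_all
 then show ?thesis by (rule op_trace_eq[OF power_formula, unfolded W_def])
qed

section \<open>The trace series and its gradient\<close>

lemma integral_C1_derivative:
 fixes u u' :: "real => complex"
 assumes d: "!!y. (u hvd u' y) (at y)" "cont u'"
  and b: "!!y. norm (u y) <= K" "!!y. norm (u' y) <= K'" and i: "L1 u" "L1 u'"
 shows "(LBINT x. u' x) = 0"
proof -
 have e: "u = Rop 1 (%y. u' y + of_real 1 * u y)" by (rule Rop_unique[OF _ d b]) simp
 have "fourier (Rop 1 (%y. u' y + of_real 1 * u y)) 0 = fourier (%y. u' y + of_real 1 * u y) 0 / (\<i> * of_real 0 + of_real 1)"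
  using i by (intro fourier_Rop Bochner_Integration.integrable_add) auto
 then have "fourier u 0 = fourier (%y. u' y + u y) 0" unfolding e[symmetric] by simp
 then have "(LBINT x. u x) = (LBINT x. u' x + u x)" unfolding fourier_wave using c0_nz by (simp add: wave_def)
 then show ?thesis using i by simp
qed

lemma potential_add: "potential q ==> potential f ==> potential (%x. q x + k * f x)"
 unfolding potential_def using bounded_add[of q "%x. k * f x"] bounded_mult[of "%_. k" f] by (auto intro!: continuous_intros)

lemma potential_cmult: "potential f ==> potential (%x. k * f x)"
 unfolding potential_def using bounded_mult[of "%_. k" f] by (auto intro!: continuous_intros)

lemma L2_norm_perturb:
 assumes "potential q" "potential f"
 shows "L2_norm (%x. q x + of_real h * f x) <= L2_norm q + \<bar>h\<bar> * L2_norm f"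
proof -
 have "L2_norm (%x. q x + of_real h * f x) <= L2_norm q + L2_norm (%x. of_real h * f x)"
  using assms by (intro L2_norm_triangle sq_integrable_cmult potential_sq_integrable)
 also have "L2_norm (%x. of_real h * f x) <= \<bar>h\<bar> * L2_norm f"
  by (rule L2_norm_bounded_mult[OF potential_sq_integrable[OF assms(2)]]) auto
 finally show ?thesis by simp
qed

text \<open>The logarithm of the transmission coefficient, up to sign; the trace series is minus this quantity.\<close>

definition energy :: "complex => real => (real => complex) => (real => complex) => complex" where
 "energy kap sig q r = (LBINT x. kap * q x * riccati (- (2 * sig)) (%x. kap * r x) (%x. kap * q x) x)"

context lax_potential
begin

lemma m_integrable: "L1 m" and n_integrable: "L1 n"
proof -
 note c = C1_bounded_continuous[OF m_C1] C1_bounded_continuous[OF n_C1]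
 have [measurable]: "m \<in> BM" "n \<in> BM" using C1_bounded_measurable[OF m_C1] C1_bounded_measurable[OF n_C1] by auto
 have [measurable]: "q \<in> BM" "r \<in> BM" using q r unfolding potential_def by auto
 have i: "L1 (%x. kap * p x * (u x)^2)" if "L1 p" "u \<in> BM" "!!x. norm (u x) <= 1 / 2" for p u :: "real => complex"
 proof (rule L1_bound)
  show "L1 (%x. norm (kap * p x))" using that(1) by simp
  show "(%x. kap * p x * (u x)^2) \<in> borel_measurable lborel" using that(1,2) by measurable
  have "norm ((u x)^2) <= 1" for x using power_mono[OF that(3)[of x] norm_ge_zero, of 2] by (simp add: norm_power power_divide)
  then show "AE x in lborel. norm (kap * p x * (u x)^2) <= norm (norm (kap * p x))"
   by (intro AE_I2) (simp add: norm_mult[of "_ * _" "_^2"] mult_right_le_one_le del: norm_power)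
 qed
 have qr: "L1 q" "L1 r" using q r unfolding potential_def by auto
 have "L1 (Rop (- (2 * sig)) (%x. kap * r x - kap * q x * (m x)^2))"
  using qr by (intro Rop_L1 sigma_nz Bochner_Integration.integrable_diff i m_bound) auto
 then show "L1 m" using m_eq by simp
 have "L1 (Rop (2 * sig) (%x. kap * q x - kap * r x * (n x)^2))"
  using qr by (intro Rop_L1 sigma_nz Bochner_Integration.integrable_diff i n_bound) auto
 then show "L1 n" using n_eq by simp
qed

lemma energy_m: "energy kap sig q r = (LBINT x. kap * q x * m x)"
 unfolding energy_def m_def ..

end

text \<open>The integrand is minus the derivative of $\log(1 - m n)$, where $m$ and $n$ belong to different potentials; this function vanishes at infinity.\<close>

lemma mixed_wronskian:
 assumes 1: "lax_potential kap sig q r" and 2: "lax_potential kap sig q' r'"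
 defines "m \<equiv> lax_potential.m kap sig q r" and "n \<equiv> lax_potential.n kap sig q' r'"
 shows "(LBINT x. kap * r' x * n x + kap * q x * m x + (kap * (q' x - q x) * m x - kap * (r' x - r x) * n x) / (1 - m x * n x)) = 0"
  and "L1 (%x. kap * q x * m x)" "L1 (%x. kap * r' x * n x)"
  and "L1 (%x. (kap * (q' x - q x) * m x - kap * (r' x - r x) * n x) / (1 - m x * n x))"
  and "!!x. norm (1 - m x * n x) \<ge> 3 / 4"
proof -
 interpret A: lax_potential kap sig q r by (rule 1)
 interpret B: lax_potential kap sig q' r' by (rule 2)
 note mC = A.m_C1[folded m_def] and nC = B.n_C1[folded n_def]
 have mb: "norm (m x) <= 1 / 2" and nb: "norm (n x) <= 1 / 2" for x using A.m_bound B.n_bound unfolding m_def n_def by auto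
 have z: "norm (m x * n x) <= 1 / 4" for x unfolding norm_mult using mult_mono[OF mb nb] by simp
 show det: "norm (1 - m x * n x) \<ge> 3 / 4" for x using norm_triangle_ineq2[of 1 "m x * n x"] z[of x] by simp
 have nz: "1 - m x * n x ~= 0" for x using det[of x] by auto
 show i1: "L1 (%x. kap * q x * m x)" by (rule A.continuous_integrable_mult(2)[OF A.q(1) mC])
 show i2: "L1 (%x. kap * r' x * n x)" by (rule B.continuous_integrable_mult(2)[OF B.r(1) nC])
 have pd: "potential (%x. q' x - q x)" "potential (%x. r' x - r x)"
  using potential_add[OF B.q(1) A.q(1), of "- 1"] potential_add[OF B.r(1) A.r(1), of "- 1"] by simp_all
 let ?X = "%x. (kap * (q' x - q x) * m x - kap * (r' x - r x) * n x) / (1 - m x * n x)"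
 note inv = C1_bounded_inverse[OF C1_bounded_diff[OF C1_bounded_const[of 1] C1_bounded_mult[OF mC nC]], of "3/4"]
 note inv = inv[OF _ det, simplified]
 note X1 = A.continuous_integrable_mult[OF pd(1) C1_bounded_mult[OF mC inv]] and X2 = A.continuous_integrable_mult[OF pd(2) C1_bounded_mult[OF nC inv]]
 have Xe: "?X = (%x. kap * (q' x - q x) * (m x * (1 / (1 - m x * n x))) - kap * (r' x - r x) * (n x * (1 / (1 - m x * n x))))"
  by (simp add: fun_eq_iff diff_divide_distrib)
 have Xp: "?X x = kap * (q' x - q x) * (m x * (1 / (1 - m x * n x))) - kap * (r' x - r x) * (n x * (1 / (1 - m x * n x)))" for x
  by (simp add: diff_divide_distrib)
 show i3: "L1 ?X" unfolding Xe by (intro Bochner_Integration.integrable_diff X1 X2)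
 let ?L = "%x. Ln (1 - m x * n x)" and ?L' = "%x. - (kap * r' x * n x + kap * q x * m x + ?X x)"
 have nonneg: "1 - m x * n x \<notin> \<real>\<^sub>\<le>\<^sub>0" for x
 proof -
  have "Re (m x * n x) <= 1 / 4" using order_trans[OF complex_Re_le_cmod z] .
  then show ?thesis by (auto simp: complex_nonpos_Reals_iff)
 qed
 have dm: "((%x. 1 - m x * n x) has_vector_derivative
   - (m y * (kap * q' y - kap * r' y * (n y)^2 - 2 * sig * n y) + (kap * r y - kap * q y * (m y)^2 + 2 * sig * m y) * n y)) (at y)" for y
  using C1_bounded_diff[OF C1_bounded_const[of 1] C1_bounded_mult[OF mC nC]] unfolding C1_bounded_def by simp
 have dL: "(?L hvd ?L' y) (at y)" for y
 proof -
  have e: "- (m y * (kap * q' y - kap * r' y * (n y)^2 - 2 * sig * n y) + (kap * r y - kap * q y * (m y)^2 + 2 * sig * m y) * n y) * inverse (1 - m y * n y) = ?L' y"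
   using nz[of y] by (simp add: field_simps power2_eq_square)
  show ?thesis using field_vector_diff_chain_at[OF dm[of y] has_field_derivative_Ln[OF nonneg[of y]]] unfolding o_def e .
 qed
 have cm: "cont m" "cont n" using C1_bounded_continuous[OF mC] C1_bounded_continuous[OF nC] by auto
 note Y1 = A.continuous_integrable_mult[OF A.q(1) mC] and Y2 = B.continuous_integrable_mult[OF B.r(1) nC]
 have cL': "cont ?L'" unfolding Xp by (intro continuous_on_minus continuous_on_add continuous_on_diff X1(1) X2(1) Y1(1) Y2(1))
 have "\<exists>C. \<forall>x. norm (kap * r' x * n x + kap * q x * m x + ?X x) <= C" unfolding Xp by (intro bounded_add bounded_diff X1 X2 Y1 Y2)
 then obtain K' where "\<forall>x. norm (kap * r' x * n x + kap * q x * m x + ?X x) <= K'" by blast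
 then have K': "norm (?L' x) <= K'" for x by (simp only: norm_minus_cancel)
 have Lb: "norm (?L x) <= 2 * norm (m x * n x)" for x
  using norm_Ln_le[of "- (m x * n x)"] z[of x] by simp
 have mn: "norm (m x * n x) <= norm (m x)" for x unfolding norm_mult using mult_left_mono[OF nb[of x], of "norm (m x)"] norm_ge_zero[of "m x"] by linarith
 have "cont ?L" using dL by (intro continuous_at_imp_continuous_on) (auto intro: has_vector_derivative_continuous)
 then have Lm: "?L \<in> borel_measurable lborel" using borel_measurable_continuous_onI by auto
 have iL: "L1 ?L"
 proof (rule L1_bound[OF _ Lm])
  show "L1 (%x. 2 * norm (m x))" using A.m_integrable unfolding m_def by simp
  show "AE x in lborel. norm (?L x) <= norm (2 * norm (m x))"
  proof (rule AE_I2)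
   fix x show "norm (?L x) <= norm (2 * norm (m x))" using Lb[of x] mn[of x] by simp
  qed
 qed
 have bL: "norm (?L x) <= 1 / 2" for x using Lb[of x] z[of x] by linarith
 have iL': "L1 ?L'" by (intro integrable_minus Bochner_Integration.integrable_add i1 i2 i3)
 have "(LBINT x. ?L' x) = 0" by (rule integral_C1_derivative[OF dL cL' bL K' iL iL'])
 then show "(LBINT x. kap * r' x * n x + kap * q x * m x + ?X x) = 0" unfolding Bochner_Integration.integral_minus by simp
qed

text \<open>Subtracting the Wronskian identity for equal potentials leaves only differences of the potentials, so no derivative of $m$ or $n$ is needed to differentiate the energy.\<close>

lemma energy_difference:
 assumes 1: "lax_potential kap sig q r" and 2: "lax_potential kap sig q' r'"
 defines "m \<equiv> lax_potential.m kap sig q r" and "n \<equiv> lax_potential.n kap sig q' r'"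
 shows "energy kap sig q' r' - energy kap sig q r = (LBINT x. (kap * (q' x - q x) * m x - kap * (r' x - r x) * n x) / (1 - m x * n x))"
  and "energy kap sig q r = - (LBINT x. kap * r x * lax_potential.n kap sig q r x)"
proof -
 interpret A: lax_potential kap sig q r by (rule 1)
 interpret B: lax_potential kap sig q' r' by (rule 2)
 have self: "lax_potential kap sig p s ==> energy kap sig p s = - (LBINT x. kap * s x * lax_potential.n kap sig p s x)" for p s
  using mixed_wronskian(1)[of kap sig p s p s] mixed_wronskian(2,3)[of kap sig p s p s] lax_potential.energy_m[of kap sig p s]
  by (simp add: eq_neg_iff_add_eq_0 add.commute)
 show "energy kap sig q r = - (LBINT x. kap * r x * lax_potential.n kap sig q r x)" by (rule self[OF 1])
 note w = mixed_wronskian[OF 1 2, folded m_def n_def]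
 have gen: "(LBINT x. A x + B x + C x) = (LBINT x. A x) + (LBINT x. B x) + (LBINT x. C x)"
  if "L1 A" "L1 B" "L1 C" for A B C :: "real => complex" using that by simp
 have arith: "E' = - a ==> E = b ==> a + b + c = 0 ==> E' - E = c" for E' E a b c :: complex by (simp add: add_eq_0_iff)
 have "energy kap sig q' r' = - (LBINT x. kap * r' x * n x)" unfolding n_def by (rule self[OF 2])
 moreover have "energy kap sig q r = (LBINT x. kap * q x * m x)" unfolding m_def by (rule A.energy_m)
 ultimately show "energy kap sig q' r' - energy kap sig q r = (LBINT x. (kap * (q' x - q x) * m x - kap * (r' x - r x) * n x) / (1 - m x * n x))"
  using w(1)[unfolded gen[OF w(3,2,4)]] arith by blast
qed

lemma n_stability:
 assumes 1: "lax_potential kap sig q r" and f: "potential f" and g: "potential g"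
 shows "\<exists>C\<ge>0. \<forall>h::real. \<bar>h\<bar> <= 1 --> lax_potential kap sig (%x. q x + of_real h * f x) (%x. r x + of_real h * g x) -->
  (\<forall>x. norm (lax_potential.n kap sig (%x. q x + of_real h * f x) (%x. r x + of_real h * g x) x - lax_potential.n kap sig q r x) <= C * \<bar>h\<bar>)"
proof -
 interpret A: lax_potential kap sig q r by (rule 1)
 obtain F where F: "!!x. norm (f x) <= F" using f unfolding potential_def by blast
 obtain G where G: "!!x. norm (g x) <= G" using g unfolding potential_def by blast
 have FG: "F \<ge> 0" "G \<ge> 0" using order_trans[OF norm_ge_zero F] order_trans[OF norm_ge_zero G] .
 have [measurable]: "f \<in> BM" "g \<in> BM" "q \<in> BM" "r \<in> BM"
  using f g A.q A.r unfolding potential_def by (auto intro: borel_measurable_continuous_onI)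
 obtain Q where Q: "!!x. norm (q x) <= Q" using A.q(1) unfolding potential_def by blast
 obtain R where R: "!!x. norm (r x) <= R" using A.r(1) unfolding potential_def by blast
 let ?D = "norm kap * (F + G) / \<bar>2 * sig\<bar>"
 have D0: "?D \<ge> 0" using FG by simp
 have "norm (lax_potential.n kap sig (%x. q x + of_real h * f x) (%x. r x + of_real h * g x) x - A.n x) <= 2 * ?D * \<bar>h\<bar>"
  if 2: "lax_potential kap sig (%x. q x + of_real h * f x) (%x. r x + of_real h * g x)" for h x
 proof -
  interpret B: lax_potential kap sig "%x. q x + of_real h * f x" "%x. r x + of_real h * g x" by (rule 2)
  have [measurable]: "A.n \<in> BM" "B.n \<in> BM" using C1_bounded_measurable[OF A.n_C1] C1_bounded_measurable[OF B.n_C1] by auto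
  have sq: "norm ((A.n y)^2) <= 1" "norm ((B.n y)^2) <= 1" for y
   using power_mono[OF A.n_bound[of y] norm_ge_zero, of 2] power_mono[OF B.n_bound[of y] norm_ge_zero, of 2] by (simp_all add: norm_power power_divide)
  let ?P = "%y. of_real h * (kap * f y - kap * g y * (B.n y)^2)" and ?S = "%y. kap * r y * (A.n y * A.n y - B.n y * B.n y)"
  let ?hB = "%x. kap * (q x + of_real h * f x) - kap * (r x + of_real h * g x) * (B.n x)^2" and ?hA = "%x. kap * q x - kap * r x * (A.n x)^2"
  have Pb: "norm (?P y) <= \<bar>h\<bar> * (norm kap * (F + G))" for y
  proof -
   have "norm (kap * f y - kap * g y * (B.n y)^2) <= norm kap * norm (f y) + norm kap * norm (g y) * norm ((B.n y)^2)"
    using norm_triangle_ineq4[of "kap * f y" "kap * g y * (B.n y)^2"] by (simp only: norm_mult)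
   also have "... <= norm kap * F + norm kap * G * 1" using F G FG sq by (intro add_mono mult_mono) auto
   finally have t: "norm (kap * f y - kap * g y * (B.n y)^2) <= norm kap * (F + G)" by (simp add: distrib_left)
   show ?thesis unfolding norm_mult[of "of_real h"] norm_of_real by (rule mult_left_mono[OF t]) simp
  qed
  have bd: "\<exists>d. (\<forall>y. norm (A.n y - B.n y) <= d)" using norm_triangle_ineq4 A.n_bound B.n_bound by (meson add_mono order_trans)
  define d where "d = (SUP y. norm (A.n y - B.n y))"
  have bdd: "bdd_above (range (%y. norm (A.n y - B.n y)))" using bd by (auto simp: bdd_above_def)
  have db: "norm (A.n y - B.n y) <= d" for y unfolding d_def by (rule cSUP_upper[OF _ bdd]) simp
  have nn: "norm (A.n y * A.n y - B.n y * B.n y) <= d" for y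
  proof -
   have "norm (A.n y * A.n y - B.n y * B.n y) = norm (A.n y - B.n y) * norm (A.n y + B.n y)" unfolding norm_mult[symmetric] by (simp add: algebra_simps)
   also have "... <= d * 1" using db norm_triangle_ineq[of "A.n y" "B.n y"] A.n_bound[of y] B.n_bound[of y] order_trans[OF norm_ge_zero db]
    by (intro mult_mono) auto
   finally show ?thesis by simp
  qed
  have Sm: "norm (Rop (2 * sig) ?S y) <= d / 4" for y
   using A.small(3) nn unfolding small_for_def by simp
  have split: "B.n y - A.n y = Rop (2 * sig) ?P y + Rop (2 * sig) ?S y" for y
  proof -
   have Sb: "norm (?S y) <= norm kap * R * d" for y unfolding norm_mult[of "_ * _" "_ - _"] norm_mult[of kap]
    using R nn order_trans[OF norm_ge_zero R] by (intro mult_mono) auto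
   have hA: "norm (?hA y) <= norm kap * Q + norm kap * R * 1" for y
   proof -
    have "norm (?hA y) <= norm kap * norm (q y) + norm kap * norm (r y) * norm ((A.n y)^2)"
     using norm_triangle_ineq4[of "kap * q y" "kap * r y * (A.n y)^2"] by (simp only: norm_mult)
    also have "... <= norm kap * Q + norm kap * R * 1" using Q R sq order_trans[OF norm_ge_zero R] by (intro add_mono mult_mono) auto
    finally show ?thesis .
   qed
   have e: "?hB = (%y. ?hA y + (?P y + ?S y))" by (simp add: fun_eq_iff algebra_simps power2_eq_square)
   have PSb: "norm (?P y + ?S y) <= \<bar>h\<bar> * (norm kap * (F + G)) + norm kap * R * d" for y using norm_triangle_le[OF add_mono[OF Pb Sb]] .
   have "B.n y = Rop (2 * sig) ?hB y" using B.n_eq by metis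
   also have "... = Rop (2 * sig) ?hA y + Rop (2 * sig) (%y. ?P y + ?S y) y"
    unfolding e by (rule Rop_add[OF A.sigma_nz(2) _ hA _ PSb]) measurable
   also have "Rop (2 * sig) (%y. ?P y + ?S y) y = Rop (2 * sig) ?P y + Rop (2 * sig) ?S y"
    by (rule Rop_add[OF A.sigma_nz(2) _ Pb _ Sb]) measurable
   also have "Rop (2 * sig) ?hA y = A.n y" using A.n_eq by metis
   finally show ?thesis by simp
  qed
  have Pd: "norm (Rop (2 * sig) ?P y) <= ?D * \<bar>h\<bar>" for y
  proof -
   have "norm (Rop (2 * sig) ?P y) <= (\<bar>h\<bar> * (norm kap * (F + G))) / \<bar>2 * sig\<bar>" by (rule Rop_bound_sup[OF A.sigma_nz(2) _ Pb]) measurable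
   then show ?thesis by (simp add: mult_ac)
  qed
  have step: "norm (A.n y - B.n y) <= ?D * \<bar>h\<bar> + d / 4" for y
   unfolding norm_minus_commute[of "A.n y"] split by (rule norm_triangle_le[OF add_mono[OF Pd Sm]])
  have "d <= ?D * \<bar>h\<bar> + d / 4" unfolding d_def by (rule cSUP_least) (use step[unfolded d_def] in auto)
  moreover have "0 <= ?D * \<bar>h\<bar>" by (rule mult_nonneg_nonneg[OF D0]) simp
  ultimately have "d <= 2 * (?D * \<bar>h\<bar>)" by argo
  then show "norm (B.n x - A.n x) <= 2 * ?D * \<bar>h\<bar>" using db[of x] by (simp add: norm_minus_commute)
 qed
 then show ?thesis using D0 by (intro exI[of _ "2 * ?D"]) auto
qed

lemma energy_derivative:
 assumes 1: "lax_potential kap sig q r" and f: "potential f" and g: "potential g"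
  and ev: "\<forall>\<^sub>F h in at 0. lax_potential kap sig (%x. q x + of_real h * f x) (%x. r x + of_real h * g x)"
 shows "((%h. energy kap sig (%x. q x + of_real h * f x) (%x. r x + of_real h * g x)) has_vector_derivative
   (LBINT x. kap * f x * g21 kap q r x + kap * g x * g12 kap q r x)) (at 0)"
proof -
 interpret A: lax_potential kap sig q r by (rule 1)
 define N where "N h = lax_potential.n kap sig (%x. q x + of_real h * f x) (%x. r x + of_real h * g x)" for h :: real
 obtain C where C: "C \<ge> 0" "!!h x. \<bar>h\<bar> <= 1 ==> lax_potential kap sig (%x. q x + of_real h * f x) (%x. r x + of_real h * g x) ==> norm (N h x - A.n x) <= C * \<bar>h\<bar>"
  using n_stability[OF 1 f g] unfolding N_def by blast
 have ev1: "\<forall>\<^sub>F h in at (0::real). lax_potential kap sig (%x. q x + of_real h * f x) (%x. r x + of_real h * g x) \<and> \<bar>h\<bar> <= 1 \<and> h ~= 0"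
 proof -
  have "\<forall>\<^sub>F h in at (0::real). \<bar>h\<bar> <= 1 \<and> h ~= 0" unfolding eventually_at by (intro exI[of _ 1]) (auto simp: dist_real_def)
  with ev show ?thesis by eventually_elim blast
 qed
 let ?I = "%h x. (kap * f x * A.m x - kap * g x * N h x) / (1 - A.m x * N h x)"
 have fg: "L1 f" "L1 g" using f g unfolding potential_def by auto
 have [measurable]: "f \<in> BM" "g \<in> BM" "A.m \<in> BM" "A.n \<in> BM"
  using fg C1_bounded_measurable[OF A.m_C1] C1_bounded_measurable[OF A.n_C1] by auto
 have quot: "(energy kap sig (%x. q x + of_real h * f x) (%x. r x + of_real h * g x) - energy kap sig q r) / of_real h = (LBINT x. ?I h x)"
  if "lax_potential kap sig (%x. q x + of_real h * f x) (%x. r x + of_real h * g x) \<and> \<bar>h\<bar> <= 1 \<and> h ~= 0" for h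
 proof -
  have "energy kap sig (%x. q x + of_real h * f x) (%x. r x + of_real h * g x) - energy kap sig q r =
    (LBINT x. (kap * (q x + of_real h * f x - q x) * A.m x - kap * (r x + of_real h * g x - r x) * N h x) / (1 - A.m x * N h x))"
   unfolding N_def using energy_difference(1)[OF 1] that by blast
  also have "... = (LBINT x. of_real h * ?I h x)"
   by (rule int_cong) (simp_all add: algebra_simps diff_divide_distrib)
  finally have "energy kap sig (%x. q x + of_real h * f x) (%x. r x + of_real h * g x) - energy kap sig q r = of_real h * (LBINT x. ?I h x)"
   unfolding integral_mult_right_zero .
  then show ?thesis using that by simp
 qed
 have lim: "((%h. LBINT x. ?I h x) \<longlongrightarrow> (LBINT x. (kap * f x * A.m x - kap * g x * A.n x) / (1 - A.m x * A.n x))) (at 0)"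
 proof (rule tendsto_at_iff_sequentially[THEN iffD2])
  show "\<forall>X. (\<forall>i. X i \<in> UNIV - {0}) --> X -->> 0 --> ((%h. LBINT x. ?I h x) \<circ> X) -->> (LBINT x. (kap * f x * A.m x - kap * g x * A.n x) / (1 - A.m x * A.n x))"
  proof (intro allI impI)
   fix X :: "nat => real" assume X: "\<forall>i. X i \<in> UNIV - {0}" "X -->> 0"
   have "filterlim X (at 0) sequentially" using X by (auto simp: filterlim_at)
   then have "\<forall>\<^sub>F i in sequentially. lax_potential kap sig (%x. q x + of_real (X i) * f x) (%x. r x + of_real (X i) * g x) \<and> \<bar>X i\<bar> <= 1 \<and> X i ~= 0"
    using ev1 eventually_compose_filterlim by blast
   then obtain i0 where i0: "!!i. i \<ge> i0 ==> lax_potential kap sig (%x. q x + of_real (X i) * f x) (%x. r x + of_real (X i) * g x) \<and> \<bar>X i\<bar> <= 1"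
    unfolding eventually_sequentially by blast
   let ?Y = "%i. X (i + i0)"
   have Y: "lax_potential kap sig (%x. q x + of_real (?Y i) * f x) (%x. r x + of_real (?Y i) * g x)" "\<bar>?Y i\<bar> <= 1" for i using i0[of "i + i0"] by auto
   have [measurable]: "N (?Y i) \<in> BM" for i
    unfolding N_def using C1_bounded_measurable[OF lax_potential.n_C1[OF Y(1)[of i]]] by auto
   have nb: "norm (N (?Y i) x) <= 1 / 2" for i x unfolding N_def by (rule lax_potential.n_bound[OF Y(1)])
   have det: "norm (1 - A.m x * N (?Y i) x) \<ge> 3 / 4" for i x unfolding N_def by (rule mixed_wronskian(5)[OF 1 Y(1)])
   have Yl: "?Y -->> 0" using X(2) by (rule LIMSEQ_ignore_initial_segment)
   have Nl: "(%i. N (?Y i) x) -->> A.n x" for x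
   proof (rule LIM_zero_cancel, rule Lim_null_comparison)
    show "\<forall>\<^sub>F i in sequentially. norm (N (?Y i) x - A.n x) <= C * \<bar>?Y i\<bar>" using C(2) Y by simp
    show "(%i. C * \<bar>?Y i\<bar>) -->> 0" using tendsto_mult_left[OF tendsto_rabs_zero[OF Yl], of C] by simp
   qed
   have "(%i. LBINT x. ?I (?Y i) x) -->> (LBINT x. (kap * f x * A.m x - kap * g x * A.n x) / (1 - A.m x * A.n x))"
   proof (rule integral_dominated_convergence[where w = "%x. norm kap * norm (f x) + norm kap * norm (g x)"])
    show "L1 (%x. norm kap * norm (f x) + norm kap * norm (g x))" using fg by simp
    show "AE x in lborel. (%i. ?I (?Y i) x) -->> (kap * f x * A.m x - kap * g x * A.n x) / (1 - A.m x * A.n x)"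
     by (intro AE_I2 tendsto_intros Nl A.det_nz)
    show "AE x in lborel. norm (?I (?Y i) x) <= norm kap * norm (f x) + norm kap * norm (g x)" for i
    proof (rule AE_I2)
     fix x
     have "norm (kap * f x * A.m x - kap * g x * N (?Y i) x) <= norm kap * norm (f x) * norm (A.m x) + norm kap * norm (g x) * norm (N (?Y i) x)"
      using norm_triangle_ineq4[of "kap * f x * A.m x" "kap * g x * N (?Y i) x"] by (simp add: norm_mult)
     also have "... <= norm kap * norm (f x) * (1/2) + norm kap * norm (g x) * (1/2)"
      by (intro add_mono mult_left_mono A.m_bound nb) auto
     finally have t: "norm (kap * f x * A.m x - kap * g x * N (?Y i) x) <= (norm kap * norm (f x) + norm kap * norm (g x)) / 2" by simp
     have "norm (?I (?Y i) x) <= ((norm kap * norm (f x) + norm kap * norm (g x)) / 2) / (3 / 4)"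
      unfolding norm_divide using t det[of x i] by (intro frac_le) auto
     also have "... <= norm kap * norm (f x) + norm kap * norm (g x)" by simp
     finally show "norm (?I (?Y i) x) <= norm kap * norm (f x) + norm kap * norm (g x)" .
    qed
   qed measurable
   then show "((%h. LBINT x. ?I h x) \<circ> X) -->> (LBINT x. (kap * f x * A.m x - kap * g x * A.n x) / (1 - A.m x * A.n x))"
    unfolding o_def by (rule LIMSEQ_offset)
  qed
 qed
 have val: "(LBINT x. (kap * f x * A.m x - kap * g x * A.n x) / (1 - A.m x * A.n x)) = (LBINT x. kap * f x * g21 kap q r x + kap * g x * g12 kap q r x)"
  by (rule int_cong) (simp_all add: A.diagonal_green diff_divide_distrib)
 have "((%h. (energy kap sig (%x. q x + of_real h * f x) (%x. r x + of_real h * g x) - energy kap sig q r) / of_real h) \<longlongrightarrow> (LBINT x. kap * f x * g21 kap q r x + kap * g x * g12 kap q r x)) (at 0)"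
  unfolding val[symmetric] by (rule Lim_transform_eventually[OF lim]) (use ev1 in eventually_elim, simp add: quot)
 then show ?thesis by (intro has_vector_derivative_quotientI) simp
qed

lemma ker_has_derivative:
 assumes "y ~= x"
 shows "((%y. ker c (y - x)) hvd - of_real c * ker c (y - x)) (at y)"
proof -
 define K0 :: complex where "K0 = (if 0 < c then (if x < y then of_real (exp (c * x)) else 0) else (if x < y then 0 else - of_real (exp (c * x))))"
 define S where "S = (if x < y then {x<..} else {..<x})"
 have e: "K0 * of_real (exp (- c * z)) = ker c (z - x)" if "z \<in> S" for z
 proof -
  have "exp (- (c * (z - x))) = exp (c * x) * exp (- c * z)" unfolding exp_add[symmetric] by (simp add: algebra_simps)
  then show ?thesis using that assms by (auto simp: K0_def S_def ker_def split: if_splits)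
 qed
 have yS: "y \<in> S" "open S" using assms by (auto simp: S_def)
 have d: "((%z. K0 * of_real (exp (- c * z))) hvd K0 * of_real (- c * exp (- c * y))) (at y)"
  by (intro has_vector_derivative_mult_right has_vector_derivative_exp_mult)
 have eq: "K0 * of_real (- c * exp (- c * y)) = - of_real c * ker c (y - x)" unfolding e[OF yS(1), symmetric] by simp
 show ?thesis unfolding eq[symmetric]
 proof (rule has_vector_derivative_transform_within_open[OF d yS(2,1)])
  fix z assume "z \<in> S"
  then show "K0 * of_real (exp (- c * z)) = ker c (z - x)" by (rule e)
 qed
qed

context gauge
begin

text \<open>A column of the Green function solves the integral equation whose Neumann series has the terms of the trace formula.\<close>

lemma column:
 "\<exists>K. \<forall>x. \<exists>u. bmeas u \<and> (\<forall>y. norm (u y) <= K) \<and> u x = of_real (sgn sig) * g12 kap q r x \<and>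
   u = hop sig (%y. kap * q y) (%y. ker (- sig) (y - x) + hop (- sig) (%y. kap * r y) u y)"
proof -
 have ex: "\<exists>C. \<forall>x. norm (p x) <= C" if "C1_bounded p p'" for p p' using C1_bounded_bounds[OF that] by blast
 obtain B11 where B11: "!!x. norm (b11 x) <= B11" using ex[OF b(1)] by blast
 obtain B12 where B12: "!!x. norm (b12 x) <= B12" using ex[OF b(2)] by blast
 obtain B21 where B21: "!!x. norm (b21 x) <= B21" using ex[OF b(3)] by blast
 obtain B22 where B22: "!!x. norm (b22 x) <= B22" using ex[OF b(4)] by blast
 obtain A12 where A12: "!!x. norm (a12 x) <= A12" using ex[OF a(2)] by blast
 obtain A22 where A22: "!!x. norm (a22 x) <= A22" using ex[OF a(4)] by blast
 obtain Q where Q: "!!x. norm (q x) <= Q" using pot(3) by blast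
 obtain R where R: "!!x. norm (r x) <= R" using pot(4) by blast
 note nn = order_trans[OF norm_ge_zero B11] order_trans[OF norm_ge_zero B12] order_trans[OF norm_ge_zero B21] order_trans[OF norm_ge_zero B22]
  order_trans[OF norm_ge_zero A12] order_trans[OF norm_ge_zero A22] order_trans[OF norm_ge_zero Q] order_trans[OF norm_ge_zero R]
 have bound: "norm (s * a * ker c z + t * b * ker c' z') <= B * A + B' * A'"
  if "norm s <= B" "norm a <= A" "norm t <= B'" "norm b <= A'" "0 <= B" "0 <= B'" "0 <= A" "0 <= A'" for s a t b :: complex and B A B' A' c z c' z'
 proof -
  have "norm (s * a * ker c z + t * b * ker c' z') <= norm s * norm a * norm (ker c z) + norm t * norm b * norm (ker c' z')"
   using norm_triangle_ineq[of "s * a * ker c z" "t * b * ker c' z'"] by (simp add: norm_mult)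
  also have "... <= B * A * 1 + B' * A' * 1" using that by (intro add_mono mult_mono norm_ker_le_1) auto
  finally show ?thesis by simp
 qed
 have main: "\<exists>u. bmeas u \<and> (\<forall>y. norm (u y) <= B11 * A12 + B12 * A22) \<and> u x = of_real (sgn sig) * g12 kap q r x \<and>
   u = hop sig (%y. kap * q y) (%y. ker (- sig) (y - x) + hop (- sig) (%y. kap * r y) u y)" for x
 proof -
  define u where "u y = (b11 y * a12 x) * ker sig (y - x) + (b12 y * a22 x) * ker (- sig) (y - x)" for y
  define w where "w y = (b21 y * a12 x) * ker sig (y - x) + (b22 y * a22 x) * ker (- sig) (y - x)" for y
  define v where "v y = (b21 y * a12 x) * ker sig (y - x) + (b22 y * a22 x - 1) * ker (- sig) (y - x)" for y
  have wv: "w y = ker (- sig) (y - x) + v y" for y by (simp add: w_def v_def algebra_simps)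
  have Du: "u y = D y x $ 1 $ 2" and Dv: "v y = D y x $ 2 $ 2" for y unfolding u_def v_def D_def vector_2 by simp_all
  have cD: "cont (%y. D y x)"
  proof -
   have "cont (%y. (%(y, x). D y x) (y, x))" by (rule continuous_on_compose2[OF D_continuous]) (auto intro!: continuous_intros)
   then show ?thesis by simp
  qed
  have cu: "cont u" and cv: "cont v"
   unfolding Du[abs_def] Dv[abs_def] by (intro bounded_linear.continuous_on[OF bounded_linear_vec_nth] cD)+
  have ub: "norm (u y) <= B11 * A12 + B12 * A22" for y unfolding u_def by (rule bound[OF B11 A12 B12 A22]) (rule nn)+
  have wb: "norm (w y) <= B21 * A12 + B22 * A22" for y unfolding w_def by (rule bound[OF B21 A12 B22 A22]) (rule nn)+
  have vb: "norm (v y) <= (B21 * A12 + B22 * A22) + 1" for y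
  proof -
   have "norm (v y) = norm (w y - ker (- sig) (y - x))" by (simp add: wv)
   also have "... <= norm (w y) + norm (ker (- sig) (y - x))" by (rule norm_triangle_ineq4)
   finally show ?thesis using wb[of y] norm_ker_le_1[of "- sig" "y - x"] by linarith
  qed
  have [measurable]: "u \<in> BM" "v \<in> BM" using cu cv by (auto intro: borel_measurable_continuous_onI)
  have wm [measurable]: "w \<in> BM" unfolding wv[abs_def] by measurable
  have kd: "((%y. ker c (y - x)) hvd - of_real c * ker c (y - x)) (at y)" if "y ~= x" for y c by (rule ker_has_derivative[OF that])
  have bd: "(b11 hvd kap * q y * b21 y) (at y)" "(b12 hvd kap * q y * b22 y - 2 * sig * b12 y) (at y)"
    "(b21 hvd kap * r y * b11 y + 2 * sig * b21 y) (at y)" "(b22 hvd kap * r y * b12 y) (at y)" for y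
   using b unfolding C1_bounded_def by auto
  have rule: "((%y. (f y * A) * ker sig (y - x) + (g y * B - k) * ker (- sig) (y - x)) has_vector_derivative
    (f y * A) * (- of_real sig * ker sig (y - x)) + (f' * A) * ker sig (y - x) + ((g y * B - k) * (- of_real (- sig) * ker (- sig) (y - x)) + (g' * B) * ker (- sig) (y - x))) (at y)"
   if y: "y ~= x" and fg: "(f hvd f') (at y)" "(g hvd g') (at y)" for f g f' g' A B k y
  proof -
   have "((%y. g y * B - k) hvd g' * B - 0) (at y)" by (intro has_vector_derivative_diff has_vector_derivative_mult_left fg has_vector_derivative_const)
   then have gB: "((%y. g y * B - k) hvd g' * B) (at y)" by simp
   show ?thesis by (intro has_vector_derivative_add has_vector_derivative_mult has_vector_derivative_mult_left kd y fg gB)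
  qed
  have kc: "isCont (%y. ker (- sig) (y - x)) y" if "y ~= x" for y using has_vector_derivative_continuous[OF kd[OF that]] by simp
  have wc: "isCont w y" if "y ~= x" for y unfolding wv[abs_def] using kc[OF that] cv by (intro continuous_intros) (auto simp: continuous_on_eq_continuous_at)
  have ueq: "u = Rop sig (%y. kap * q y * w y)"
  proof (rule Rop_char[OF sigma _ _ cu ub])
   show "(%y. kap * q y * w y) \<in> BM" by measurable
   show "norm (kap * q y * w y) <= norm kap * Q * (B21 * A12 + B22 * A22)" for y
    unfolding norm_mult using Q wb nn by (intro mult_mono) auto
   fix y assume y: "y ~= x"
   have "isCont (%y. kap * q y * w y) y" using wc[OF y] pot(1) by (intro continuous_intros) (auto simp: continuous_on_eq_continuous_at)
   moreover have "(u hvd (kap * q y * w y - of_real sig * u y)) (at y)"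
   proof -
    have ue: "u = (%y. (b11 y * a12 x) * ker sig (y - x) + (b12 y * a22 x - 0) * ker (- sig) (y - x))" by (simp add: u_def fun_eq_iff)
    show ?thesis unfolding ue by (rule has_vector_derivative_eq_rhs[OF rule[OF y bd(1) bd(2)]]) (simp add: w_def algebra_simps)
   qed
   ultimately show "isCont (%y. kap * q y * w y) y \<and> (u hvd kap * q y * w y - of_real sig * u y) (at y)" ..
  qed
  have veq: "v = Rop (- sig) (%y. kap * r y * u y)"
  proof (rule Rop_char[OF _ _ _ cv vb, where x = x])
   show "- sig ~= 0" using sigma by simp
   show "(%y. kap * r y * u y) \<in> BM" by measurable
   show "norm (kap * r y * u y) <= norm kap * R * (B11 * A12 + B12 * A22)" for y
    unfolding norm_mult using R ub nn by (intro mult_mono) auto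
   fix y assume y: "y ~= x"
   have "isCont (%y. kap * r y * u y) y" using cu pot(2) by (intro continuous_intros) (auto simp: continuous_on_eq_continuous_at)
   moreover have "(v hvd (kap * r y * u y - of_real (- sig) * v y)) (at y)"
    unfolding v_def[abs_def] by (rule has_vector_derivative_eq_rhs[OF rule[OF y bd(3) bd(4)]]) (simp add: u_def v_def algebra_simps)
   ultimately show "isCont (%y. kap * r y * u y) y \<and> (v hvd kap * r y * u y - of_real (- sig) * v y) (at y)" ..
  qed
  have "of_real (sgn sig) * g12 kap q r x = of_real (sgn sig * sgn sig) * u x"
   unfolding g12_def sgn_kappa green_diff_D Du by (simp only: of_real_mult mult.assoc)
  also have "sgn sig * sgn sig = 1" using sigma by (simp add: sgn_if)
  finally have gu: "u x = of_real (sgn sig) * g12 kap q r x" by simp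
  have "u = hop sig (%y. kap * q y) (%y. ker (- sig) (y - x) + hop (- sig) (%y. kap * r y) u y)"
   unfolding hop_def veq[symmetric] wv[symmetric] by (rule ueq)
  then show ?thesis using gu ub unfolding bmeas_def by (intro exI[of _ u]) auto
 qed
 show ?thesis using main by blast
qed

end

lemma hop_sup_bound:
 assumes k: "(norm kap)^2 = \<bar>c\<bar>" and c: "1 <= \<bar>c\<bar>" and p: "potential p" and f: "f \<in> BM" "!!y. norm (f y) <= M"
 shows "norm (hop c (%y. kap * p y) f x) <= L2_norm p * M"
proof -
 have M: "0 <= M" using order_trans[OF norm_ge_zero f(2)] .
 have s: "sqint (%y. kap * p y)" by (intro sq_integrable_cmult potential_sq_integrable p)
 have "norm kap <= sqrt (2 * \<bar>c\<bar>)" using k by (intro real_le_rsqrt) simp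
 moreover have "L2_norm (%y. kap * p y) <= norm kap * L2_norm p" by (rule L2_norm_bounded_mult[OF potential_sq_integrable[OF p]]) auto
 ultimately have "L2_norm (%y. kap * p y) <= sqrt (2 * \<bar>c\<bar>) * L2_norm p" by (meson L2_norm_nonneg mult_right_mono order_trans)
 then have "L2_norm (%y. kap * p y) / sqrt (2 * \<bar>c\<bar>) <= L2_norm p" using c by (simp add: pos_divide_le_eq mult.commute)
 then have "M * (L2_norm (%y. kap * p y) / sqrt (2 * \<bar>c\<bar>)) <= M * L2_norm p" using M by (rule mult_left_mono)
 moreover have "norm (hop c (%y. kap * p y) f x) <= M * (L2_norm (%y. kap * p y) / sqrt (2 * \<bar>c\<bar>))"
  unfolding hop_def by (rule Rop_bound_L2[OF _ s f]) (use c in auto)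
 ultimately show ?thesis by (simp add: mult.commute)
qed

lemma hop_add:
 assumes c: "c ~= 0" and a: "bmeas a" and f: "bmeas f" and g: "bmeas g"
 shows "hop c a (%y. f y + k * g y) = (%x. hop c a f x + k * hop c a g x)"
proof
 fix x
 have af: "bmeas (%y. a y * f y)" "bmeas (%y. k * (a y * g y))" by (intro bmeas_intros a f g)+
 then obtain M N where MN: "!!y. norm (a y * f y) <= M" "!!y. norm (k * (a y * g y)) <= N" unfolding bmeas_def by blast
 have "hop c a (%y. f y + k * g y) x = Rop c (%y. a y * f y + k * (a y * g y)) x" unfolding hop_def by (simp add: algebra_simps)
 also have "... = Rop c (%y. a y * f y) x + Rop c (%y. k * (a y * g y)) x"
  by (rule Rop_add[OF c _ MN(1) _ MN(2)]) (use af in \<open>auto simp: bmeas_def\<close>)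
 finally show "hop c a (%y. f y + k * g y) x = hop c a f x + k * hop c a g x" unfolding hop_def Rop_cmult .
qed

lemma bmeas_hop: "c ~= 0 ==> L1 a ==> bmeas f ==> bmeas (hop c a f)"
 using good_op_hop[of c a] unfolding good_op_def bmeas_def by meson

lemma bmeas_potential: "potential p ==> bmeas p"
 unfolding potential_def bmeas_def by auto

locale trace_series =
 fixes kap :: complex and sig :: real and q r :: "real => complex"
 assumes kappa: "\<i> * kap^2 = of_real sig" and sigma: "1 <= \<bar>sig\<bar>"
  and q3: "potential q" "L2_norm q <= 1 / 3" and r3: "potential r" "L2_norm r <= 1 / 3"
  and qd: "\<exists>C. \<forall>xi. norm (fourier q xi) <= C / (1 + xi^2)"
begin

sublocale lax_potential kap sig q r using kappa sigma q3 r3 by unfold_locales auto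

sublocale TS: trace_setup sig "%x. kap * q x" "%x. kap * r x"
proof
 obtain C where C: "!!xi. norm (fourier q xi) <= C / (1 + xi^2)" using qd by blast
 have "norm (fourier (%x. kap * q x) xi) <= (norm kap * C) / (1 + xi^2)" for xi
  using mult_left_mono[OF C[of xi], of "norm kap"] by (simp add: fourier_cmult norm_mult)
 then show "\<exists>C. \<forall>xi. norm (fourier (%x. kap * q x) xi) <= C / (1 + xi^2)" by blast
qed (use sigma q r potential_cmult in auto)

abbreviation "T \<equiv> hop sig (%x. kap * q x)"
abbreviation "S \<equiv> hop (- sig) (%x. kap * r x)"

lemma W_Suc': "TS.W (Suc j) f = TS.W j (T (S f))"
 unfolding TS.W_def funpow_Suc_right by simp

lemma bm: "bmeas (%x. kap * q x)" "bmeas (%x. kap * r x)" "bmeas f ==> bmeas (T f)" "bmeas f ==> bmeas (S f)"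
 using bmeas_potential[OF potential_cmult[OF q(1)]] bmeas_potential[OF potential_cmult[OF r(1)]] bmeas_hop[OF _ TS.a(1)] bmeas_hop[OF _ TS.b(1)] sigma_nz by auto

lemma W_bmeas: "bmeas f ==> bmeas (TS.W j f)"
 by (induction j) (auto intro: bm)

lemma W_add: "bmeas f ==> bmeas g ==> TS.W j (%y. f y + k * g y) = (%x. TS.W j f x + k * TS.W j g x)"
proof (induction j)
 case (Suc j)
 have "- sig ~= 0" "sig ~= 0" using sigma by auto
 then show ?case using Suc by (simp add: hop_add bm W_bmeas)
qed simp

lemma TS_bound:
 assumes f: "bmeas f" "!!y. norm (f y) <= M"
 shows "norm (T f x) <= M / 3" "norm (S f x) <= M / 3"
proof -
 have M: "0 <= M" using order_trans[OF norm_ge_zero f(2)] .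
 have "norm (T f x) <= L2_norm q * M" by (rule hop_sup_bound[OF norm_kappa sigma q(1)]) (use f in \<open>auto simp: bmeas_def\<close>)
 also have "... <= M / 3" using mult_right_mono[OF q3(2) M] by simp
 finally show "norm (T f x) <= M / 3" .
 have "norm (S f x) <= L2_norm r * M" by (rule hop_sup_bound[OF _ _ r(1)]) (use f norm_kappa sigma in \<open>auto simp: bmeas_def\<close>)
 also have "... <= M / 3" using mult_right_mono[OF r3(2) M] by simp
 finally show "norm (S f x) <= M / 3" .
qed

lemma W_sup: "bmeas f ==> (!!y. norm (f y) <= M) ==> norm (TS.W j f x) <= M / 9 ^ j"
proof (induction j arbitrary: x)
 case (Suc j)
 have w: "norm (TS.W j f y) <= M / 9 ^ j" for y by (rule Suc.IH[OF Suc.prems])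
 have "norm (S (TS.W j f) y) <= M / 9 ^ j / 3" for y by (rule TS_bound(2)[OF W_bmeas[OF Suc.prems(1)] w])
 from TS_bound(1)[OF bm(4)[OF W_bmeas[OF Suc.prems(1)]] this] show ?case by simp
qed simp

definition tr :: "nat => complex" where
 "tr j = (LBINT x. kap * r x * TS.W j (T (%y. ker (- sig) (y - x))) x)"

lemma k_bmeas: "bmeas (%y. ker (- sig) (y - x))"
 unfolding bmeas_def using norm_ker_le_1 by auto

lemma k_bound: "norm (TS.W j (T (%y. ker (- sig) (y - x))) z) <= 1 / 9 ^ j"
proof -
 have "norm (T (%y. ker (- sig) (y - x)) z) <= 1" for z
  using TS_bound(1)[OF k_bmeas norm_ker_le_1, of x z] by simp
 then show ?thesis by (rule W_sup[OF bm(3)[OF k_bmeas]])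
qed

lemma tr_integrable: "L1 (%x. kap * r x * TS.W j (T (%y. ker (- sig) (y - x))) x)"
proof (rule L1_bound)
 show "L1 (%x. norm (kap * r x) * (1 / 9 ^ j))" using TS.b(1) by simp
 show "(%x. kap * r x * TS.W j (T (%y. ker (- sig) (y - x))) x) \<in> borel_measurable lborel" using TS.diagonal_measurable TS.b(2) by measurable
 show "AE x in lborel. norm (kap * r x * TS.W j (T (%y. ker (- sig) (y - x))) x) <= norm (norm (kap * r x) * (1 / 9 ^ j))"
 proof (rule AE_I2)
  fix x
  show "norm (kap * r x * TS.W j (T (%y. ker (- sig) (y - x))) x) <= norm (norm (kap * r x) * (1 / 9 ^ j))"
   unfolding norm_mult[of "kap * r x"] using mult_left_mono[OF k_bound[of j x x], of "norm (kap * r x)"] by simp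
 qed
qed

lemma tr_bound: "norm (tr j) <= (LBINT x. norm (kap * r x)) / 9 ^ j"
proof -
 have "norm (tr j) <= (LBINT x. norm (kap * r x * TS.W j (T (%y. ker (- sig) (y - x))) x))" unfolding tr_def by (rule integral_norm_bound)
 also have "... <= (LBINT x. norm (kap * r x) * (1 / 9 ^ j))"
 proof (rule integral_mono)
  show "L1 (%x. norm (kap * r x * TS.W j (T (%y. ker (- sig) (y - x))) x))" by (rule integrable_norm[OF tr_integrable])
  show "L1 (%x. norm (kap * r x) * (1 / 9 ^ j))" by (rule integrable_mult_left[OF integrable_norm[OF TS.b(1)]])
  show "norm (kap * r x * TS.W j (T (%y. ker (- sig) (y - x))) x) <= norm (kap * r x) * (1 / 9 ^ j)" for x
   unfolding norm_mult[of "kap * r x"] by (intro mult_left_mono k_bound) simp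
 qed
 finally show ?thesis by simp
qed

lemma scaled: "\<bar>l\<bar> <= 3 / 2 ==> lax_potential kap sig q (%x. of_real l * r x)"
proof
 assume l: "\<bar>l\<bar> <= 3 / 2"
 have "L2_norm (%x. of_real l * r x) <= \<bar>l\<bar> * L2_norm r" by (rule L2_norm_bounded_mult[OF potential_sq_integrable[OF r(1)]]) auto
 also have "... <= 3 / 2 * (1 / 3)" using l r3(2) by (intro mult_mono) auto
 finally show "L2_norm (%x. of_real l * r x) <= 1 / 2" by simp
qed (use kappa sigma q r potential_cmult in auto)

text \<open>The Neumann series of the column converges geometrically: each factor $TS$ contributes $1/9$, against $3/2$ from the scaling of $r$.\<close>

lemma resolvent_series:
 assumes l: "\<bar>l\<bar> <= 3 / 2"
 shows "(%n. of_real l ^ n * tr n) sums (LBINT x. kap * r x * (of_real (sgn sig) * g12 kap q (%x. of_real l * r x) x))"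
proof -
 interpret L: lax_potential kap sig q "%x. of_real l * r x" by (rule scaled[OF l])
 obtain K where K: "!!x. \<exists>u. bmeas u \<and> (\<forall>y. norm (u y) <= K) \<and> u x = of_real (sgn sig) * g12 kap q (%x. of_real l * r x) x \<and>
   u = T (%y. ker (- sig) (y - x) + hop (- sig) (%y. kap * (of_real l * r y)) u y)"
 proof -
  obtain E1 E2 where g: "gauge kap sig q (%x. of_real l * r x) E1 (%x. L.n x * E2 x) (%x. L.m x * E1 x) E2
   (%x. 1 / (1 - L.m x * L.n x) * (1 / E1 x)) (%x. - L.n x * (1 / (1 - L.m x * L.n x) * (1 / E1 x)))
   (%x. - L.m x * (1 / (1 - L.m x * L.n x) * (1 / E2 x))) (%x. 1 / (1 - L.m x * L.n x) * (1 / E2 x))"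
   using L.gauge_exists by blast
  from gauge.column[OF g] obtain K where K: "\<forall>x. \<exists>u. bmeas u \<and> (\<forall>y. norm (u y) <= K) \<and> u x = of_real (sgn sig) * g12 kap q (%x. of_real l * r x) x \<and>
   u = T (%y. ker (- sig) (y - x) + hop (- sig) (%y. kap * (of_real l * r y)) u y)" ..
  show ?thesis by (rule that) (rule K[rule_format])
 qed
 let ?g = "%x. of_real (sgn sig) * g12 kap q (%x. of_real l * r x) x"
 have expand: "norm (?g x - (\<Sum>n<M. of_real l ^ n * TS.W n (T (%y. ker (- sig) (y - x))) x)) <= K * (1 / 6) ^ M" for x M
 proof -
  obtain u where u: "bmeas u" "!!y. norm (u y) <= K" "u x = ?g x" "u = T (%y. ker (- sig) (y - x) + hop (- sig) (%y. kap * (of_real l * r y)) u y)"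
   using K by blast
  have "hop (- sig) (%y. kap * (of_real l * r y)) u = (%y. of_real l * S u y)"
   unfolding hop_def Rop_cmult[symmetric] by (simp add: mult_ac)
  then have "u = T (%y. ker (- sig) (y - x) + of_real l * S u y)" using u(4) by simp
  also have "... = (%z. T (%y. ker (- sig) (y - x)) z + of_real l * T (S u) z)"
   using sigma by (intro hop_add bm k_bmeas u(1)) auto
  finally have ueq: "u = (%z. T (%y. ker (- sig) (y - x)) z + of_real l * T (S u) z)" .
  have it: "u z = (\<Sum>n<M. of_real l ^ n * TS.W n (T (%y. ker (- sig) (y - x))) z) + of_real l ^ M * TS.W M u z" for z M
  proof (induction M)
   case (Suc M)
   have "TS.W M u z = TS.W M (%z. T (%y. ker (- sig) (y - x)) z + of_real l * T (S u) z) z" using ueq by simp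
   also have "... = TS.W M (T (%y. ker (- sig) (y - x))) z + of_real l * TS.W M (T (S u)) z" by (simp add: W_add bm k_bmeas u(1))
   also have "TS.W M (T (S u)) = TS.W (Suc M) u" by (rule W_Suc'[symmetric])
   finally show ?case using Suc by (simp add: distrib_left mult.assoc del: TS.W_Suc)
  qed simp
  have "norm (?g x - (\<Sum>n<M. of_real l ^ n * TS.W n (T (%y. ker (- sig) (y - x))) x)) = norm (of_real l ^ M * TS.W M u x)"
   unfolding u(3)[symmetric] it[of x M] by simp
  also have "... = \<bar>l\<bar> ^ M * norm (TS.W M u x)" by (simp add: norm_mult norm_power)
  also have "... <= (3 / 2) ^ M * (K / 9 ^ M)" by (intro mult_mono power_mono l W_sup u) auto
  also have "... = K * (1 / 6) ^ M"
  proof -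
   have "(3 / 2 :: real) ^ M / 9 ^ M = (1 / 6) ^ M" unfolding power_divide[symmetric] by simp
   then show ?thesis by (simp add: field_simps)
  qed
  finally show ?thesis .
 qed
 have gi: "L1 (%x. kap * r x * ?g x)"
  using integrable_mult_right[OF continuous_integrable_mult(2)[OF r(1) L.green_C1(1)], of "of_real (sgn sig)"] by (simp add: mult_ac)
 let ?B = "LBINT x. norm (kap * r x)"
 have diff: "norm ((\<Sum>n<M. of_real l ^ n * tr n) - (LBINT x. kap * r x * ?g x)) <= ?B * K * (1 / 6) ^ M" for M
 proof -
  let ?s = "%x. \<Sum>n<M. of_real l ^ n * (kap * r x * TS.W n (T (%y. ker (- sig) (y - x))) x)"
  have si: "L1 ?s" by (intro Bochner_Integration.integrable_sum integrable_mult_right tr_integrable)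
  have "(\<Sum>n<M. of_real l ^ n * tr n) = (LBINT x. ?s x)"
   unfolding tr_def by (subst Bochner_Integration.integral_sum) (auto intro: tr_integrable)
  then have "(\<Sum>n<M. of_real l ^ n * tr n) - (LBINT x. kap * r x * ?g x) = (LBINT x. ?s x - kap * r x * ?g x)"
   using si gi by simp
  moreover have "?s x - kap * r x * ?g x = - (kap * r x * (?g x - (\<Sum>n<M. of_real l ^ n * TS.W n (T (%y. ker (- sig) (y - x))) x)))" for x
   by (simp add: sum_distrib_left right_diff_distrib mult_ac)
  moreover have "norm (LBINT x. ?s x - kap * r x * ?g x) <= (LBINT x. norm (?s x - kap * r x * ?g x))" by (rule integral_norm_bound)
  moreover have "(LBINT x. norm (?s x - kap * r x * ?g x)) <= (LBINT x. norm (kap * r x) * (K * (1 / 6) ^ M))"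
  proof (rule integral_mono)
   show "L1 (%x. norm (?s x - kap * r x * ?g x))" using si gi by (intro integrable_norm Bochner_Integration.integrable_diff)
   show "L1 (%x. norm (kap * r x) * (K * (1 / 6) ^ M))" using TS.b(1) by simp
   show "norm (?s x - kap * r x * ?g x) <= norm (kap * r x) * (K * (1 / 6) ^ M)" for x
    unfolding calculation(2) norm_minus_cancel norm_mult[of "kap * r x"] by (intro mult_left_mono expand) simp
  qed
  ultimately show ?thesis by (simp add: mult.assoc)
 qed
 have "(%M. (\<Sum>n<M. of_real l ^ n * tr n) - (LBINT x. kap * r x * ?g x)) -->> 0"
 proof (rule Lim_null_comparison)
  show "\<forall>\<^sub>F M in sequentially. norm ((\<Sum>n<M. of_real l ^ n * tr n) - (LBINT x. kap * r x * ?g x)) <= ?B * K * (1 / 6) ^ M" using diff by simp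
  show "(%M. ?B * K * (1 / 6) ^ M) -->> 0" by (intro tendsto_mult_right_zero LIMSEQ_realpow_zero) auto
 qed
 then show ?thesis unfolding sums_def by (simp only: LIM_zero_iff)
qed

text \<open>Both sides vanish when $r$ is scaled by zero, and they have the same derivative in the scaling parameter.\<close>

lemma A_fun_energy: "A_fun kap q r = - energy kap sig q r"
proof -
 define c where "c n = (case n of 0 => 0 | Suc j => tr j / of_nat (Suc j))" for n
 define Pw where "Pw z = (\<Sum>n. c n * z ^ n)" for z :: complex
 define E where "E l = energy kap sig q (%x. of_real l * r x)" for l :: real
 let ?B = "LBINT x. norm (kap * r x)" and ?s = "complex_of_real (sgn sig)"
 have ss: "?s * ?s = 1" using sigma by (auto simp: sgn_if)
 have sm: "summable (%n. c n * 2 ^ n)"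
 proof (rule summable_comparison_test')
  show "summable (%n. (9 * ?B) * (2 / 9) ^ n)" by (intro summable_mult summable_geometric) auto
  show "norm (c n * 2 ^ n) <= (9 * ?B) * (2 / 9) ^ n" if "n \<ge> 0" for n
  proof (cases n)
   case (Suc m)
   have "norm (c n) <= norm (tr m)" unfolding c_def Suc by (simp add: norm_divide divide_le_eq mult_le_cancel_left1 del: of_nat_Suc)
   also have "... <= ?B / 9 ^ m" by (rule tr_bound)
   also have "... = 9 * ?B / 9 ^ n" by (simp add: Suc)
   finally have "norm (c n) * 2 ^ n <= 9 * ?B / 9 ^ n * 2 ^ n" by (rule mult_right_mono) simp
   then show ?thesis by (simp add: norm_mult norm_power power_divide)
  qed (simp add: c_def)
 qed
 have dc: "diffs c n = tr n" for n unfolding diffs_def c_def by (simp del: of_nat_Suc)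
 have dP: "((%l. Pw (of_real l)) hvd (LBINT x. kap * r x * (?s * g12 kap q (%x. of_real l * r x) x))) (at l)" if l: "l \<in> {0..1}" for l
 proof -
  have "DERIV Pw (of_real l) :> (\<Sum>n. diffs c n * of_real l ^ n)"
   unfolding Pw_def[abs_def] by (rule termdiffs_strong[OF sm]) (use l in auto)
  also have "(\<Sum>n. diffs c n * of_real l ^ n) = (LBINT x. kap * r x * (?s * g12 kap q (%x. of_real l * r x) x))"
   unfolding dc mult.commute[of "tr _"] using resolvent_series[of l] l by (intro sums_unique[symmetric]) auto
  finally show ?thesis by (rule has_vector_derivative_real_field)
 qed
 have dE: "(E hvd (LBINT x. kap * r x * g12 kap q (%x. of_real l * r x) x)) (at l)" if l: "l \<in> {0..1}" for l
 proof -
  let ?F = "%h. energy kap sig (%x. q x + of_real h * 0) (%x. of_real l * r x + of_real h * r x)"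
  have z: "potential (%_. 0)" unfolding potential_def by auto
  have e: "(%x. of_real l * r x + of_real h * r x) = (%x. of_real (l + h) * r x)" for h by (simp add: algebra_simps)
  have lp: "lax_potential kap sig (%x. q x + of_real h * 0) (%x. of_real l * r x + of_real h * r x)" if h: "\<bar>h\<bar> < 1 / 2" for h :: real
  proof -
   have "0 <= l" "l <= 1" using l by auto
   then have "\<bar>l + h\<bar> <= 3 / 2" using h abs_triangle_ineq[of l h] abs_of_nonneg[of l] by linarith
   from scaled[OF this] show ?thesis unfolding e mult_zero_right add_0_right .
  qed
  have "\<forall>\<^sub>F h in at (0::real). \<bar>h\<bar> < 1 / 2" unfolding eventually_at by (intro exI[of _ "1/2"]) (auto simp: dist_real_def)
  then have "\<forall>\<^sub>F h in at (0::real). lax_potential kap sig (%x. q x + of_real h * 0) (%x. of_real l * r x + of_real h * r x)"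
   by (rule eventually_mono) (rule lp)
  from energy_derivative[OF scaled z r(1) this] l
  have "(?F hvd (LBINT x. kap * r x * g12 kap q (%x. of_real l * r x) x)) (at 0)" by simp
  then have F: "(?F hvd (LBINT x. kap * r x * g12 kap q (%x. of_real l * r x) x)) (at (l - l))" by simp
  have "((%t. t - l) hvd 1 - 0) (at l)" by (intro has_vector_derivative_diff has_vector_derivative_id has_vector_derivative_const)
  from vector_diff_chain_at[OF this F] show ?thesis unfolding o_def e E_def[abs_def] by simp
 qed
 have "((%l. E l - ?s * Pw (of_real l)) hvd 0) (at l within {0..1})" if l: "l \<in> {0..1}" for l
 proof -
  have "((%l. E l - ?s * Pw (of_real l)) hvd (LBINT x. kap * r x * g12 kap q (%x. of_real l * r x) x) - ?s * (LBINT x. kap * r x * (?s * g12 kap q (%x. of_real l * r x) x))) (at l)"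
   by (intro has_vector_derivative_diff has_vector_derivative_mult_right dE dP l)
  also have "?s * (LBINT x. kap * r x * (?s * g12 kap q (%x. of_real l * r x) x)) = (LBINT x. (?s * ?s) * (kap * r x * g12 kap q (%x. of_real l * r x) x))"
   unfolding integral_mult_right_zero[symmetric] by (simp add: mult_ac)
  finally show ?thesis unfolding ss by (simp add: has_vector_derivative_at_within)
 qed
 then obtain k where k: "!!l. l \<in> {0..1} ==> E l - ?s * Pw (of_real l) = k"
  using has_vector_derivative_zero_constant[of "{0..1}" "%l. E l - ?s * Pw (of_real l)"] by (metis convex_real_interval(5))
 have "E 0 = 0" unfolding E_def using energy_difference(2)[OF scaled[of 0] scaled[of 0]] by simp
 moreover have "Pw 0 = 0" unfolding Pw_def using powser_zero[of c] by (simp add: c_def)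
 ultimately have "E 1 = ?s * Pw 1" using k[of 0] k[of 1] by simp
 moreover have "E 1 = energy kap sig q r" by (simp add: E_def)
 moreover have "A_fun kap q r = - ?s * Pw 1"
 proof -
  have sc: "summable c" using powser_inside[OF sm, of 1] by simp
  have cz: "c 0 = 0" and cS: "c (Suc j) = 1 / of_nat (Suc j) * tr j" for j by (simp_all add: c_def)
  have "Pw 1 = suminf c" unfolding Pw_def by simp
  also have "... = (\<Sum>j. c (Suc j))" using suminf_split_head[OF sc] cz by simp
  finally have P1: "Pw 1 = (\<Sum>j. c (Suc j))" .
  have ot: "op_trace ((Lambda_op kap q \<circ> Gamma_op kap r) ^^ Suc j) = tr j" for j
   unfolding tr_def TS.W_def by (rule trace_formula[OF kappa TS.trace_setup_axioms])
  show ?thesis unfolding A_fun_def kappa sgn_of_real ot P1 cS ..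
 qed
 ultimately show ?thesis by simp
qed

end

lemma schwartz_potential: "schwartz f ==> potential f"
 unfolding potential_def using schwartz_continuous schwartz_bounded schwartz_integrable by blast

lemma cnj_potential: "schwartz f ==> potential (%x. cnj (f x))"
proof -
 assume f: "schwartz f"
 have "L1 (%x. cnj (f x))" using schwartz_integrable[OF f] by simp
 then show ?thesis using schwartz_potential[OF f] unfolding potential_def by (auto intro: continuous_intros)
qed

lemma decay_perturb:
 assumes q: "schwartz q" and f: "schwartz f"
 shows "\<exists>C. \<forall>xi. norm (fourier (%x. q x + of_real h * f x) xi) <= C / (1 + xi^2)"
proof -
 obtain A where A: "!!xi. norm (fourier q xi) <= A / (1 + xi^2)" using schwartz_fourier_decay[OF q] by blast
 obtain B where B: "!!xi. norm (fourier f xi) <= B / (1 + xi^2)" using schwartz_fourier_decay[OF f] by blast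
 have "norm (fourier (%x. q x + of_real h * f x) xi) <= (A + \<bar>h\<bar> * B) / (1 + xi^2)" for xi
 proof -
  have "L1 q" "L1 (%x. of_real (- h) * f x)" using schwartz_integrable q f by (auto intro: integrable_mult_right)
  from fourier_diff[OF this, of xi]
  have "fourier (%x. q x + of_real h * f x) xi = fourier q xi + of_real h * fourier f xi" unfolding fourier_cmult by simp
  then have "norm (fourier (%x. q x + of_real h * f x) xi) <= norm (fourier q xi) + \<bar>h\<bar> * norm (fourier f xi)"
   using norm_triangle_ineq[of "fourier q xi" "of_real h * fourier f xi"] by (simp add: norm_mult)
  also have "... <= A / (1 + xi^2) + \<bar>h\<bar> * (B / (1 + xi^2))" by (intro add_mono mult_left_mono A B) simp
  finally show ?thesis by (simp add: add_divide_distrib)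
 qed
 then show ?thesis by blast
qed

lemma eventually_small:
 assumes "potential q" "potential f" "L2_norm q < b"
 shows "\<forall>\<^sub>F h in at (0::real). L2_norm (%x. q x + of_real h * f x) <= b"
proof -
 have "((%h::real. L2_norm q + \<bar>h\<bar> * L2_norm f) \<longlongrightarrow> L2_norm q + \<bar>0\<bar> * L2_norm f) (at 0)" by (intro tendsto_intros)
 then have "\<forall>\<^sub>F h in at (0::real). L2_norm q + \<bar>h\<bar> * L2_norm f < b" using assms(3) by (intro order_tendstoD(2)) auto
 then show ?thesis by eventually_elim (use L2_norm_perturb[OF assms(1,2)] in \<open>meson less_le order_trans\<close>)
qed

lemma L2_norm_cnj: "L2_norm (%x. cnj (f x)) = L2_norm f" "L2_norm (%x. - f x) = L2_norm (f :: real => complex)"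
 unfolding L2_norm_def by simp_all

text \<open>Replacing $f$ by $i f$ separates the two functional derivatives; continuity removes the null sets.\<close>

theorem A_fun_gradient:
 assumes kappa: "\<i> * kap^2 = of_real sig" and sigma: "1 <= \<bar>sig\<bar>"
  and qs: "schwartz q" "L2_norm q < 1 / 3" and rs: "schwartz r" "L2_norm r < 1 / 3"
  and F: "functional_derivatives (A_fun kap) q r hq hr"
 shows "hq = (%x. - kap * g21 kap q r x)" and "hr = (%x. - kap * g12 kap q r x)"
proof -
 note pq = schwartz_potential[OF qs(1)] and pr = schwartz_potential[OF rs(1)]
 interpret lax_potential kap sig q r using kappa sigma pq pr qs rs by unfold_locales auto
 note C = C1_bounded_continuous[OF green_C1(1)] C1_bounded_continuous[OF green_C1(2)]
 have hc: "cont hq" "cont hr" using F unfolding functional_derivatives_def by auto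
 have gi: "L1 (%x. f x * g21 kap q r x)" "L1 (%x. cnj (f x) * g12 kap q r x)" if f: "schwartz f" for f
 proof -
  have k: "kap ~= 0" using norm_kappa sigma by auto
  show "L1 (%x. f x * g21 kap q r x)"
   using integrable_mult_right[OF continuous_integrable_mult(2)[OF schwartz_potential[OF f] green_C1(2)], of "1 / kap"] k by simp
  show "L1 (%x. cnj (f x) * g12 kap q r x)"
   using integrable_mult_right[OF continuous_integrable_mult(2)[OF cnj_potential[OF f] green_C1(1)], of "1 / kap"] k by simp
 qed
 have hi: "L1 (%x. f x * hq x)" "L1 (%x. cnj (f x) * hr x)" if "schwartz f" for f
  using F that unfolding functional_derivatives_def by auto
 have eq: "(LBINT x. f x * (hq x + kap * g21 kap q r x)) = (LBINT x. cnj (f x) * (hr x + kap * g12 kap q r x))" if f: "schwartz f" for f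
 proof -
  note pf = schwartz_potential[OF f] and pc = potential_cmult[OF cnj_potential[OF f], of "- 1"]
  let ?q = "%h x. q x + of_real h * f x" and ?r = "%h x. r x + of_real h * (- 1 * cnj (f x))"
  have ev3: "\<forall>\<^sub>F h in at (0::real). L2_norm (?q h) <= 1 / 3 \<and> L2_norm (?r h) <= 1 / 3"
   using eventually_small[OF pq pf qs(2)] eventually_small[OF pr pc rs(2)] by eventually_elim simp
  have lp: "lax_potential kap sig (?q h) (?r h)" if "L2_norm (?q h) <= 1 / 3 \<and> L2_norm (?r h) <= 1 / 3" for h
   using that kappa sigma potential_add[OF pq pf] potential_add[OF pr pc] by unfold_locales auto
  have A: "A_fun kap (?q h) (?r h) = - energy kap sig (?q h) (?r h)" if h: "L2_norm (?q h) <= 1 / 3 \<and> L2_norm (?r h) <= 1 / 3" for h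
  proof -
   have "trace_series kap sig (?q h) (?r h)"
    using h kappa sigma potential_add[OF pq pf] potential_add[OF pr pc] decay_perturb[OF qs(1) f] by unfold_locales auto
   then show ?thesis by (rule trace_series.A_fun_energy)
  qed
  have "\<forall>\<^sub>F h in at (0::real). lax_potential kap sig (?q h) (?r h)" using ev3 by eventually_elim (rule lp)
  from energy_derivative[OF lax_potential_axioms pf pc this]
  have "((%h. - energy kap sig (?q h) (?r h)) hvd - (LBINT x. kap * f x * g21 kap q r x + kap * (- 1 * cnj (f x)) * g12 kap q r x)) (at 0)"
   by (rule has_vector_derivative_minus)
  then have d1: "((%h. A_fun kap (?q h) (?r h)) hvd - (LBINT x. kap * f x * g21 kap q r x + kap * (- 1 * cnj (f x)) * g12 kap q r x)) (at 0)"
  proof (rule has_vector_derivative_cong_at)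
   show "\<forall>\<^sub>F h in at 0. - energy kap sig (?q h) (?r h) = A_fun kap (?q h) (?r h)" using ev3 by eventually_elim (rule A[symmetric])
   show "- energy kap sig (?q 0) (?r 0) = A_fun kap (?q 0) (?r 0)" by (rule A[symmetric]) (use qs rs in auto)
  qed
  have d2: "((%h. A_fun kap (?q h) (?r h)) hvd (LBINT x. f x * hq x - cnj (f x) * hr x)) (at 0)"
  proof -
   have e: "r x + of_real h * (- 1 * cnj (f x)) = r x - of_real h * cnj (f x)" for h x by simp
   show ?thesis unfolding e using F f unfolding functional_derivatives_def by blast
  qed
  have "(LBINT x. f x * hq x - cnj (f x) * hr x) = - (LBINT x. kap * f x * g21 kap q r x + kap * (- 1 * cnj (f x)) * g12 kap q r x)"
   by (rule vector_derivative_unique_at[OF d2 d1])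
  also have "(%x. kap * f x * g21 kap q r x + kap * (- 1 * cnj (f x)) * g12 kap q r x) = (%x. kap * (f x * g21 kap q r x) - kap * (cnj (f x) * g12 kap q r x))" by (simp add: mult_ac)
  finally have e: "(LBINT x. f x * hq x - cnj (f x) * hr x) = - (LBINT x. kap * (f x * g21 kap q r x) - kap * (cnj (f x) * g12 kap q r x))" .
  have s1: "(LBINT x. f x * (hq x + kap * g21 kap q r x)) = (LBINT x. f x * hq x) + kap * (LBINT x. f x * g21 kap q r x)"
   using hi[OF f] gi[OF f] by (simp add: distrib_left mult.left_commute)
  have s2: "(LBINT x. cnj (f x) * (hr x + kap * g12 kap q r x)) = (LBINT x. cnj (f x) * hr x) + kap * (LBINT x. cnj (f x) * g12 kap q r x)"
   using hi[OF f] gi[OF f] by (simp add: distrib_left mult.left_commute)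
  have "(LBINT x. f x * hq x) - (LBINT x. cnj (f x) * hr x) = - (kap * (LBINT x. f x * g21 kap q r x) - kap * (LBINT x. cnj (f x) * g12 kap q r x))"
   using e hi[OF f] gi[OF f] by simp
  then show ?thesis unfolding s1 s2 by (simp add: algebra_simps)
 qed
 have schi: "schwartz (%x. \<i> * f x)" if f: "schwartz f" for f
 proof -
  have "(dx ^^ n) (%x. \<i> * f x) = (%x. \<i> * (dx ^^ n) f x)" for n
  proof (induction n)
   case (Suc n)
   have d: "((dx ^^ n) f hvd dx ((dx ^^ n) f) x) (at x)" for x
    using f has_vector_derivative_dx unfolding schwartz_def by blast
   have "dx (%x. \<i> * (dx ^^ n) f x) = (%x. \<i> * dx ((dx ^^ n) f) x)"
    unfolding dx_def[of "%x. \<i> * (dx ^^ n) f x"] by (rule ext, rule vector_derivative_at, rule has_vector_derivative_mult_right, rule d)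
   then show ?case using Suc by simp
  qed simp
  then show ?thesis using f unfolding schwartz_def by (auto simp: norm_mult intro!: differentiable_mult)
 qed
 have z: "(LBINT x. f x * (hq x + kap * g21 kap q r x)) = 0" "(LBINT x. cnj (f x) * (hr x + kap * g12 kap q r x)) = 0" if f: "schwartz f" for f
 proof -
  have a: "\<i> * (LBINT x. f x * (hq x + kap * g21 kap q r x)) = - \<i> * (LBINT x. cnj (f x) * (hr x + kap * g12 kap q r x))"
   using eq[OF schi[OF f]] unfolding complex_cnj_mult complex_cnj_i integral_mult_right_zero[symmetric] mult.assoc .
  then show "(LBINT x. f x * (hq x + kap * g21 kap q r x)) = 0" using eq[OF f] by simp
  then show "(LBINT x. cnj (f x) * (hr x + kap * g12 kap q r x)) = 0" using eq[OF f] by simp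
 qed
 have c1: "cont (%x. hq x + kap * g21 kap q r x)" "cont (%x. cnj (hr x + kap * g12 kap q r x))"
  using C hc by (auto intro!: continuous_intros)
 have "AE x in lborel. hq x + kap * g21 kap q r x = 0"
 proof (rule schwartz_separates)
  show "L1 (%x. (hq x + kap * g21 kap q r x) * f x)" if f: "schwartz f" for f
   using Bochner_Integration.integrable_add[OF hi(1)[OF f] integrable_mult_right[OF gi(1)[OF f], of kap]] by (simp add: algebra_simps)
  show "(LBINT x. (hq x + kap * g21 kap q r x) * f x) = 0" if f: "schwartz f" for f using z(1)[OF f] by (simp add: mult.commute)
 qed (use c1 borel_measurable_continuous_onI in auto)
 from continuous_eq_AE[OF c1(1) continuous_on_const this] show "hq = (%x. - kap * g21 kap q r x)" by (simp add: fun_eq_iff add_eq_0_iff2)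
 have "AE x in lborel. cnj (hr x + kap * g12 kap q r x) = 0"
 proof (rule schwartz_separates)
  have cn: "cnj (hr x + kap * g12 kap q r x) * f x = cnj (cnj (f x) * (hr x + kap * g12 kap q r x))" for f x by simp
  have i: "L1 (%x. cnj (f x) * (hr x + kap * g12 kap q r x))" if f: "schwartz f" for f
   using Bochner_Integration.integrable_add[OF hi(2)[OF f] integrable_mult_right[OF gi(2)[OF f], of kap]] by (simp add: algebra_simps)
  show "L1 (%x. cnj (hr x + kap * g12 kap q r x) * f x)" if f: "schwartz f" for f
   unfolding cn using i[OF f] by (simp only: integrable_cnj)
  show "(LBINT x. cnj (hr x + kap * g12 kap q r x) * f x) = 0" if f: "schwartz f" for f
   unfolding cn Bochner_Integration.integral_cnj z(2)[OF f] by simp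
 qed (use c1 borel_measurable_continuous_onI in auto)
 from continuous_eq_AE[OF c1(2) continuous_on_const this] show "hr = (%x. - kap * g12 kap q r x)"
  by (simp add: fun_eq_iff add_eq_0_iff2 del: complex_cnj_add complex_cnj_mult)
qed

lemma L2_norm_le_Hs_norm:
 assumes q: "schwartz q" and s: "0 < s" "s < 1"
 shows "L2_norm q <= Hs_norm s q"
proof -
 obtain C where C: "!!xi. norm (fourier q xi) <= C / (1 + xi^2)" using schwartz_fourier_decay[OF q] by blast
 have C0: "0 <= C" using order_trans[OF norm_ge_zero C[of 0]] by simp
 have [measurable]: "q \<in> BM" using schwartz_measurable[OF q] .
 have i1: "L1 (%xi. (norm (fourier q xi))\<^sup>2)" using schwartz_fourier_integrable(2)[OF q] by (simp add: sqint_def)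
 have i2: "L1 (%xi. (4 + xi^2) powr s * (norm (fourier q xi))^2)"
 proof (rule decay_integrable)
  show "(%xi. (4 + xi^2) powr s * (norm (fourier q xi))^2) \<in> BM" by measurable
  fix xi :: real
  have p: "1 + xi^2 > 0" by (simp add: add_pos_nonneg)
  have "(4 + xi^2) powr s <= (4 + xi^2) powr 1" using s by (intro powr_mono) auto
  also have "... <= 4 * (1 + xi^2)" by simp
  finally have "(4 + xi^2) powr s * (norm (fourier q xi))^2 <= 4 * (1 + xi^2) * (C / (1 + xi^2))\<^sup>2"
   using C p C0 by (intro mult_mono power_mono) auto
  also have "... = (4 * C^2) / (1 + xi^2)"
  proof -
   have gen: "d ~= 0 ==> 4 * d * (C / d)^2 = (4 * C^2) / d" for d :: real by (simp add: power2_eq_square field_simps)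
   show ?thesis by (rule gen) (use p in simp)
  qed
  finally show "norm ((4 + xi^2) powr s * (norm (fourier q xi))^2) <= (4 * C^2) / (1 + xi^2)" by simp
 qed
 have "L2_norm q = L2_norm (fourier q)"
  by (rule L2_fourier_isometry[symmetric]) (intro L2_fourier_classical schwartz_integrable schwartz_sq_integrable q)
 also have "... <= Hs_norm s q" unfolding L2_norm_def Hs_norm_def
 proof (intro real_sqrt_le_mono integral_mono i1 i2)
  fix xi :: real
  have "1 powr s <= (4 + xi^2) powr s" using s by (intro powr_mono2) auto
  then show "(norm (fourier q xi))^2 <= (4 + xi^2) powr s * (norm (fourier q xi))^2" by (simp add: mult_le_cancel_right1)
 qed
 finally show ?thesis .
qed

lemma schwartz_derivative_uniform:
 assumes "schwartz_has_derivative u v t"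
 shows "uniform_limit UNIV (%tau x. (u tau x - u t x) / of_real (tau - t)) v (at t)"
proof (rule uniform_limitI)
 fix e :: real assume e: "0 < e"
 then have "\<forall>\<^sub>F h in at (0::real). \<forall>x. \<bar>x\<bar> ^ 0 * norm ((dx ^^ 0) (%y. (u (t + h) y - u t y) / of_real h - v y) x) <= e / 2"
  using assms unfolding schwartz_has_derivative_def by (meson half_gt_zero)
 then have "\<forall>\<^sub>F tau in at t. \<forall>x. norm ((u tau x - u t x) / of_real (tau - t) - v x) <= e / 2"
  unfolding eventually_at_to_0[of _ t] by (simp add: add.commute)
 then show "\<forall>\<^sub>F tau in at t. \<forall>x\<in>UNIV. dist ((u tau x - u t x) / of_real (tau - t)) (v x) < e"
 proof eventually_elim
  case (elim tau)
  show ?case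
  proof
   fix x
   have "norm ((u tau x - u t x) / of_real (tau - t) - v x) <= e / 2" using elim by blast
   then show "dist ((u tau x - u t x) / of_real (tau - t)) (v x) < e" using e unfolding dist_norm by linarith
  qed
 qed
qed

text \<open>Two seminorms of the difference quotient bound it by a square-integrable weight, so the $L^2$ norm is continuous along the curve.\<close>

lemma schwartz_derivative_L2:
 assumes d: "schwartz_has_derivative u v t" and sc: "\<forall>\<^sub>F tau in at t. schwartz (u tau)" "schwartz (u t)" and b: "L2_norm (u t) < b"
 shows "\<forall>\<^sub>F tau in at t. L2_norm (u tau) <= b"
proof -
 have v: "schwartz v" using d unfolding schwartz_has_derivative_def by blast
 let ?D = "%h y. (u (t + h) y - u t y) / of_real h - v y"
 have k: "\<forall>\<^sub>F h in at (0::real). \<forall>x. \<bar>x\<bar> ^ j * norm (?D h x) <= 1" for j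
 proof -
  have "\<forall>\<^sub>F h in at (0::real). \<forall>x. \<bar>x\<bar> ^ j * norm ((dx ^^ 0) (?D h) x) <= 1"
   using d unfolding schwartz_has_derivative_def by (meson zero_less_one)
  then show ?thesis by simp
 qed
 let ?c = "sqrt (LBINT x. 4 * (1 / (1 + (x::real)^2)))"
 have lim: "((%h::real. L2_norm (u t) + \<bar>h\<bar> * (L2_norm v + ?c)) \<longlongrightarrow> L2_norm (u t) + \<bar>0\<bar> * (L2_norm v + ?c)) (at 0)" by (intro tendsto_intros)
 have ev: "\<forall>\<^sub>F h in at (0::real). L2_norm (u t) + \<bar>h\<bar> * (L2_norm v + ?c) < b" using order_tendstoD(2)[OF lim] b by simp
 have "\<forall>\<^sub>F h in at (0::real). schwartz (u (t + h))" using sc(1) unfolding eventually_at_to_0[of _ t] by (simp add: add.commute)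
 moreover have "\<forall>\<^sub>F h in at (0::real). h ~= 0" by (simp add: eventually_at_filter)
 ultimately have "\<forall>\<^sub>F h in at (0::real). L2_norm (u (t + h)) <= b" using k[of 0] k[of 1] ev
 proof eventually_elim
  case (elim h)
  have sD: "sqint (?D h)"
   using sq_integrable_diff[OF sq_integrable_cmult[OF sq_integrable_diff[OF schwartz_sq_integrable[OF elim(1)] schwartz_sq_integrable[OF sc(2)]], of "1 / of_real h"] schwartz_sq_integrable[OF v]] by simp
  have "(norm (?D h x))^2 <= 4 * (1 / (1 + x^2))" for x
  proof -
   have p: "1 + x^2 > 0" by (simp add: add_pos_nonneg)
   have n: "norm (?D h x) <= 1" "\<bar>x\<bar> * norm (?D h x) <= 1" using elim(3,4) by simp_all
   have "(1 + x^2) * (norm (?D h x))^2 = (norm (?D h x))^2 + (\<bar>x\<bar> * norm (?D h x))^2" by (simp add: algebra_simps power_mult_distrib)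
   also have "... <= 1^2 + 1^2" by (intro add_mono power_mono n) auto
   finally show ?thesis using p by (simp add: pos_le_divide_eq mult.commute)
  qed
  then have "L2_norm (?D h) <= ?c" unfolding L2_norm_def
   using sD inverse_square_integrable by (intro real_sqrt_le_mono integral_mono integrable_mult_right) (auto simp: sqint_def)
  moreover have "L2_norm (u (t + h)) <= L2_norm (u t) + \<bar>h\<bar> * (L2_norm v + L2_norm (?D h))"
  proof -
   have "u (t + h) = (%x. u t x + of_real h * (v x + ?D h x))" using elim(2) by (simp add: fun_eq_iff)
   then have "L2_norm (u (t + h)) = L2_norm (%x. u t x + of_real h * (v x + ?D h x))" by (rule arg_cong[where f = L2_norm])
   also have "... <= L2_norm (u t) + L2_norm (%x. of_real h * (v x + ?D h x))"
    by (intro L2_norm_triangle sq_integrable_cmult sq_integrable_add schwartz_sq_integrable sc(2) v sD)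
   also have "L2_norm (%x. of_real h * (v x + ?D h x)) <= \<bar>h\<bar> * L2_norm (%x. v x + ?D h x)"
    by (rule L2_norm_bounded_mult[OF sq_integrable_add[OF schwartz_sq_integrable[OF v] sD]]) auto
   also have "... <= \<bar>h\<bar> * (L2_norm v + L2_norm (?D h))" by (intro mult_left_mono L2_norm_triangle schwartz_sq_integrable v sD) auto
   finally show ?thesis by simp
  qed
  ultimately show ?case using elim(5) mult_left_mono[of "L2_norm v + L2_norm (?D h)" "L2_norm v + ?c" "\<bar>h\<bar>"] by linarith
 qed
 then show ?thesis unfolding eventually_at_to_0[of _ t] by (simp add: add.commute)
qed

text \<open>The Sobolev norm dominates the $L^2$ norm, so the ball of radius $1/4$ leaves room for a neighbourhood of $t$ and for the variations in the gradient.\<close>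

theorem conservation_at_time:
 fixes q r :: "real => real => complex"
 assumes s: "0 < s" "s < 1 / 2" and mu: "\<i> * mu^2 \<in> complex_of_real ` (UNIV - {-1<..<1})" and ka: "\<i> * kap^2 \<in> complex_of_real ` (UNIV - {-1<..<1})"
  and ne: "kap^2 ~= mu^2" and I: "open I" "t \<in> I" and fl: "hamiltonian_flow (A_fun kap) I q r"
  and ball: "q t \<in> schwartz_ball s \<delta>" "\<delta> <= 1 / 4" and rt: "r t = (%x. - cnj (q t x))"
 shows "\<exists>sig sig'. lax_potential mu sig (q t) (r t) \<and> lax_potential kap sig' (q t) (r t) \<and> (\<forall>\<^sub>F tau in at t. lax_potential mu sig (q tau) (r tau)) \<and>
  uniform_limit UNIV (%tau x. (q tau x - q t x) / of_real (tau - t)) (%x. - kap * dx (g12 kap (q t) (r t)) x) (at t) \<and>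
  uniform_limit UNIV (%tau x. (r tau x - r t x) / of_real (tau - t)) (%x. - kap * dx (g21 kap (q t) (r t)) x) (at t)"
proof -
 obtain sig where S: "\<i> * mu^2 = of_real sig" "1 <= \<bar>sig\<bar>" using mu by (auto simp: abs_if not_less split: if_splits)
 obtain sig' where S': "\<i> * kap^2 = of_real sig'" "1 <= \<bar>sig'\<bar>" using ka by (auto simp: abs_if not_less split: if_splits)
 have sc: "schwartz (q tau)" "schwartz (r tau)" if "tau \<in> I" for tau using fl that unfolding hamiltonian_flow_def by auto
 have nq: "L2_norm (q t) <= 1 / 4" using L2_norm_le_Hs_norm[OF sc(1)[OF I(2)], of s] s ball unfolding schwartz_ball_def by simp
 have nr: "L2_norm (r t) <= 1 / 4" using nq unfolding rt L2_norm_cnj(2) L2_norm_cnj(1) .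
 have lp: "lax_potential \<nu> tau p w" if "\<i> * \<nu>\<^sup>2 = of_real tau" "1 <= \<bar>tau\<bar>" "schwartz p" "schwartz w" "L2_norm p <= 1 / 2" "L2_norm w <= 1 / 2" for \<nu> tau p w
  using that schwartz_potential by unfold_locales auto
 have A: "lax_potential mu sig (q t) (r t)" and K: "lax_potential kap sig' (q t) (r t)" using lp S S' sc[OF I(2)] nq nr by auto
 obtain hq hr where h: "functional_derivatives (A_fun kap) (q t) (r t) hq hr" "schwartz_has_derivative q (dx hr) t" "schwartz_has_derivative r (dx hq) t"
  using fl I(2) unfolding hamiltonian_flow_def by blast
 interpret K: lax_potential kap sig' "q t" "r t" by (rule K)
 have hq: "hq = (%x. - kap * g21 kap (q t) (r t) x)" and hr: "hr = (%x. - kap * g12 kap (q t) (r t) x)"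
  using A_fun_gradient[OF S' sc(1)[OF I(2)] _ sc(2)[OF I(2)] _ h(1)] nq nr by auto
 have dxc: "dx (%x. - kap * g x) = (%x. - kap * dx g x)" if "C1_bounded g g'" for g g'
  unfolding C1_bounded_dx[OF that] unfolding dx_def
  by (rule ext, rule vector_derivative_at, rule has_vector_derivative_mult_right, rule C1_bounded_has_derivative[OF that])
 have Iev: "\<forall>\<^sub>F tau in at t. tau \<in> I" using I eventually_at_in_open' by blast
 have "\<forall>\<^sub>F tau in at t. schwartz (q tau)" by (rule eventually_mono[OF Iev]) (rule sc(1))
 moreover have "\<forall>\<^sub>F tau in at t. schwartz (r tau)" by (rule eventually_mono[OF Iev]) (rule sc(2))
 ultimately have scq: "\<forall>\<^sub>F tau in at t. schwartz (q tau)" "\<forall>\<^sub>F tau in at t. schwartz (r tau)" .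
 have e1: "\<forall>\<^sub>F tau in at t. L2_norm (q tau) <= 1 / 2" by (rule schwartz_derivative_L2[OF h(2) scq(1) sc(1)[OF I(2)]]) (use nq in simp)
 have e2: "\<forall>\<^sub>F tau in at t. L2_norm (r tau) <= 1 / 2" by (rule schwartz_derivative_L2[OF h(3) scq(2) sc(2)[OF I(2)]]) (use nr in simp)
 have "\<forall>\<^sub>F tau in at t. lax_potential mu sig (q tau) (r tau)" using scq e1 e2 by eventually_elim (rule lp[OF S])
 moreover note schwartz_derivative_uniform[OF h(2), unfolded hr dxc[OF K.green_C1(1)]] schwartz_derivative_uniform[OF h(3), unfolded hq dxc[OF K.green_C1(2)]]
 ultimately show ?thesis using A K by blast
qed


section \<open>The conservation laws\<close>

text \<open>The density and the flow have their own spectral parameters, and the two potentials are small for both of them.\<close>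

theorem proposition4p7:
  fixes s :: real
  assumes "0 < s" and "s < 1 / 2"
  shows "\<exists>\<delta>\<^sub>0>0. \<forall>\<delta>. 0 < \<delta> \<and> \<delta> \<le> \<delta>\<^sub>0 \<longrightarrow>
    (\<forall>(\<mu>::complex) (\<kappa>::complex) (I::real set) (t::real)
        (q::real \<Rightarrow> real \<Rightarrow> complex) (r::real \<Rightarrow> real \<Rightarrow> complex).
      \<i> * \<mu>\<^sup>2 \<in> complex_of_real ` (UNIV - {-1<..<1}) \<longrightarrow>
      \<i> * \<kappa>\<^sup>2 \<in> complex_of_real ` (UNIV - {-1<..<1}) \<longrightarrow>
      \<kappa>\<^sup>2 \<noteq> \<mu>\<^sup>2 \<longrightarrow>
      open I \<longrightarrow> t \<in> I \<longrightarrow>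
      hamiltonian_flow (A_fun \<kappa>) I q r \<longrightarrow>
      q t \<in> schwartz_ball s \<delta> \<longrightarrow>
      r t = (\<lambda>x. - cnj (q t x)) \<longrightarrow>
      (\<forall>x.
        ((\<lambda>\<tau>. g12 \<mu> (q \<tau>) (r \<tau>) x) has_vector_derivative
            - Xi \<mu> \<kappa> * g12 \<mu> (q t) (r t) x * (gam \<kappa> (q t) (r t) x + 1)
            + Theta \<mu> \<kappa> * g12 \<kappa> (q t) (r t) x * (gam \<mu> (q t) (r t) x + 1)) (at t)
        \<and> ((\<lambda>\<tau>. g21 \<mu> (q \<tau>) (r \<tau>) x) has_vector_derivative
            Xi \<mu> \<kappa> * g21 \<mu> (q t) (r t) x * (gam \<kappa> (q t) (r t) x + 1)
            - Theta \<mu> \<kappa> * g21 \<kappa> (q t) (r t) x * (gam \<mu> (q t) (r t) x + 1)) (at t)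
        \<and> ((\<lambda>\<tau>. gam \<mu> (q \<tau>) (r \<tau>) x) has_vector_derivative
            - 2 * Theta \<mu> \<kappa> * (g12 \<kappa> (q t) (r t) x * g21 \<mu> (q t) (r t) x
                             - g21 \<kappa> (q t) (r t) x * g12 \<mu> (q t) (r t) x)) (at t)
        \<and> (\<exists>a b. ((\<lambda>\<tau>. gamma_density \<mu> (q \<tau>) (r \<tau>) x) has_vector_derivative a) (at t)
                \<and> ((\<lambda>y. j_gamma \<mu> \<kappa> (q t) (r t) y) has_vector_derivative b) (at x)
                \<and> a + b = 0)
        \<and> (\<exists>a b. ((\<lambda>\<tau>. rho_density \<mu> (q \<tau>) (r \<tau>) x) has_vector_derivative a) (at t)
                \<and> ((\<lambda>y. j_A \<mu> \<kappa> (q t) (r t) y) has_vector_derivative b) (at x)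
                \<and> a + b = 0)))"
  apply (rule exI[of _ "1/4"], rule conjI, simp)
  apply (intro allI impI)
  subgoal premises prems for \<delta> \<mu> \<kappa> I t q r x
  proof -
    have d: "\<delta> \<le> 1 / 4" using prems(1) by simp
    obtain \<sigma> \<sigma>' where C: "lax_potential \<mu> \<sigma> (q t) (r t)" "lax_potential \<kappa> \<sigma>' (q t) (r t)"
      "\<forall>\<^sub>F \<tau> in at t. lax_potential \<mu> \<sigma> (q \<tau>) (r \<tau>)"
      "uniform_limit UNIV (\<lambda>\<tau> x. (q \<tau> x - q t x) / of_real (\<tau> - t)) (\<lambda>x. - \<kappa> * dx (g12 \<kappa> (q t) (r t)) x) (at t)"
      "uniform_limit UNIV (\<lambda>\<tau> x. (r \<tau> x - r t x) / of_real (\<tau> - t)) (\<lambda>x. - \<kappa> * dx (g21 \<kappa> (q t) (r t)) x) (at t)"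
      using conservation_at_time[OF assms prems(2-8) d prems(9)] by blast
    note F = flow_derivatives[OF C(1,2) prems(4) C(3,4,5)]
    show ?thesis by (intro conjI; rule F)
  qed
  done

end
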